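(* The following counting problem is \textup{\#P}-complete: given a finite contractible region $\Gamma\subset\mathbb{Z}^3$, compute the number of tilings of $\Gamma$ by dominoes, i.e.\ by copies of the $2\times1\times1$ brick (rotations allowed).
   Context: Identify $\mathbb{Z}^3$ with the set of closed unit cubes in $\mathbb{R}^3$ centered at integer lattice points. A region is a finite subset $\Gamma\subset\mathbb{Z}^3$, identified with $\overline\Gamma\subset\mathbb{R}^3$, the union of the corresponding closed unit cubes. $\Gamma$ is contractible if $\overline\Gamma$ is contractible and its interior is also contractible. A tiling of $\Gamma$ by a tile $T$ is a partition of $\Gamma$ into pairwise disjoint subsets, each an image of $T$ under an isometry of $\mathbb{Z}^3$. *)

theory Defs
  imports
    "HOL-Analysis.Analysis"
    "HOL-Computational_Algebra.Polynomial"
    "HOL-Library.Disjoint_Sets"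
begin

section \<open>Regions in the cubic lattice and their tilings\<close>

definition lattice_point :: "int ^ 3 \<Rightarrow> real ^ 3" where
  "lattice_point c = (\<chi> i. real_of_int (c $ i))"

definition unit_cube :: "int ^ 3 \<Rightarrow> (real ^ 3) set" where
  "unit_cube c = {p. \<forall>i. \<bar>p $ i - lattice_point c $ i\<bar> \<le> 1 / 2}"

definition region_body :: "(int ^ 3) set \<Rightarrow> (real ^ 3) set" where
  "region_body \<Gamma> = (\<Union>c\<in>\<Gamma>. unit_cube c)"

text \<open>The library's \<^const>\<open>contractible\<close> holds of the empty set, which is not a contractible
  space by the usual convention; hence the explicit nonemptiness condition.\<close>

definition contractible_region :: "(int ^ 3) set \<Rightarrow> bool" where
  "contractible_region \<Gamma> \<longleftrightarrow> finite \<Gamma> \<and> \<Gamma> \<noteq> {} \<and>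
     contractible (region_body \<Gamma>) \<and> contractible (interior (region_body \<Gamma>))"

definition lattice_isometry :: "(int ^ 3 \<Rightarrow> int ^ 3) \<Rightarrow> bool" where
  "lattice_isometry f \<longleftrightarrow> bij f \<and>
     (\<forall>x y. dist (lattice_point (f x)) (lattice_point (f y)) = dist (lattice_point x) (lattice_point y))"

definition tilings :: "(int ^ 3) set \<Rightarrow> (int ^ 3) set \<Rightarrow> (int ^ 3) set set set" where
  "tilings T \<Gamma> = {P. partition_on \<Gamma> P \<and> (\<forall>A\<in>P. \<exists>f. lattice_isometry f \<and> A = f ` T)}"

definition domino :: "(int ^ 3) set" where
  "domino = {c. c $ 1 \<in> {0..<2} \<and> c $ 2 \<in> {0..<1} \<and> c $ 3 \<in> {0..<1}}"


section \<open>Turing machines with a function oracle\<close>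

text \<open>Deterministic machines with \<open>ntapes\<close> two-way infinite tapes, states \<open>{0..<nstates}\<close> and tape
  symbols \<open>{0..<nsyms}\<close>.  Only the values of \<open>delta\<close> on these finite ranges matter.
  Symbols: 0 is the blank, 1 and 2 are the bits, 3 is a separator.
  States: 0 is initial, 1 is halting, 2 asks a query, 3 is entered when the query is answered.
  Tape 0 carries input and output; tape 1 carries queries and their answers.\<close>

datatype dir = Leftwards | Stay | Rightwards

record machine =
  ntapes :: nat
  nstates :: nat
  nsyms :: nat
  delta :: "nat \<Rightarrow> nat list \<Rightarrow> nat \<times> (nat \<times> dir) list"

definition wf_machine :: "machine \<Rightarrow> bool" where
  "wf_machine M \<longleftrightarrow> 2 \<le> ntapes M \<and> 4 \<le> nstates M \<and> 4 \<le> nsyms M \<and>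
     (\<forall>q ss. q < nstates M \<and> length ss = ntapes M \<and> set ss \<subseteq> {..<nsyms M} \<longrightarrow>
        (case delta M q ss of (q', acts) \<Rightarrow>
           q' < nstates M \<and> length acts = ntapes M \<and> fst ` set acts \<subseteq> {..<nsyms M}))"

text \<open>A tape is its contents together with the head position.\<close>

type_synonym tape = "(int \<Rightarrow> nat) \<times> int"
type_synonym config = "nat \<times> tape list"

definition scanned :: "tape \<Rightarrow> nat" where
  "scanned t = fst t (snd t)"

definition act :: "nat \<times> dir \<Rightarrow> tape \<Rightarrow> tape" where
  "act a t = ((fst t)(snd t := fst a),
     (case snd a of Leftwards \<Rightarrow> snd t - 1 | Stay \<Rightarrow> snd t | Rightwards \<Rightarrow> snd t + 1))"

definition tape_of :: "nat list \<Rightarrow> tape" where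
  "tape_of ss = (\<lambda>i. if 0 \<le> i \<and> i < int (length ss) then ss ! nat i else 0, 0)"

fun bit_sym :: "bool \<Rightarrow> nat" where
  "bit_sym False = 1"
| "bit_sym True = 2"

definition holds_word :: "tape \<Rightarrow> bool list \<Rightarrow> bool" where
  "holds_word t w \<longleftrightarrow>
     (\<forall>i<length w. fst t (int i) = bit_sym (w ! i)) \<and> fst t (int (length w)) = 0"

text \<open>Binary expansion without leading zeros, least significant bit first.\<close>

fun bits_of_nat :: "nat \<Rightarrow> bool list" where
  "bits_of_nat n = (if n = 0 then [] else odd n # bits_of_nat (n div 2))"

declare bits_of_nat.simps [simp del]

text \<open>The oracle is a partial function \<open>F\<close>; the machine gets stuck, without halting, on a query
  outside its domain.\<close>

inductive step :: "machine \<Rightarrow> (bool list \<rightharpoonup> nat) \<Rightarrow> config \<Rightarrow> config \<Rightarrow> bool" for M F where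
  ordinary: "q \<noteq> 1 \<Longrightarrow> q \<noteq> 2 \<Longrightarrow> delta M q (map scanned ts) = (q', acts) \<Longrightarrow>
    step M F (q, ts) (q', map2 act acts ts)"
| query: "holds_word (ts ! 1) w \<Longrightarrow> F w = Some n \<Longrightarrow>
    step M F (2, ts) (3, ts[1 := tape_of (map bit_sym (bits_of_nat n))])"

definition initial :: "machine \<Rightarrow> nat list \<Rightarrow> config" where
  "initial M ss = (0, tape_of ss # replicate (ntapes M - 1) (tape_of []))"

definition outputs_within ::
    "machine \<Rightarrow> (bool list \<rightharpoonup> nat) \<Rightarrow> nat list \<Rightarrow> nat \<Rightarrow> bool list \<Rightarrow> bool" where
  "outputs_within M F ss t w \<longleftrightarrow>
     (\<exists>k\<le>t. \<exists>ts. (step M F ^^ k) (initial M ss) (1, ts) \<and> holds_word (ts ! 0) w)"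

lemma holds_word_unique:
  assumes "holds_word t v" "holds_word t w"
  shows "v = w"
proof -
  have pos: "bit_sym b \<noteq> 0" for b by (cases b) auto
  have inj: "bit_sym a = bit_sym b \<Longrightarrow> a = b" for a b by (cases a; cases b) auto
  have le: "length v \<le> length w" if "holds_word t v" "holds_word t w" for v w
  proof (rule ccontr)
    assume "\<not> length v \<le> length w"
    then have "fst t (int (length w)) = bit_sym (v ! length w)"
      using that(1) by (simp add: holds_word_def)
    then show False using that(2) pos by (simp add: holds_word_def)
  qed
  have len: "length v = length w" using assms le by (simp add: le_antisym)
  show ?thesis
  proof (rule nth_equalityI[OF len])
    fix i assume "i < length v"
    then show "v ! i = w ! i" using assms len by (intro inj) (simp add: holds_word_def)
  qed
qed

lemma step_deterministic:
  assumes "step M F c c1" "step M F c c2"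
  shows "c1 = c2"
  using assms(1)
proof cases
  case (ordinary q ts q' acts)
  then show ?thesis using assms(2) by (auto elim: step.cases)
next
  case (query ts w n)
  from assms(2) query(1) obtain w' n' where "holds_word (ts ! 1) w'" "F w' = Some n'"
      "c2 = (3, ts[1 := tape_of (map bit_sym (bits_of_nat n'))])"
    by (auto elim: step.cases)
  with query holds_word_unique[of "ts ! 1" w w'] show ?thesis by simp
qed


section \<open>The class #P and #P-completeness\<close>

text \<open>No oracle is available to the machine here: every query gets stuck.\<close>

definition polytime_relation :: "(bool list \<Rightarrow> bool list \<Rightarrow> bool) \<Rightarrow> bool" where
  "polytime_relation R \<longleftrightarrow> (\<exists>M (p :: nat poly). wf_machine M \<and>
     (\<forall>x y. outputs_within M Map.empty (map bit_sym x @ [3] @ map bit_sym y)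
        (poly p (length x + length y)) [R x y]))"

definition polynomially_balanced :: "(bool list \<Rightarrow> bool list \<Rightarrow> bool) \<Rightarrow> bool" where
  "polynomially_balanced R \<longleftrightarrow>
     (\<exists>p :: nat poly. \<forall>x y. R x y \<longrightarrow> length y \<le> poly p (length x))"

definition sharp_P :: "(bool list \<Rightarrow> nat) set" where
  "sharp_P = {\<lambda>x. card {y. R x y} | R. polytime_relation R \<and> polynomially_balanced R}"

text \<open>A counting problem is a partial function: its domain is the set of (encoded) instances.
  Nothing is required of a machine on inputs that are not instances, and conversely a reduction
  may query the oracle on instances only.\<close>

type_synonym counting_problem = "bool list \<rightharpoonup> nat"

definition in_sharp_P :: "counting_problem \<Rightarrow> bool" where
  "in_sharp_P P \<longleftrightarrow> (\<exists>f\<in>sharp_P. \<forall>x n. P x = Some n \<longrightarrow> f x = n)"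

definition polytime_Turing_reducible :: "(bool list \<Rightarrow> nat) \<Rightarrow> counting_problem \<Rightarrow> bool" where
  "polytime_Turing_reducible g P \<longleftrightarrow> (\<exists>M (p :: nat poly). wf_machine M \<and>
     (\<forall>x. outputs_within M P (map bit_sym x) (poly p (length x)) (bits_of_nat (g x))))"

definition sharp_P_complete :: "counting_problem \<Rightarrow> bool" where
  "sharp_P_complete P \<longleftrightarrow> in_sharp_P P \<and> (\<forall>g\<in>sharp_P. polytime_Turing_reducible g P)"


section \<open>Counting domino tilings of contractible regions\<close>

text \<open>A region is given by a list of its cubes, in any order and without repetition, with
  coordinates in signed binary; every number is written in a self-delimiting way.\<close>

definition enc_nat :: "nat \<Rightarrow> bool list" where
  "enc_nat n = concat (map (\<lambda>b. [True, b]) (bits_of_nat n)) @ [False]"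

definition enc_int :: "int \<Rightarrow> bool list" where
  "enc_int z = (z < 0) # enc_nat (nat \<bar>z\<bar>)"

definition enc_cube :: "int ^ 3 \<Rightarrow> bool list" where
  "enc_cube c = enc_int (c $ 1) @ enc_int (c $ 2) @ enc_int (c $ 3)"

definition enc_cubes :: "(int ^ 3) list \<Rightarrow> bool list" where
  "enc_cubes cs = concat (map enc_cube cs)"

lemma bits_of_nat_inject: "bits_of_nat m = bits_of_nat n \<Longrightarrow> m = n"
proof (induction m arbitrary: n rule: less_induct)
  case (less m)
  show ?case
  proof (cases "m = 0 \<or> n = 0")
    case True
    then show ?thesis using less.prems
      by (auto simp: bits_of_nat.simps[of m] bits_of_nat.simps[of n] bits_of_nat.simps[of 0] split: if_splits)
  next
    case False
    then have "odd m = odd n" "bits_of_nat (m div 2) = bits_of_nat (n div 2)"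
      using less.prems by (simp_all add: bits_of_nat.simps[of m] bits_of_nat.simps[of n])
    moreover from this less.IH[of "m div 2"] False have "m div 2 = n div 2" by simp
    ultimately show ?thesis by presburger
  qed
qed

lemma doubled_bits_append_inject:
  "concat (map (\<lambda>b. [True, b]) u) @ False # v = concat (map (\<lambda>b. [True, b]) u') @ False # v' \<longleftrightarrow>
     u = u' \<and> v = v'"
proof (induction u arbitrary: u')
  case Nil
  show ?case by (cases u') auto
next
  case (Cons b u)
  show ?case by (cases u') (auto simp: Cons.IH)
qed

lemma enc_int_append_inject: "enc_int a @ v = enc_int b @ w \<longleftrightarrow> a = b \<and> v = w"
  by (auto simp: enc_int_def enc_nat_def doubled_bits_append_inject dest!: bits_of_nat_inject)

lemma enc_cube_append_inject: "enc_cube c @ v = enc_cube d @ w \<longleftrightarrow> c = d \<and> v = w"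
  by (auto simp: enc_cube_def enc_int_append_inject vec_eq_iff forall_3)

lemma inj_enc_cubes: "inj enc_cubes"
proof (rule injI)
  show "enc_cubes cs = enc_cubes ds \<Longrightarrow> cs = ds" for cs ds
  proof (induction cs arbitrary: ds)
    case Nil
    then show ?case
      by (cases ds) (auto simp: enc_cubes_def enc_cube_def enc_int_def)
  next
    case (Cons c cs)
    then show ?case
      by (cases ds)
        (simp_all add: enc_cubes_def enc_cube_append_inject, simp add: enc_cube_def enc_int_def)
  qed
qed

definition domino_tilings_problem :: counting_problem where
  "domino_tilings_problem w =
     (if \<exists>cs. w = enc_cubes cs \<and> distinct cs \<and> contractible_region (set cs)
      then Some (card (tilings domino (set (inv enc_cubes w))))
      else None)"

lemma domino_tilings_problem_enc_cubes:
  "domino_tilings_problem (enc_cubes cs) =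
     (if distinct cs \<and> contractible_region (set cs) then Some (card (tilings domino (set cs))) else None)"
  by (auto simp: domino_tilings_problem_def inj_enc_cubes dest: injD[OF inj_enc_cubes])

end

theory Submission imports Defs "HOL-Number_Theory.Cong"
begin

text \<open>
  Membership: a tiling is certified by the direction in which the partner of each cube lies.  The directions can be
  interleaved with the code of the region, and comparing all pairs of cubes checks them, since a carry automaton decides
  whether two binary numbers differ by a given unit.

  Hardness: the accepting witnesses of a machine are the locally consistent fillings of its tableau, where a cell holds one of
  \<open>K\<close> local views and all constraints are between two cells.  Give every pair of a cell and a view a row and a column of a grid
  of \<open>8 \<times> 16\<close> blocks.  Matchings of the grid select one view for each cell, and the block at a crossing of two incompatible
  choices has no matching.  A signal that turns off its lane in the wrong direction has to pass \<open>m\<close> blocks which double the number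
  of matchings each; so modulo \<open>2 ^ m\<close> the number of matchings is \<open>2 ^ e\<close> times the number of fillings, which can be read off
  the binary digits of the oracle's answer.  The grid lies in one layer of cubes.  Its holes are filled, and a cube above or below each
  filling cube forces a vertical domino there; this makes the region contractible and does not change the number of tilings.
\<close>

section \<open>Perfect matchings\<close>

text \<open>Matchings of plane graphs are counted by determinants, so a flat grid would not do: the
  blocks \<open>HX\<close> and \<open>HE\<close> have three cells at height 1 each, a bridge of one
  wire over another. The obstacle is that a conflict has to count 0 while turning signals cannot be
  forbidden locally and all counts are nonnegative. The chain of \<open>m\<close> blocks
  \<open>CH\<close> supplies the weight -1: a signal on its upper lane doubles until it drops to the
  lower lane, in total 1 + 2 + ... + 2^(m-1) ways, which is -1 modulo 2^m. In \<open>HE\<close> the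
  unwanted outcomes come in pairs of equal weight on both lanes, and these cancel. Rows and columns
  select views independently; different views of the same cell are declared incompatible, so both
  selections agree. A chosen row passes \<open>N\<close> columns with weight 2 each, and there are
  \<open>G\<close> chosen rows, whence the factor 2^(N G). The chain length N G + N leaves room for
  the count, which is less than 2^N. The sides 8 and 16 of the blocks are powers of two: the binary
  code of a coordinate is then a constant of the program followed by the number of the
  block.\<close>

definition matchings :: "('a => 'a => bool) => 'a set => 'a set set set" where
  "matchings E V = {P. partition_on V P & (\<forall>A\<in>P. \<exists>a b. A = {a, b} & E a b)}"

definition pm :: "('a => 'a => bool) => 'a set => nat" where
  "pm E V = card (matchings E V)"

type_synonym cell = "int \<times> int \<times> int"

fun adj :: "cell => cell => bool" where
  "adj (x, y, z) (x', y', z') \<longleftrightarrow> \<bar>x - x'\<bar> + \<bar>y - y'\<bar> + \<bar>z - z'\<bar> = 1"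

lemma matchings_empty: "matchings E {} = {{}}"
  by (auto simp: matchings_def partition_on_empty)

lemma pm_empty [simp]: "pm E {} = 1"
  by (simp add: pm_def matchings_empty)

lemma finite_matchings: "finite V ==> finite (matchings E V)"
  by (rule finite_subset[of _ "Pow (Pow V)"]) (auto simp: matchings_def partition_on_def)

text \<open>Expansion along \<open>a\<close>: deleting the one edge at \<open>a\<close> inverts the
  insertion of that edge. All later counts rest on this recursion.\<close>

lemma matchings_insert:
  assumes a: "a \<notin> V" and sym: "\<And>a b. E a b ==> E b a" and irr: "\<And>a. \<not> E a a"
  shows "matchings E (insert a V) = (\<Union>b\<in>{b\<in>V. E a b}. insert {a, b} ` matchings E (V - {b}))"
proof (intro subset_antisym subsetI)
  fix P assume P: "P \<in> matchings E (insert a V)"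
  then have part: "partition_on (insert a V) P" and ed: "\<And>A. A \<in> P ==> \<exists>a b. A = {a, b} & E a b"
    by (auto simp: matchings_def)
  from part have "a \<in> \<Union>P" by (simp add: partition_on_def)
  then obtain A where A: "A \<in> P" "a \<in> A" by blast
  from ed[OF A(1)] A(2) obtain b where b: "A = {a, b}" "E a b" using sym by blast
  have "b \<in> insert a V" using b part A by (auto simp: partition_on_def)
  then have bV: "b \<in> V" using b irr by auto
  have "partition_on (insert a V - A) (P - {A})"
    using part A(1) unfolding partition_on_def
    by (auto simp: disjoint_def)
  moreover have "insert a V - A = V - {b}" using b a by auto
  ultimately have "P - {A} \<in> matchings E (V - {b})" using ed by (auto simp: matchings_def)
  moreover have "P = insert {a, b} (P - {A})" using A b by auto
  ultimately show "P \<in> (\<Union>b\<in>{b\<in>V. E a b}. insert {a, b} ` matchings E (V - {b}))"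
    using bV b by blast
next
  fix P assume "P \<in> (\<Union>b\<in>{b\<in>V. E a b}. insert {a, b} ` matchings E (V - {b}))"
  then obtain b Q where b: "b \<in> V" "E a b" and P: "P = insert {a, b} Q" and Q: "Q \<in> matchings E (V - {b})"
    by blast
  have pQ: "partition_on (V - {b}) Q" using Q by (simp add: matchings_def)
  have dq: "disjnt {a, b} (\<Union>Q)" using pQ a by (auto simp: partition_on_def disjnt_def)
  have ee: "insert a V - {a, b} = V - {b}" using a by auto
  have "partition_on (insert a V) (insert {a, b} Q)"
    unfolding partition_on_insert[OF dq] ee using pQ b by simp
  then show "P \<in> matchings E (insert a V)" using P Q b by (auto simp: matchings_def)
qed

lemma pm_insert:
  assumes fin: "finite V" and a: "a \<notin> V" and sym: "\<And>a b. E a b ==> E b a" and irr: "\<And>a. \<not> E a a"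
  shows "pm E (insert a V) = (\<Sum>b\<in>{b\<in>V. E a b}. pm E (V - {b}))"
proof -
  \<comment> \<open>No matching of \<open>V - {c}\<close> covers \<open>a\<close>; hence inserting
    an edge at \<open>a\<close> is injective, and different partners of \<open>a\<close> give
    disjoint sets of matchings.\<close>
  have nin: "{a, b} \<notin> P" if P: "P \<in> matchings E (V - {c})" for b c P
  proof
    assume "{a, b} \<in> P"
    then have "a \<in> \<Union>P" by blast
    moreover have "\<Union>P = V - {c}" using P by (simp add: matchings_def partition_on_def)
    ultimately show False using a by blast
  qed
  have inj: "inj_on (insert {a, b}) (matchings E (V - {b}))" for b
  proof (rule inj_onI)
    fix P Q assume PQ: "P \<in> matchings E (V - {b})" "Q \<in> matchings E (V - {b})" "insert {a, b} P = insert {a, b} Q"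
    then show "P = Q" using nin[OF PQ(1), of b] nin[OF PQ(2), of b] by (simp add: insert_ident)
  qed
  have "card (\<Union>b\<in>{b\<in>V. E a b}. insert {a, b} ` matchings E (V - {b})) =
      (\<Sum>b\<in>{b\<in>V. E a b}. card (insert {a, b} ` matchings E (V - {b})))"
  proof (rule card_UN_disjoint)
    show "\<forall>i\<in>{b \<in> V. E a b}. \<forall>j\<in>{b \<in> V. E a b}. i \<noteq> j -->
        insert {a, i} ` matchings E (V - {i}) \<inter> insert {a, j} ` matchings E (V - {j}) = {}"
    proof (intro ballI impI, rule ccontr)
      fix i j assume ij: "i \<in> {b \<in> V. E a b}" "j \<in> {b \<in> V. E a b}" "i \<noteq> j"
        and "insert {a, i} ` matchings E (V - {i}) \<inter> insert {a, j} ` matchings E (V - {j}) \<noteq> {}"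
      then obtain P Q where "P \<in> matchings E (V - {i})" "insert {a, i} P = insert {a, j} Q" by blast
      then have "{a, j} \<in> insert {a, i} P" "{a, j} \<notin> P" using nin[of P i j] by auto
      then have "{a, j} = {a, i}" by simp
      then show False using ij a by (auto simp: doubleton_eq_iff)
    qed
  qed (use fin in \<open>auto intro: finite_matchings\<close>)
  also have "\<dots> = (\<Sum>b\<in>{b\<in>V. E a b}. pm E (V - {b}))"
    by (simp add: card_image[OF inj] pm_def)
  finally show ?thesis by (simp add: pm_def matchings_insert[OF a sym irr])
qed

text \<open>The value 0 outside \<open>A\<close> lets sums run over all subsets of a cut: asking for
  a port that a block does not have counts nothing.\<close>

definition pmx :: "('a => 'a => bool) => 'a set => 'a set => nat" where
  "pmx E A T = (if T \<subseteq> A then pm E (A - T) else 0)"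

text \<open>Sorts the matchings by the set \<open>S\<close> of cut edges that they use; since
  \<open>X\<close> is itself a matching, \<open>S\<close> is determined by its ends on either side.
  In the induction a vertex \<open>a\<close> of \<open>A\<close> is expanded: a partner inside
  \<open>A\<close> accounts for the sets \<open>S\<close> that avoid \<open>a\<close>, the only
  possible partner in \<open>B\<close> for those that contain the edge at \<open>a\<close>.\<close>

lemma pm_cut:
  assumes sym: "\<And>a b. E a b ==> E b a" and irr: "\<And>a. \<not> E a a"
    and X: "finite X" "inj_on fst X" "inj_on snd X" "\<And>u w. (u, w) \<in> X ==> E u w"
    and "finite A" "finite B" "A \<inter> B = {}" "\<And>a b. a \<in> A ==> b \<in> B ==> E a b ==> (a, b) \<in> X"
  shows "pm E (A \<union> B) = (\<Sum>S\<in>Pow X. pmx E A (fst ` S) * pmx E B (snd ` S))"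
  using assms(7-)
proof (induction "card A" arbitrary: A B rule: less_induct)
  case less
  show ?case
  proof (cases "A = {}")
    case True
    have "(\<Sum>S\<in>Pow X. pmx E A (fst ` S) * pmx E B (snd ` S)) = (\<Sum>S\<in>{{}}. pmx E A (fst ` S) * pmx E B (snd ` S))"
      using X(1) by (intro sum.mono_neutral_right) (auto simp: pmx_def True)
    then show ?thesis by (simp add: True pmx_def)
  next
    case False
    then obtain a where "a \<in> A" by blast
    define A' where "A' = A - {a}"
    have A: "A = insert a A'" "a \<notin> A'" "finite A'" "finite B" "a \<notin> B" "A' \<inter> B = {}"
      using \<open>a \<in> A\<close> less.prems by (auto simp: A'_def)
    have cA: "card A' < card A" unfolding A'_def by (rule card_Diff1_less[OF less.prems(1) \<open>a \<in> A\<close>])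
    let ?f = "%A B S. pmx E A (fst ` S) * pmx E B (snd ` S)"
    have cr: "\<And>x y. x \<in> A' ==> y \<in> B ==> E x y ==> (x, y) \<in> X" using less.prems(4) A(1) by blast
    have IH1: "pm E ((A' - {b}) \<union> B) = (\<Sum>S\<in>Pow X. ?f (A' - {b}) B S)" for b
    proof (rule less.hyps)
      show "card (A' - {b}) < card A" using cA card_Diff1_le[of A' b] by linarith
    qed (use A(3,4,6) cr in blast)+
    have IH2: "pm E (A' \<union> (B - {w})) = (\<Sum>S\<in>Pow X. ?f A' (B - {w}) S)" for w
      by (rule less.hyps[OF cA]) (use A(3,4,6) cr in blast)+
    have dj: "A' \<union> B - {b} = (A' - {b}) \<union> B" if "b \<in> A'" for b using that A by auto
    have dj2: "A' \<union> B - {b} = A' \<union> (B - {b})" if "b \<in> B" for b using that A by auto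
    have "pm E (A \<union> B) = pm E (insert a (A' \<union> B))" by (simp add: A)
    also have "\<dots> = (\<Sum>b\<in>{b\<in>A' \<union> B. E a b}. pm E (A' \<union> B - {b}))"
      by (rule pm_insert) (use A sym irr in auto)
    also have "{b\<in>A' \<union> B. E a b} = {b\<in>A'. E a b} \<union> {b\<in>B. E a b}" by auto
    also have "(\<Sum>b\<in>{b\<in>A'. E a b} \<union> {b\<in>B. E a b}. pm E (A' \<union> B - {b})) =
       (\<Sum>b\<in>{b\<in>A'. E a b}. pm E (A' \<union> B - {b})) + (\<Sum>b\<in>{b\<in>B. E a b}. pm E (A' \<union> B - {b}))"
      by (rule sum.union_disjoint) (use A in auto)
    also have "(\<Sum>b\<in>{b\<in>A'. E a b}. pm E (A' \<union> B - {b})) = (\<Sum>b\<in>{b\<in>A'. E a b}. \<Sum>S\<in>Pow X. ?f (A' - {b}) B S)"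
      by (rule sum.cong) (auto simp: dj IH1)
    also have "\<dots> = (\<Sum>S\<in>Pow X. \<Sum>b\<in>{b\<in>A'. E a b}. ?f (A' - {b}) B S)" by (rule sum.swap)
    also have "\<dots> = (\<Sum>S\<in>{S\<in>Pow X. a \<notin> fst ` S}. ?f A B S)"
    proof -
      have "(\<Sum>b\<in>{b\<in>A'. E a b}. ?f (A' - {b}) B S) = (if a \<notin> fst ` S then ?f A B S else 0)" for S
      proof (cases "a \<in> fst ` S \<or> \<not> fst ` S \<subseteq> A'")
        case True
        then have "\<not> fst ` S \<subseteq> A' - {b}" for b using A(2) by blast
        then have "pmx E (A' - {b}) (fst ` S) = 0" for b by (simp add: pmx_def)
        moreover have "a \<notin> fst ` S ==> \<not> fst ` S \<subseteq> A" using True A(1) by blast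
        then have "a \<notin> fst ` S ==> pmx E A (fst ` S) = 0" by (simp add: pmx_def)
        ultimately show ?thesis by simp
      next
        case F: False
        have "pmx E A (fst ` S) = pm E (insert a (A' - fst ` S))"
        proof -
          have "A - fst ` S = insert a (A' - fst ` S)" "fst ` S \<subseteq> A" using F A(1) by blast+
          then show ?thesis by (simp add: pmx_def)
        qed
        also have "\<dots> = (\<Sum>b\<in>{b\<in>A' - fst ` S. E a b}. pm E (A' - fst ` S - {b}))"
          by (rule pm_insert) (use A sym irr in auto)
        also have "\<dots> = (\<Sum>b\<in>{b\<in>A'. E a b}. pmx E (A' - {b}) (fst ` S))"
        proof (rule sum.mono_neutral_cong_left)
          show "pm E (A' - fst ` S - {b}) = pmx E (A' - {b}) (fst ` S)" if "b \<in> {b\<in>A' - fst ` S. E a b}" for b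
          proof -
            have "A' - fst ` S - {b} = A' - {b} - fst ` S" by blast
            moreover have "fst ` S \<subseteq> A' - {b}" using F that by blast
            ultimately show ?thesis unfolding pmx_def by simp
          qed
        next
          show "\<forall>b\<in>{b\<in>A'. E a b} - {b\<in>A' - fst ` S. E a b}. pmx E (A' - {b}) (fst ` S) = 0"
          proof
            fix b assume "b \<in> {b\<in>A'. E a b} - {b\<in>A' - fst ` S. E a b}"
            then have "\<not> fst ` S \<subseteq> A' - {b}" by blast
            then show "pmx E (A' - {b}) (fst ` S) = 0" by (simp add: pmx_def)
          qed
        qed (use A(3) in auto)
        finally show ?thesis using F by (simp add: sum_distrib_right)
      qed
      then show ?thesis using X(1) by (simp add: sum.If_cases Int_def)
    qed
    also have "(\<Sum>b\<in>{b\<in>B. E a b}. pm E (A' \<union> B - {b})) = (\<Sum>S\<in>{S\<in>Pow X. a \<in> fst ` S}. ?f A B S)"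
    proof (cases "\<exists>w. (a, w) \<in> X")
      case False
      then have "{b\<in>B. E a b} = {}" using less.prems(4) \<open>a \<in> A\<close> by blast
      moreover have "{S\<in>Pow X. a \<in> fst ` S} = {}" using False by force
      ultimately show ?thesis by (simp only: sum.empty)
    next
      case True
      then obtain w where w: "(a, w) \<in> X" by blast
      have uw: "v = w" if "(a, v) \<in> X" for v using inj_onD[OF X(2) _ w that] by simp
      have img: "{S\<in>Pow X. a \<in> fst ` S} = insert (a, w) ` Pow (X - {(a, w)})"
      proof (intro subset_antisym subsetI)
        fix S assume "S \<in> {S\<in>Pow X. a \<in> fst ` S}"
        then have "(a, w) \<in> S" "S \<subseteq> X" using uw by auto
        then have "S = insert (a, w) (S - {(a, w)})" "S - {(a, w)} \<in> Pow (X - {(a, w)})" by auto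
        then show "S \<in> insert (a, w) ` Pow (X - {(a, w)})" by blast
      next
        fix S assume "S \<in> insert (a, w) ` Pow (X - {(a, w)})"
        then obtain S' where "S = insert (a, w) S'" "S' \<subseteq> X" by blast
        then show "S \<in> {S\<in>Pow X. a \<in> fst ` S}" using w by simp
      qed
      have inj: "inj_on (insert (a, w)) (Pow (X - {(a, w)}))"
        by (rule inj_onI, subst (asm) insert_ident) auto
      have step: "?f A B (insert (a, w) S) = (if w \<in> B then ?f A' (B - {w}) S else 0)" if S: "S \<in> Pow (X - {(a, w)})" for S
      proof -
        have "a \<notin> fst ` S" using S uw by auto
        then have 1: "pmx E A (insert a (fst ` S)) = pmx E A' (fst ` S)"
        proof -
          have "A - insert a (fst ` S) = A' - fst ` S" using A(1,2) by blast
          moreover have "insert a (fst ` S) \<subseteq> A \<longleftrightarrow> fst ` S \<subseteq> A'" using A(1,2) \<open>a \<notin> fst ` S\<close> by blast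
          ultimately show ?thesis by (simp add: pmx_def)
        qed
        have "w \<notin> snd ` S"
        proof
          assume "w \<in> snd ` S"
          then obtain v where v: "(v, w) \<in> S" by auto
          then have "(v, w) = (a, w)" using X(3) w S by (intro inj_onD[OF X(3)]) auto
          then show False using v S by auto
        qed
        then have 2: "pmx E B (insert w (snd ` S)) = (if w \<in> B then pmx E (B - {w}) (snd ` S) else 0)"
        proof -
          have "B - insert w (snd ` S) = B - {w} - snd ` S" by blast
          moreover have "insert w (snd ` S) \<subseteq> B \<longleftrightarrow> w \<in> B & snd ` S \<subseteq> B - {w}" using \<open>w \<notin> snd ` S\<close> by blast
          ultimately show ?thesis by (simp add: pmx_def)
        qed
        show ?thesis by (simp add: 1 2)
      qed
      have "(\<Sum>S\<in>{S\<in>Pow X. a \<in> fst ` S}. ?f A B S) = (\<Sum>S\<in>Pow (X - {(a, w)}). if w \<in> B then ?f A' (B - {w}) S else 0)"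
        unfolding img sum.reindex[OF inj] o_def by (rule sum.cong[OF refl step])
      also have "\<dots> = (if w \<in> B then (\<Sum>S\<in>Pow (X - {(a, w)}). ?f A' (B - {w}) S) else 0)" by simp
      also have "(\<Sum>S\<in>Pow (X - {(a, w)}). ?f A' (B - {w}) S) = (\<Sum>S\<in>Pow X. ?f A' (B - {w}) S)"
      proof (rule sum.mono_neutral_left)
        show "\<forall>S\<in>Pow X - Pow (X - {(a, w)}). ?f A' (B - {w}) S = 0"
        proof
          fix S assume "S \<in> Pow X - Pow (X - {(a, w)})"
          then have "(a, w) \<in> S" by blast
          then have "a \<in> fst ` S" by force
          then show "?f A' (B - {w}) S = 0" using A by (auto simp: pmx_def)
        qed
      qed (use X in auto)
      also have "(if w \<in> B then (\<Sum>S\<in>Pow X. ?f A' (B - {w}) S) else 0) = (\<Sum>b\<in>{b\<in>B. E a b}. pm E (A' \<union> B - {b}))"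
      proof (cases "w \<in> B")
        case True
        then have eq: "{b\<in>B. E a b} = {w}" using less.prems(4) \<open>a \<in> A\<close> uw X(4)[OF w] by blast
        show ?thesis unfolding eq using True by (simp add: dj2 IH2)
      next
        case False
        then have eq: "{b\<in>B. E a b} = {}" using less.prems(4) \<open>a \<in> A\<close> uw by blast
        show ?thesis unfolding eq using False by simp
      qed
      finally show ?thesis by simp
    qed
    also have "(\<Sum>S\<in>{S\<in>Pow X. a \<notin> fst ` S}. ?f A B S) + (\<Sum>S\<in>{S\<in>Pow X. a \<in> fst ` S}. ?f A B S) = (\<Sum>S\<in>Pow X. ?f A B S)"
    proof -
      have P: "Pow X = {S\<in>Pow X. a \<notin> fst ` S} \<union> {S\<in>Pow X. a \<in> fst ` S}" by blast
      have "(\<Sum>S\<in>Pow X. ?f A B S) = (\<Sum>S\<in>{S\<in>Pow X. a \<notin> fst ` S} \<union> {S\<in>Pow X. a \<in> fst ` S}. ?f A B S)"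
        by (rule sum.cong[OF P refl])
      also have "\<dots> = (\<Sum>S\<in>{S\<in>Pow X. a \<notin> fst ` S}. ?f A B S) + (\<Sum>S\<in>{S\<in>Pow X. a \<in> fst ` S}. ?f A B S)"
        by (rule sum.union_disjoint) (use X(1) in auto)
      finally show ?thesis by simp
    qed
    finally show ?thesis .
  qed
qed

lemma pm_image:
  assumes sym: "\<And>a b. E a b ==> E b a" and irr: "\<And>a. \<not> E a a"
    and sym': "\<And>a b. E' a b ==> E' b a" and irr': "\<And>a. \<not> E' a a"
    and "finite V" "inj_on f V" "\<And>a b. a \<in> V ==> b \<in> V ==> E' (f a) (f b) = E a b"
  shows "pm E' (f ` V) = pm E V"
  using assms(5-)
proof (induction "card V" arbitrary: V rule: less_induct)
  case less
  show ?case
  proof (cases "V = {}")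
    case False
    then obtain a W where V: "V = insert a W" "a \<notin> W" by (meson mk_disjoint_insert all_not_in_conv)
    have fW: "finite W" using less.prems V by simp
    have inj: "inj_on f W" "f a \<notin> f ` W" using less.prems(2) V by auto
    have "pm E' (f ` V) = (\<Sum>b\<in>{b\<in>f ` W. E' (f a) b}. pm E' (f ` W - {b}))"
      unfolding V image_insert by (rule pm_insert) (use fW inj sym' irr' in auto)
    also have "{b\<in>f ` W. E' (f a) b} = f ` {b\<in>W. E a b}" using less.prems(3) V by auto
    also have "(\<Sum>b\<in>f ` {b\<in>W. E a b}. pm E' (f ` W - {b})) = (\<Sum>b\<in>{b\<in>W. E a b}. pm E' (f ` (W - {b})))"
    proof -
      have "inj_on f {b\<in>W. E a b}" using inj(1) by (rule inj_on_subset) auto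
      moreover have "f ` W - {f b} = f ` (W - {b})" if "b \<in> W" for b
        using inj_on_image_set_diff[OF inj(1), of W "{b}"] that by simp
      ultimately show ?thesis by (simp add: sum.reindex)
    qed
    also have "\<dots> = (\<Sum>b\<in>{b\<in>W. E a b}. pm E (W - {b}))"
    proof (rule sum.cong[OF refl])
      fix b
      have "card (W - {b}) < card V" using V fW card_Diff1_le[of W b] by simp
      then show "pm E' (f ` (W - {b})) = pm E (W - {b})"
        using less.hyps[of "W - {b}"] fW inj(1) less.prems(3) V by (auto intro: inj_on_subset)
    qed
    also have "\<dots> = pm E V" unfolding V by (rule pm_insert[symmetric]) (use fW V sym irr in auto)
    finally show ?thesis .
  qed simp
qed

text \<open>Each \<open>f d\<close> has \<open>d\<close> as its only neighbour, so this edge is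
  forced, and removing both ends takes away no choice.\<close>

lemma pm_remove_leaves:
  assumes sym: "\<And>a b. E a b ==> E b a" and irr: "\<And>a. \<not> E a a"
    and "finite V" "finite D" "inj_on f D" "V \<inter> D = {}" "V \<inter> f ` D = {}" "D \<inter> f ` D = {}"
    and "\<And>d. d \<in> D ==> E (f d) d" "\<And>d c. d \<in> D ==> c \<in> V \<union> D \<union> f ` D ==> E (f d) c ==> c = d"
  shows "pm E (V \<union> D \<union> f ` D) = pm E V"
  using assms(4-)
proof (induction D rule: finite_induct)
  case (insert d D)
  have IH: "pm E (V \<union> D \<union> f ` D) = pm E V" proof (rule insert.IH)
    fix e c assume "e \<in> D" "c \<in> V \<union> D \<union> f ` D" "E (f e) c"
    then show "c = e" using insert.prems(6)[of e c] by blast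
  qed (use insert.prems(1-5) in blast)+
  have new: "d \<notin> V" "d \<notin> f ` D" "f d \<notin> V" "f d \<notin> D" "f d \<notin> f ` D" "f d \<noteq> d"
    using insert.prems(1-4) insert.hyps by auto
  have eq: "V \<union> insert d D \<union> f ` insert d D = insert (f d) (insert d (V \<union> D \<union> f ` D))" by auto
  have "pm E (insert (f d) (insert d (V \<union> D \<union> f ` D))) =
      (\<Sum>b\<in>{b\<in>insert d (V \<union> D \<union> f ` D). E (f d) b}. pm E (insert d (V \<union> D \<union> f ` D) - {b}))"
    by (rule pm_insert) (use new insert.hyps assms(3) sym irr in auto)
  also have "{b\<in>insert d (V \<union> D \<union> f ` D). E (f d) b} = {d}"
    using insert.prems(5)[of d] insert.prems(6)[of d] by blast
  finally have "pm E (insert (f d) (insert d (V \<union> D \<union> f ` D))) = pm E (insert d (V \<union> D \<union> f ` D) - {d})"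
    by simp
  moreover have "insert d (V \<union> D \<union> f ` D) - {d} = V \<union> D \<union> f ` D" using new insert.hyps by auto
  ultimately show ?case using IH by (simp only: eq)
qed simp

lemma adj_sym: "adj a b ==> adj b a"
  by (cases a; cases b) auto

lemma adj_irrefl: "\<not> adj a a"
  by (cases a) auto

text \<open>\<open>pm_insert\<close> as an executable recursion, so that blocks can be counted by
  evaluation.\<close>

function pml :: "cell list => nat" where
  "pml [] = 1"
| "pml (a # l) = sum_list (map (%b. pml (remove1 b l)) (filter (adj a) l))"
  by pat_completeness auto
termination by (relation "Wellfounded.measure length") (auto simp: length_remove1)

lemma pm_set: "distinct l ==> pm adj (set l) = pml l"
proof (induction l rule: pml.induct)
  case (2 a l)
  have "pm adj (set (a # l)) = (\<Sum>b\<in>{b\<in>set l. adj a b}. pm adj (set l - {b}))"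
    unfolding list.set by (rule pm_insert) (use 2 adj_sym adj_irrefl in auto)
  also have "\<dots> = (\<Sum>b\<in>set (filter (adj a) l). pml (remove1 b l))"
  proof (rule sum.cong)
    fix b assume "b \<in> set (filter (adj a) l)"
    then have "pm adj (set (remove1 b l)) = pml (remove1 b l)" using 2 by simp
    then show "pm adj (set l - {b}) = pml (remove1 b l)" using 2(2) by simp
  qed simp
  finally show ?case using 2(2) by (simp add: sum_list_distinct_conv_sum_set)
qed simp

section \<open>Tilings of slabs\<close>

definition vadj :: "int ^ 3 => int ^ 3 => bool" where
  "vadj a b \<longleftrightarrow> \<bar>a $ 1 - b $ 1\<bar> + \<bar>a $ 2 - b $ 2\<bar> + \<bar>a $ 3 - b $ 3\<bar> = 1"

lemma vadj_sym: "vadj a b ==> vadj b a"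
  by (auto simp: vadj_def)

lemma vadj_irrefl: "\<not> vadj a a"
  by (simp add: vadj_def)

lemma dist_lattice_point:
  "dist (lattice_point a) (lattice_point b) = sqrt (real_of_int ((a $ 1 - b $ 1)\<^sup>2 + (a $ 2 - b $ 2)\<^sup>2 + (a $ 3 - b $ 3)\<^sup>2))"
  by (simp add: dist_vec_def L2_set_def lattice_point_def sum_3 dist_real_def)

text \<open>Links Euclidean distance, which isometries preserve, with adjacency in absolute values.
  It is special to integers: t^2 is at least |t|, and equal to it when |t| is at most 1.\<close>

lemma sum_squares_eq_1_int:
  fixes x y z :: int
  shows "x\<^sup>2 + y\<^sup>2 + z\<^sup>2 = 1 \<longleftrightarrow> \<bar>x\<bar> + \<bar>y\<bar> + \<bar>z\<bar> = 1"
proof -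
  have sq: "(t::int)\<^sup>2 \<ge> \<bar>t\<bar>" for t
  proof (cases "t = 0")
    case False
    then have "1 \<le> \<bar>t\<bar>" by linarith
    then have "\<bar>t\<bar> \<le> \<bar>t\<bar> ^ 2" by (rule self_le_power) simp
    then show ?thesis by simp
  qed simp
  have sq0: "(t::int)\<^sup>2 = \<bar>t\<bar>" if "\<bar>t\<bar> \<le> 1" for t
  proof -
    have "t = 0 \<or> t = 1 \<or> t = -1" using that by linarith
    then show ?thesis by auto
  qed
  show ?thesis
  proof
    assume a: "x\<^sup>2 + y\<^sup>2 + z\<^sup>2 = 1"
    have "\<bar>x\<bar> \<le> 1" "\<bar>y\<bar> \<le> 1" "\<bar>z\<bar> \<le> 1"
      using a sq[of x] sq[of y] sq[of z] zero_le_power2[of x] zero_le_power2[of y] zero_le_power2[of z] by linarith+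
    then show "\<bar>x\<bar> + \<bar>y\<bar> + \<bar>z\<bar> = 1" using a by (simp add: sq0)
  next
    assume a: "\<bar>x\<bar> + \<bar>y\<bar> + \<bar>z\<bar> = 1"
    then have "\<bar>x\<bar> \<le> 1" "\<bar>y\<bar> \<le> 1" "\<bar>z\<bar> \<le> 1" by linarith+
    then show "x\<^sup>2 + y\<^sup>2 + z\<^sup>2 = 1" using a by (simp add: sq0)
  qed
qed

lemma vadj_iff_dist: "vadj a b \<longleftrightarrow> dist (lattice_point a) (lattice_point b) = 1"
  unfolding vadj_def dist_lattice_point sum_squares_eq_1_int[symmetric]
  by (simp only: real_sqrt_eq_1_iff of_int_eq_1_iff)

lemma domino_eq: "domino = {0, axis 1 1}"
proof -
  have "c = 0 \<or> c = axis 1 1" if "c \<in> domino" for c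
  proof -
    have "c $ 1 = 0 \<or> c $ 1 = 1" "c $ 2 = 0" "c $ 3 = 0" using that by (auto simp: domino_def)
    then show ?thesis by (auto simp: vec_eq_iff forall_3 axis_def)
  qed
  then show ?thesis by (auto simp: domino_def axis_def)
qed

text \<open>The isometry that takes 0 to \<open>a\<close> and the first unit vector to
  \<open>b\<close>: exchange axis 1 with the axis \<open>k\<close> in which the two points differ,
  multiply by the sign \<open>s\<close> of the difference, and translate by
  \<open>a\<close>.\<close>

lemma lattice_isometry_ex:
  assumes "vadj a b"
  shows "\<exists>f. lattice_isometry f & {a, b} = f ` domino"
proof -
  obtain k where k: "b $ k \<noteq> a $ k" "\<bar>b $ k - a $ k\<bar> = 1" "\<And>i. i \<noteq> k ==> b $ i = a $ i"
  proof -
    have "(\<bar>b $ 1 - a $ 1\<bar> = 1 & b $ 2 = a $ 2 & b $ 3 = a $ 3) \<or> (\<bar>b $ 2 - a $ 2\<bar> = 1 & b $ 1 = a $ 1 & b $ 3 = a $ 3)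
        \<or> (\<bar>b $ 3 - a $ 3\<bar> = 1 & b $ 1 = a $ 1 & b $ 2 = a $ 2)"
    proof -
      have "(\<bar>x\<bar> = 1 & y = 0 & z = 0) \<or> (\<bar>y\<bar> = 1 & x = 0 & z = 0) \<or> (\<bar>z\<bar> = 1 & x = 0 & y = 0)"
        if "\<bar>x\<bar> + \<bar>y\<bar> + \<bar>z\<bar> = 1" for x y z :: int
        using that by (cases "x = 0"; cases "y = 0") auto
      from this[of "b $ 1 - a $ 1" "b $ 2 - a $ 2" "b $ 3 - a $ 3"] show ?thesis
        using assms by (simp add: vadj_def abs_minus_commute)
    qed
    then show ?thesis
    proof (elim disjE conjE)
      assume h: "\<bar>b $ 1 - a $ 1\<bar> = 1" "b $ 2 = a $ 2" "b $ 3 = a $ 3"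
      have "b $ i = a $ i" if "i \<noteq> 1" for i using h that exhaust_3[of i] by (elim disjE) simp_all
      then show ?thesis using h(1) by (intro that[of 1]) auto
    next
      assume h: "\<bar>b $ 2 - a $ 2\<bar> = 1" "b $ 1 = a $ 1" "b $ 3 = a $ 3"
      have "b $ i = a $ i" if "i \<noteq> 2" for i using h that exhaust_3[of i] by (elim disjE) simp_all
      then show ?thesis using h(1) by (intro that[of 2]) auto
    next
      assume h: "\<bar>b $ 3 - a $ 3\<bar> = 1" "b $ 1 = a $ 1" "b $ 2 = a $ 2"
      have "b $ i = a $ i" if "i \<noteq> 3" for i using h that exhaust_3[of i] by (elim disjE) simp_all
      then show ?thesis using h(1) by (intro that[of 3]) auto
    qed
  qed
  define s where "s = b $ k - a $ k"
  have s2: "s * s = 1" using k(2) unfolding s_def by (metis abs_mult_self_eq mult_1)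
  define \<tau> where "\<tau> = Transposition.transpose 1 k"
  define f where "f c = (\<chi> i. a $ i + s * c $ \<tau> i)" for c :: "int ^ 3"
  define g where "g c = (\<chi> i. s * (c $ \<tau> i - a $ \<tau> i))" for c :: "int ^ 3"
  have tt: "\<tau> (\<tau> i) = i" for i by (simp add: \<tau>_def)
  have "g (f c) = c" "f (g c) = c" for c
    by (simp_all add: vec_eq_iff f_def g_def tt s2 flip: mult.assoc)
  then have "bij f" by (intro o_bij[of g]) (auto simp: fun_eq_iff)
  moreover have "dist (lattice_point (f x)) (lattice_point (f y)) = dist (lattice_point x) (lattice_point y)" for x y
  proof -
    have "(\<Sum>i\<in>UNIV. (dist (lattice_point (f x) $ i) (lattice_point (f y) $ i))\<^sup>2) =
        (\<Sum>i\<in>UNIV. (dist (lattice_point x $ \<tau> i) (lattice_point y $ \<tau> i))\<^sup>2)"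
    proof (rule sum.cong[OF refl])
      fix i
      have r: "real_of_int s * real_of_int s = 1" using s2 by (metis of_int_1 of_int_mult)
      have "(real_of_int s * u - real_of_int s * v)\<^sup>2 = (real_of_int s * real_of_int s) * (u - v)\<^sup>2" for u v
        by (simp add: power2_eq_square algebra_simps)
      then show "(dist (lattice_point (f x) $ i) (lattice_point (f y) $ i))\<^sup>2 =
          (dist (lattice_point x $ \<tau> i) (lattice_point y $ \<tau> i))\<^sup>2"
        by (simp add: lattice_point_def f_def dist_real_def r)
    qed
    also have "\<dots> = (\<Sum>i\<in>UNIV. (dist (lattice_point x $ i) (lattice_point y $ i))\<^sup>2)"
      by (rule sum.reindex_bij_betw) (simp add: \<tau>_def)
    finally show ?thesis by (simp add: dist_vec_def L2_set_def)
  qed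
  moreover have "f 0 = a" by (simp add: f_def vec_eq_iff)
  moreover have "f (axis 1 1) = b"
  proof -
    have "f (axis 1 1) $ i = b $ i" for i
      by (cases "i = k"; cases "i = 1") (auto simp: f_def axis_def \<tau>_def s_def k(3) Transposition.transpose_def)
    then show ?thesis by (simp add: vec_eq_iff)
  qed
  ultimately show ?thesis by (intro exI[of _ f]) (simp add: lattice_isometry_def domino_eq)
qed

lemma tilings_domino: "tilings domino \<Gamma> = matchings vadj \<Gamma>"
proof -
  have "(\<exists>f. lattice_isometry f & A = f ` domino) \<longleftrightarrow> (\<exists>a b. A = {a, b} & vadj a b)" for A
  proof
    assume "\<exists>f. lattice_isometry f & A = f ` domino"
    then obtain f where f: "lattice_isometry f" "A = {f 0, f (axis 1 1)}" by (auto simp: domino_eq)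
    have "vadj 0 (axis 1 1)" by (simp add: vadj_def axis_def)
    then have "vadj (f 0) (f (axis 1 1))" using f(1) by (simp add: vadj_iff_dist lattice_isometry_def)
    then show "\<exists>a b. A = {a, b} & vadj a b" using f by blast
  qed (use lattice_isometry_ex in blast)
  then show ?thesis by (simp add: tilings_def matchings_def)
qed

definition vec_of_cell :: "cell => int ^ 3" where
  "vec_of_cell c = vector [fst c, fst (snd c), snd (snd c)]"

lemma vec_of_cell_nth [simp]:
  "vec_of_cell c $ 1 = fst c" "vec_of_cell c $ 2 = fst (snd c)" "vec_of_cell c $ 3 = snd (snd c)"
  by (simp_all add: vec_of_cell_def)

lemma inj_vec_of_cell: "inj vec_of_cell"
  by (rule injI) (metis prod.collapse vec_of_cell_nth)

lemma card_tilings_cells: "finite V ==> card (tilings domino (vec_of_cell ` V)) = pm adj V"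
  unfolding tilings_domino pm_def[symmetric]
  by (rule pm_image) (auto simp: adj_sym adj_irrefl vadj_sym vadj_irrefl vadj_def intro: inj_on_subset[OF inj_vec_of_cell])

definition flatten :: "real => real ^ 3 => real ^ 3" where
  "flatten s p = (\<chi> i. if i = 3 then s * p $ 3 else p $ i)"

lemma flatten_nth [simp]: "flatten s p $ 1 = p $ 1" "flatten s p $ 2 = p $ 2" "flatten s p $ 3 = s * p $ 3"
  by (simp_all add: flatten_def)

lemma continuous_on_flatten [continuous_intros]: "continuous_on S (flatten s)"
  unfolding flatten_def
proof (intro continuous_on_vec_lambda)
  fix i :: 3
  show "continuous_on S (%x. if i = 3 then s * x $ 3 else x $ i)"
    by (cases "i = 3") (auto intro!: continuous_intros)
qed

text \<open>Scaling the third coordinate from 1 down to 0 never leaves the body, because every cube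
  above or below rests on the full middle layer. What remains lies in a convex box. The same motion
  contracts the interior.\<close>

lemma contractible_slab:
  fixes a b c d :: int
  assumes ne: "a < b" "c < d"
    and sub: "\<Gamma> \<subseteq> {v. a \<le> v $ 1 & v $ 1 < b & c \<le> v $ 2 & v $ 2 < d & \<bar>v $ 3\<bar> \<le> 1}"
    and base: "{v. a \<le> v $ 1 & v $ 1 < b & c \<le> v $ 2 & v $ 2 < d & v $ 3 = 0} \<subseteq> \<Gamma>"
  shows "contractible_region \<Gamma>"
proof -
  define S where "S = region_body \<Gamma>"
  define l :: "real ^ 3" where "l = vector [real_of_int a - 1/2, real_of_int c - 1/2, -1/2]"
  define u :: "real ^ 3" where "u = vector [real_of_int b - 1/2, real_of_int d - 1/2, 1/2]"
  define p0 :: "real ^ 3" where "p0 = vector [real_of_int a, real_of_int c, 0]"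
  have in_cube: "p \<in> unit_cube v \<longleftrightarrow> (\<bar>p $ 1 - real_of_int (v $ 1)\<bar> \<le> 1/2 & \<bar>p $ 2 - real_of_int (v $ 2)\<bar> \<le> 1/2
      & \<bar>p $ 3 - real_of_int (v $ 3)\<bar> \<le> 1/2)" for p v
    by (simp add: unit_cube_def lattice_point_def forall_3)
  have cell_of: "\<exists>z. a' \<le> z & z < b' & \<bar>t - real_of_int z\<bar> \<le> 1/2"
    if "real_of_int a' - 1/2 \<le> t" "t \<le> real_of_int b' - 1/2" "a' < b'" for t and a' b' :: int
  proof (cases "t = real_of_int b' - 1/2")
    case True
    then show ?thesis using that by (intro exI[of _ "b' - 1"]) auto
  next
    case False
    show ?thesis
    proof (intro exI[of _ "\<lfloor>t + 1/2\<rfloor>"] conjI)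
      show "a' \<le> \<lfloor>t + 1/2\<rfloor>" using that by (simp add: le_floor_iff)
      show "\<lfloor>t + 1/2\<rfloor> < b'" using that False by (simp add: floor_less_iff)
      show "\<bar>t - real_of_int \<lfloor>t + 1/2\<rfloor>\<bar> \<le> 1/2" by linarith
    qed
  qed
  have flat: "cbox l u \<subseteq> S"
  proof
    fix p assume "p \<in> cbox l u"
    then have p: "real_of_int a - 1/2 \<le> p $ 1" "p $ 1 \<le> real_of_int b - 1/2" "real_of_int c - 1/2 \<le> p $ 2"
      "p $ 2 \<le> real_of_int d - 1/2" "\<bar>p $ 3\<bar> \<le> 1/2"
      by (auto simp: mem_box_cart forall_3 l_def u_def)
    obtain x where x: "a \<le> x" "x < b" "\<bar>p $ 1 - real_of_int x\<bar> \<le> 1/2" using cell_of[OF p(1,2) ne(1)] by blast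
    obtain y where y: "c \<le> y" "y < d" "\<bar>p $ 2 - real_of_int y\<bar> \<le> 1/2" using cell_of[OF p(3,4) ne(2)] by blast
    have "vec_of_cell (x, y, 0) \<in> \<Gamma>" using base x y by auto
    moreover have "p \<in> unit_cube (vec_of_cell (x, y, 0))" using x y p by (simp add: in_cube)
    ultimately show "p \<in> S" by (auto simp: S_def region_body_def)
  qed
  have S_sides: "real_of_int a - 1/2 \<le> p $ 1" "p $ 1 \<le> real_of_int b - 1/2" "real_of_int c - 1/2 \<le> p $ 2"
    "p $ 2 \<le> real_of_int d - 1/2" if "p \<in> S" for p
  proof -
    from that obtain v where v: "v \<in> \<Gamma>" "p \<in> unit_cube v" by (auto simp: S_def region_body_def)
    have "a \<le> v $ 1" "v $ 1 \<le> b - 1" "c \<le> v $ 2" "v $ 2 \<le> d - 1" using sub v by auto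
    then have "real_of_int a \<le> real_of_int (v $ 1)" "real_of_int (v $ 1) \<le> real_of_int b - 1"
      "real_of_int c \<le> real_of_int (v $ 2)" "real_of_int (v $ 2) \<le> real_of_int d - 1" by linarith+
    then show "real_of_int a - 1/2 \<le> p $ 1" "p $ 1 \<le> real_of_int b - 1/2" "real_of_int c - 1/2 \<le> p $ 2"
      "p $ 2 \<le> real_of_int d - 1/2" using v(2) unfolding in_cube by linarith+
  qed
  have scale: "flatten s p \<in> S" if "p \<in> S" "0 \<le> s" "s \<le> 1" for s p
  proof (cases "\<bar>s * p $ 3\<bar> \<le> 1/2")
    case True
    then have "flatten s p \<in> cbox l u" using S_sides[OF that(1)] by (auto simp: mem_box_cart forall_3 l_def u_def)
    then show ?thesis using flat by blast
  next
    case False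
    from that obtain v where v: "v \<in> \<Gamma>" "p \<in> unit_cube v" by (auto simp: S_def region_body_def)
    have v3: "v $ 3 = 0 \<or> v $ 3 = 1 \<or> v $ 3 = -1" using sub v by auto
    have ab: "\<bar>s * p $ 3\<bar> \<le> \<bar>p $ 3\<bar>" using that by (simp add: abs_mult mult_left_le_one_le)
    \<comment> \<open>Here 1/2 < |s p3| and |s p3| is at most |p3|, with equal signs. So the point
      was in an outer cube, and it has not yet come down as far as the middle layer.\<close>
    have "\<bar>s * p $ 3 - real_of_int (v $ 3)\<bar> \<le> 1/2"
    proof -
      have p3: "\<bar>p $ 3 - real_of_int (v $ 3)\<bar> \<le> 1/2" using v(2) by (simp add: in_cube)
      have v3': "real_of_int (v $ 3) = 0 \<or> real_of_int (v $ 3) = 1 \<or> real_of_int (v $ 3) = -1" using v3 by auto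
      have sg: "(p $ 3 \<ge> 0 & s * p $ 3 \<ge> 0) \<or> (p $ 3 \<le> 0 & s * p $ 3 \<le> 0)"
        using that mult_nonneg_nonneg[of s "p $ 3"] mult_nonneg_nonpos[of s "p $ 3"] by linarith
      show ?thesis using v3' sg p3 ab False by (elim disjE conjE) linarith+
    qed
    then have "flatten s p \<in> unit_cube v" using v(2) by (simp add: in_cube)
    then show ?thesis using v by (auto simp: S_def region_body_def)
  qed
  have seg: "closed_segment p (flatten 0 p) \<subseteq> U" if "\<And>s. 0 \<le> s ==> s \<le> 1 ==> flatten s p \<in> U" for p U
  proof
    fix q assume "q \<in> closed_segment p (flatten 0 p)"
    then obtain t where t: "0 \<le> t" "t \<le> 1" "q = (1 - t) *\<^sub>R p + t *\<^sub>R flatten 0 p" by (auto simp: in_segment)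
    then have "q = flatten (1 - t) p" by (simp add: vec_eq_iff forall_3 algebra_simps)
    then show "q \<in> U" using that[of "1 - t"] t by simp
  qed
  \<comment> \<open>Two straight-line homotopies in succession: down to height 0, then inside the
    convex set \<open>W\<close> to the point \<open>p0\<close>.\<close>
  have main: "contractible U"
    if U: "\<And>p s. p \<in> U ==> 0 \<le> s ==> s \<le> 1 ==> flatten s p \<in> U"
      and W: "convex W" "W \<subseteq> U" "p0 \<in> W" "\<And>p. p \<in> U ==> flatten 0 p \<in> W" for U W
  proof -
    have "homotopic_with_canon (%x. True) U U id (flatten 0)"
      by (rule homotopic_with_linear) (use seg U in \<open>auto intro!: continuous_intros\<close>)
    moreover have "homotopic_with_canon (%x. True) U U (flatten 0) (%x. p0)"
    proof (rule homotopic_with_linear)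
      fix p assume "p \<in> U"
      then show "closed_segment (flatten 0 p) p0 \<subseteq> U"
        using closed_segment_subset[of "flatten 0 p" W p0] W by blast
    qed (auto intro!: continuous_intros)
    ultimately show ?thesis unfolding contractible_def by (blast intro: homotopic_with_trans)
  qed
  have p0: "p0 \<in> box l u" using ne by (auto simp: mem_box_cart forall_3 l_def u_def p0_def)
  have cS: "contractible S"
  proof (rule main[of S "cbox l u"])
    show "p0 \<in> cbox l u" using p0 box_subset_cbox by blast
    show "flatten 0 p \<in> cbox l u" if "p \<in> S" for p
      using S_sides[OF that] by (auto simp: mem_box_cart forall_3 l_def u_def)
  qed (use scale flat in auto)
  have boxI: "box l u \<subseteq> interior S"
    using flat box_subset_cbox by (intro interior_maximal) auto
  have int0: "flatten 0 p \<in> box l u" if "p \<in> interior S" for p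
  proof -
    have "p \<in> interior {q. q $ 1 \<ge> real_of_int a - 1/2}" "p \<in> interior {q. q $ 1 \<le> real_of_int b - 1/2}"
      "p \<in> interior {q. q $ 2 \<ge> real_of_int c - 1/2}" "p \<in> interior {q. q $ 2 \<le> real_of_int d - 1/2}"
      using that by (rule subsetD[OF interior_mono, rotated]; use S_sides in blast)+
    then show ?thesis by (auto simp: mem_box_cart forall_3 l_def u_def)
  qed
  have "contractible (interior S)"
  proof (rule main[of "interior S" "box l u"])
    fix p s assume p: "p \<in> interior S" and s: "0 \<le> s" "s \<le> (1::real)"
    show "flatten s p \<in> interior S"
    \<comment> \<open>For positive \<open>s\<close> the scaling is a homeomorphism, so the image of
      the interior is an open subset of \<open>S\<close>. For \<open>s = 0\<close> the image is not
      open, but it lies in the open box of the middle layer.\<close>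
    proof (cases "s = 0")
      case True
      then show ?thesis using int0[OF p] boxI by auto
    next
      case False
      have inv: "flatten (1/s) (flatten s q) = q" "flatten s (flatten (1/s) q) = q" for q
        using False by (simp_all add: vec_eq_iff forall_3)
      have "open (flatten (1/s) -` interior S)"
        by (intro open_vimage continuous_on_flatten) auto
      moreover have "flatten s p \<in> flatten (1/s) -` interior S" using p inv by simp
      moreover have "flatten (1/s) -` interior S \<subseteq> S"
      proof
        fix q assume "q \<in> flatten (1/s) -` interior S"
        then have "flatten (1/s) q \<in> S" using interior_subset[of S] by auto
        then have "flatten s (flatten (1/s) q) \<in> S" using s by (rule scale)
        then show "q \<in> S" by (simp add: inv)
      qed
      ultimately show ?thesis by (rule interiorI)
    qed
  qed (use boxI p0 int0 in auto)
  moreover have "finite \<Gamma>"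
  proof (rule finite_subset)
    show "\<Gamma> \<subseteq> vec_of_cell ` ({a..<b} \<times> {c..<d} \<times> {-1..1})"
    proof
      fix v assume v: "v \<in> \<Gamma>"
      have "v = vec_of_cell (v $ 1, v $ 2, v $ 3)" by (simp add: vec_eq_iff forall_3)
      moreover have "(v $ 1, v $ 2, v $ 3) \<in> {a..<b} \<times> {c..<d} \<times> {-1..1}" using sub v by auto
      ultimately show "v \<in> vec_of_cell ` ({a..<b} \<times> {c..<d} \<times> {-1..1})" by (rule image_eqI)
    qed
  qed auto
  moreover have "vec_of_cell (a, c, 0) \<in> \<Gamma>" using base ne by auto
  ultimately show ?thesis using cS by (auto simp: contractible_region_def S_def)
qed

section \<open>The blocks\<close>

text \<open>\<open>EM\<close> is empty. \<open>TF\<close> and \<open>TM\<close> are the heads of the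
  first and of the other columns of a group, \<open>TP\<close> is a plain wire beside them.
  \<open>LF\<close> and \<open>LM\<close> begin the first and the other rows of a group.
  \<open>HE\<close> and \<open>HX\<close> are crossings of a row and a column with and without
  conflict, \<open>CH\<close> is a link of the chain. \<open>RL\<close> and \<open>RM\<close> end
  the last and the other rows of a group, \<open>BL\<close> and \<open>BM\<close> the last and the
  other columns.\<close>

datatype block = EM | TF | TM | TP | LF | LM | HE | HX | CH | RM | RL | BM | BL

definition hline :: "int => int => int => cell list" where
  "hline a b y = map (%x. (x, y, 0)) [a..b]"

definition vline :: "int => int => int => cell list" where
  "vline x a b = map (%y. (x, y, 0)) [a..b]"

text \<open>A wire is a path with an even number of cells: it can be matched inside, or both of its
  ends can be matched to neighbours, which is a signal. An odd path must give away one end; this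
  makes the sources \<open>TF\<close>, \<open>LF\<close> and the sinks \<open>RL\<close>,
  \<open>BL\<close>. Entry ports (left, top) and exit ports (right, bottom) have opposite colours of
  the checkerboard, which is why signals run only to the right and downward.\<close>

fun cells :: "block => cell list" where
  "cells EM = []"
| "cells TP = hline 0 7 5"
| "cells TM = hline 0 7 5 @ vline 3 6 15"
| "cells TF = hline 1 7 5 @ vline 3 6 15"
| "cells LM = vline 3 0 15 @ hline 4 7 5"
| "cells LF = vline 3 1 15 @ hline 4 7 5"
| "cells RM = vline 3 0 15 @ [(0,5,0), (1,5,0), (1,6,0), (2,6,0)]"
| "cells RL = vline 3 0 14 @ [(0,5,0), (1,5,0), (1,6,0), (2,6,0)]"
| "cells BM = hline 0 7 5 @ vline 3 0 3 @ [(4,3,0), (4,4,0)]"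
| "cells BL = hline 0 6 5 @ vline 3 0 3 @ [(4,3,0), (4,4,0)]"
| "cells CH = hline 0 7 1 @ hline 0 7 5 @ [(1,2,0), (5,2,0), (6,2,0), (1,3,0), (2,3,0), (2,4,0)]"
| "cells HX = hline 0 7 5 @ vline 3 0 4 @ vline 3 6 15 @ [(3,4,1), (3,5,1), (3,6,1), (5,6,0), (6,6,0)]"
| "cells HE = hline 0 7 5 @ vline 3 0 3 @ [(2,3,0), (2,4,0)] @ hline 4 7 1 @ vline 3 6 8 @ vline 1 6 8
     @ hline 1 6 9 @ [(6,8,0), (6,7,0), (6,6,0)] @ vline 3 10 15 @ [(3,8,1), (3,9,1), (3,10,1)]"

text \<open>On the right and lower border there are only port cells, so that adjacent blocks touch
  in ports alone. The condition on raised cells at even places prepares the towers of the filling: a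
  tower of height 1 stands on an odd place, and beside a raised cell at an even place there must be
  no hole that would carry one.\<close>

definition block_ok :: "cell list => bool" where
  "block_ok l \<longleftrightarrow> distinct l & list_all (%(x, y, z). 0 \<le> x & x < 8 & 0 \<le> y & y < 16 & (z = 0 \<or> z = 1) &
     (x = 7 --> (y = 1 \<or> y = 5) & z = 0) & (y = 15 --> x = 3 & z = 0) &
     (z = 1 --> (x, y, 0) \<in> set l &
        ((x + y) mod 2 = 0 --> (x + 1, y, 0) \<in> set l & (x - 1, y, 0) \<in> set l & (x, y + 1, 0) \<in> set l & (x, y - 1, 0) \<in> set l))) l"

lemma block_ok_cells: "block_ok (cells t)"
  by (cases t; simp only:; code_simp)

lemma distinct_cells: "distinct (cells t)"
  using block_ok_cells[of t] by (simp add: block_ok_def)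

lemma cells_bounds:
  assumes "(x, y, z) \<in> set (cells t)"
  shows "0 \<le> x" "x < 8" "0 \<le> y" "y < 16" "z = 0 \<or> z = 1" "x = 7 ==> (y = 1 \<or> y = 5) & z = 0" "y = 15 ==> x = 3 & z = 0"
    "z = 1 ==> (x, y, 0) \<in> set (cells t)"
    "z = 1 ==> (x + y) mod 2 = 0 ==> (x + 1, y, 0) \<in> set (cells t) & (x - 1, y, 0) \<in> set (cells t) &
       (x, y + 1, 0) \<in> set (cells t) & (x, y - 1, 0) \<in> set (cells t)"
  using bspec[OF block_ok_cells[of t, unfolded block_ok_def list_all_iff, THEN conjunct2] assms]
  unfolding prod.case by blast+

definition ports :: "bool => bool => int set" where
  "ports a b = (if a then {1} else {}) \<union> (if b then {5} else {})"

definition cuts :: "bool => bool => bool => bool => bool => bool => cell list" where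
  "cuts la lb t ra rb b = (if la then [(0,1,0)] else []) @ (if lb then [(0,5,0)] else []) @ (if t then [(3,0,0)] else [])
     @ (if ra then [(7,1,0)] else []) @ (if rb then [(7,5,0)] else []) @ (if b then [(3,15,0)] else [])"

text \<open>The number of perfect matchings of a block after its port cells have been matched to cells of
  neighbouring blocks: on the left (upper, lower), on the top, on the right (upper, lower), at the bottom.\<close>

definition sig :: "block => bool => bool => bool => bool => bool => bool => nat" where
  "sig u la lb t ra rb b = pmx adj (set (cells u)) (set (cuts la lb t ra rb b))"

definition sigl :: "cell list => bool => bool => bool => bool => bool => bool => nat" where
  "sigl l la lb t ra rb b = (let c = cuts la lb t ra rb b in
     if list_all (%x. x \<in> set l) c then pml (filter (%x. x \<notin> set c) l) else 0)"

lemma sig_code: "sig u la lb t ra rb b = sigl (cells u) la lb t ra rb b"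
proof -
  have "set (filter (%x. x \<notin> set c) (cells u)) = set (cells u) - set c" for c by auto
  then have "pm adj (set (cells u) - set c) = pml (filter (%x. x \<notin> set c) (cells u))" for c
    by (metis distinct_cells distinct_filter pm_set)
  then show ?thesis by (auto simp: sig_def sigl_def pmx_def Let_def list_all_iff)
qed

text \<open>The order is left upper, left lower, top, right upper, right lower, bottom. An upper
  signal stays up in \<open>CH\<close> with weight 2 or drops with weight 1. In \<open>HE\<close> a
  column signal that turns right has weight 1 on either lane, and two signals that meet leave by the
  bottom and one right lane with weight 4 on either lane. These pairs are to cancel.\<close>

fun sig_table :: "block => (bool list \<times> nat) list" where
  "sig_table EM = [([False,False,False,False,False,False],1)]"
| "sig_table TP = [([False,False,False,False,False,False],1), ([False,True,False,False,True,False],1)]"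
| "sig_table TM = [([False,False,False,False,False,False],1), ([False,True,False,False,False,True],1), ([False,True,False,False,True,False],1)]"
| "sig_table TF = [([False,False,False,False,False,True],1), ([False,False,False,False,True,False],1)]"
| "sig_table LM = [([False,False,False,False,False,False],1), ([False,False,True,False,False,True],1), ([False,False,True,False,True,False],1)]"
| "sig_table LF = [([False,False,False,False,False,True],1), ([False,False,False,False,True,False],1)]"
| "sig_table RM = [([False,False,False,False,False,False],1), ([False,False,True,False,False,True],1), ([False,True,False,False,False,True],1)]"
| "sig_table RL = [([False,False,True,False,False,False],1), ([False,True,False,False,False,False],1)]"
| "sig_table BM = [([False,False,False,False,False,False],1), ([False,False,True,False,True,False],1), ([False,True,False,False,True,False],1)]"
| "sig_table BL = [([False,False,True,False,False,False],1), ([False,True,False,False,False,False],1)]"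
| "sig_table CH = [([False,False,False,False,False,False],1), ([False,True,False,False,True,False],1), ([True,False,False,False,True,False],1),
     ([True,False,False,True,False,False],2), ([True,True,False,True,True,False],2)]"
| "sig_table HX = [([False,False,False,False,False,False],1), ([False,False,True,False,False,True],1), ([False,True,False,False,False,True],3),
     ([False,True,False,False,True,False],2), ([False,True,True,False,True,True],2)]"
| "sig_table HE = [([False,False,False,False,False,False],1), ([False,False,True,False,False,True],1), ([False,False,True,False,True,False],1),
     ([False,False,True,True,False,False],1), ([False,True,False,False,False,True],4), ([False,True,False,False,True,False],2),
     ([False,True,True,False,True,True],4), ([False,True,True,True,False,True],4), ([False,True,True,True,True,False],2)]"

definition lookup :: "(bool list \<times> nat) list => bool list => nat" where
  "lookup T v = (case map_of T v of None => 0 | Some n => n)"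

definition table_ok :: "cell list => (bool list \<times> nat) list => bool" where
  "table_ok l T \<longleftrightarrow> list_all (%la. list_all (%lb. list_all (%t. list_all (%ra. list_all (%rb. list_all (%b.
     sigl l la lb t ra rb b = lookup T [la,lb,t,ra,rb,b])
     [False,True]) [False,True]) [False,True]) [False,True]) [False,True]) [False,True]"

lemma table_ok_cells: "table_ok (cells u) (sig_table u)"
  by (cases u; simp only:; code_simp)

lemma sig_eq: "sig u la lb t ra rb b = lookup (sig_table u) [la,lb,t,ra,rb,b]"
proof -
  have "x \<in> set [False, True]" for x by (cases x) auto
  then show ?thesis unfolding sig_code using table_ok_cells[of u, unfolded table_ok_def list_all_iff] by blast
qed

lemma pmx_image:
  assumes sym: "\<And>a b. E a b ==> E b a" and irr: "\<And>a. \<not> E a a"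
    and "finite A" "inj f" "\<And>a b. E (f a) (f b) = E a b"
  shows "pmx E (f ` A) (f ` T) = pmx E A T"
proof -
  have "f ` A - f ` T = f ` (A - T)" using assms(4) by (simp add: image_set_diff)
  moreover have "pm E (f ` (A - T)) = pm E (A - T)"
    by (rule pm_image) (use assms in \<open>auto intro: inj_on_subset\<close>)
  ultimately show ?thesis using assms(4) by (simp add: pmx_def inj_image_subset_iff)
qed

text \<open>\<open>pm_cut\<close> when some cells \<open>T\<close> and \<open>T'\<close> have
  already been matched to the outside.\<close>

lemma pmx_cut:
  assumes sym: "\<And>a b. E a b ==> E b a" and irr: "\<And>a. \<not> E a a"
    and X: "finite X" "inj_on fst X" "inj_on snd X" "\<And>u w. (u, w) \<in> X ==> E u w"
    and fin: "finite A" "finite B" and dj: "A \<inter> B = {}" "T \<inter> B = {}" "T' \<inter> A = {}" "T \<inter> fst ` X = {}" "T' \<inter> snd ` X = {}"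
    and cr: "\<And>a b. a \<in> A ==> b \<in> B ==> E a b ==> (a, b) \<in> X"
  shows "pmx E (A \<union> B) (T \<union> T') = (\<Sum>S\<in>Pow X. pmx E A (T \<union> fst ` S) * pmx E B (T' \<union> snd ` S))"
proof (cases "T \<subseteq> A & T' \<subseteq> B")
  case True
  have 1: "pmx E (A - T) (fst ` S) = pmx E A (T \<union> fst ` S)" if "S \<in> Pow X" for S
  proof -
    have "A - T - fst ` S = A - (T \<union> fst ` S)" by blast
    moreover have "fst ` S \<subseteq> A - T \<longleftrightarrow> T \<union> fst ` S \<subseteq> A" using that dj True by blast
    ultimately show ?thesis by (simp add: pmx_def)
  qed
  have 2: "pmx E (B - T') (snd ` S) = pmx E B (T' \<union> snd ` S)" if "S \<in> Pow X" for S
  proof -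
    have "B - T' - snd ` S = B - (T' \<union> snd ` S)" by blast
    moreover have "snd ` S \<subseteq> B - T' \<longleftrightarrow> T' \<union> snd ` S \<subseteq> B" using that dj True by blast
    ultimately show ?thesis by (simp add: pmx_def)
  qed
  have "pmx E (A \<union> B) (T \<union> T') = pm E ((A - T) \<union> (B - T'))"
  proof -
    have "A \<union> B - (T \<union> T') = (A - T) \<union> (B - T')" using dj by blast
    moreover have "T \<union> T' \<subseteq> A \<union> B" using True by blast
    ultimately show ?thesis by (simp add: pmx_def)
  qed
  also have "\<dots> = (\<Sum>S\<in>Pow X. pmx E (A - T) (fst ` S) * pmx E (B - T') (snd ` S))"
    by (rule pm_cut[OF sym irr X]) (use fin dj cr in auto)
  also have "\<dots> = (\<Sum>S\<in>Pow X. pmx E A (T \<union> fst ` S) * pmx E B (T' \<union> snd ` S))"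
    by (rule sum.cong[OF refl]) (simp only: 1 2)
  finally show ?thesis .
next
  case False
  then have "\<not> T \<union> T' \<subseteq> A \<union> B" using dj by blast
  then have l: "pmx E (A \<union> B) (T \<union> T') = 0" unfolding pmx_def by (rule if_not_P)
  have r: "pmx E A (T \<union> fst ` S) * pmx E B (T' \<union> snd ` S) = 0" for S using False by (auto simp: pmx_def)
  show ?thesis by (simp only: l r sum.neutral_const)
qed

section \<open>Transfer matrices for rows of blocks\<close>

definition shift :: "nat => nat => cell => cell" where
  "shift I J c = (8 * int J + fst c, 16 * int I + fst (snd c), snd (snd c))"

lemma shift_simp [simp]: "shift I J (x, y, z) = (8 * int J + x, 16 * int I + y, z)"
  by (simp add: shift_def)

lemma inj_shift: "inj (shift I J)"
  by (auto simp: inj_def)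

lemma adj_shift: "adj (shift I J a) (shift I J b) = adj a b"
  by (cases a; cases b) simp

definition blk :: "(nat => nat => block) => nat => nat => cell set" where
  "blk ty I J = shift I J ` set (cells (ty I J))"

lemma mem_blk: "(X, Y, Z) \<in> blk ty I J \<longleftrightarrow> (X - 8 * int J, Y - 16 * int I, Z) \<in> set (cells (ty I J))"
  unfolding blk_def by (force simp: image_iff)

lemma blk_bounds:
  assumes "(X, Y, Z) \<in> blk ty I J"
  shows "8 * int J \<le> X" "X < 8 * int J + 8" "16 * int I \<le> Y" "Y < 16 * int I + 16"
  using cells_bounds[OF assms[unfolded mem_blk]] by linarith+

definition rowp :: "(nat => nat => block) => nat => nat => cell set" where
  "rowp ty I j = (\<Union>J\<in>{1..j}. blk ty I J)"

lemma rowp_0 [simp]: "rowp ty I 0 = {}" by (simp add: rowp_def)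

lemma rowp_Suc: "rowp ty I (Suc j) = rowp ty I j \<union> blk ty I (Suc j)"
  by (auto simp: rowp_def atLeastAtMostSuc_conv)

lemma rowp_bounds:
  assumes "(X, Y, Z) \<in> rowp ty I j"
  shows "8 \<le> X" "X < 8 * int j + 8" "16 * int I \<le> Y" "Y < 16 * int I + 16"
proof -
  from assms obtain J where J: "1 \<le> J" "J \<le> j" "(X, Y, Z) \<in> blk ty I J" by (auto simp: rowp_def)
  show "8 \<le> X" "X < 8 * int j + 8" "16 * int I \<le> Y" "Y < 16 * int I + 16"
    using blk_bounds[OF J(3)] J(1,2) by linarith+
qed

lemma finite_blk: "finite (blk ty I J)" by (simp add: blk_def)
lemma finite_rowp: "finite (rowp ty I j)" by (simp add: rowp_def finite_blk)

definition tops :: "nat => nat set => cell set" where "tops I C = (%J. shift I J (3, 0, 0)) ` C"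
definition bots :: "nat => nat set => cell set" where "bots I C = (%J. shift I J (3, 15, 0)) ` C"

text \<open>The state of a sweep from left to right through row \<open>I\<close>: the signals
  \<open>C\<close> that enter from above and \<open>C'\<close> that leave below are fixed for the
  whole row, and \<open>ra\<close>, \<open>rb\<close> describe the two lanes behind block
  \<open>j\<close>.\<close>

definition rp :: "(nat => nat => block) => nat => nat set => nat set => nat => bool => bool => nat" where
  "rp ty I C C' j ra rb = pmx adj (rowp ty I j)
     (tops I (C \<inter> {1..j}) \<union> bots I (C' \<inter> {1..j}) \<union> (%y. shift I j (7, y, 0)) ` ports ra rb)"

lemma rp_0: "rp ty I C C' 0 ra rb = (if ra \<or> rb then 0 else 1)"
  by (auto simp: rp_def tops_def bots_def pmx_def ports_def)

lemma sum_Pow2: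
  assumes "p \<noteq> q"
  shows "(\<Sum>S\<in>Pow {p, q}. f S) = f {} + f {p} + f {q} + (f {p, q} :: nat)"
proof -
  have "Pow {p, q} = {{}, {p}, {q}, {p, q}}" by (auto simp: Pow_insert)
  moreover have "{} \<noteq> {p, q}" "{p} \<noteq> {p, q}" "{q} \<noteq> {p, q}" using assms by auto
  ultimately show ?thesis using assms by (simp add: add.assoc)
qed

text \<open>The cut before block \<open>Suc j\<close> is crossed by at most two edges, one for each
  lane, because of \<open>block_ok\<close>; so one block multiplies a vector with four entries by
  its table \<open>sig\<close>.\<close>

lemma rp_Suc:
  "rp ty I C C' (Suc j) ra rb =
    (\<Sum>la\<in>UNIV. \<Sum>lb\<in>UNIV. rp ty I C C' j la lb * sig (ty I (Suc j)) la lb (Suc j \<in> C) ra rb (Suc j \<in> C'))"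
proof -
  let ?A = "rowp ty I j" and ?B = "blk ty I (Suc j)"
  let ?T = "tops I (C \<inter> {1..j}) \<union> bots I (C' \<inter> {1..j})"
  let ?h = "%t ra rb b. (if t then {(3, 0, 0)} else {}) \<union> (if b then {(3, 15, 0)} else {}) \<union> (%y. (7, y, 0)) ` ports ra rb :: cell set"
  let ?T' = "shift I (Suc j) ` ?h (Suc j \<in> C) ra rb (Suc j \<in> C')"
  let ?p = "%y. (shift I j (7, y, 0), shift I (Suc j) (0, y, 0))"
  let ?X = "{?p 1, ?p 5}"
  have T: "tops I (C \<inter> {1..Suc j}) \<union> bots I (C' \<inter> {1..Suc j}) \<union> (%y. shift I (Suc j) (7, y, 0)) ` ports ra rb = ?T \<union> ?T'"
    by (auto simp: tops_def bots_def atLeastAtMostSuc_conv image_image)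
  have "rp ty I C C' (Suc j) ra rb = pmx adj (?A \<union> ?B) (?T \<union> ?T')"
    unfolding rp_def T rowp_Suc ..
  also have "\<dots> = (\<Sum>S\<in>Pow ?X. pmx adj ?A (?T \<union> fst ` S) * pmx adj ?B (?T' \<union> snd ` S))"
  proof (rule pmx_cut)
    have tb: "X < 8 * int j + 7" "X mod 8 = 3" if "(X, Y, Z) \<in> ?T" for X Y Z
      using that by (auto simp: tops_def bots_def)
    have tb': "8 * int j + 8 < X" if "(X, Y, Z) \<in> ?T'" for X Y Z
      using that by (auto simp: ports_def split: if_splits)
    have A: "X < 8 * int j + 8" if "(X, Y, Z) \<in> ?A" for X Y Z by (rule rowp_bounds(2)[OF that])
    have B: "8 * int j + 8 \<le> X" if "(X, Y, Z) \<in> ?B" for X Y Z using blk_bounds(1)[OF that] by simp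
    have dj: "P \<inter> Q = {}" if "\<And>X Y Z. (X, Y, Z) \<in> P ==> (X, Y, Z) \<in> Q ==> False" for P Q :: "cell set"
      using that by auto
    show "?A \<inter> ?B = {}" by (rule dj) (drule A, drule B, linarith)
    show "?T \<inter> ?B = {}" by (rule dj) (drule tb(1), drule B, linarith)
    show "?T' \<inter> ?A = {}" by (rule dj) (drule tb', drule A, linarith)
    show "?T \<inter> fst ` ?X = {}" by (rule dj) (drule tb(1), auto)
    show "?T' \<inter> snd ` ?X = {}" by (rule dj) (drule tb', auto)
    fix a b assume ab: "a \<in> ?A" "b \<in> ?B" "adj a b"
    obtain X Y Z where a: "a = (X, Y, Z)" by (cases a)
    obtain X' Y' Z' where b: "b = (X', Y', Z')" by (cases b)
    have "X < 8 * int j + 8" "8 * int j + 8 \<le> X'"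
      using rowp_bounds ab(1) blk_bounds(1) ab(2) unfolding a b by fastforce+
    then have X: "X = 8 * int j + 7" "X' = 8 * int j + 8" "Y' = Y" "Z' = Z"
      using ab(3) unfolding a b adj.simps by linarith+
    from ab(1) obtain J where J: "1 \<le> J" "J \<le> j" "(X, Y, Z) \<in> blk ty I J" by (auto simp: rowp_def a)
    have "J = j" using blk_bounds(2)[OF J(3)] J(2) X(1) by linarith
    then have "(7, Y - 16 * int I, Z) \<in> set (cells (ty I j))" using J(3) X(1) by (simp add: mem_blk)
    then have "Y - 16 * int I = 1 \<or> Y - 16 * int I = 5" "Z = 0" using cells_bounds(6) by blast+
    then have "Y = 16 * int I + 1 \<or> Y = 16 * int I + 5" "Z = 0" by linarith+
    then show "(a, b) \<in> ?X" using X unfolding a b by auto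
  qed (auto simp: adj_sym adj_irrefl finite_rowp finite_blk)
  also have "\<dots> = (\<Sum>la\<in>UNIV. \<Sum>lb\<in>UNIV. pmx adj ?A (?T \<union> fst ` ?p ` ports la lb) * pmx adj ?B (?T' \<union> snd ` ?p ` ports la lb))"
  proof -
    have "(\<Sum>S\<in>Pow ?X. g S) = (\<Sum>la\<in>UNIV. \<Sum>lb\<in>UNIV. g (?p ` ports la lb))" for g :: "_ => nat"
      by (subst sum_Pow2) (auto simp: UNIV_bool ports_def insert_commute)
    from this[of "%S. pmx adj ?A (?T \<union> fst ` S) * pmx adj ?B (?T' \<union> snd ` S)"] show ?thesis by (simp only:)
  qed
  also have "\<dots> = (\<Sum>la\<in>UNIV. \<Sum>lb\<in>UNIV. rp ty I C C' j la lb * sig (ty I (Suc j)) la lb (Suc j \<in> C) ra rb (Suc j \<in> C'))"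
  proof (intro sum.cong refl arg_cong2[of _ _ _ _ times])
    fix la lb
    show "pmx adj ?A (?T \<union> fst ` ?p ` ports la lb) = rp ty I C C' j la lb"
      unfolding rp_def by (simp add: image_image)
    have "?T' \<union> snd ` ?p ` ports la lb = shift I (Suc j) ` set (cuts la lb (Suc j \<in> C) ra rb (Suc j \<in> C'))"
      by (simp add: cuts_def ports_def image_Un)
    then show "pmx adj ?B (?T' \<union> snd ` ?p ` ports la lb) = sig (ty I (Suc j)) la lb (Suc j \<in> C) ra rb (Suc j \<in> C')"
      unfolding blk_def sig_def
      by (simp only: pmx_image[of adj, OF adj_sym adj_irrefl _ inj_shift adj_shift] finite_set)
  qed
  finally show ?thesis .
qed

definition rowsp :: "(nat => nat => block) => nat => nat => cell set" where
  "rowsp ty W i = (\<Union>I\<in>{1..i}. rowp ty I W)"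

lemma rowsp_Suc: "rowsp ty W (Suc i) = rowsp ty W i \<union> rowp ty (Suc i) W"
  by (auto simp: rowsp_def atLeastAtMostSuc_conv)

text \<open>The transfer vector of the upper \<open>i\<close> rows, indexed by the set of block
  columns in which a signal leaves downward.\<close>

definition rv :: "(nat => nat => block) => nat => nat => nat set => nat" where
  "rv ty W i C = pmx adj (rowsp ty W i) (bots i C)"

lemma rv_0: "rv ty W 0 C = (if C = {} then 1 else 0)"
  by (auto simp: rv_def rowsp_def pmx_def bots_def)

lemma rv_eq_0:
  assumes "J \<in> C" "(3, 15, 0) \<notin> set (cells (ty i J))"
  shows "rv ty W i C = 0"
proof -
  have "shift i J (3, 15, 0) \<notin> rowsp ty W i"
  proof
    assume "shift i J (3, 15, 0) \<in> rowsp ty W i"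
    then obtain I J' where *: "(8 * int J + 3, 16 * int i + 15, 0) \<in> blk ty I J'" by (auto simp: rowsp_def rowp_def)
    have "J' = J" "I = i" using blk_bounds[OF *] by linarith+
    then show False using * assms(2) by (simp add: mem_blk)
  qed
  then show ?thesis using assms(1) by (auto simp: rv_def pmx_def bots_def)
qed

lemma rv_Suc:
  assumes V: "V \<subseteq> {1..W}" "\<And>J. J \<in> {1..W} ==> (3, 15, 0) \<in> set (cells (ty i J)) ==> J \<in> V" and C': "C' \<subseteq> {1..W}"
  shows "rv ty W (Suc i) C' = (\<Sum>C\<in>Pow V. rv ty W i C * rp ty (Suc i) C C' W False False)"
proof -
  let ?A = "rowsp ty W i" and ?B = "rowp ty (Suc i) W"
  let ?p = "%J. (shift i J (3, 15, 0), shift (Suc i) J (3, 0, 0))"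
  have fV: "finite V" using V(1) finite_subset by blast
  have Ab: "Y < 16 * int i + 16" if "(X, Y, Z) \<in> ?A" for X Y Z
  proof -
    from that obtain I where I: "1 \<le> I" "I \<le> i" "(X, Y, Z) \<in> rowp ty I W" by (auto simp: rowsp_def)
    then show ?thesis using rowp_bounds(4)[OF I(3)] by linarith
  qed
  have Bb: "16 * int i + 16 \<le> Y" if "(X, Y, Z) \<in> ?B" for X Y Z
    using rowp_bounds(3)[OF that] by simp
  have "rv ty W (Suc i) C' = pmx adj (?A \<union> ?B) ({} \<union> bots (Suc i) C')" by (simp add: rv_def rowsp_Suc)
  also have "\<dots> = (\<Sum>S\<in>Pow (?p ` V). pmx adj ?A ({} \<union> fst ` S) * pmx adj ?B (bots (Suc i) C' \<union> snd ` S))"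
  proof (rule pmx_cut)
    show "?A \<inter> ?B = {}" using Ab Bb by fastforce
    show "bots (Suc i) C' \<inter> ?A = {}" using Ab by (fastforce simp: bots_def)
    fix a b assume ab: "a \<in> ?A" "b \<in> ?B" "adj a b"
    obtain X Y Z where a: "a = (X, Y, Z)" by (cases a)
    obtain X' Y' Z' where b: "b = (X', Y', Z')" by (cases b)
    have Y: "Y = 16 * int i + 15" "Y' = 16 * int i + 16" "X' = X" "Z' = Z"
      using Ab[of X Y Z] Bb[of X' Y' Z'] ab unfolding a b adj.simps by linarith+
    from ab(1) obtain I J where J: "1 \<le> J" "J \<le> W" "1 \<le> I" "I \<le> i" "(X, Y, Z) \<in> blk ty I J"
      by (auto simp: rowp_def rowsp_def a)
    have "I = i" using blk_bounds(4)[OF J(5)] J(4) Y(1) by linarith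
    then have *: "(X - 8 * int J, 15, Z) \<in> set (cells (ty i J))" using J(5) Y(1) by (simp add: mem_blk)
    then have "X - 8 * int J = 3 & Z = 0" by (rule cells_bounds(7)) simp
    moreover from this have "J \<in> V" using V(2)[of J] * J by auto
    moreover from calculation have "X = 8 * int J + 3" "Z = 0" by linarith+
    ultimately show "(a, b) \<in> ?p ` V" using Y unfolding a b by (auto simp: image_iff)
  qed (auto simp: adj_sym adj_irrefl finite_rowp rowsp_def fV bots_def inj_on_def)
  also have "Pow (?p ` V) = image ?p ` Pow V" by (rule image_Pow_surj[symmetric]) simp
  also have "(\<Sum>S\<in>image ?p ` Pow V. pmx adj ?A ({} \<union> fst ` S) * pmx adj ?B (bots (Suc i) C' \<union> snd ` S)) =
      (\<Sum>C\<in>Pow V. pmx adj ?A (fst ` ?p ` C) * pmx adj ?B (bots (Suc i) C' \<union> snd ` ?p ` C))"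
  proof -
    have "inj_on ?p V" by (auto simp: inj_on_def)
    then show ?thesis by (subst sum.reindex[OF inj_on_image_Pow]) (simp_all only: o_def Un_empty_left)
  qed
  also have "\<dots> = (\<Sum>C\<in>Pow V. rv ty W i C * rp ty (Suc i) C C' W False False)"
  proof (intro sum.cong refl)
    fix C assume "C \<in> Pow V"
    then have C: "C \<inter> {1..W} = C" "C' \<inter> {1..W} = C'" using V C' by auto
    show "pmx adj ?A (fst ` ?p ` C) * pmx adj ?B (bots (Suc i) C' \<union> snd ` ?p ` C) = rv ty W i C * rp ty (Suc i) C C' W False False"
      unfolding rv_def rp_def C by (simp add: image_image tops_def bots_def ports_def Un_commute)
  qed
  finally show ?thesis .
qed

section \<open>The grid of blocks\<close>

lemma rp_eq_0:
  assumes "J \<in> C" "1 \<le> J" "J \<le> j" "(3, 0, 0) \<notin> set (cells (ty I J))"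
  shows "rp ty I C C' j ra rb = 0"
proof -
  have "shift I J (3, 0, 0) \<notin> rowp ty I j"
  proof
    assume "shift I J (3, 0, 0) \<in> rowp ty I j"
    then obtain J' where *: "(8 * int J + 3, 16 * int I, 0) \<in> blk ty I J'" by (auto simp: rowp_def)
    have "J' = J" using blk_bounds[OF *] by linarith
    then show False using * assms(4) by (simp add: mem_blk)
  qed
  moreover have "shift I J (3, 0, 0) \<in> tops I (C \<inter> {1..j})" using assms(1-3) by (auto simp: tops_def simp del: shift_simp)
  ultimately have "\<not> tops I (C \<inter> {1..j}) \<union> bots I (C' \<inter> {1..j}) \<union> (%y. shift I j (7, y, 0)) ` ports ra rb \<subseteq> rowp ty I j"
    by blast
  then show ?thesis unfolding rp_def pmx_def by (rule if_not_P)
qed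

text \<open>There are \<open>G\<close> groups (cells of a tableau) of \<open>K\<close> lanes
  (views); lane \<open>g * K + t\<close> occurs both as a row and as a column. From left to right: a
  bus, then for each column its crossing and \<open>m\<close> links of chain, then another bus. From
  top to bottom: a row that starts the column signals, the \<open>N\<close> rows, and a row that
  absorbs the column signals.\<close>

locale grid =
  fixes K G m :: nat and conf :: "nat => nat => bool"
  assumes K: "0 < K"
begin

definition N :: nat where "N = K * G"
definition Wd :: nat where "Wd = 2 + N * (m + 1)"
definition col :: "nat => nat" where "col l = 2 + l * (m + 1)"

definition ty :: "nat => nat => block" where
  "ty I J =
    (if J \<le> 1 then if I \<le> 1 \<or> N + 2 \<le> I then EM else if (I - 2) mod K = 0 then LF else LM
     else if Wd \<le> J then if I \<le> 1 \<or> N + 2 \<le> I then EM else if (I - 2) mod K = K - 1 then RL else RM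
     else let l = (J - 2) div (m + 1); k = (J - 2) mod (m + 1) in
       if I \<le> 1 then if k = 0 then if l mod K = 0 then TF else TM else TP
       else if N + 2 \<le> I then if k = 0 then if l mod K = K - 1 then BL else BM else TP
       else if k = 0 then if conf (I - 2) l then HE else HX else CH)"

lemma col_less: assumes "l < N" "k \<le> m" shows "col l + k < Wd"
proof -
  have "l * (m + 1) + (m + 1) \<le> N * (m + 1)" using mult_le_mono1[of "Suc l" N "m + 1"] assms by simp
  then show ?thesis using assms(2) by (simp add: col_def Wd_def)
qed

lemma col_div: assumes "k \<le> m" shows "(col l + k - 2) div (m + 1) = l" "(col l + k - 2) mod (m + 1) = k"
proof -
  have e: "col l + k - 2 = k + l * (m + 1)" by (simp add: col_def)
  show "(col l + k - 2) div (m + 1) = l" "(col l + k - 2) mod (m + 1) = k"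
    using assms unfolding e by (simp_all add: div_mult_self3 del: mult_Suc_right)
qed

lemma ty_mid:
  assumes "i < N"
  shows "ty (i + 2) 1 = (if i mod K = 0 then LF else LM)"
    "ty (i + 2) Wd = (if i mod K = K - 1 then RL else RM)"
    "l < N ==> ty (i + 2) (col l) = (if conf i l then HE else HX)"
    "l < N ==> 0 < k ==> k \<le> m ==> ty (i + 2) (col l + k) = CH"
proof -
  show "ty (i + 2) 1 = (if i mod K = 0 then LF else LM)" using assms by (simp add: ty_def)
  have "1 < Wd" by (simp add: Wd_def)
  then show "ty (i + 2) Wd = (if i mod K = K - 1 then RL else RM)" using assms by (simp add: ty_def)
  have c: "\<not> col l \<le> 1" for l by (simp add: col_def)
  show "ty (i + 2) (col l) = (if conf i l then HE else HX)" if "l < N"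
    using assms col_less[OF that, of 0] col_div[of 0 l] c[of l] by (simp add: ty_def)
  show "ty (i + 2) (col l + k) = CH" if "l < N" "0 < k" "k \<le> m"
    using assms col_less[OF that(1,3)] col_div[OF that(3), of l] c[of l] that(2) by (simp add: ty_def)
qed

lemma ty_top:
  shows "ty 1 1 = EM" "ty 1 Wd = EM"
    "l < N ==> ty 1 (col l) = (if l mod K = 0 then TF else TM)"
    "l < N ==> 0 < k ==> k \<le> m ==> ty 1 (col l + k) = TP"
proof -
  show "ty 1 1 = EM" "ty 1 Wd = EM" by (simp_all add: ty_def)
  have c: "\<not> col l \<le> 1" for l by (simp add: col_def)
  show "ty 1 (col l) = (if l mod K = 0 then TF else TM)" if "l < N"
    using col_less[OF that, of 0] col_div[of 0 l] c[of l] by (simp add: ty_def)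
  show "ty 1 (col l + k) = TP" if "l < N" "0 < k" "k \<le> m"
    using col_less[OF that(1,3)] col_div[OF that(3), of l] c[of l] that(2) by (simp add: ty_def)
qed

lemma ty_bot:
  shows "ty (N + 2) 1 = EM" "ty (N + 2) Wd = EM"
    "l < N ==> ty (N + 2) (col l) = (if l mod K = K - 1 then BL else BM)"
    "l < N ==> 0 < k ==> k \<le> m ==> ty (N + 2) (col l + k) = TP"
proof -
  show "ty (N + 2) 1 = EM" "ty (N + 2) Wd = EM" by (simp_all add: ty_def)
  have c: "\<not> col l \<le> 1" for l by (simp add: col_def)
  show "ty (N + 2) (col l) = (if l mod K = K - 1 then BL else BM)" if "l < N"
    using col_less[OF that, of 0] col_div[of 0 l] c[of l] by (simp add: ty_def)
  show "ty (N + 2) (col l + k) = TP" if "l < N" "0 < k" "k \<le> m"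
    using col_less[OF that(1,3)] col_div[OF that(3), of l] c[of l] that(2) by (simp add: ty_def)
qed

definition cols :: "nat set" where "cols = col ` {..<N}"
definition V :: "nat set" where "V = insert 1 (insert Wd cols)"

lemma inj_col: "inj col"
  by (rule injI) (metis col_div(1)[of 0] le0 add_0_right)

lemma cols_bounds: "c \<in> cols ==> 1 < c" "c \<in> cols ==> c < Wd"
  using col_less[of _ 0] by (auto simp: cols_def col_def)

lemma V_sub: "V \<subseteq> {1..Wd}"
proof
  fix J assume "J \<in> V"
  then consider "J = 1" | "J = Wd" | "J \<in> cols" by (auto simp: V_def)
  then show "J \<in> {1..Wd}" using cols_bounds[of J] by cases (simp_all add: Wd_def)
qed

lemma V_cases:
  assumes "J \<in> {1..Wd}"
  obtains "J \<in> V" | l k where "l < N" "0 < k" "k \<le> m" "J = col l + k"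
proof (cases "J = 1 \<or> J = Wd")
  case False
  define l where "l = (J - 2) div (m + 1)"
  define k where "k = (J - 2) mod (m + 1)"
  have "2 \<le> J" using assms False by auto
  then have J: "J = col l + k" using div_mult_mod_eq[of "J - 2" "m + 1"] unfolding col_def l_def k_def by linarith
  have k: "k \<le> m" using mod_less_divisor[of "m + 1" "J - 2"] by (simp add: k_def)
  have "J - 2 < N * (m + 1)" using assms False by (auto simp: Wd_def)
  then have l: "l < N" unfolding l_def by (rule less_mult_imp_div_less)
  show ?thesis
  proof (cases "k = 0")
    case True
    then show ?thesis using l J that(1) by (simp add: V_def cols_def)
  qed (use that(2) l k J in blast)
qed (use that(1) in \<open>auto simp: V_def\<close>)

lemma chain_notin_V: assumes "l < N" "0 < k" "k \<le> m" shows "col l + k \<notin> V"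
proof
  assume "col l + k \<in> V"
  then consider "col l + k = 1" | "col l + k = Wd" | l' where "col l + k = col l'" by (auto simp: V_def cols_def)
  then show False
  proof cases
    case 1 then show False by (simp add: col_def)
  next
    case 2 then show False using col_less[OF assms(1,3)] by simp
  next
    case 3
    then show False using col_div(2)[OF assms(3), of l] col_div(2)[of 0 l'] assms(2) by simp
  qed
qed

lemma bottom_ports_V:
  assumes "I \<le> N + 1" "J \<in> {1..Wd}" "(3, 15, 0) \<in> set (cells (ty I J))"
  shows "J \<in> V"
  using assms(2)
proof (cases rule: V_cases)
  case (2 l k)
  have "ty I J = TP \<or> ty I J = CH"
    using 2 col_less[OF 2(1,3)] col_div[OF 2(3), of l] by (simp add: ty_def col_def)
  then show ?thesis using assms(3) by (auto simp: hline_def)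
qed

lemma rv_step:
  assumes "i \<le> N + 1" "C' \<subseteq> V"
  shows "rv ty Wd (Suc i) C' = (\<Sum>C\<in>Pow V. rv ty Wd i C * rp ty (Suc i) C C' Wd False False)"
  by (rule rv_Suc) (use V_sub bottom_ports_V[OF assms(1)] assms(2) in auto)

section \<open>Signals in the rows of crossings\<close>

lemma lane_index: "Suc l * (m + 1) = Suc (l * (m + 1) + m)" "col l = Suc (Suc (l * (m + 1)))"
  by (simp_all add: col_def)

text \<open>The chain acts as the weight -1. If \<open>h\<close> is the weight on the upper lane
  behind the crossing, the \<open>m\<close> links add (2^m - 1) h to the lower lane, which is -h
  modulo 2^m. Whatever is still on the upper lane then, alone or together with the lower one, dies
  at the next block, which has no upper left port. So a conflict contributes 4 - 4, and a column
  signal that turns into the row 1 - 1.\<close>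

lemma mid_lane:
  assumes i: "i < N" and l: "l < N" and C: "C \<subseteq> V" "C' \<subseteq> V"
  defines "r \<equiv> rp ty (i + 2) C C'" and "e \<equiv> col l \<in> C" and "e' \<equiv> col l \<in> C'"
  shows "r (Suc (Suc l * (m + 1))) False False =
      (if e = e' then r (Suc (l * (m + 1))) False False
       else if e' then (if conf i l then 4 else 3) * r (Suc (l * (m + 1))) False True else 0)"
    and "[r (Suc (Suc l * (m + 1))) False True =
      (if e = e' & \<not> (e & conf i l) then 2 * r (Suc (l * (m + 1))) False True else 0)] (mod 2 ^ m)"
proof -
  let ?a = "r (Suc (l * (m + 1)))"
  let ?h = "r (col l)"
  \<comment> \<open>The lower lane has gained (2^k - 1) times the initial weight of the upper one;
    written as a sum to avoid subtraction of natural numbers.\<close>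
  have chain: "r (col l + k) False False = ?h False False & r (col l + k) True False = 2 ^ k * ?h True False
      & r (col l + k) False True + ?h True False = ?h False True + 2 ^ k * ?h True False" if "k \<le> m" for k
    using that
  proof (induction k)
    case (Suc k)
    have t: "ty (i + 2) (Suc (col l + k)) = CH" using ty_mid(4)[OF i l, of "Suc k"] Suc.prems by simp
    have n: "Suc (col l + k) \<notin> C" "Suc (col l + k) \<notin> C'" using chain_notin_V[OF l, of "Suc k"] Suc.prems C by auto
    have "r (Suc (col l + k)) False False = r (col l + k) False False"
      "r (Suc (col l + k)) True False = 2 * r (col l + k) True False"
      "r (Suc (col l + k)) False True = r (col l + k) False True + r (col l + k) True False"
      unfolding r_def rp_Suc t using n by (simp_all add: UNIV_bool sig_eq lookup_def)
    then show ?case using Suc by simp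
  qed simp
  have fin: "Suc (Suc l * (m + 1)) = col l + m" by (simp add: col_def)
  have hd: "?h x y = (\<Sum>la\<in>UNIV. \<Sum>lb\<in>UNIV. ?a la lb * sig (if conf i l then HE else HX) la lb e x y e')" for x y
    using rp_Suc[of ty "i + 2" C C' "Suc (l * (m + 1))" x y] ty_mid(3)[OF i l]
    unfolding r_def e_def e'_def lane_index(2) by simp
  show "r (Suc (Suc l * (m + 1))) False False =
      (if e = e' then ?a False False else if e' then (if conf i l then 4 else 3) * ?a False True else 0)"
    unfolding fin using chain[of m] hd[of False False]
    by (cases "conf i l"; cases e; cases e') (simp_all add: UNIV_bool sig_eq lookup_def)
  have FT: "r (col l + m) False True + ?h True False = ?h False True + 2 ^ m * ?h True False" using chain[of m] by simp
  have "?h False True = (if e = e' & \<not> (e & conf i l) then 2 * ?a False True else 0) + ?h True False"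
    using hd[of False True] hd[of True False]
    by (cases "conf i l"; cases e; cases e') (simp_all add: UNIV_bool sig_eq lookup_def)
  then have "[r (col l + m) False True + ?h True False =
      (if e = e' & \<not> (e & conf i l) then 2 * ?a False True else 0) + ?h True False] (mod 2 ^ m)"
    unfolding FT by (simp add: cong_def)
  then show "[r (Suc (Suc l * (m + 1))) False True =
      (if e = e' & \<not> (e & conf i l) then 2 * ?a False True else 0)] (mod 2 ^ m)"
    unfolding fin by (simp only: cong_add_rcancel_nat)
qed

definition agree :: "nat set => nat set => nat => bool" where
  "agree C C' n \<longleftrightarrow> (\<forall>l<n. col l \<in> C \<longleftrightarrow> col l \<in> C')"

definition okp :: "nat => nat set => nat => nat" where
  "okp i C n = (\<Prod>l<n. if col l \<in> C & conf i l then 0 else 2)"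

lemma agree_Suc: "agree C C' (Suc n) \<longleftrightarrow> agree C C' n & (col n \<in> C \<longleftrightarrow> col n \<in> C')"
  by (auto simp: agree_def less_Suc_eq)

text \<open>A column signal can enter the row only by turning at an \<open>HE\<close>, and there it
  cancels modulo 2^m. So a row that starts without a signal stays without one and hands all column
  signals on unchanged.\<close>

lemma mid_row_empty:
  assumes i: "i < N" and C: "C \<subseteq> V" "C' \<subseteq> V"
    and s: "rp ty (i + 2) C C' 1 False True = 0" and "n \<le> N"
  shows "[rp ty (i + 2) C C' (Suc (n * (m + 1))) False False = of_bool (agree C C' n) * rp ty (i + 2) C C' 1 False False] (mod 2 ^ m)
    & [rp ty (i + 2) C C' (Suc (n * (m + 1))) False True = 0] (mod 2 ^ m)"
  using \<open>n \<le> N\<close>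
proof (induction n)
  case 0
  then show ?case using s by (simp add: agree_def)
next
  case (Suc n)
  then have IH: "[rp ty (i + 2) C C' (Suc (n * (m + 1))) False False = of_bool (agree C C' n) * rp ty (i + 2) C C' 1 False False] (mod 2 ^ m)"
    "[rp ty (i + 2) C C' (Suc (n * (m + 1))) False True = 0] (mod 2 ^ m)" and n: "n < N" by auto
  note L = mid_lane[OF i n C]
  have "[rp ty (i + 2) C C' (Suc (Suc n * (m + 1))) False True = 0] (mod 2 ^ m)"
    using L(2) cong_mult[OF cong_refl[of 2] IH(2)] by (auto split: if_splits intro: cong_trans)
  moreover have "[rp ty (i + 2) C C' (Suc (Suc n * (m + 1))) False False =
      of_bool (agree C C' (Suc n)) * rp ty (i + 2) C C' 1 False False] (mod 2 ^ m)"
    unfolding L(1) agree_Suc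
    using IH(1) cong_mult[OF cong_refl[of 4] IH(2)] cong_mult[OF cong_refl[of 3] IH(2)] by auto
  ultimately show ?case by simp
qed

text \<open>Follows only the outcome in which the signal reaches the right end. A signal that turned
  down into a column is missing on the right, and the right bus will reject it.\<close>

lemma mid_row_full:
  assumes i: "i < N" and C: "C \<subseteq> V" "C' \<subseteq> V" and "n \<le> N"
  shows "[rp ty (i + 2) C C' (Suc (n * (m + 1))) False True =
      of_bool (agree C C' n) * okp i C n * rp ty (i + 2) C C' 1 False True] (mod 2 ^ m)"
  using \<open>n \<le> N\<close>
proof (induction n)
  case 0
  then show ?case by (simp add: agree_def okp_def)
next
  case (Suc n)
  then have IH: "[rp ty (i + 2) C C' (Suc (n * (m + 1))) False True =
      of_bool (agree C C' n) * okp i C n * rp ty (i + 2) C C' 1 False True] (mod 2 ^ m)" and n: "n < N" by auto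
  have ok: "okp i C (Suc n) = okp i C n * (if col n \<in> C & conf i n then 0 else 2)" by (simp add: okp_def)
  show ?case
    using mid_lane(2)[OF i n C] cong_mult[OF cong_refl[of 2] IH] unfolding agree_Suc ok
    by (auto split: if_splits simp: ac_simps intro: cong_trans)
qed

end

context grid begin

definition amp :: "nat => nat set => nat set => nat" where
  "amp i C C' = rp ty (i + 2) C C' Wd False False"

text \<open>The left bus carries a signal as long as no row of the group has been chosen: the first
  row creates it, and it leaves the bus into the chosen row. The right bus carries a signal once a
  row has been chosen, and the last row absorbs it. \<open>L0\<close> and \<open>R0\<close> describe
  a row without a signal at that end, \<open>L1\<close> and \<open>R1\<close> a row with
  one.\<close>

definition L0 :: "nat => nat set => nat set => bool" where
  "L0 i C C' \<longleftrightarrow> (if i mod K = 0 then 1 \<notin> C & 1 \<in> C' else (1 \<in> C \<longleftrightarrow> 1 \<in> C'))"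
definition L1 :: "nat => nat set => nat set => bool" where
  "L1 i C C' \<longleftrightarrow> (if i mod K = 0 then 1 \<notin> C & 1 \<notin> C' else 1 \<in> C & 1 \<notin> C')"
definition R0 :: "nat => nat set => nat set => bool" where
  "R0 i C C' \<longleftrightarrow> (if i mod K = K - 1 then Wd \<in> C & Wd \<notin> C' else (Wd \<in> C \<longleftrightarrow> Wd \<in> C'))"
definition R1 :: "nat => nat set => nat set => bool" where
  "R1 i C C' \<longleftrightarrow> (if i mod K = K - 1 then Wd \<notin> C & Wd \<notin> C' else Wd \<notin> C & Wd \<in> C')"

lemma left_block:
  assumes "i < N"
  shows "rp ty (i + 2) C C' 1 False False = of_bool (L0 i C C')" "rp ty (i + 2) C C' 1 False True = of_bool (L1 i C C')"
  using rp_Suc[of ty "i + 2" C C' 0] ty_mid(1)[OF assms]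
  by (simp_all add: rp_0 UNIV_bool sig_eq lookup_def L0_def L1_def)

lemma right_block:
  assumes "i < N"
  shows "amp i C C' = of_bool (R0 i C C') * rp ty (i + 2) C C' (Suc (N * (m + 1))) False False +
     of_bool (R1 i C C') * rp ty (i + 2) C C' (Suc (N * (m + 1))) False True"
proof -
  have W: "Wd = Suc (Suc (N * (m + 1)))" by (simp add: Wd_def)
  show ?thesis using ty_mid(2)[OF assms] unfolding amp_def
    unfolding W rp_Suc by (simp add: UNIV_bool sig_eq lookup_def R0_def R1_def W)
qed

text \<open>In the second case \<open>R0\<close> is excluded because it is the exit for signals that
  were lost on the way, whose weights 3 and 4 are not under control.\<close>

lemma amp_cong:
  assumes i: "i < N" and C: "C \<subseteq> V" "C' \<subseteq> V"
  shows "L0 i C C' ==> [amp i C C' = of_bool (R0 i C C' & agree C C' N)] (mod 2 ^ m)"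
    and "L1 i C C' ==> \<not> R0 i C C' ==> [amp i C C' = of_bool (R1 i C C' & agree C C' N) * okp i C N] (mod 2 ^ m)"
    and "\<not> L0 i C C' ==> \<not> L1 i C C' ==> [amp i C C' = 0] (mod 2 ^ m)"
proof -
  let ?r = "rp ty (i + 2) C C' (Suc (N * (m + 1)))"
  assume l: "L0 i C C'"
  then have "\<not> L1 i C C'" by (auto simp: L0_def L1_def split: if_splits)
  then have *: "[?r False False = of_bool (agree C C' N)] (mod 2 ^ m)" "[?r False True = 0] (mod 2 ^ m)"
    using mid_row_empty[OF i C _ order_refl] left_block[OF i] l by auto
  show "[amp i C C' = of_bool (R0 i C C' & agree C C' N)] (mod 2 ^ m)"
    unfolding right_block[OF i]
    using cong_add[OF cong_mult[OF cong_refl *(1)] cong_mult[OF cong_refl *(2)], of "of_bool (R0 i C C')" "of_bool (R1 i C C')"]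
    by (simp add: of_bool_conj)
next
  assume l: "L1 i C C'" "\<not> R0 i C C'"
  show "[amp i C C' = of_bool (R1 i C C' & agree C C' N) * okp i C N] (mod 2 ^ m)"
    unfolding right_block[OF i] using cong_mult[OF cong_refl mid_row_full[OF i C order_refl], of "of_bool (R1 i C C')"]
      left_block[OF i] l by (simp add: of_bool_conj mult.assoc)
next
  assume l: "\<not> L0 i C C'" "\<not> L1 i C C'"
  let ?r = "rp ty (i + 2) C C' (Suc (N * (m + 1)))"
  have "[?r False False = 0] (mod 2 ^ m)" "[?r False True = 0] (mod 2 ^ m)"
    using mid_row_empty[OF i C _ order_refl] left_block[OF i] l by auto
  from cong_add[OF cong_mult[OF cong_refl this(1)] cong_mult[OF cong_refl this(2)], of "of_bool (R0 i C C')" "of_bool (R1 i C C')"]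
  show "[amp i C C' = 0] (mod 2 ^ m)" unfolding right_block[OF i] by simp
qed

section \<open>Groups of rows: one chosen row in each group\<close>

definition vec :: "nat => nat set => nat" where "vec i C = rv ty Wd (Suc i) C"

lemma vec_Suc:
  assumes "i < N" "C' \<subseteq> V"
  shows "vec (Suc i) C' = (\<Sum>C\<in>Pow V. vec i C * amp i C C')"
  using rv_step[of "Suc i" C'] assms by (simp add: vec_def amp_def)

lemma finite_V: "finite V" by (simp add: V_def cols_def)

lemma vec_cong_sum:
  assumes "i < N" "C' \<subseteq> V" "\<And>C. C \<subseteq> V ==> [vec i C * amp i C C' = s C] (mod 2 ^ m)"
  shows "[vec (Suc i) C' = (\<Sum>C\<in>Pow V. s C)] (mod 2 ^ m)"
  unfolding vec_Suc[OF assms(1,2)] using assms(3) by (intro cong_sum) auto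

lemma not_cols: "1 \<notin> cols" "Wd \<notin> cols" "1 \<noteq> Wd"
  using cols_bounds by (auto simp: Wd_def)

lemma agree_iff: "agree C C' N \<longleftrightarrow> C \<inter> cols = C' \<inter> cols"
  by (auto simp: agree_def cols_def)

lemma split_V: "C \<subseteq> V ==> C = (C \<inter> cols) \<union> (if 1 \<in> C then {1} else {}) \<union> (if Wd \<in> C then {Wd} else {})"
  by (auto simp: V_def)

definition onehot :: "nat set => bool" where
  "onehot c \<longleftrightarrow> (\<forall>g<G. card {t. t < K & col (g * K + t) \<in> c} = 1)"

text \<open>The intended transfer vector after \<open>g\<close> groups of rows: the columns in
  \<open>c\<close> stay as the top row has chosen them, and each group contributes the sum over its
  possible chosen rows.\<close>

definition F :: "nat => nat set => nat" where
  "F g c = of_bool (onehot c) * (\<Prod>g'<g. \<Sum>t<K. okp (g' * K + t) c N)"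

lemma okp_Int_cols: "okp i (C \<inter> cols) N = okp i C N"
  unfolding okp_def by (rule prod.cong) (auto simp: cols_def)

text \<open>Inside a group the buses tell the progress: a signal on the left means that no row has
  been chosen yet, one on the right that a row has been chosen, and both at once have weight 0. The
  state without any signal, the trace of a lost one, is not followed: no later row of the group can
  repair it, and the sink at the end of the last row needs a signal from the bus or from the
  row.\<close>

lemma group_step:
  assumes g: "g < G" and start: "\<And>c. c \<subseteq> cols ==> [vec (g * K) c = F g c] (mod 2 ^ m)"
    and W0: "\<And>C. C \<subseteq> V ==> Wd \<in> C ==> vec (g * K) C = 0"
    and "t < K"
  shows "(t < K - 1 --> (\<forall>c\<subseteq>cols. [vec (g * K + Suc t) (insert 1 c) = F g c] (mod 2 ^ m) &
      [vec (g * K + Suc t) (insert Wd c) = F g c * (\<Sum>t'<Suc t. okp (g * K + t') c N)] (mod 2 ^ m) &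
      [vec (g * K + Suc t) (insert 1 (insert Wd c)) = 0] (mod 2 ^ m))) &
    (t = K - 1 --> (\<forall>c\<subseteq>cols. [vec (g * K + Suc t) c = F g c * (\<Sum>t'<K. okp (g * K + t') c N)] (mod 2 ^ m)))"
  using \<open>t < K\<close>
proof (induction t)
  case 0
  define i where "i = g * K"
  have i: "i < N" using g K by (simp add: N_def mult.commute i_def)
  have m0: "i mod K = 0" by (simp add: i_def)
  note start = start[folded i_def] and W0 = W0[folded i_def]
  have key: "[vec i C * amp i C C' = (if C = c then of_bool (1 \<in> C' & R0 i C C') * vec i c +
      of_bool (1 \<notin> C' & R1 i C C') * okp i c N * vec i c else 0)] (mod 2 ^ m)"
    if C: "C \<subseteq> V" "C' \<subseteq> V" "C' \<inter> cols = c" "1 \<notin> C' ==> \<not> R0 i (C - {Wd}) C'" for C C' c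
  proof -
    consider "Wd \<in> C" | "1 \<in> C" "Wd \<notin> C" | "C \<subseteq> cols" using C(1) by (auto simp: V_def)
    then show ?thesis
    proof cases
      case 1
      then show ?thesis using W0[OF C(1)] not_cols C(3) by (cases "C = c") auto
    next
      case 2
      then have "C \<noteq> c" using C(3) not_cols by auto
      moreover have "[amp i C C' = 0] (mod 2 ^ m)" using amp_cong(3)[OF i C(1,2)] 2 m0 by (auto simp: L0_def L1_def)
      ultimately show ?thesis using cong_mult[OF cong_refl[of "vec i C"], of "amp i C C'" 0] by simp
    next
      case 3
      have nC: "1 \<notin> C" "Wd \<notin> C" using 3 not_cols by auto
      have ag: "agree C C' N \<longleftrightarrow> C = c" using 3 C(3) by (auto simp: agree_iff)
      show ?thesis
      proof (cases "1 \<in> C'")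
        case True
        have "[amp i C C' = of_bool (R0 i C C' & agree C C' N)] (mod 2 ^ m)"
          by (rule amp_cong(1)[OF i C(1,2)]) (use True nC m0 in \<open>simp add: L0_def\<close>)
        from cong_mult[OF cong_refl[of "vec i C"] this[unfolded ag]] show ?thesis using True by (cases "C = c") (simp_all add: ag mult.commute)
      next
        case False
        have "[amp i C C' = of_bool (R1 i C C' & agree C C' N) * okp i C N] (mod 2 ^ m)"
          by (rule amp_cong(2)[OF i C(1,2)]) (use False nC m0 C(4) in \<open>simp_all add: L1_def\<close>)
        from cong_mult[OF cong_refl[of "vec i C"] this[unfolded ag]] show ?thesis using False by (cases "C = c") (simp_all add: ag ac_simps)
      qed
    qed
  qed
  have res: "[vec (Suc i) C' = of_bool (1 \<in> C' & R0 i c C') * vec i c + of_bool (1 \<notin> C' & R1 i c C') * okp i c N * vec i c] (mod 2 ^ m)"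
    if C: "C' \<subseteq> V" "C' \<inter> cols = c" "1 \<notin> C' ==> \<not> R0 i c C'" for C' c
  proof -
    have c: "c \<subseteq> cols" "c \<subseteq> V" "c - {Wd} = c" using C not_cols by (auto simp: V_def)
    have "\<And>C. C \<subseteq> V ==> 1 \<notin> C' ==> \<not> R0 i (C - {Wd}) C'" using C(3) not_cols c by (auto simp: R0_def split: if_splits)
    then have "[vec (Suc i) C' = (\<Sum>C\<in>Pow V. if C = c then of_bool (1 \<in> C' & R0 i C C') * vec i c +
      of_bool (1 \<notin> C' & R1 i C C') * okp i c N * vec i c else 0)] (mod 2 ^ m)"
      by (intro vec_cong_sum[OF i C(1)] key) (use C in auto)
    then show ?thesis using c(2) finite_V by (simp add: sum.delta)
  qed
  show ?case unfolding i_def[symmetric]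
  proof (intro conjI impI allI)
    fix c assume t: "0 < K - 1" and c: "c \<subseteq> cols"
    have nl: "i mod K \<noteq> K - 1" using t m0 by simp
    have ns: "1 \<notin> c" "Wd \<notin> c" "c \<inter> cols = c" using c not_cols by auto
    have sub: "insert 1 c \<subseteq> V" "insert Wd c \<subseteq> V" "insert 1 (insert Wd c) \<subseteq> V" using c by (auto simp: V_def)
    show "[vec (i + Suc 0) (insert 1 c) = F g c] (mod 2 ^ m)"
      using res[OF sub(1), of c] ns not_cols nl start[OF c] by (auto simp: R0_def intro: cong_trans)
    show "[vec (i + Suc 0) (insert Wd c) = F g c * (\<Sum>t'<Suc 0. okp (i + t') c N)] (mod 2 ^ m)"
      using res[OF sub(2), of c] ns not_cols nl cong_mult[OF cong_refl[of "okp i c N"] start[OF c]]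
      by (auto simp: R0_def R1_def mult.commute intro: cong_trans)
    show "[vec (i + Suc 0) (insert 1 (insert Wd c)) = 0] (mod 2 ^ m)"
      using res[OF sub(3), of c] ns not_cols nl by (auto simp: R0_def R1_def)
  next
    fix c assume t: "0 = K - 1" and c: "c \<subseteq> cols"
    then have K1: "(\<Sum>t'<K. okp (i + t') c N) = okp i c N" using K by (cases K) auto
    have lst: "i mod K = K - 1" using t m0 by simp
    have ns: "1 \<notin> c" "Wd \<notin> c" "c \<inter> cols = c" using c not_cols by auto
    have "c \<subseteq> V" using c by (auto simp: V_def)
    then show "[vec (i + Suc 0) c = F g c * (\<Sum>t'<K. okp (i + t') c N)] (mod 2 ^ m)"
      using res[of c c] ns not_cols lst cong_mult[OF cong_refl[of "okp i c N"] start[OF c]]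
      unfolding K1 by (auto simp: R0_def R1_def mult.commute intro: cong_trans)
  qed
next
  case (Suc t)
  define i where "i = g * K + Suc t"
  have i: "i < N"
  proof -
    have "Suc g * K \<le> G * K" using g by (intro mult_le_mono1) simp
    then show ?thesis using Suc.prems by (simp add: N_def mult.commute i_def)
  qed
  have im: "i mod K = Suc t" unfolding i_def using Suc.prems by (metis mod_less mod_mult_self3)
  then have nf: "i mod K \<noteq> 0" by simp
  from Suc have IH: "\<And>c. c \<subseteq> cols ==> [vec i (insert 1 c) = F g c] (mod 2 ^ m)"
    "\<And>c. c \<subseteq> cols ==> [vec i (insert Wd c) = F g c * (\<Sum>t'<Suc t. okp (g * K + t') c N)] (mod 2 ^ m)"
    "\<And>c. c \<subseteq> cols ==> [vec i (insert 1 (insert Wd c)) = 0] (mod 2 ^ m)" unfolding i_def by auto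
  define last where "last = (Suc t = K - 1)"
  have Rl: "R0 i C C' \<longleftrightarrow> (if last then Wd \<in> C & Wd \<notin> C' else (Wd \<in> C \<longleftrightarrow> Wd \<in> C'))"
    "R1 i C C' \<longleftrightarrow> (if last then Wd \<notin> C & Wd \<notin> C' else Wd \<notin> C & Wd \<in> C')" for C C'
    by (simp_all add: R0_def R1_def im last_def)
  have Ll: "L0 i C C' \<longleftrightarrow> (1 \<in> C \<longleftrightarrow> 1 \<in> C')" "L1 i C C' \<longleftrightarrow> 1 \<in> C & 1 \<notin> C'" for C C'
    by (simp_all add: L0_def L1_def nf)
  \<comment> \<open>The targets \<open>C'\<close> of interest: the left bus is busy, or else the
    right bus is busy unless this is the last row of the group. The first summand comes from the
    state before the choice, the second from the state after it.\<close>
  have key: "[vec i C * amp i C C' =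
      (if C = insert 1 c then of_bool (1 \<in> C' & R0 i C C') * F g c + of_bool (1 \<notin> C' & R1 i C C') * okp i c N * F g c else 0) +
      (if C = insert Wd c then of_bool (1 \<notin> C') * (F g c * (\<Sum>t'<Suc t. okp (g * K + t') c N)) else 0)] (mod 2 ^ m)"
    if C: "C \<subseteq> V" "C' \<subseteq> V" "C' \<inter> cols = c" "1 \<notin> C' ==> Wd \<notin> C' \<longleftrightarrow> last" for C C' c
  proof -
    define d where "d = C \<inter> cols"
    have d: "d \<subseteq> cols" "C = d \<union> (if 1 \<in> C then {1} else {}) \<union> (if Wd \<in> C then {Wd} else {})"
      unfolding d_def using split_V[OF C(1)] by auto
    have c: "c \<subseteq> cols" using C(3) by auto
    have ag: "agree C C' N \<longleftrightarrow> d = c" by (simp add: agree_iff d_def C(3))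
    have ok: "okp i C N = okp i d N" unfolding d_def okp_Int_cols ..
    have nd: "1 \<notin> d" "Wd \<notin> d" "1 \<notin> c" "Wd \<notin> c" using d(1) c not_cols by auto
    consider "1 \<in> C" "Wd \<in> C" | "1 \<in> C" "Wd \<notin> C" | "1 \<notin> C" "Wd \<in> C" | "1 \<notin> C" "Wd \<notin> C" by blast
    then show ?thesis
    proof cases
      case 1
      then have "C = insert 1 (insert Wd d)" using d(2) by auto
      then have v: "[vec i C = 0] (mod 2 ^ m)" using IH(3)[OF d(1)] by simp
      have "C \<noteq> insert 1 c" "C \<noteq> insert Wd c" using 1 nd not_cols(3) by auto
      then show ?thesis using cong_mult[OF v cong_refl[of "amp i C C'"]] by simp
    next
      case 2
      then have Cd: "C = insert 1 d" using d(2) by auto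
      have n: "C \<noteq> insert Wd c" "C = insert 1 c \<longleftrightarrow> d = c" using 2 nd Cd by (blast, metis insert_ident)
      show ?thesis
      proof (cases "1 \<in> C'")
        case True
        have "[amp i C C' = of_bool (R0 i C C' & agree C C' N)] (mod 2 ^ m)"
          by (rule amp_cong(1)[OF i C(1,2)]) (use True 2 in \<open>simp add: Ll\<close>)
        from cong_mult[OF IH(1)[OF d(1), folded Cd] this] show ?thesis using n True by (cases "d = c") (simp_all add: ag mult.commute)
      next
        case False
        have "[amp i C C' = of_bool (R1 i C C' & agree C C' N) * okp i C N] (mod 2 ^ m)"
          by (rule amp_cong(2)[OF i C(1,2)]) (use False 2 C(4) in \<open>auto simp: Ll Rl\<close>)
        from cong_mult[OF IH(1)[OF d(1), folded Cd] this] show ?thesis using n False by (cases "d = c") (simp_all add: ag ok ac_simps)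
      qed
    next
      case 3
      then have Cd: "C = insert Wd d" using d(2) by auto
      have n: "C \<noteq> insert 1 c" "C = insert Wd c \<longleftrightarrow> d = c" using 3 nd Cd by (blast, metis insert_ident)
      show ?thesis
      proof (cases "1 \<in> C'")
        case True
        have "[amp i C C' = 0] (mod 2 ^ m)"
          by (rule amp_cong(3)[OF i C(1,2)]) (use True 3 in \<open>simp_all add: Ll\<close>)
        from cong_mult[OF cong_refl[of "vec i C"] this] show ?thesis using n True by simp
      next
        case False
        have "[amp i C C' = of_bool (R0 i C C' & agree C C' N)] (mod 2 ^ m)"
          by (rule amp_cong(1)[OF i C(1,2)]) (use False 3 in \<open>simp add: Ll\<close>)
        moreover have "R0 i C C'" using 3 C(4)[OF False] by (auto simp: Rl)
        ultimately have "[amp i C C' = of_bool (d = c)] (mod 2 ^ m)" by (simp add: ag)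
        from cong_mult[OF IH(2)[OF d(1), folded Cd] this] show ?thesis using n False by (cases "d = c") (simp_all del: sum.lessThan_Suc)
      qed
    next
      case 4
      have n: "C \<noteq> insert 1 c" "C \<noteq> insert Wd c" using 4 by auto
      have "[amp i C C' = 0] (mod 2 ^ m)"
      proof (cases "1 \<in> C'")
        case True
        show ?thesis by (rule amp_cong(3)[OF i C(1,2)]) (use True 4 in \<open>simp_all add: Ll\<close>)
      next
        case False
        have "[amp i C C' = of_bool (R0 i C C' & agree C C' N)] (mod 2 ^ m)"
          by (rule amp_cong(1)[OF i C(1,2)]) (use False 4 in \<open>simp add: Ll\<close>)
        moreover have "\<not> R0 i C C'" using 4 C(4)[OF False] by (auto simp: Rl)
        ultimately show ?thesis by simp
      qed
      from cong_mult[OF cong_refl[of "vec i C"] this] show ?thesis using n by simp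
    qed
  qed
  have res: "[vec (Suc i) C' = of_bool (1 \<in> C' & R0 i (insert 1 c) C') * F g c + of_bool (1 \<notin> C' & R1 i (insert 1 c) C') * okp i c N * F g c
      + of_bool (1 \<notin> C') * (F g c * (\<Sum>t'<Suc t. okp (g * K + t') c N))] (mod 2 ^ m)"
    if C: "C' \<subseteq> V" "C' \<inter> cols = c" "1 \<notin> C' ==> Wd \<notin> C' \<longleftrightarrow> last" for C' c
  proof -
    have c: "insert 1 c \<in> Pow V" "insert Wd c \<in> Pow V" using C by (auto simp: V_def)
    have "[vec (Suc i) C' = (\<Sum>C\<in>Pow V. (if C = insert 1 c then of_bool (1 \<in> C' & R0 i C C') * F g c + of_bool (1 \<notin> C' & R1 i C C') * okp i c N * F g c else 0) +
      (if C = insert Wd c then of_bool (1 \<notin> C') * (F g c * (\<Sum>t'<Suc t. okp (g * K + t') c N)) else 0))] (mod 2 ^ m)"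
      by (intro vec_cong_sum[OF i C(1)] key) (use C in auto)
    then show ?thesis using c finite_V by (simp add: sum.distrib sum.delta del: sum.lessThan_Suc Pow_iff)
  qed
  have ii: "g * K + Suc (Suc t) = Suc i" by (simp add: i_def)
  have io: "okp (g * K + Suc t) c N = okp i c N" for c by (simp add: i_def)
  show ?case unfolding ii
  proof (intro conjI impI allI)
    fix c assume t: "Suc t < K - 1" and c: "c \<subseteq> cols"
    have nl: "\<not> last" using t by (simp add: last_def)
    have ns: "1 \<notin> c" "Wd \<notin> c" "c \<inter> cols = c" using c not_cols by auto
    have sub: "insert 1 c \<subseteq> V" "insert Wd c \<subseteq> V" "insert 1 (insert Wd c) \<subseteq> V" using c by (auto simp: V_def)
    show "[vec (Suc i) (insert 1 c) = F g c] (mod 2 ^ m)"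
      using res[OF sub(1), of c] ns not_cols nl by (auto simp: Rl simp del: sum.lessThan_Suc)
    show "[vec (Suc i) (insert Wd c) = F g c * (\<Sum>t'<Suc (Suc t). okp (g * K + t') c N)] (mod 2 ^ m)"
    proof -
      have i1: "insert Wd c \<inter> cols = c" using c not_cols by auto
      have "R1 i (insert 1 c) (insert Wd c)" "Wd \<notin> insert Wd c \<longleftrightarrow> last" using ns not_cols nl by (simp_all add: Rl)
      then have "[vec (Suc i) (insert Wd c) = okp i c N * F g c + F g c * (\<Sum>t'<Suc t. okp (g * K + t') c N)] (mod 2 ^ m)"
        using res[OF sub(2) i1] ns not_cols by simp
      moreover have "okp i c N * F g c + F g c * (\<Sum>t'<Suc t. okp (g * K + t') c N) =
          F g c * (\<Sum>t'<Suc (Suc t). okp (g * K + t') c N)"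
        unfolding sum.lessThan_Suc[of _ "Suc t"] io distrib_left by (simp only: ac_simps)
      ultimately show ?thesis by simp
    qed
    show "[vec (Suc i) (insert 1 (insert Wd c)) = 0] (mod 2 ^ m)"
      using res[OF sub(3), of c] ns not_cols nl by (auto simp: Rl simp del: sum.lessThan_Suc)
  next
    fix c assume t: "Suc t = K - 1" and c: "c \<subseteq> cols"
    have nl: "last" using t by (simp add: last_def)
    have ns: "1 \<notin> c" "Wd \<notin> c" "c \<inter> cols = c" using c not_cols by auto
    have "c \<subseteq> V" using c by (auto simp: V_def)
    moreover have KS: "(\<Sum>t'<K. okp (g * K + t') c N) = (\<Sum>t'<Suc t. okp (g * K + t') c N) + okp i c N"
    proof -
      have "{..<K} = {..<Suc (Suc t)}" using t K by auto
      then show ?thesis by (simp only: sum.lessThan_Suc io)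
    qed
    ultimately show "[vec (Suc i) c = F g c * (\<Sum>t'<K. okp (g * K + t') c N)] (mod 2 ^ m)"
    proof -
      assume cV: "c \<subseteq> V"
      have "R1 i (insert 1 c) c" "Wd \<notin> c \<longleftrightarrow> last" using ns not_cols nl by (simp_all add: Rl)
      then have "[vec (Suc i) c = okp i c N * F g c + F g c * (\<Sum>t'<Suc t. okp (g * K + t') c N)] (mod 2 ^ m)"
        using res[OF cV ns(3)] ns by simp
      then show ?thesis unfolding KS distrib_left by (simp only: ac_simps)
    qed
  qed
qed

end

section \<open>Top row, bottom row and the count modulo a power of two\<close>

context grid begin

definition cnt :: "nat set => nat => nat => nat" where
  "cnt c g n = card {t. t < n & col (g * K + t) \<in> c}"

lemma cnt_0 [simp]: "cnt c g 0 = 0" by (simp add: cnt_def)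

lemma cnt_Suc [simp]: "cnt c g (Suc n) = cnt c g n + of_bool (col (g * K + n) \<in> c)"
proof -
  have "{t. t < Suc n & col (g * K + t) \<in> c} = (if col (g * K + n) \<in> c then insert n else id) {t. t < n & col (g * K + t) \<in> c}"
    by (auto simp: less_Suc_eq)
  then show ?thesis by (simp add: cnt_def)
qed

lemma onehot_cnt: "onehot c \<longleftrightarrow> (\<forall>g<G. cnt c g K = 1)"
  by (simp add: onehot_def cnt_def)

lemma lane_less: assumes "g < G" "n < K" shows "g * K + n < N" "(g * K + n) mod K = n"
proof -
  have "Suc g * K \<le> G * K" using assms(1) by (intro mult_le_mono1) simp
  then show "g * K + n < N" using assms(2) by (simp add: N_def mult.commute)
  show "(g * K + n) mod K = n" using assms(2) by simp
qed

lemma plain_chain: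
  assumes "l < N" "C \<subseteq> V" "C' \<subseteq> V" "\<And>k. 0 < k ==> k \<le> m ==> ty I (col l + k) = TP"
  shows "rp ty I C C' (Suc (Suc l * (m + 1))) False x = rp ty I C C' (col l) False x"
proof -
  have "rp ty I C C' (col l + k) False x = rp ty I C C' (col l) False x" if "k \<le> m" for k
    using that
  proof (induction k)
    case (Suc k)
    have t: "ty I (Suc (col l + k)) = TP" using assms(4)[of "Suc k"] Suc.prems by simp
    have n: "Suc (col l + k) \<notin> C" "Suc (col l + k) \<notin> C'" using chain_notin_V[OF assms(1), of "Suc k"] Suc.prems assms by auto
    have "rp ty I C C' (Suc (col l + k)) False x = rp ty I C C' (col l + k) False x"
      unfolding rp_Suc t using n by (cases x) (simp_all add: UNIV_bool sig_eq lookup_def)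
    then show ?case using Suc by simp
  qed simp
  note ch = this[OF order_refl]
  have e: "Suc (Suc l * (m + 1)) = col l + m" by (simp add: col_def)
  show ?thesis unfolding e by (rule ch)
qed

lemma top_lane:
  assumes l: "l < N" and c: "c \<subseteq> cols"
  defines "r \<equiv> rp ty 1 {} c"
  shows "r (Suc (Suc l * (m + 1))) False False = (if l mod K = 0 then of_bool (col l \<in> c) * r (Suc (l * (m + 1))) False False
      else of_bool (col l \<notin> c) * r (Suc (l * (m + 1))) False False + of_bool (col l \<in> c) * r (Suc (l * (m + 1))) False True)"
    "r (Suc (Suc l * (m + 1))) False True = of_bool (col l \<notin> c) * (if l mod K = 0 then r (Suc (l * (m + 1))) False False
      else r (Suc (l * (m + 1))) False True)"
proof -
  have cV: "{} \<subseteq> V" "c \<subseteq> V" using c by (auto simp: V_def)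
  have ch: "r (Suc (Suc l * (m + 1))) False x = r (col l) False x" for x
    unfolding r_def by (rule plain_chain[OF l cV ty_top(4)[OF l]])
  have hd: "r (col l) False x = (\<Sum>la\<in>UNIV. \<Sum>lb\<in>UNIV. r (Suc (l * (m + 1))) la lb * sig (if l mod K = 0 then TF else TM) la lb False False x (col l \<in> c))" for x
    using rp_Suc[of ty 1 "{}" c "Suc (l * (m + 1))" False x] ty_top(3)[OF l]
    unfolding r_def lane_index(2) by simp
  show "r (Suc (Suc l * (m + 1))) False False = (if l mod K = 0 then of_bool (col l \<in> c) * r (Suc (l * (m + 1))) False False
      else of_bool (col l \<notin> c) * r (Suc (l * (m + 1))) False False + of_bool (col l \<in> c) * r (Suc (l * (m + 1))) False True)"
    "r (Suc (Suc l * (m + 1))) False True = of_bool (col l \<notin> c) * (if l mod K = 0 then r (Suc (l * (m + 1))) False False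
      else r (Suc (l * (m + 1))) False True)"
    unfolding ch hd by (cases "l mod K = 0"; cases "col l \<in> c"; simp add: UNIV_bool sig_eq lookup_def)+
qed

lemma all_less_Suc: "(\<forall>x<Suc n. P x) \<longleftrightarrow> (\<forall>x<n. P x) & P n"
  by (auto simp: less_Suc_eq)

text \<open>Along the top row a signal runs as long as no column of the group has been selected. A
  signal that is left over meets a block without a port for it, the next \<open>TF\<close> or the
  final \<open>EM\<close>; so exactly one column is selected.\<close>

lemma top_group:
  assumes c: "c \<subseteq> cols" and g: "g < G" and n: "0 < n" "n \<le> K" and P: "rp ty 1 {} c (Suc (g * K * (m + 1))) False False = of_bool P"
  shows "rp ty 1 {} c (Suc ((g * K + n) * (m + 1))) False False = of_bool (P & cnt c g n = 1) &
    rp ty 1 {} c (Suc ((g * K + n) * (m + 1))) False True = of_bool (P & cnt c g n = 0)"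
  using n
proof (induction n)
  case (Suc n)
  have l: "g * K + n < N" "(g * K + n) mod K = n" using lane_less[OF g, of n] Suc.prems by auto
  note T = top_lane[OF l(1) c]
  have e: "g * K + Suc n = Suc (g * K + n)" by simp
  show ?case
  proof (cases "n = 0")
    case True
    show ?thesis unfolding e T l(2) using True P by (cases "col (g * K) \<in> c"; cases P) simp_all
  next
    case False
    then have IH: "rp ty 1 {} c (Suc ((g * K + n) * (m + 1))) False False = of_bool (P & cnt c g n = 1)"
      "rp ty 1 {} c (Suc ((g * K + n) * (m + 1))) False True = of_bool (P & cnt c g n = 0)" using Suc by auto
    show ?thesis unfolding e T l(2) IH using False by (cases "col (g * K + n) \<in> c"; cases P) simp_all
  qed
qed simp

lemma top_all:
  assumes c: "c \<subseteq> cols" and "g \<le> G"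
  shows "rp ty 1 {} c (Suc (g * K * (m + 1))) False False = of_bool (\<forall>g'<g. cnt c g' K = 1)"
  using \<open>g \<le> G\<close>
proof (induction g)
  case 0
  have "1 \<notin> c" using c not_cols by auto
  then show ?case using rp_Suc[of ty 1 "{}" c 0] ty_top(1) by (simp add: rp_0 UNIV_bool sig_eq lookup_def)
next
  case (Suc g)
  then have g: "g < G" and IH: "rp ty 1 {} c (Suc (g * K * (m + 1))) False False = of_bool (\<forall>g'<g. cnt c g' K = 1)" by auto
  have e: "Suc g * K = g * K + K" by simp
  show ?case unfolding e using top_group[OF c g K order_refl IH] by (simp only: all_less_Suc)
qed

lemma vec_0:
  assumes c: "c \<subseteq> cols"
  shows "vec 0 c = of_bool (onehot c)"
proof -
  have cV: "c \<subseteq> V" using c by (auto simp: V_def)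
  have Wc: "Wd \<notin> c" using c not_cols by auto
  have W: "Wd = Suc (Suc (G * K * (m + 1)))" by (simp add: Wd_def N_def mult.commute)
  have "vec 0 c = (\<Sum>C\<in>Pow V. rv ty Wd 0 C * rp ty 1 C c Wd False False)"
    using rv_step[of 0 c] cV by (simp add: vec_def)
  also have "\<dots> = (\<Sum>C\<in>Pow V. if C = {} then rp ty 1 {} c Wd False False else 0)"
    by (rule sum.cong) (auto simp: rv_0)
  also have "\<dots> = rp ty 1 {} c Wd False False" using finite_V by (simp add: sum.delta)
  also have "\<dots> = rp ty 1 {} c (Suc (G * K * (m + 1))) False False"
    using ty_top(2) Wc unfolding W rp_Suc by (simp add: UNIV_bool sig_eq lookup_def)
  finally show ?thesis using top_all[OF c order_refl] by (simp add: onehot_cnt)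
qed

text \<open>Between groups the right bus is empty for a local reason, exactly and not only modulo
  2^m: \<open>RL\<close> and the \<open>EM\<close> in the top row have no bottom port.\<close>

lemma vec_groups:
  assumes "g \<le> G"
  shows "(\<forall>c\<subseteq>cols. [vec (g * K) c = F g c] (mod 2 ^ m)) & (\<forall>C\<subseteq>V. Wd \<in> C --> vec (g * K) C = 0)"
  using assms
proof (induction g)
  case 0
  have "vec 0 C = 0" if "Wd \<in> C" for C
    unfolding vec_def by (rule rv_eq_0[OF that]) (use ty_top(2) in simp)
  then show ?case using vec_0 by (simp add: F_def)
next
  case (Suc g)
  then have g: "g < G" and IH: "\<And>c. c \<subseteq> cols ==> [vec (g * K) c = F g c] (mod 2 ^ m)"
    "\<And>C. C \<subseteq> V ==> Wd \<in> C ==> vec (g * K) C = 0" by auto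
  have K1: "K - 1 < K" "Suc (K - 1) = K" using K by auto
  have l: "g * K + (K - 1) < N" "(g * K + (K - 1)) mod K = K - 1" using lane_less[OF g K1(1)] by auto
  have e: "Suc g * K = g * K + Suc (K - 1)" using K1 by simp
  have "[vec (Suc g * K) c = F (Suc g) c] (mod 2 ^ m)" if "c \<subseteq> cols" for c
    using group_step[OF g IH K1(1)] that unfolding e by (simp add: F_def mult.assoc)
  moreover have "vec (Suc g * K) C = 0" if "Wd \<in> C" for C
    unfolding vec_def
  proof (rule rv_eq_0[OF that])
    have e2: "Suc (Suc g * K) = g * K + (K - 1) + 2" using K1 by simp
    show "(3, 15, 0) \<notin> set (cells (ty (Suc (Suc g * K)) Wd))"
      unfolding e2 ty_mid(2)[OF l(1)] l(2) by (auto simp: vline_def)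
  qed
  ultimately show ?case by blast
qed

lemma bot_lane:
  assumes l: "l < N" and c: "c \<subseteq> cols"
  defines "r \<equiv> rp ty (N + 2) c {}"
  shows "r (Suc (Suc l * (m + 1))) False False = of_bool (col l \<notin> c) * (if l mod K = K - 1 then r (Suc (l * (m + 1))) False True else r (Suc (l * (m + 1))) False False)
      + (if l mod K = K - 1 then of_bool (col l \<in> c) * r (Suc (l * (m + 1))) False False else 0)"
    "r (Suc (Suc l * (m + 1))) False True = (if l mod K = K - 1 then 0 else of_bool (col l \<notin> c) * r (Suc (l * (m + 1))) False True
      + of_bool (col l \<in> c) * r (Suc (l * (m + 1))) False False)"
proof -
  have cV: "c \<subseteq> V" "{} \<subseteq> V" using c by (auto simp: V_def)
  have ch: "r (Suc (Suc l * (m + 1))) False x = r (col l) False x" for x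
    unfolding r_def by (rule plain_chain[OF l cV ty_bot(4)[OF l]])
  have hd: "r (col l) False x = (\<Sum>la\<in>UNIV. \<Sum>lb\<in>UNIV. r (Suc (l * (m + 1))) la lb * sig (if l mod K = K - 1 then BL else BM) la lb (col l \<in> c) False x False)" for x
    using rp_Suc[of ty "N + 2" c "{}" "Suc (l * (m + 1))" False x] ty_bot(3)[OF l]
    unfolding r_def lane_index(2) by simp
  show "r (Suc (Suc l * (m + 1))) False False = of_bool (col l \<notin> c) * (if l mod K = K - 1 then r (Suc (l * (m + 1))) False True else r (Suc (l * (m + 1))) False False)
      + (if l mod K = K - 1 then of_bool (col l \<in> c) * r (Suc (l * (m + 1))) False False else 0)"
    "r (Suc (Suc l * (m + 1))) False True = (if l mod K = K - 1 then 0 else of_bool (col l \<notin> c) * r (Suc (l * (m + 1))) False True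
      + of_bool (col l \<in> c) * r (Suc (l * (m + 1))) False False)"
    unfolding ch hd by (cases "l mod K = K - 1"; cases "col l \<in> c"; simp add: UNIV_bool sig_eq lookup_def)+
qed

text \<open>The bottom row carries the one signal of the group on to the last column of the group,
  whose block is a sink; it has weight 1 and imposes nothing new on one-hot sets.\<close>

lemma bot_group:
  assumes c: "c \<subseteq> cols" and g: "g < G" and n: "n \<le> K" and one: "cnt c g K = 1"
    and P: "rp ty (N + 2) c {} (Suc (g * K * (m + 1))) False False = 1" "rp ty (N + 2) c {} (Suc (g * K * (m + 1))) False True = 0"
  shows "if n < K then rp ty (N + 2) c {} (Suc ((g * K + n) * (m + 1))) False False = of_bool (cnt c g n = 0) &
      rp ty (N + 2) c {} (Suc ((g * K + n) * (m + 1))) False True = of_bool (cnt c g n = 1)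
    else rp ty (N + 2) c {} (Suc ((g * K + n) * (m + 1))) False False = 1 &
      rp ty (N + 2) c {} (Suc ((g * K + n) * (m + 1))) False True = 0"
  using n
proof (induction n)
  case 0
  then show ?case using P K by simp
next
  case (Suc n)
  have l: "g * K + n < N" "(g * K + n) mod K = n" using lane_less[OF g, of n] Suc.prems by auto
  note T = bot_lane[OF l(1) c]
  have e: "g * K + Suc n = Suc (g * K + n)" by simp
  have IH: "rp ty (N + 2) c {} (Suc ((g * K + n) * (m + 1))) False False = of_bool (cnt c g n = 0)"
    "rp ty (N + 2) c {} (Suc ((g * K + n) * (m + 1))) False True = of_bool (cnt c g n = 1)" using Suc by auto
  show ?case
  proof (cases "Suc n = K")
    case True
    then have nl: "n = K - 1" by simp
    have "cnt c g (Suc n) = 1" unfolding True by (rule one)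
    then have "cnt c g n + of_bool (col (g * K + n) \<in> c) = 1" by simp
    moreover have "\<not> Suc n < K" using True by simp
    ultimately show ?thesis unfolding e T l(2) IH if_P[OF nl] by (cases "col (g * K + n) \<in> c") simp_all
  next
    case False
    then have nl: "n \<noteq> K - 1" "Suc n < K" using Suc.prems by auto
    show ?thesis unfolding e T l(2) IH if_not_P[OF nl(1)] using nl(2) by (cases "col (g * K + n) \<in> c") simp_all
  qed
qed

lemma bot_row:
  assumes c: "c \<subseteq> cols" and oh: "onehot c"
  shows "rp ty (N + 2) c {} Wd False False = 1"
proof -
  have "rp ty (N + 2) c {} (Suc (g * K * (m + 1))) False False = 1 & rp ty (N + 2) c {} (Suc (g * K * (m + 1))) False True = 0"
    if "g \<le> G" for g using that
  proof (induction g)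
    case 0
    have "1 \<notin> c" using c not_cols by auto
    then show ?case using rp_Suc[of ty "N + 2" c "{}" 0] ty_bot(1) by (simp add: rp_0 UNIV_bool sig_eq lookup_def)
  next
    case (Suc g)
    then have g: "g < G" by simp
    have e: "Suc g * K = g * K + K" by simp
    have "cnt c g K = 1" using oh g by (simp add: onehot_cnt)
    then show ?case unfolding e using bot_group[OF c g order_refl] Suc by simp
  qed
  from this[OF order_refl] have "rp ty (N + 2) c {} (Suc (N * (m + 1))) False False = 1" by (simp add: N_def mult.commute)
  moreover have "Wd \<notin> c" using c not_cols by auto
  moreover have W: "Wd = Suc (Suc (N * (m + 1)))" by (simp add: Wd_def)
  ultimately show ?thesis using ty_bot(2) unfolding W rp_Suc by (simp add: UNIV_bool sig_eq lookup_def)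
qed

lemma core_cong:
  "[pm adj (rowsp ty Wd (N + 2)) = (\<Sum>c\<in>Pow cols. F G c)] (mod 2 ^ m)"
proof -
  have GN: "G * K = N" by (simp add: N_def mult.commute)
  have "pm adj (rowsp ty Wd (N + 2)) = rv ty Wd (Suc (N + 1)) {}" by (simp add: rv_def pmx_def bots_def)
  also have "\<dots> = (\<Sum>C\<in>Pow V. vec N C * rp ty (N + 2) C {} Wd False False)"
    using rv_step[of "N + 1" "{}"] by (simp add: vec_def)
  also have "\<dots> = (\<Sum>C\<in>Pow cols. vec N C * rp ty (N + 2) C {} Wd False False)"
  proof (rule sum.mono_neutral_right)
    show "\<forall>C\<in>Pow V - Pow cols. vec N C * rp ty (N + 2) C {} Wd False False = 0"
    proof
      fix C assume "C \<in> Pow V - Pow cols"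
      then have "1 \<in> C \<or> Wd \<in> C" by (auto simp: V_def)
      then obtain J where "J \<in> C" "1 \<le> J" "J \<le> Wd" "ty (N + 2) J = EM"
        using ty_bot(1,2) by (metis Wd_def add_leD1 le_add1 one_add_one order_refl)
      then have "rp ty (N + 2) C {} Wd False False = 0" by (intro rp_eq_0) auto
      then show "vec N C * rp ty (N + 2) C {} Wd False False = 0" by simp
    qed
  qed (use finite_V in \<open>auto simp: V_def\<close>)
  finally have eq: "pm adj (rowsp ty Wd (N + 2)) = (\<Sum>C\<in>Pow cols. vec N C * rp ty (N + 2) C {} Wd False False)" .
  show ?thesis unfolding eq
  proof (rule cong_sum)
    fix c assume "c \<in> Pow cols"
    then have c: "c \<subseteq> cols" by simp
    have "[vec N c = F G c] (mod 2 ^ m)" using vec_groups[OF order_refl] c by (simp add: GN)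
    then have *: "[vec N c * rp ty (N + 2) c {} Wd False False = F G c * rp ty (N + 2) c {} Wd False False] (mod 2 ^ m)"
      by (rule cong_mult) simp
    show "[vec N c * rp ty (N + 2) c {} Wd False False = F G c] (mod 2 ^ m)"
    proof (cases "onehot c")
      case True then show ?thesis using * bot_row[OF c True] by simp
    next
      case False then show ?thesis using * by (simp add: F_def)
    qed
  qed
qed

section \<open>From signals to selections of views\<close>

lemma okp_eq: "okp i c N = 2 ^ N * of_bool (\<forall>l<N. col l \<in> c --> \<not> conf i l)"
proof (cases "\<forall>l<N. col l \<in> c --> \<not> conf i l")
  case True
  then have "okp i c N = (\<Prod>l<N. 2)" unfolding okp_def by (intro prod.cong) auto
  then show ?thesis using True by simp
next
  case False
  then show ?thesis by (auto simp: okp_def)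
qed

definition lanes :: "(nat => nat) => nat set" where
  "lanes f = (%g. col (g * K + f g)) ` {..<G}"

lemma Collect_unique: "(\<And>h. h \<in> S ==> Q h ==> h = f) ==> f \<in> S ==> {h \<in> S. Q h} = (if Q f then {f} else {})"
proof (rule set_eqI)
  fix h assume u: "\<And>h. h \<in> S ==> Q h ==> h = f" and f: "f \<in> S"
  show "h \<in> {h \<in> S. Q h} \<longleftrightarrow> h \<in> (if Q f then {f} else {})"
  proof (cases "h = f")
    case False
    then have "\<not> (h \<in> S & Q h)" using u by blast
    then show ?thesis using False by simp
  qed (simp add: f)
qed

lemma lane_inj: "g * K + t = g' * K + t' ==> t < K ==> t' < K ==> g = g' & t = t'"
proof -
  assume e: "g * K + t = g' * K + t'" and t: "t < K" "t' < K"
  have d: "(a * K + b) div K = a" "(a * K + b) mod K = b" if "b < K" for a b using that by simp_all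
  show ?thesis using d[OF t(1), of g] d[OF t(2), of g'] unfolding e by simp
qed

lemma col_mem_lanes:
  assumes "f \<in> PiE {..<G} (%_. {..<K})" "g < G" "t < K"
  shows "col (g * K + t) \<in> lanes f \<longleftrightarrow> t = f g"
proof -
  have "f g' < K" if "g' < G" for g' using assms(1) that by (auto simp: PiE_iff)
  note fK = this
  show ?thesis
  proof
    assume "col (g * K + t) \<in> lanes f"
    then obtain g' where g': "g' < G" "g * K + t = g' * K + f g'" by (auto simp: lanes_def inj_eq[OF inj_col])
    show "t = f g" using lane_inj[OF g'(2) assms(3) fK[OF g'(1)]] by simp
  qed (use assms(2) in \<open>simp add: lanes_def\<close>)
qed

lemma lanes_bij: "bij_betw lanes (PiE {..<G} (%_. {..<K})) {c\<in>Pow cols. onehot c}"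
proof (rule bij_betw_imageI)
  show "inj_on lanes (PiE {..<G} (%_. {..<K}))"
  proof (rule inj_onI)
    fix f h assume f: "f \<in> PiE {..<G} (%_. {..<K})" and h: "h \<in> PiE {..<G} (%_. {..<K})" and e: "lanes f = lanes h"
    show "f = h"
    proof (rule PiE_ext[OF f h])
      fix g assume g: "g \<in> {..<G}"
      then have "f g < K" using f by (auto simp: PiE_iff)
      then show "f g = h g" using col_mem_lanes[OF f, of g "f g"] col_mem_lanes[OF h, of g "f g"] e g by simp
    qed
  qed
  show "lanes ` (PiE {..<G} (%_. {..<K})) = {c\<in>Pow cols. onehot c}"
  proof (intro subset_antisym subsetI)
    fix c assume "c \<in> lanes ` (PiE {..<G} (%_. {..<K}))"
    then obtain f where f: "f \<in> PiE {..<G} (%_. {..<K})" "c = lanes f" by blast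
    have fK: "f g < K" if "g < G" for g using f(1) that by (auto simp: PiE_iff)
    have "c \<subseteq> cols" using f(2) fK lane_less by (auto simp: lanes_def cols_def)
    moreover have "{t. t < K & col (g * K + t) \<in> c} = {f g}" if "g < G" for g
      using col_mem_lanes[OF f(1) that] fK[OF that] f(2) by auto
    ultimately show "c \<in> {c\<in>Pow cols. onehot c}" by (simp add: onehot_def)
  next
    fix c assume c: "c \<in> {c\<in>Pow cols. onehot c}"
    then have "\<forall>g\<in>{..<G}. \<exists>t. {t. t < K & col (g * K + t) \<in> c} = {t}" by (auto simp: onehot_def card_1_singleton_iff)
    then obtain h where h: "\<And>g. g < G ==> {t. t < K & col (g * K + t) \<in> c} = {h g}" by (metis lessThan_iff)
    define f where "f = restrict h {..<G}"
    have hK: "h g < K" if "g < G" for g using h[OF that] by auto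
    have f: "f \<in> PiE {..<G} (%_. {..<K})" using hK by (auto simp: f_def)
    have "c = lanes f"
    proof (intro subset_antisym subsetI)
      fix x assume x: "x \<in> c"
      then obtain l where l: "l < N" "x = col l" using c by (auto simp: cols_def)
      have "l = l div K * K + l mod K" "l mod K < K" using K by auto
      moreover have "l div K < G" using l(1) by (simp add: N_def mult.commute less_mult_imp_div_less)
      moreover have "l mod K \<in> {t. t < K & col (l div K * K + t) \<in> c}" using x l(2) K by simp
      ultimately have "l mod K = h (l div K)" using h[of "l div K"] by simp
      then show "x \<in> lanes f" using \<open>l div K < G\<close> \<open>l = l div K * K + l mod K\<close> l(2) unfolding lanes_def
        by (intro image_eqI[of _ _ "l div K"]) (auto simp: f_def)
    next
      fix x assume "x \<in> lanes f"
      then obtain g where "g < G" "x = col (g * K + h g)" by (auto simp: lanes_def f_def)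
      then show "x \<in> c" using h[of g] by auto
    qed
    then show "c \<in> lanes ` (PiE {..<G} (%_. {..<K}))" using f by blast
  qed
qed

text \<open>\<open>f\<close> is the selection made by the columns and \<open>h\<close> the one made
  by the rows: the product over the groups of the sums over their rows expands into a sum over all
  \<open>h\<close>.\<close>

lemma F_lanes:
  assumes f: "f \<in> PiE {..<G} (%_. {..<K})"
  shows "F G (lanes f) = 2 ^ (N * G) * card {h \<in> PiE {..<G} (%_. {..<K}). \<forall>g<G. \<forall>g'<G. \<not> conf (g * K + h g) (g' * K + f g')}"
proof -
  have oh: "onehot (lanes f)" using lanes_bij f by (auto simp: bij_betw_def)
  have ok: "(\<forall>l<N. col l \<in> lanes f --> \<not> conf i l) \<longleftrightarrow> (\<forall>g'<G. \<not> conf i (g' * K + f g'))" for i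
  proof -
    have "g' * K + f g' < N" if "g' < G" for g' using lane_less(1)[OF that] f that by (auto simp: PiE_iff)
    then show ?thesis by (auto simp: lanes_def inj_eq[OF inj_col])
  qed
  have "F G (lanes f) = (\<Prod>g<G. \<Sum>t<K. 2 ^ N * of_bool (\<forall>g'<G. \<not> conf (g * K + t) (g' * K + f g')))"
    by (simp add: F_def oh okp_eq ok)
  also have "\<dots> = (\<Prod>g<G. 2 ^ N * card {t\<in>{..<K}. \<forall>g'<G. \<not> conf (g * K + t) (g' * K + f g')})"
    by (rule prod.cong) (auto simp: sum_distrib_left[symmetric] sum.If_cases of_bool_def Int_def intro!: arg_cong[of _ _ card])
  also have "\<dots> = 2 ^ (N * G) * card (PiE {..<G} (%g. {t\<in>{..<K}. \<forall>g'<G. \<not> conf (g * K + t) (g' * K + f g')}))"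
    by (simp add: card_PiE prod.distrib power_mult)
  also have "PiE {..<G} (%g. {t\<in>{..<K}. \<forall>g'<G. \<not> conf (g * K + t) (g' * K + f g')}) =
      {h \<in> PiE {..<G} (%_. {..<K}). \<forall>g<G. \<forall>g'<G. \<not> conf (g * K + h g) (g' * K + f g')}"
    unfolding set_eq_iff mem_Collect_eq PiE_iff by blast
  finally show ?thesis .
qed

text \<open>By the hypothesis \<open>diag\<close> the only row selection that can be free of
  conflicts with the columns \<open>f\<close> is \<open>f\<close> itself, so the count of pairs
  collapses to a count of single selections.\<close>

theorem core_count:
  assumes diag: "\<And>g t t'. g < G ==> t < K ==> t' < K ==> t \<noteq> t' ==> conf (g * K + t) (g * K + t')"
  shows "[pm adj (rowsp ty Wd (N + 2)) =
    2 ^ (N * G) * card {f \<in> PiE {..<G} (%_. {..<K}). \<forall>g<G. \<forall>g'<G. \<not> conf (g * K + f g) (g' * K + f g')}] (mod 2 ^ m)"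
proof -
  let ?P = "PiE {..<G} (%_. {..<K})"
  have fP: "finite ?P" by (intro finite_PiE) auto
  have "(\<Sum>c\<in>Pow cols. F G c) = (\<Sum>c\<in>{c\<in>Pow cols. onehot c}. F G c)"
    by (rule sum.mono_neutral_right) (auto simp: cols_def F_def)
  also have "\<dots> = (\<Sum>f\<in>?P. F G (lanes f))" by (rule sum.reindex_bij_betw[OF lanes_bij, symmetric])
  also have "\<dots> = (\<Sum>f\<in>?P. 2 ^ (N * G) * of_bool (\<forall>g<G. \<forall>g'<G. \<not> conf (g * K + f g) (g' * K + f g')))"
  proof (rule sum.cong[OF refl])
    fix f assume f: "f \<in> ?P"
    have "h = f" if "h \<in> ?P" "\<forall>g<G. \<forall>g'<G. \<not> conf (g * K + h g) (g' * K + f g')" for h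
    proof (rule PiE_ext[OF that(1) f])
      fix g assume "g \<in> {..<G}"
      then show "h g = f g" using diag[of g "h g" "f g"] that f PiE_mem[OF that(1)] PiE_mem[OF f] by blast
    qed
    moreover define Q where "Q h \<longleftrightarrow> (\<forall>g<G. \<forall>g'<G. \<not> conf (g * K + h g) (g' * K + f g'))" for h
    ultimately have uniq: "\<And>h. h \<in> ?P ==> Q h ==> h = f" by blast
    have "{h \<in> ?P. Q h} = (if Q f then {f} else {})" by (rule Collect_unique[OF uniq f])
    then have "card {h \<in> ?P. Q h} = of_bool (Q f)" by simp
    then show "F G (lanes f) = 2 ^ (N * G) * of_bool (\<forall>g<G. \<forall>g'<G. \<not> conf (g * K + f g) (g' * K + f g'))"
      unfolding F_lanes[OF f] Q_def by (simp only:)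
  qed
  also have "\<dots> = 2 ^ (N * G) * card {f \<in> ?P. \<forall>g<G. \<forall>g'<G. \<not> conf (g * K + f g) (g' * K + f g')}"
    using fP by (simp add: sum_distrib_left[symmetric] of_bool_def sum.If_cases Int_def)
  finally show ?thesis using core_cong by simp
qed

end

section \<open>The region of a grid\<close>

text \<open>A hole is filled and gets a tower above or below according to the colour of its square;
  so the towers of adjacent holes lie on opposite sides of the layer.\<close>

definition colcells :: "block => int => int => cell list" where
  "colcells t x y = (x, y, 0) # (if (x, y, 0) \<in> set (cells t) then if (x, y, 1) \<in> set (cells t) then [(x, y, 1)] else []
     else [(x, y, if (x + y) mod 2 = 0 then -1 else 1)])"

definition full :: "block => cell list" where
  "full t = concat (map (%x. concat (map (colcells t x) [0..15])) [0..7])"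

definition region_list :: "(nat => nat => block) => nat => nat => cell list" where
  "region_list ty W H = concat (map (%I. concat (map (%J. map (shift I J) (full (ty I J))) [1..<Suc W])) [1..<Suc H])"

lemma distinct_concat_mapI:
  assumes "distinct xs" "\<And>x. x \<in> set xs ==> distinct (f x)"
    "\<And>x y. x \<in> set xs ==> y \<in> set xs ==> x \<noteq> y ==> set (f x) \<inter> set (f y) = {}"
  shows "distinct (concat (map f xs))"
  using assms
proof (induction xs)
  case (Cons a xs)
  have "set (f a) \<inter> set (f y) = {}" if "y \<in> set xs" for y using that Cons.prems(1) Cons.prems(3)[of a y] by auto
  moreover have "distinct (concat (map f xs))" by (rule Cons.IH) (use Cons.prems in auto)
  ultimately show ?case using Cons.prems(2)[of a] by auto
qed simp

lemma mem_full:
  "(x, y, z) \<in> set (full t) \<longleftrightarrow> 0 \<le> x & x < 8 & 0 \<le> y & y < 16 & (z = 0 \<or>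
     (if (x, y, 0) \<in> set (cells t) then z = 1 & (x, y, 1) \<in> set (cells t) else z = (if (x + y) mod 2 = 0 then -1 else 1)))"
proof -
  have "fst c = a & fst (snd c) = b" if "c \<in> set (colcells t a b)" for a b c
    using that by (auto simp: colcells_def split: if_splits)
  then have "(x, y, z) \<in> set (full t) \<longleftrightarrow> x \<in> {0..7} & y \<in> {0..15} & (x, y, z) \<in> set (colcells t x y)"
    unfolding full_def set_concat set_map set_upto by fastforce
  moreover have "x \<in> {0..7} \<longleftrightarrow> 0 \<le> x & x < 8" "y \<in> {0..15} \<longleftrightarrow> 0 \<le> y & y < 16" by auto
  moreover have "(x, y, z) \<in> set (colcells t x y) \<longleftrightarrow> z = 0 \<or>
     (if (x, y, 0) \<in> set (cells t) then z = 1 & (x, y, 1) \<in> set (cells t) else z = (if (x + y) mod 2 = 0 then -1 else 1))"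
    by (simp add: colcells_def)
  ultimately show ?thesis by blast
qed

lemma distinct_full: "distinct (full t)"
  unfolding full_def
  by (intro distinct_concat_mapI) (auto simp: colcells_def split: if_splits)

lemma mem_region_list:
  "(X, Y, Z) \<in> set (region_list ty W H) \<longleftrightarrow>
    (\<exists>I\<in>{1..H}. \<exists>J\<in>{1..W}. (X - 8 * int J, Y - 16 * int I, Z) \<in> set (full (ty I J)))"
proof -
  have "(X, Y, Z) \<in> shift I J ` A \<longleftrightarrow> (X - 8 * int J, Y - 16 * int I, Z) \<in> A" for I J A
    by (force simp: image_iff)
  then show ?thesis unfolding region_list_def by (simp add: atLeastLessThanSuc_atLeastAtMost del: upt_Suc)
qed

lemma mem_rowsp:
  "(X, Y, Z) \<in> rowsp ty W H \<longleftrightarrow>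
    (\<exists>I\<in>{1..H}. \<exists>J\<in>{1..W}. (X - 8 * int J, Y - 16 * int I, Z) \<in> set (cells (ty I J)))"
  by (auto simp: rowsp_def rowp_def mem_blk)

definition in_box :: "nat => nat => int => int => bool" where
  "in_box W H X Y \<longleftrightarrow> 8 \<le> X & X < 8 * int W + 8 & 16 \<le> Y & Y < 16 * int H + 16"

lemma locate:
  assumes "in_box W H X Y"
  obtains I J where "I \<in> {1..H}" "J \<in> {1..W}" "0 \<le> X - 8 * int J" "X - 8 * int J < 8" "0 \<le> Y - 16 * int I" "Y - 16 * int I < 16"
    "\<And>Z. (X, Y, Z) \<in> rowsp ty W H \<longleftrightarrow> (X - 8 * int J, Y - 16 * int I, Z) \<in> set (cells (ty I J))"
    "\<And>Z. (X, Y, Z) \<in> set (region_list ty W H) \<longleftrightarrow> (X - 8 * int J, Y - 16 * int I, Z) \<in> set (full (ty I J))"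
proof -
  define I where "I = nat (Y div 16)"
  define J where "J = nat (X div 8)"
  have IJ: "int I = Y div 16" "int J = X div 8" using assms by (auto simp: I_def J_def in_box_def)
  have I: "I \<in> {1..H}" and J: "J \<in> {1..W}" using assms IJ unfolding in_box_def by auto
  have b: "0 \<le> X - 8 * int J" "X - 8 * int J < 8" "0 \<le> Y - 16 * int I" "Y - 16 * int I < 16"
    unfolding IJ by auto
  have uJ: "J' = J" if "0 \<le> X - 8 * int J'" "X - 8 * int J' < 8" for J' using that b by linarith
  have uI: "I' = I" if "0 \<le> Y - 16 * int I'" "Y - 16 * int I' < 16" for I' using that b by linarith
  show ?thesis
  proof (rule that[OF I J b])
    fix Z
    show "(X, Y, Z) \<in> rowsp ty W H \<longleftrightarrow> (X - 8 * int J, Y - 16 * int I, Z) \<in> set (cells (ty I J))"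
    proof
      assume "(X, Y, Z) \<in> rowsp ty W H"
      then obtain I' J' where *: "(X - 8 * int J', Y - 16 * int I', Z) \<in> set (cells (ty I' J'))" by (auto simp: mem_rowsp)
      show "(X - 8 * int J, Y - 16 * int I, Z) \<in> set (cells (ty I J))"
        using * uJ[OF cells_bounds(1,2)[OF *]] uI[OF cells_bounds(3,4)[OF *]] by simp
    next
      assume "(X - 8 * int J, Y - 16 * int I, Z) \<in> set (cells (ty I J))"
      then show "(X, Y, Z) \<in> rowsp ty W H" unfolding mem_rowsp using I J by blast
    qed
    show "(X, Y, Z) \<in> set (region_list ty W H) \<longleftrightarrow> (X - 8 * int J, Y - 16 * int I, Z) \<in> set (full (ty I J))"
    proof
      assume "(X, Y, Z) \<in> set (region_list ty W H)"
      then obtain I' J' where *: "(X - 8 * int J', Y - 16 * int I', Z) \<in> set (full (ty I' J'))" by (auto simp: mem_region_list)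
      then have "J' = J" "I' = I" using uI uJ unfolding mem_full by blast+
      then show "(X - 8 * int J, Y - 16 * int I, Z) \<in> set (full (ty I J))" using * by simp
    next
      assume "(X - 8 * int J, Y - 16 * int I, Z) \<in> set (full (ty I J))"
      then show "(X, Y, Z) \<in> set (region_list ty W H)" unfolding mem_region_list using I J by blast
    qed
  qed
qed

lemma in_boxI:
  assumes "I \<in> {1..H}" "J \<in> {1..W}" "0 \<le> X - 8 * int J" "X - 8 * int J < 8" "0 \<le> Y - 16 * int I" "Y - 16 * int I < 16"
  shows "in_box W H X Y"
proof -
  have "1 \<le> int I" "int I \<le> int H" "1 \<le> int J" "int J \<le> int W" using assms(1,2) by auto
  then show ?thesis using assms(3-) unfolding in_box_def by linarith
qed

lemma region_in_box: "(X, Y, Z) \<in> set (region_list ty W H) ==> in_box W H X Y"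
  unfolding mem_region_list mem_full using in_boxI by blast

lemma core_in_box: "(X, Y, Z) \<in> rowsp ty W H ==> in_box W H X Y"
proof -
  assume "(X, Y, Z) \<in> rowsp ty W H"
  then obtain I J where "I \<in> {1..H}" "J \<in> {1..W}" and *: "(X - 8 * int J, Y - 16 * int I, Z) \<in> set (cells (ty I J))"
    unfolding mem_rowsp by blast
  then show ?thesis using cells_bounds(1-4)[OF *] by (intro in_boxI)
qed

lemma distinct_region_list: "distinct (region_list ty W H)"
  unfolding region_list_def
proof (intro distinct_concat_mapI)
  fix I J show "distinct (map (shift I J) (full (ty I J)))"
    by (simp add: distinct_map distinct_full inj_on_subset[OF inj_shift])
next
  fix I J J' :: nat assume ne: "J \<noteq> J'"
  show "set (map (shift I J) (full (ty I J))) \<inter> set (map (shift I J') (full (ty I J'))) = {}"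
  proof (rule ccontr)
    assume "set (map (shift I J) (full (ty I J))) \<inter> set (map (shift I J') (full (ty I J'))) \<noteq> {}"
    then obtain c where "c \<in> shift I J ` set (full (ty I J))" "c \<in> shift I J' ` set (full (ty I J'))"
      unfolding set_map by blast
    then obtain a b where ab: "a \<in> set (full (ty I J))" "b \<in> set (full (ty I J'))" "shift I J a = shift I J' b"
      by (elim imageE) metis
    obtain x y z where a: "a = (x, y, z)" by (cases a)
    obtain x' y' z' where b: "b = (x', y', z')" by (cases b)
    have "(x, y, z) \<in> set (full (ty I J))" "(x', y', z') \<in> set (full (ty I J'))" "8 * int J + x = 8 * int J' + x'"
      using ab by (simp_all add: a b)
    then show False using ne unfolding mem_full by linarith
  qed
next
  fix I I' :: nat assume ne: "I \<noteq> I'"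
  show "set (concat (map (%J. map (shift I J) (full (ty I J))) [1..<Suc W])) \<inter>
      set (concat (map (%J. map (shift I' J) (full (ty I' J))) [1..<Suc W])) = {}"
  proof (rule ccontr)
    assume ne': "set (concat (map (%J. map (shift I J) (full (ty I J))) [1..<Suc W])) \<inter>
      set (concat (map (%J. map (shift I' J) (full (ty I' J))) [1..<Suc W])) \<noteq> {}"
    have U: "set (concat (map (%J. map (shift I J) (full (ty I J))) js)) = (\<Union>J\<in>set js. shift I J ` set (full (ty I J)))" for I js
      by simp
    obtain c where "c \<in> (\<Union>J\<in>set [1..<Suc W]. shift I J ` set (full (ty I J)))" "c \<in> (\<Union>J\<in>set [1..<Suc W]. shift I' J ` set (full (ty I' J)))"
      using ne' unfolding U by blast
    then obtain J J' a b where ab: "a \<in> set (full (ty I J))" "b \<in> set (full (ty I' J'))" "shift I J a = shift I' J' b"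
      by (elim UN_E imageE) metis
    obtain x y z where a: "a = (x, y, z)" by (cases a)
    obtain x' y' z' where b: "b = (x', y', z')" by (cases b)
    have "(x, y, z) \<in> set (full (ty I J))" "(x', y', z') \<in> set (full (ty I' J'))" "16 * int I + y = 16 * int I' + y'"
      using ab by (simp_all add: a b)
    then show False using ne unfolding mem_full by linarith
  qed
qed simp_all

definition tower :: "cell => cell" where
  "tower c = (fst c, fst (snd c), if (fst c + fst (snd c)) mod 2 = 0 then -1 else 1)"

lemma parity_shift: "(X - 8 * int J + (Y - 16 * int I)) mod 2 = (X + Y) mod 2"
proof -
  have "X - 8 * int J + (Y - 16 * int I) = (X + Y) + 2 * (- 4 * int J - 8 * int I)" by simp
  then show ?thesis by (simp only: mod_mult_self2)
qed

lemma abs_sum_eq_1: "\<bar>a\<bar> + \<bar>b\<bar> = 1 ==> (a = 0 & (b = 1 \<or> b = -1)) \<or> (b = 0 & (a = 1 \<or> a = -1))" for a b :: int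
  by (cases "a = 0"; cases "b = 0") auto

text \<open>The tower of a hole has no neighbour but its base. A tower beside it lies on the other
  side of the layer. A raised cell beside a tower of height 1 would stand on an even place, and
  \<open>block_ok\<close> keeps holes away from those. Thus the towers are leaves and
  \<open>pm_remove_leaves\<close> applies.\<close>

lemma pm_region: "pm adj (set (region_list ty W H)) = pm adj (rowsp ty W H)"
proof -
  let ?C = "rowsp ty W H" and ?R = "set (region_list ty W H)"
  define D where "D = {(X, Y, 0 :: int) |X Y. in_box W H X Y & (X, Y, 0) \<notin> ?C}"
  have base: "(X, Y, 0) \<in> ?C" if h: "(X, Y, 1) \<in> ?C" for X Y
    using h cells_bounds(8) unfolding mem_rowsp by blast
  have hump: "(X', Y', 0) \<in> ?C" if h: "(X, Y, 1) \<in> ?C" "(X + Y) mod 2 = 0" "\<bar>X - X'\<bar> + \<bar>Y - Y'\<bar> = 1" for X Y X' Y'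
  proof -
    from h(1) obtain I J where IJ: "I \<in> {1..H}" "J \<in> {1..W}" and *: "(X - 8 * int J, Y - 16 * int I, 1) \<in> set (cells (ty I J))"
      by (auto simp: mem_rowsp)
    have "(X - 8 * int J + (Y - 16 * int I)) mod 2 = 0" using h(2) by (simp only: parity_shift)
    note n = cells_bounds(9)[OF * refl this]
    have "(X' - 8 * int J = X - 8 * int J + 1 & Y' - 16 * int I = Y - 16 * int I) \<or>
        (X' - 8 * int J = X - 8 * int J - 1 & Y' - 16 * int I = Y - 16 * int I) \<or>
        (X' - 8 * int J = X - 8 * int J & Y' - 16 * int I = Y - 16 * int I + 1) \<or>
        (X' - 8 * int J = X - 8 * int J & Y' - 16 * int I = Y - 16 * int I - 1)"
      using abs_sum_eq_1[OF h(3)] by (elim disjE conjE) linarith+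
    then have "(X' - 8 * int J, Y' - 16 * int I, 0) \<in> set (cells (ty I J))" using n by (elim disjE conjE) (simp_all only:)
    then show ?thesis unfolding mem_rowsp using IJ by blast
  qed
  have z01: "Z = 0 \<or> Z = 1" if "(X, Y, Z) \<in> ?C" for X Y Z
    using that cells_bounds(5) unfolding mem_rowsp by blast
  have R: "?R = ?C \<union> D \<union> tower ` D"
  proof (intro set_eqI)
    fix c :: cell
    obtain X Y Z where c: "c = (X, Y, Z)" by (cases c)
    show "c \<in> ?R \<longleftrightarrow> c \<in> ?C \<union> D \<union> tower ` D"
    proof (cases "in_box W H X Y")
      case True
      obtain I J where b: "0 \<le> X - 8 * int J" "X - 8 * int J < 8" "0 \<le> Y - 16 * int I" "Y - 16 * int I < 16"
        and C: "\<And>Z. (X, Y, Z) \<in> ?C \<longleftrightarrow> (X - 8 * int J, Y - 16 * int I, Z) \<in> set (cells (ty I J))"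
        and RR: "\<And>Z. (X, Y, Z) \<in> ?R \<longleftrightarrow> (X - 8 * int J, Y - 16 * int I, Z) \<in> set (full (ty I J))"
        using locate[OF True, where ty = ty] by metis
      have "c \<in> ?R \<longleftrightarrow> Z = 0 \<or> (if (X, Y, 0) \<in> ?C then Z = 1 & (X, Y, 1) \<in> ?C else Z = (if (X + Y) mod 2 = 0 then -1 else 1))"
        unfolding c RR C mem_full parity_shift using b by simp
      moreover have "(X, Y, Z) \<in> ?C \<longleftrightarrow> (Z = 0 & (X, Y, 0) \<in> ?C) \<or> (Z = 1 & (X, Y, 1) \<in> ?C)" using z01 by blast
      moreover have "(X, Y, Z) \<in> D \<longleftrightarrow> Z = 0 & (X, Y, 0) \<notin> ?C" using True by (auto simp: D_def)
      moreover have "(X, Y, Z) \<in> tower ` D \<longleftrightarrow> Z = (if (X + Y) mod 2 = 0 then -1 else 1) & (X, Y, 0) \<notin> ?C"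
        using True by (auto simp: D_def tower_def image_iff)
      ultimately show ?thesis unfolding c using base[of X Y] by auto
    next
      case False
      then have "c \<notin> ?R" "c \<notin> ?C" "c \<notin> D" "c \<notin> tower ` D"
        unfolding c using region_in_box core_in_box by (auto simp: D_def tower_def)
      then show ?thesis by simp
    qed
  qed
  have "pm adj (?C \<union> D \<union> tower ` D) = pm adj ?C"
  proof (rule pm_remove_leaves)
    show "finite ?C" by (simp add: rowsp_def finite_rowp)
    show "finite D"
    proof (rule finite_subset)
      show "D \<subseteq> ?R" unfolding R by blast
    qed simp
    show "inj_on tower D" by (auto simp: inj_on_def D_def tower_def)
    show "?C \<inter> D = {}" by (auto simp: D_def)
    show "?C \<inter> tower ` D = {}"
    proof -
      have "tower (X, Y, 0) \<notin> ?C" if "(X, Y, 0) \<notin> ?C" for X Y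
        using base[of X Y] z01[of X Y "-1"] that by (auto simp: tower_def)
      then show ?thesis by (auto simp: D_def)
    qed
    show "D \<inter> tower ` D = {}" by (auto simp: D_def tower_def split: if_splits)
    show "adj (tower d) d" if "d \<in> D" for d using that by (auto simp: D_def tower_def)
    fix d c assume d: "d \<in> D" and c: "c \<in> ?C \<union> D \<union> tower ` D" and a: "adj (tower d) c"
    obtain X Y where d': "d = (X, Y, 0)" "(X, Y, 0) \<notin> ?C" using d by (auto simp: D_def)
    obtain X' Y' Z' where c': "c = (X', Y', Z')" by (cases c)
    define s :: int where "s = (if (X + Y) mod 2 = 0 then -1 else 1)"
    have s1: "s = 1 \<or> s = -1" by (simp add: s_def)
    have a': "\<bar>X - X'\<bar> + \<bar>Y - Y'\<bar> + \<bar>s - Z'\<bar> = 1" using a by (simp add: d' c' tower_def s_def)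
    show "c = d"
    proof (cases "Z' = 0")
      case True
      then have "X' = X" "Y' = Y" using a' s1 by auto
      then show ?thesis using True by (simp add: c' d')
    next
      case False
      then have zs: "Z' = s" "\<bar>X - X'\<bar> + \<bar>Y - Y'\<bar> = 1"
      proof -
        have "c \<in> D ==> Z' = 0" "c \<in> tower ` D ==> Z' = 1 \<or> Z' = -1"
          unfolding c' by (auto simp: D_def tower_def split: if_splits)
        then have "Z' = 1 \<or> Z' = -1" using c False z01 unfolding c' by blast
        then show "Z' = s" "\<bar>X - X'\<bar> + \<bar>Y - Y'\<bar> = 1" using s1 a' by auto
      qed
      have par: "(X' + Y') mod 2 \<noteq> (X + Y) mod 2"
      proof -
        have "X' + Y' = X + Y + 1 \<or> X' + Y' = X + Y - 1" using abs_sum_eq_1[OF zs(2)] by (elim disjE conjE) linarith+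
        moreover have "(v + 1) mod 2 \<noteq> v mod 2" "(v - 1) mod 2 \<noteq> v mod 2" for v :: int by presburger+
        ultimately show ?thesis by metis
      qed
      have "c \<notin> D" using False by (auto simp: c' D_def)
      moreover have "c \<notin> tower ` D"
      proof
        assume "c \<in> tower ` D"
        then have "Z' = (if (X' + Y') mod 2 = 0 then -1 else 1)" by (auto simp: c' D_def tower_def)
        then show False using par zs(1) unfolding s_def by presburger
      qed
      ultimately have cC: "(X', Y', Z') \<in> ?C" using c c' by auto
      then have "Z' = 1" using z01 False by blast
      then have "(X + Y) mod 2 \<noteq> 0" using zs(1) by (simp add: s_def split: if_splits)
      then have "(X' + Y') mod 2 = 0" using par by presburger
      then have "(X, Y, 0) \<in> ?C" using hump[of X' Y' X Y] cC \<open>Z' = 1\<close> zs(2) by (simp add: abs_minus_commute)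
      then show ?thesis using d' by simp
    qed
  qed (auto simp: adj_sym adj_irrefl)
  then show ?thesis by (simp only: R)
qed

lemma contractible_region_list:
  assumes "0 < W" "0 < H"
  shows "contractible_region (set (map vec_of_cell (region_list ty W H)))"
proof (rule contractible_slab[of 8 "8 * int W + 8" 16 "16 * int H + 16"])
  show "set (map vec_of_cell (region_list ty W H)) \<subseteq> {v. 8 \<le> v $ 1 & v $ 1 < 8 * int W + 8 & 16 \<le> v $ 2 & v $ 2 < 16 * int H + 16 & \<bar>v $ 3\<bar> \<le> 1}"
  proof
    fix v assume "v \<in> set (map vec_of_cell (region_list ty W H))"
    then obtain X Y Z where v: "v = vec_of_cell (X, Y, Z)" "(X, Y, Z) \<in> set (region_list ty W H)" by auto
    moreover have "\<bar>Z\<bar> \<le> 1" using v(2) unfolding mem_region_list mem_full by (auto split: if_splits)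
    ultimately show "v \<in> {v. 8 \<le> v $ 1 & v $ 1 < 8 * int W + 8 & 16 \<le> v $ 2 & v $ 2 < 16 * int H + 16 & \<bar>v $ 3\<bar> \<le> 1}"
      using region_in_box[OF v(2)] by (simp add: in_box_def)
  qed
  show "{v. 8 \<le> v $ 1 & v $ 1 < 8 * int W + 8 & 16 \<le> v $ 2 & v $ 2 < 16 * int H + 16 & v $ 3 = 0} \<subseteq> set (map vec_of_cell (region_list ty W H))"
  proof
    fix v :: "int ^ 3" assume v: "v \<in> {v. 8 \<le> v $ 1 & v $ 1 < 8 * int W + 8 & 16 \<le> v $ 2 & v $ 2 < 16 * int H + 16 & v $ 3 = 0}"
    then have "in_box W H (v $ 1) (v $ 2)" by (simp add: in_box_def)
    then have "(v $ 1, v $ 2, 0) \<in> set (region_list ty W H)" by (rule locate[where ty = ty]) (simp add: mem_full)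
    moreover have "v = vec_of_cell (v $ 1, v $ 2, 0)" using v by (simp add: vec_eq_iff forall_3)
    ultimately show "v \<in> set (map vec_of_cell (region_list ty W H))" by auto
  qed
qed (use assms in auto)

theorem domino_tilings_region:
  assumes "0 < W" "0 < H"
  shows "domino_tilings_problem (enc_cubes (map vec_of_cell (region_list ty W H))) = Some (pm adj (rowsp ty W H))"
proof -
  have "distinct (map vec_of_cell (region_list ty W H))"
    by (simp add: distinct_map distinct_region_list inj_on_subset[OF inj_vec_of_cell])
  moreover have "card (tilings domino (set (map vec_of_cell (region_list ty W H)))) = pm adj (rowsp ty W H)"
    using card_tilings_cells[of "set (region_list ty W H)"] pm_region by simp
  ultimately show ?thesis
    using contractible_region_list[OF assms] by (simp add: domino_tilings_problem_enc_cubes del: set_map)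
qed

section \<open>Programs for Turing machines\<close>

type_synonym store = "nat => tape"

text \<open>A structured language that sees all scanned symbols at once. \<open>Case\<close> turns
  the view into a parameter of the command, which thereby remembers it in the finite control after
  the heads have moved.\<close>

datatype com =
    Skip
  | Op nat "nat => nat" dir
  | Seq com com (infixr ";;" 60)
  | Case "(nat => nat) => com"
  | While "(nat => nat) => bool" com

definition view :: "store => nat => nat" where
  "view tp = (%j. scanned (tp j))"

inductive exec :: "com => store => nat => store => bool" where
  Skip: "exec Skip tp 1 tp"
| Op: "exec (Op j f d) tp 1 (tp(j := act (f (scanned (tp j)), d) (tp j)))"
| Seq: "exec a tp n \<tau> ==> exec b \<tau> k \<rho> ==> exec (a ;; b) tp (Suc (n + k)) \<rho>"
| Case: "exec (f (view tp)) tp n \<tau> ==> exec (Case f) tp (Suc n) \<tau>"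
| WhileT: "p (view tp) ==> exec c tp n \<tau> ==> exec (While p c) \<tau> k \<rho> ==> exec (While p c) tp (Suc (n + k)) \<rho>"
| WhileF: "\<not> p (view tp) ==> exec (While p c) tp 1 tp"

definition views :: "nat => nat => (nat => nat) set" where
  "views kk g = {v. (\<forall>j<kk. v j < g) & (\<forall>j\<ge>kk. v j = 0)}"

lemma finite_views: "finite (views kk g)"
proof (rule finite_subset)
  show "views kk g \<subseteq> {f. \<forall>x. (x \<in> {..<kk} --> f x \<in> {..<g}) & (x \<notin> {..<kk} --> f x = 0)}"
    by (auto simp: views_def)
qed (intro finite_set_of_finite_funs, auto)

primrec wfc :: "nat => nat => com => bool" where
  "wfc kk g Skip \<longleftrightarrow> True"
| "wfc kk g (Op j f d) \<longleftrightarrow> j < kk & (\<forall>a<g. f a < g)"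
| "wfc kk g (a ;; b) \<longleftrightarrow> wfc kk g a & wfc kk g b"
| "wfc kk g (Case f) \<longleftrightarrow> (\<forall>v. wfc kk g (f v))"
| "wfc kk g (While p c) \<longleftrightarrow> wfc kk g c"

text \<open>The states of the machine compiled from a program are the stacks of commands that remain to be
  executed; only finitely many of them are reachable.\<close>

primrec conts :: "(nat => nat) set => com => com list => com list set" where
  "conts V Skip k = {Skip # k}"
| "conts V (Op j f d) k = {Op j f d # k}"
| "conts V (a ;; b) k = insert ((a ;; b) # k) (conts V a (b # k) \<union> conts V b k)"
| "conts V (Case f) k = insert (Case f # k) (\<Union>v\<in>V. conts V (f v) k)"
| "conts V (While p c) k = insert (While p c # k) (conts V c (While p c # k))"

fun nxt :: "com list => (nat => nat) => com list \<times> (nat => nat \<times> dir)" where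
  "nxt [] v = ([], %i. (v i, Stay))"
| "nxt (Skip # k) v = (k, %i. (v i, Stay))"
| "nxt (Op j f d # k) v = (k, %i. if i = j then (f (v i), d) else (v i, Stay))"
| "nxt ((a ;; b) # k) v = (a # b # k, %i. (v i, Stay))"
| "nxt (Case f # k) v = (f v # k, %i. (v i, Stay))"
| "nxt (While p c # k) v = (if p v then c # While p c # k else k, %i. (v i, Stay))"

lemma conts_self: "c # k \<in> conts V c k"
  by (cases c) auto

lemma finite_conts: "finite V ==> finite (conts V c k)"
  by (induction c arbitrary: k) auto

lemma conts_closed: "s \<in> conts V c k ==> v \<in> V ==> fst (nxt s v) \<in> insert k (conts V c k)"
proof (induction c arbitrary: s k)
  case (Seq a b)
  then consider "s = (a ;; b) # k" | "s \<in> conts V a (b # k)" | "s \<in> conts V b k" by auto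
  then show ?case
  proof cases
    case 2
    then show ?thesis using Seq.IH(1)[OF 2 Seq.prems(2)] conts_self[of b k V] by auto
  qed (use Seq conts_self[of a "b # k" V] in auto)
next
  case (Case f)
  then consider "s = Case f # k" | w where "w \<in> V" "s \<in> conts V (f w) k" by auto
  then show ?case
  proof cases
    case 1
    then show ?thesis using Case.prems conts_self[of "f v" k V] by auto
  next
    case 2
    then show ?thesis using Case.IH[of "f w" s k] Case.prems by auto
  qed
next
  case (While p c)
  then consider "s = While p c # k" | "s \<in> conts V c (While p c # k)" by auto
  then show ?case
  proof cases
    case 2
    then show ?thesis using While.IH[OF 2 While.prems(2)] by auto
  qed (use conts_self[of c "While p c # k" V] in auto)
qed auto

lemma conts_wf: "wfc kk g c ==> list_all (wfc kk g) k ==> s \<in> conts V c k ==> list_all (wfc kk g) s"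
proof (induction c arbitrary: k s)
  case (Case f)
  then consider "s = Case f # k" | w where "w \<in> V" "s \<in> conts V (f w) k" by auto
  then show ?case
  proof cases
    case 1 then show ?thesis using Case.prems by simp
  next
    case 2
    show ?thesis by (rule Case.IH[OF rangeI _ Case.prems(2) 2(2)]) (use Case.prems in simp)
  qed
next
  case (Seq a b)
  have ab: "wfc kk g a" "wfc kk g b" "list_all (wfc kk g) (b # k)" using Seq.prems(1,2) by simp_all
  from Seq.prems(3) consider "s = (a ;; b) # k" | "s \<in> conts V a (b # k)" | "s \<in> conts V b k" by auto
  then show ?case
  proof cases
    case 1 then show ?thesis using ab Seq.prems(2) by simp
  next
    case 2 then show ?thesis by (rule Seq.IH(1)[OF ab(1,3)])
  next
    case 3 then show ?thesis by (rule Seq.IH(2)[OF ab(2) Seq.prems(2)])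
  qed
next
  case (While p c)
  have ab: "wfc kk g c" "list_all (wfc kk g) (While p c # k)" using While.prems(1,2) by simp_all
  from While.prems(3) consider "s = While p c # k" | "s \<in> conts V c (While p c # k)" by auto
  then show ?case
  proof cases
    case 1 then show ?thesis using ab by simp
  next
    case 2 then show ?thesis by (rule While.IH[OF ab])
  qed
qed auto

lemma nxt_wf:
  assumes "list_all (wfc kk g) s" "v \<in> views kk g" "i < kk"
  shows "fst (snd (nxt s v) i) < g"
proof (cases s)
  case Nil
  then show ?thesis using assms by (simp add: views_def)
next
  case (Cons c k)
  then show ?thesis using assms by (cases c) (simp_all add: views_def)
qed

text \<open>The stacks \<open>sA\<close> and \<open>sB\<close> are numbered as the state that asks a
  query and the state entered with the answer; the empty stack is the halting state.\<close>

locale compiled =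
  fixes kk g :: nat and Q :: "com list set" and s0 sA sB :: "com list" and e :: "com list => nat" and nq :: nat
  assumes kk: "2 \<le> kk" and g: "4 \<le> g"
    and inj: "inj_on e (Q \<union> {sA, sB})"
    and special: "e s0 = 0" "e [] = 1" "e sA = 2" "e sB = 3"
    and mem: "s0 \<in> Q" "[] \<in> Q" "sA \<noteq> []"
    and bound: "e ` (Q \<union> {sA, sB}) \<subseteq> {..<nq}" "4 \<le> nq"
    and closed: "\<And>s v. s \<in> Q ==> s \<noteq> sA ==> v \<in> views kk g ==> fst (nxt s v) \<in> Q \<union> {sA, sB}"
    and wfQ: "\<And>s. s \<in> Q ==> list_all (wfc kk g) s"
begin

definition M :: machine where
  "M = \<lparr>ntapes = kk, nstates = nq, nsyms = g, delta = %q ss.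
     (let v = (%j. if j < kk then ss ! j else 0) in
      if q \<in> e ` (Q - {sA}) then
        (e (fst (nxt (inv_into (Q - {sA}) e q) v)), map (snd (nxt (inv_into (Q - {sA}) e q) v)) [0..<kk])
      else (1, map (%j. (v j, Stay)) [0..<kk]))\<rparr>"

lemma view_mem: "length ss = kk ==> set ss \<subseteq> {..<g} ==> (%j. if j < kk then ss ! j else 0) \<in> views kk g"
  using nth_mem by (fastforce simp: views_def)

lemma wf_M: "wf_machine M"
proof -
  have "case delta M q ss of (q', acts) => q' < nstates M & length acts = ntapes M & fst ` set acts \<subseteq> {..<nsyms M}"
    if "q < nstates M" "length ss = ntapes M" "set ss \<subseteq> {..<nsyms M}" for q ss
  proof -
    define v where "v = (%j. if j < kk then ss ! j else 0)"
    have v: "v \<in> views kk g" unfolding v_def using that by (intro view_mem) (auto simp: M_def)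
    show ?thesis
    proof (cases "q \<in> e ` (Q - {sA})")
      case True
      define s where "s = inv_into (Q - {sA}) e q"
      have s: "s \<in> Q" "s \<noteq> sA" using inv_into_into[OF True] by (auto simp: s_def)
      have "e (fst (nxt s v)) < nq" using closed[OF s v] bound by auto
      moreover have "fst (snd (nxt s v) i) < g" if "i < kk" for i by (rule nxt_wf[OF wfQ[OF s(1)] v that])
      ultimately show ?thesis using True by (auto simp: M_def Let_def v_def[symmetric] s_def[symmetric])
    next
      case False
      moreover have "ss ! j < g" if "j < kk" for j using v that by (auto simp: views_def v_def)
      ultimately show ?thesis using bound by (auto simp: M_def Let_def)
    qed
  qed
  then show ?thesis using kk g bound by (auto simp: wf_machine_def M_def)
qed

definition tps :: "store => tape list" where "tps tp = map tp [0..<kk]"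

text \<open>A store has infinitely many tapes. Those from \<open>kk\<close> on must show blanks, so
  that the view of the store is what the machine with \<open>kk\<close> tapes sees.\<close>

definition good :: "store => bool" where
  "good tp \<longleftrightarrow> (\<forall>j<kk. \<forall>i. fst (tp j) i < g) & (\<forall>j\<ge>kk. scanned (tp j) = 0)"

lemma good_view: "good tp ==> view tp \<in> views kk g"
  by (auto simp: good_def views_def view_def scanned_def)

lemma act_stay: "act (scanned t, Stay) t = t"
  by (simp add: act_def scanned_def)

lemma step_nxt:
  assumes s: "s \<in> Q" "s \<noteq> []" "s \<noteq> sA" and good: "good tp"
  shows "step M F (e s, tps tp) (e (fst (nxt s (view tp))), tps (%i. act (snd (nxt s (view tp)) i) (tp i)))"
proof -
  have inv: "inv_into (Q - {sA}) e (e s) = s"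
    by (rule inv_into_f_f) (use inj s in \<open>auto intro: inj_on_subset\<close>)
  have "e s \<noteq> e []" "e s \<noteq> e sA" using inj_onD[OF inj, of s] s mem by auto
  then have q: "e s \<noteq> 1" "e s \<noteq> 2" using special by auto
  have v: "(%j. if j < kk then map scanned (tps tp) ! j else 0) = view tp"
    using good by (auto simp: tps_def view_def good_def)
  have d: "delta M (e s) (map scanned (tps tp)) = (e (fst (nxt s (view tp))), map (snd (nxt s (view tp))) [0..<kk])"
    using s by (simp add: M_def Let_def v inv)
  have "map2 act (map (snd (nxt s (view tp))) [0..<kk]) (tps tp) = tps (%i. act (snd (nxt s (view tp)) i) (tp i))"
    by (auto simp: tps_def intro: nth_equalityI)
  then show ?thesis using step.ordinary[OF q d, of F] by simp
qed

lemma act_good: "(\<And>i. fst t i < g) ==> fst a < g ==> fst (act a t) i < g"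
  by (simp add: act_def)

lemma relpowp_2: "(P ^^ n) x y ==> (P ^^ k) y z ==> (P ^^ (n + k)) x z"
  by (auto simp: relpowp_add)

text \<open>The costs in \<open>exec\<close> count one step for each rearrangement of the stack, so
  both times agree exactly.\<close>

lemma exec_sim:
  "exec c tp n \<tau> ==> conts (views kk g) c k \<subseteq> Q - {sA} ==> good tp ==> wfc kk g c ==>
    (step M F ^^ n) (e (c # k), tps tp) (e k, tps \<tau>) & good \<tau>"
proof (induction arbitrary: k rule: exec.induct)
  case (Skip tp)
  then show ?case using step_nxt[of "Skip # k" tp F] by (simp add: view_def act_stay eq_OO)
next
  case (Op j f d tp)
  let ?\<tau> = "tp(j := act (f (scanned (tp j)), d) (tp j))"
  have "(%i. act (snd (nxt (Op j f d # k) (view tp)) i) (tp i)) = ?\<tau>"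
    by (auto simp: view_def act_stay)
  moreover have "good ?\<tau>"
    using Op by (auto simp: good_def scanned_def intro!: act_good)
  ultimately show ?case using step_nxt[of "Op j f d # k" tp F] Op.prems by (simp add: eq_OO del: fun_upd_apply)
next
  case (Seq a tp n \<tau> b l \<rho>)
  have "(step M F ^^ 1) (e ((a ;; b) # k), tps tp) (e (a # b # k), tps tp)"
    using step_nxt[of "(a ;; b) # k" tp F] Seq.prems by (simp add: view_def act_stay eq_OO)
  moreover have 1: "(step M F ^^ n) (e (a # b # k), tps tp) (e (b # k), tps \<tau>) & good \<tau>"
    by (rule Seq.IH(1)) (use Seq.prems in auto)
  moreover have 2: "(step M F ^^ l) (e (b # k), tps \<tau>) (e k, tps \<rho>) & good \<rho>"
    by (rule Seq.IH(2)) (use Seq.prems 1 in auto)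
  ultimately have "(step M F ^^ (1 + (n + l))) (e ((a ;; b) # k), tps tp) (e k, tps \<rho>)"
    by (blast intro: relpowp_2)
  then show ?case using 2 by simp
next
  case (Case f tp n \<tau>)
  have "(step M F ^^ 1) (e (Case f # k), tps tp) (e (f (view tp) # k), tps tp)"
    using step_nxt[of "Case f # k" tp F] Case.prems by (simp add: view_def act_stay eq_OO)
  moreover have 1: "(step M F ^^ n) (e (f (view tp) # k), tps tp) (e k, tps \<tau>) & good \<tau>"
    by (rule Case.IH) (use Case.prems good_view[OF Case.prems(2)] in auto)
  ultimately have "(step M F ^^ (1 + n)) (e (Case f # k), tps tp) (e k, tps \<tau>)"
    by (blast intro: relpowp_2)
  then show ?case using 1 by simp
next
  case (WhileT p tp c n \<tau> l \<rho>)
  have "(step M F ^^ 1) (e (While p c # k), tps tp) (e (c # While p c # k), tps tp)"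
    using step_nxt[of "While p c # k" tp F] WhileT by (simp add: view_def act_stay eq_OO)
  moreover have 1: "(step M F ^^ n) (e (c # While p c # k), tps tp) (e (While p c # k), tps \<tau>) & good \<tau>"
    by (rule WhileT.IH(1)) (use WhileT.prems in auto)
  moreover have 2: "(step M F ^^ l) (e (While p c # k), tps \<tau>) (e k, tps \<rho>) & good \<rho>"
    by (rule WhileT.IH(2)) (use WhileT.prems 1 in auto)
  ultimately have "(step M F ^^ (1 + (n + l))) (e (While p c # k), tps tp) (e k, tps \<rho>)"
    by (blast intro: relpowp_2)
  then show ?case using 2 by simp
next
  case (WhileF p tp c)
  then show ?case using step_nxt[of "While p c # k" tp F] by (simp add: view_def act_stay eq_OO)
qed

definition init :: "nat list => store" where
  "init ss = (%j. if j = 0 then tape_of ss else tape_of [])"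

lemma tps_init: "initial M ss = (e s0, tps (init ss))"
proof -
  have "map (init ss) [0..<kk] = tape_of ss # replicate (kk - 1) (tape_of [])"
    using kk by (intro nth_equalityI) (auto simp: init_def nth_Cons split: nat.splits)
  then show ?thesis by (simp add: initial_def M_def tps_def special)
qed

lemma good_init: "set ss \<subseteq> {..<g} ==> good (init ss)"
proof -
  assume a: "set ss \<subseteq> {..<g}"
  have "ss ! i < g" if "i < length ss" for i using a nth_mem[OF that] by auto
  then show ?thesis using g kk by (auto simp: good_def init_def tape_of_def scanned_def)
qed

end

lemma state_numbering:
  fixes Q :: "com list set"
  assumes fin: "finite Q" and d: "distinct [s0, [], sA, sB]"
  obtains e :: "com list => nat" and nq where "inj_on e (Q \<union> {sA, sB})" "e s0 = 0" "e [] = 1" "e sA = 2" "e sB = 3"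
    "e ` (Q \<union> {sA, sB}) \<subseteq> {..<nq}" "4 \<le> (nq :: nat)"
proof -
  let ?Q = "Q \<union> {sA, sB}"
  obtain f :: "com list => nat" where f: "inj_on f ?Q"
    using finite_imp_inj_to_nat_seg[of ?Q] fin by auto
  define e where "e s = (if s = s0 then 0 else if s = [] then 1 else if s = sA then 2 else if s = sB then 3 else 4 + f s)" for s
  have "inj_on e ?Q"
  proof (rule inj_onI)
    fix x y assume xy: "x \<in> ?Q" "y \<in> ?Q" "e x = e y"
    show "x = y" using xy(3) inj_onD[OF f _ xy(1,2)] unfolding e_def by (auto split: if_splits)
  qed
  moreover have "finite (e ` ?Q)" using fin by simp
  then obtain b where "\<forall>x\<in>e ` ?Q. x < b" by (auto simp: finite_nat_set_iff_bounded)
  then have "e ` ?Q \<subseteq> {..<4 + b}" by auto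
  moreover have "e s0 = 0" "e [] = 1" "e sA = 2" "e sB = 3" using d by (auto simp: e_def)
  ultimately show ?thesis using that by (metis le_add1)
qed

definition start :: "nat list => store" where
  "start ss = (%j. if j = 0 then tape_of ss else tape_of [])"

theorem machine_of_program:
  assumes "2 \<le> kk" "4 \<le> g" "wfc kk g c"
  obtains M where "wf_machine M"
    "\<And>F ss n \<tau> w t. set ss \<subseteq> {..<4} ==> exec c (start ss) n \<tau> ==> n \<le> t ==> holds_word (\<tau> 0) w ==> outputs_within M F ss t w"
proof -
  let ?V = "views kk g"
  define Q where "Q = insert [] (conts ?V c [])"
  have fin: "finite Q" by (simp add: Q_def finite_conts finite_views)
  obtain n where n: "\<And>s. s \<in> Q ==> length s < n" using finite_imageI[OF fin, of length]
    by (metis finite_nat_set_iff_bounded imageI)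
  \<comment> \<open>Without an oracle the states 2 and 3 must be unreachable: two stacks that are
    too long to occur in \<open>Q\<close>.\<close>
  define sA where "sA = replicate (Suc n) Skip"
  define sB where "sB = replicate (Suc (Suc n)) Skip"
  have AB: "sA \<notin> Q" "sB \<notin> Q" using n[of sA] n[of sB] by (auto simp: sA_def sB_def)
  have c: "[c] \<in> Q" using conts_self by (auto simp: Q_def)
  have "length sA \<noteq> length sB" by (simp add: sA_def sB_def)
  then have "sA \<noteq> sB" by auto
  then have d: "distinct [[c], [], sA, sB]" using AB c by (auto simp: sA_def sB_def Q_def)
  obtain e :: "com list => nat" and nq where e: "inj_on e (Q \<union> {sA, sB})" "e [c] = 0" "e [] = 1" "e sA = 2" "e sB = 3"
    "e ` (Q \<union> {sA, sB}) \<subseteq> {..<nq}" "4 \<le> nq" by (rule state_numbering[OF fin d])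
  interpret compiled kk g Q "[c]" sA sB e nq
  proof
    show "fst (nxt s v) \<in> Q \<union> {sA, sB}" if "s \<in> Q" "v \<in> views kk g" for s v
      using conts_closed[of s ?V c "[]" v] that by (auto simp: Q_def)
    show "list_all (wfc kk g) s" if "s \<in> Q" for s using conts_wf[OF assms(3), of "[]" s ?V] that by (auto simp: Q_def)
  qed (use assms e c in \<open>auto simp: Q_def sA_def\<close>)
  show ?thesis
  proof (rule that[OF wf_M])
    fix F ss n \<tau> w t assume h: "set ss \<subseteq> {..<4}" "exec c (start ss) n \<tau>" "n \<le> t" "holds_word (\<tau> 0) w"
    have gi: "good (init ss)" using h(1) assms(2) by (intro good_init) auto
    have "(step M F ^^ n) (e [c], tps (init ss)) (e [], tps \<tau>) & good \<tau>"
      by (rule exec_sim) (use h(2) gi assms(3) AB in \<open>auto simp: Q_def start_def init_def\<close>)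
    moreover have "tps \<tau> ! 0 = \<tau> 0" using assms(1) by (simp add: tps_def)
    ultimately show "outputs_within M F ss t w" using h e(3) unfolding outputs_within_def tps_init
      by (metis special(2))
  qed
qed

theorem machine_of_oracle_program:
  assumes "2 \<le> kk" "4 \<le> g" "wfc kk g c1" "wfc kk g c2"
  obtains M where "wf_machine M"
    "\<And>F ss n1 \<tau>1 q N n2 \<tau>2 w t. set ss \<subseteq> {..<4} ==> exec c1 (start ss) n1 \<tau>1 ==> holds_word (\<tau>1 1) q ==> F q = Some N ==>
      exec c2 (\<tau>1(1 := tape_of (map bit_sym (bits_of_nat N)))) n2 \<tau>2 ==> n1 + n2 + 1 \<le> t ==> holds_word (\<tau>2 0) w ==>
      outputs_within M F ss t w"
proof -
  let ?V = "views kk g"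
  have "finite (conts ?V c2 [])" by (simp add: finite_conts finite_views)
  then obtain n where n: "\<And>s. s \<in> conts ?V c2 [] ==> length s < n" using finite_imageI[of _ length]
    by (metis finite_nat_set_iff_bounded imageI)
  \<comment> \<open>The stack that lies below \<open>c1\<close>. When it surfaces, \<open>c1\<close>
    is finished and the query is asked. It is longer than all stacks of \<open>c2\<close> and, by
    \<open>len1\<close>, shorter than those of \<open>c1\<close>, so it occurs nowhere else.\<close>
  define sA where "sA = replicate (Suc (Suc n)) Skip"
  have sA2: "sA \<notin> conts ?V c2 []" using n[of sA] by (auto simp: sA_def)
  define Q where "Q = insert [] (conts ?V c1 sA \<union> {sA} \<union> conts ?V c2 [])"
  have len1: "length k < length s" if "s \<in> conts ?V c k" for s c k
    using that
  proof (induction c arbitrary: k s)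
    case (Seq a b)
    then consider "s = (a ;; b) # k" | "s \<in> conts ?V a (b # k)" | "s \<in> conts ?V b k" by auto
    then show ?case using Seq.IH(1)[of s "b # k"] Seq.IH(2)[of s k] by cases (simp, force, simp)
  next
    case (While p c)
    then consider "s = While p c # k" | "s \<in> conts ?V c (While p c # k)" by auto
    then show ?case using While.IH[of s "While p c # k"] by cases auto
  next
    case (Case f)
    then consider "s = Case f # k" | w where "s \<in> conts ?V (f w) k" by auto
    then show ?case using Case.IH[OF rangeI] by cases auto
  qed auto
  have sA1: "sA \<notin> conts ?V c1 sA" using len1 by blast
  have fin: "finite Q" by (simp add: Q_def finite_conts finite_views)
  have c: "c1 # sA \<in> Q" "[c2] \<in> Q" using conts_self by (auto simp: Q_def)
  have d: "distinct [c1 # sA, [], sA, [c2]]" by (auto simp: sA_def)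
  obtain e :: "com list => nat" and nq where e: "inj_on e (Q \<union> {sA, [c2]})" "e (c1 # sA) = 0" "e [] = 1" "e sA = 2" "e [c2] = 3"
    "e ` (Q \<union> {sA, [c2]}) \<subseteq> {..<nq}" "4 \<le> nq" by (rule state_numbering[OF fin d])
  interpret compiled kk g Q "c1 # sA" sA "[c2]" e nq
  proof
    show "fst (nxt s v) \<in> Q \<union> {sA, [c2]}" if "s \<in> Q" "s \<noteq> sA" "v \<in> views kk g" for s v
      using conts_closed[of s ?V c1 sA v] conts_closed[of s ?V c2 "[]" v] that by (auto simp: Q_def)
    show "list_all (wfc kk g) s" if "s \<in> Q" for s
      using conts_wf[OF assms(3), of sA s ?V] conts_wf[OF assms(4), of "[]" s ?V] that by (auto simp: Q_def sA_def list_all_iff)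
  qed (use assms e c in \<open>auto simp: Q_def sA_def\<close>)
  show ?thesis
  proof (rule that[OF wf_M])
    fix F ss n1 \<tau>1 q N n2 \<tau>2 w t
    assume h: "set ss \<subseteq> {..<4}" "exec c1 (start ss) n1 \<tau>1" "holds_word (\<tau>1 1) q" "F q = Some N"
      "exec c2 (\<tau>1(1 := tape_of (map bit_sym (bits_of_nat N)))) n2 \<tau>2" "n1 + n2 + 1 \<le> t" "holds_word (\<tau>2 0) w"
    let ?A = "tape_of (map bit_sym (bits_of_nat N))"
    have gi: "good (init ss)" using h(1) assms(2) by (intro good_init) auto
    have 1: "(step M F ^^ n1) (e (c1 # sA), tps (init ss)) (e sA, tps \<tau>1) & good \<tau>1"
      by (rule exec_sim) (use h(2) gi assms(3) sA1 in \<open>auto simp: Q_def start_def init_def\<close>)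
    have t1: "tps \<tau>1 ! 1 = \<tau>1 1" "(tps \<tau>1)[1 := ?A] = tps (\<tau>1(1 := ?A))"
      using assms(1) by (auto simp: tps_def intro!: nth_equalityI simp: nth_list_update)
    have 2: "(step M F ^^ 1) (e sA, tps \<tau>1) (e [c2], tps (\<tau>1(1 := ?A)))"
      using step.query[of "tps \<tau>1" q F N M] h(3,4) t1 e(4,5) by (simp add: eq_OO)
    have "bit_sym b < g" for b using assms(2) by (cases b) auto
    then have "fst ?A i < g" for i using assms(2) by (auto simp: tape_of_def)
    then have g2: "good (\<tau>1(1 := ?A))" using 1 assms(1) by (auto simp: good_def)
    have 3: "(step M F ^^ n2) (e [c2], tps (\<tau>1(1 := ?A))) (e [], tps \<tau>2) & good \<tau>2"
      by (rule exec_sim) (use h(5) g2 assms(4) sA2 in \<open>auto simp: Q_def\<close>)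
    have "(step M F ^^ (n1 + (1 + n2))) (e (c1 # sA), tps (init ss)) (e [], tps \<tau>2)"
      using relpowp_2[OF conjunct1[OF 1] relpowp_2[OF 2 conjunct1[OF 3]]] .
    moreover have "tps \<tau>2 ! 0 = \<tau>2 0" using assms(1) by (simp add: tps_def)
    ultimately show "outputs_within M F ss t w" using h(6,7) e(3) unfolding outputs_within_def tps_init
      by (intro exI[of _ "n1 + (1 + n2)"]) auto
  qed
qed

section \<open>Programs in polynomial time\<close>

definition runs :: "com => store => nat => store => bool" where
  "runs c tp n \<tau> \<longleftrightarrow> (\<exists>k\<le>n. exec c tp k \<tau>)"

lemma runs_mono: "runs c tp n \<tau> ==> n \<le> n' ==> runs c tp n' \<tau>"
  by (auto simp: runs_def intro: order_trans)

lemma runs_Skip: "runs Skip tp 1 tp"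
  unfolding runs_def by (intro exI[of _ 1]) (simp add: exec.Skip[simplified])

lemma runs_Op: "runs (Op j f d) tp 1 (tp(j := act (f (scanned (tp j)), d) (tp j)))"
  unfolding runs_def by (intro exI[of _ 1]) (simp add: exec.Op[simplified])

lemma runs_Seq: "runs a tp n \<tau> ==> runs b \<tau> k \<rho> ==> runs (a ;; b) tp (Suc (n + k)) \<rho>"
  unfolding runs_def by (metis Suc_le_mono add_mono exec.Seq)

lemma runs_Case: "runs (f (view tp)) tp n \<tau> ==> runs (Case f) tp (Suc n) \<tau>"
  unfolding runs_def by (metis Suc_le_mono exec.Case)

lemma runs_While:
  assumes "\<And>i. i < k ==> p (view (s i))" "\<And>i. i < k ==> runs c (s i) n (s (Suc i))" "\<not> p (view (s k))"
  shows "runs (While p c) (s 0) (Suc (k * Suc n)) (s k)"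
  using assms
proof (induction k arbitrary: s)
  case 0
  then show ?case using exec.WhileF[of p "s 0" c] by (auto simp: runs_def)
next
  case (Suc k)
  have "runs (While p c) (s (Suc 0)) (Suc (k * Suc n)) (s (Suc k))"
    by (rule Suc.IH[of "%i. s (Suc i)"]) (use Suc.prems in auto)
  then obtain l where l: "l \<le> Suc (k * Suc n)" "exec (While p c) (s (Suc 0)) l (s (Suc k))" by (auto simp: runs_def)
  obtain h where h: "h \<le> n" "exec c (s 0) h (s (Suc 0))" using Suc.prems(2)[of 0] by (auto simp: runs_def)
  have "exec (While p c) (s 0) (Suc (h + l)) (s (Suc k))" using Suc.prems(1)[of 0] h l by (intro exec.WhileT) auto
  moreover have "Suc (h + l) \<le> Suc (Suc k * Suc n)" using h l by simp
  ultimately show ?case unfolding runs_def by blast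
qed

definition pbound :: "'i set => ('i => nat) => ('i => nat) => bool" where
  "pbound D sz f \<longleftrightarrow> (\<exists>p :: nat poly. \<forall>i\<in>D. f i \<le> poly p (sz i))"

text \<open>A program with one polynomial time bound for a whole family of initial and final stores.
  Families may also be indexed by pairs of an input and a loop counter, which is how loop bodies are
  treated.\<close>

definition PR :: "'i set => ('i => nat) => com => ('i => store) => ('i => store) => bool" where
  "PR D sz c s t \<longleftrightarrow> (\<exists>p :: nat poly. \<forall>i\<in>D. runs c (s i) (poly p (sz i)) (t i))"

lemma PR_intro: "pbound D sz n ==> (\<And>i. i \<in> D ==> runs c (s i) (n i) (t i)) ==> PR D sz c s t"
  unfolding PR_def pbound_def using runs_mono by metis

lemma PR_elim:
  assumes "PR D sz c s t"
  obtains n where "pbound D sz n" "\<And>i. i \<in> D ==> runs c (s i) (n i) (t i)"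
proof -
  obtain p :: "nat poly" where "\<forall>i\<in>D. runs c (s i) (poly p (sz i)) (t i)" using assms by (auto simp: PR_def)
  then show ?thesis by (intro that[of "%i. poly p (sz i)"]) (auto simp: pbound_def)
qed

lemma pbound_const: "pbound D sz (%i. c)"
  unfolding pbound_def by (intro exI[of _ "[:c:]"]) simp

lemma pbound_sz: "pbound D sz sz"
  unfolding pbound_def by (intro exI[of _ "[:0, 1:]"]) simp

lemma pbound_add: "pbound D sz f ==> pbound D sz h ==> pbound D sz (%i. f i + h i)"
  unfolding pbound_def by (elim exE, rule_tac x = "p + pa" in exI) (simp add: add_mono)

lemma pbound_mult: "pbound D sz f ==> pbound D sz h ==> pbound D sz (%i. f i * h i)"
  unfolding pbound_def by (elim exE, rule_tac x = "p * pa" in exI) (simp add: mult_mono)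

lemma pbound_Suc: "pbound D sz f ==> pbound D sz (%i. Suc (f i))"
  using pbound_add[OF pbound_const[of _ _ 1]] by fastforce

lemma pbound_power: "pbound D sz f ==> pbound D sz (%i. f i ^ c)"
  by (induction c) (simp_all add: pbound_const pbound_mult)

lemma pbound_mono: "pbound D sz h ==> (\<And>i. i \<in> D ==> f i \<le> h i) ==> pbound D sz f"
  unfolding pbound_def by (meson order_trans)

lemmas pbound_intros = pbound_const pbound_sz pbound_Suc pbound_add pbound_mult pbound_power

lemma pbound_map: "pbound D sz f ==> (\<And>i. i \<in> D' ==> h i \<in> D) ==> (\<And>i. i \<in> D' ==> sz' i = sz (h i)) ==> pbound D' sz' (%i. f (h i))"
  unfolding pbound_def by metis

lemma poly_mono_nat: "x \<le> y ==> poly p x \<le> poly p (y :: nat)" for p :: "nat poly"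
proof (induction p)
  case (pCons a p)
  then show ?case by (simp add: mult_mono)
qed simp

lemma PR_Skip: "PR D sz Skip s s"
  by (rule PR_intro[OF pbound_const[of _ _ 1]]) (rule runs_Skip)

lemma PR_Op: "(\<And>i. i \<in> D ==> (s i)(j := act (f (scanned (s i j)), d) (s i j)) = t i) ==> PR D sz (Op j f d) s t"
  by (rule PR_intro[OF pbound_const[of _ _ 1]]) (metis runs_Op)

lemma PR_Seq: "PR D sz a s t ==> PR D sz b t u ==> PR D sz (a ;; b) s u"
proof -
  assume "PR D sz a s t" "PR D sz b t u"
  then obtain n k where "pbound D sz n" "\<And>i. i \<in> D ==> runs a (s i) (n i) (t i)"
    "pbound D sz k" "\<And>i. i \<in> D ==> runs b (t i) (k i) (u i)" by (elim PR_elim) blast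
  then show ?thesis by (intro PR_intro[of D sz "%i. Suc (n i + k i)"] pbound_intros runs_Seq) auto
qed

lemma PR_cong: "PR D sz c s t ==> (\<And>i. i \<in> D ==> s i = s' i) ==> (\<And>i. i \<in> D ==> t i = t' i) ==> PR D sz c s' t'"
  unfolding PR_def by metis

lemma PR_map: "PR D sz c s t ==> (\<And>i. i \<in> D' ==> h i \<in> D & sz' i = sz (h i) & s' i = s (h i) & t' i = t (h i)) ==> PR D' sz' c s' t'"
  unfolding PR_def by metis

text \<open>The body is required over all pairs of an input and a pass, with the size of the input
  alone; so a single polynomial bounds every pass, and the product with the number of passes is
  again polynomial.\<close>

lemma PR_While:
  assumes n: "pbound D sz n"
    and p: "\<And>i k. i \<in> D ==> k < n i ==> p (view (s i k))" "\<And>i. i \<in> D ==> \<not> p (view (s i (n i)))"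
    and c: "PR {(i, k). i \<in> D & k < n i} (%(i, k). sz i) c (%(i, k). s i k) (%(i, k). s i (Suc k))"
  shows "PR D sz (While p c) (%i. s i 0) (%i. s i (n i))"
proof -
  obtain q :: "nat poly" where q: "\<And>i k. i \<in> D ==> k < n i ==> runs c (s i k) (poly q (sz i)) (s i (Suc k))"
    using c by (auto simp: PR_def)
  show ?thesis
  proof (rule PR_intro)
    show "pbound D sz (%i. Suc (n i * Suc (poly q (sz i))))"
      by (intro pbound_intros n) (auto simp: pbound_def)
    fix i assume "i \<in> D"
    then show "runs (While p c) (s i 0) (Suc (n i * Suc (poly q (sz i)))) (s i (n i))"
      using p q by (intro runs_While) auto
  qed
qed

primrec seqs :: "(nat => com) => nat => com" where
  "seqs c 0 = Skip"
| "seqs c (Suc k) = seqs c k ;; c k"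

lemma wfc_seqs: "(\<And>i. i < n ==> wfc kk g (c i)) ==> wfc kk g (seqs c n)"
  by (induction n) auto

lemma PR_seqs: "(\<And>k. k < n ==> PR D sz (c k) (%i. s i k) (%i. s i (Suc k))) ==> PR D sz (seqs c n) (%i. s i 0) (%i. s i n)"
proof (induction n)
  case 0
  then show ?case by (simp add: PR_Skip)
next
  case (Suc n)
  then show ?case by (auto intro: PR_Seq)
qed

definition arr :: "nat list => int => tape" where
  "arr w i = (%z. if 0 \<le> z & z < int (length w) then w ! nat z else 0, i)"

lemma tape_of_arr: "tape_of w = arr w 0"
  by (simp add: tape_of_def arr_def)

lemma scanned_arr: "i < length w ==> scanned (arr w (int i)) = w ! i"
  by (simp add: arr_def scanned_def)

lemma scanned_arr_end [simp]: "scanned (arr w (int (length w))) = 0"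
  by (simp add: arr_def scanned_def)

lemma scanned_arr_left [simp]: "scanned (arr w (- 1)) = 0"
  by (simp add: arr_def scanned_def)

lemma act_id [simp]: "act (scanned t, d) t = (fst t, case d of Leftwards => snd t - 1 | Stay => snd t | Rightwards => snd t + 1)"
  by (simp add: act_def scanned_def)

lemma arr_move: "(fst (arr w i), k) = arr w k" "snd (arr w i) = i"
  by (simp_all add: arr_def)

lemma arr_write:
  assumes "i < length w"
  shows "act (a, Rightwards) (arr w (int i)) = arr (w[i := a]) (int (Suc i))"
    "act (a, Leftwards) (arr w (int i)) = arr (w[i := a]) (int i - 1)"
    "act (a, Stay) (arr w (int i)) = arr (w[i := a]) (int i)"
  using assms by (auto simp: act_def arr_def fun_eq_iff nth_list_update)

lemma arr_append:
  "act (a, Rightwards) (arr w (int (length w))) = arr (w @ [a]) (int (length (w @ [a])))"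
  "act (a, Stay) (arr w (int (length w))) = arr (w @ [a]) (int (length w))"
  by (auto simp: act_def arr_def fun_eq_iff nth_append)

lemma arr_erase_last: "act (0, Leftwards) (arr (w @ [a]) (int (length w))) = arr w (int (length w) - 1)"
  by (auto simp: act_def arr_def fun_eq_iff nth_append)

section \<open>Loops over the symbols of a tape\<close>

definition mv :: "nat => dir => com" where "mv j d = Op j (%a. a) d"
definition wr :: "nat => nat => dir => com" where "wr j a d = Op j (%_. a) d"
definition rewind :: "nat => com" where
  "rewind j = mv j Leftwards ;; While (%v. v j \<noteq> 0) (mv j Leftwards) ;; mv j Rightwards"
definition For :: "nat => com => com" where
  "For j c = While (%v. v j \<noteq> 0) (c ;; mv j Rightwards) ;; rewind j"

lemma wfc_basic [simp]:
  "wfc kk g (mv j d) \<longleftrightarrow> j < kk" "wfc kk g (wr j a d) \<longleftrightarrow> j < kk & (g = 0 \<or> a < g)"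
  "wfc kk g (rewind j) \<longleftrightarrow> j < kk" "wfc kk g (For j c) \<longleftrightarrow> wfc kk g c & j < kk"
  by (auto simp: mv_def wr_def rewind_def For_def)

lemma PR_mv: "(\<And>i. i \<in> D ==> (s i)(j := (fst (s i j), case d of Leftwards => snd (s i j) - 1 | Stay => snd (s i j) | Rightwards => snd (s i j) + 1)) = t i)
    ==> PR D sz (mv j d) s t"
  unfolding mv_def by (rule PR_Op) simp

lemma PR_wr: "(\<And>i. i \<in> D ==> (s i)(j := act (a, d) (s i j)) = t i) ==> PR D sz (wr j a d) s t"
  unfolding wr_def by (rule PR_Op) simp

text \<open>Words contain no blank, so the blank at position -1 is where the head stops.\<close>

lemma PR_rewind:
  assumes len: "pbound D sz (%i. length (w i))"
    and s: "\<And>i. i \<in> D ==> s i j = arr (w i) (int (q i)) & q i \<le> length (w i) & 0 \<notin> set (w i)"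
  shows "PR D sz (rewind j) s (%i. (s i)(j := arr (w i) 0))"
  unfolding rewind_def
proof (intro PR_Seq)
  let ?t = "%i k. (s i)(j := arr (w i) (int (q i) - 1 - int k))"
  show "PR D sz (mv j Leftwards) s (%i. ?t i 0)"
    by (rule PR_mv) (use s in \<open>auto simp: arr_move\<close>)
  show "PR D sz (While (%v. v j \<noteq> 0) (mv j Leftwards)) (%i. ?t i 0) (%i. ?t i (q i))"
  proof (rule PR_While)
    show "pbound D sz q" by (rule pbound_mono[OF len]) (use s in auto)
    fix i k assume i: "i \<in> D" and k: "k < q i"
    then have "int (q i) - 1 - int k = int (q i - 1 - k)" by simp
    moreover have "q i - 1 - k < length (w i)" using s[OF i] k by linarith
    ultimately have "scanned (arr (w i) (int (q i) - 1 - int k)) = w i ! (q i - 1 - k)" by (simp only: scanned_arr)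
    moreover have "w i ! (q i - 1 - k) \<noteq> 0" using s[OF i] nth_mem[OF \<open>q i - 1 - k < length (w i)\<close>] by metis
    ultimately show "view (?t i k) j \<noteq> 0" by (simp add: view_def)
  next
    show "PR {(i, k). i \<in> D & k < q i} (%(i, k). sz i) (mv j Leftwards) (%(i, k). ?t i k) (%(i, k). ?t i (Suc k))"
      by (rule PR_mv) (auto simp: arr_move algebra_simps)
  qed (simp add: view_def)
  show "PR D sz (mv j Rightwards) (%i. ?t i (q i)) (%i. (s i)(j := arr (w i) 0))"
    by (rule PR_mv) (auto simp: arr_move)
qed

text \<open>The word on tape \<open>j\<close> is the loop counter, one pass for each symbol; the
  body finds the head on the current symbol and must leave it there.\<close>

lemma PR_For:
  assumes len: "pbound D sz (%i. length (w i))"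
    and w: "\<And>i. i \<in> D ==> 0 \<notin> set (w i)"
    and start: "\<And>i. i \<in> D ==> s i 0 j = arr (w i) 0"
    and c: "PR {(i, k). i \<in> D & k < length (w i)} (%(i, k). sz i) c
      (%(i, k). (s i k)(j := arr (w i) (int k))) (%(i, k). (s i (Suc k))(j := arr (w i) (int k)))"
  shows "PR D sz (For j c) (%i. s i 0) (%i. (s i (length (w i)))(j := arr (w i) 0))"
proof -
  let ?t = "%i k. (s i k)(j := arr (w i) (int k))"
  have "PR D sz (While (%v. v j \<noteq> 0) (c ;; mv j Rightwards)) (%i. ?t i 0) (%i. ?t i (length (w i)))"
  proof (rule PR_While[OF len])
    fix i k assume i: "i \<in> D" and k: "k < length (w i)"
    have "w i ! k \<noteq> 0" using w[OF i] nth_mem[OF k] by metis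
    then show "view (?t i k) j \<noteq> 0" using k by (simp add: view_def scanned_arr)
  next
    show "PR {(i, k). i \<in> D & k < length (w i)} (%(i, k). sz i) (c ;; mv j Rightwards) (%(i, k). ?t i k) (%(i, k). ?t i (Suc k))"
      by (rule PR_Seq[OF c], rule PR_mv) (auto simp: arr_move algebra_simps)
  qed (simp add: view_def)
  moreover have "PR D sz (rewind j) (%i. ?t i (length (w i))) (%i. (?t i (length (w i)))(j := arr (w i) 0))"
    by (rule PR_rewind[OF len, where q = "%i. length (w i)"]) (use w in auto)
  ultimately have "PR D sz (For j c) (%i. ?t i 0) (%i. (?t i (length (w i)))(j := arr (w i) 0))"
    unfolding For_def by (rule PR_Seq)
  then show ?thesis by (rule PR_cong) (auto simp: start[symmetric])
qed

section \<open>Writing down the region\<close>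

definition outt :: "nat list => tape" where "outt w = arr w (int (length w))"

lemma act_outt [simp]: "act (a, Rightwards) (outt w) = outt (w @ [a])"
  by (simp only: outt_def arr_append)

lemma bit_sym_simps [simp]: "bit_sym b = 0 \<longleftrightarrow> False" "0 = bit_sym b \<longleftrightarrow> False"
  by (cases b; simp)+

lemma bit_sym_image [simp]: "0 \<notin> bit_sym ` A"
  by auto

lemma bit_sym_less: "3 \<le> g ==> bit_sym b < g"
  by (cases b) auto

lemma bit_sym_copy: "(if bit_sym b = 1 then 1 else 2) = bit_sym b"
  by (cases b) auto

lemma PR_app:
  assumes "\<And>i. i \<in> D ==> s i j = outt (u i)"
  shows "PR D sz (wr j a Rightwards) s (%i. (s i)(j := outt (u i @ [a])))"
  by (rule PR_wr) (use assms in auto)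

definition putw :: "nat => nat list => com" where
  "putw j w = seqs (%k. wr j (w ! k) Rightwards) (length w)"

lemma wfc_putw [simp]: "j < kk ==> (\<And>a. a \<in> set w ==> a < g) ==> wfc kk g (putw j w)"
  unfolding putw_def by (intro wfc_seqs) auto

lemma PR_putw:
  assumes "\<And>i. i \<in> D ==> s i j = outt (u i)"
  shows "PR D sz (putw j w) s (%i. (s i)(j := outt (u i @ w)))"
proof -
  let ?s = "%i k. (s i)(j := outt (u i @ take k w))"
  have "PR D sz (putw j w) (%i. ?s i 0) (%i. ?s i (length w))"
    unfolding putw_def
  proof (rule PR_seqs)
    fix k assume k: "k < length w"
    have "PR D sz (wr j (w ! k) Rightwards) (%i. ?s i k) (%i. (?s i k)(j := outt ((u i @ take k w) @ [w ! k])))"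
      by (rule PR_app) simp
    then show "PR D sz (wr j (w ! k) Rightwards) (%i. ?s i k) (%i. ?s i (Suc k))"
      using k by (simp add: take_Suc_conv_app_nth)
  qed
  then show ?thesis by (rule PR_cong) (auto simp: assms[symmetric])
qed

lemma PR_copy:
  assumes "\<And>i. i \<in> D ==> s i j = outt (u i)"
  shows "PR D sz (Case (%v. wr j (f v) Rightwards)) s (%i. (s i)(j := outt (u i @ [f (view (s i))])))"
proof (rule PR_intro[OF pbound_const[of _ _ 2]])
  fix i assume i: "i \<in> D"
  have "runs (wr j (f (view (s i))) Rightwards) (s i) 1 ((s i)(j := outt (u i @ [f (view (s i))])))"
    using runs_Op[of j "%_. f (view (s i))" Rightwards "s i"] assms[OF i] by (simp add: wr_def)
  then have "runs (Case (%v. wr j (f v) Rightwards)) (s i) (Suc 1) ((s i)(j := outt (u i @ [f (view (s i))])))"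
    by (intro runs_Case)
  then show "runs (Case (%v. wr j (f v) Rightwards)) (s i) 2 ((s i)(j := outt (u i @ [f (view (s i))])))"
    by (simp add: numeral_2_eq_2)
qed

lemma PR_For_emit:
  assumes len: "pbound D sz (%i. length (w i))" and ne: "j \<noteq> jj"
    and s: "\<And>i. i \<in> D ==> s i jj = arr (w i) 0 & 0 \<notin> set (w i) & s i j = outt (u i)"
    and c: "PR {(i, k). i \<in> D & k < length (w i)} (%(i, k). sz i) c
      (%(i, k). (s i)(jj := arr (w i) (int k), j := outt (u i @ concat (map (f i) [0..<k]))))
      (%(i, k). (s i)(jj := arr (w i) (int k), j := outt (u i @ concat (map (f i) [0..<k]) @ f i k)))"
  shows "PR D sz (For jj c) s (%i. (s i)(j := outt (u i @ concat (map (f i) [0..<length (w i)]))))"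
proof -
  let ?s = "%i k. (s i)(j := outt (u i @ concat (map (f i) [0..<k])))"
  have "PR D sz (For jj c) (%i. ?s i 0) (%i. (?s i (length (w i)))(jj := arr (w i) 0))"
  proof (rule PR_For[OF len])
    show "PR {(i, k). i \<in> D & k < length (w i)} (%(i, k). sz i) c
      (%(i, k). (?s i k)(jj := arr (w i) (int k))) (%(i, k). (?s i (Suc k))(jj := arr (w i) (int k)))"
      by (rule PR_cong[OF c]) (auto simp: fun_upd_twist[OF ne])
  qed (use s ne in auto)
  then show ?thesis by (rule PR_cong) (use s ne in \<open>auto simp: fun_eq_iff\<close>)
qed

definition dbl :: "bool list => bool list" where "dbl u = concat (map (%b. [True, b]) u)"

text \<open>Writes the self-delimiting code of a nonnegative number whose low bits are the constant
  \<open>low\<close> and whose high bits stand on tape \<open>jj\<close>; the first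
  \<open>False\<close> is the sign.\<close>

definition putnum :: "nat => bool list => com" where
  "putnum jj low = putw 1 (map bit_sym (False # dbl low)) ;;
     For jj (wr 1 2 Rightwards ;; Case (%v. wr 1 (if v jj = 1 then 1 else 2) Rightwards)) ;; wr 1 1 Rightwards"

definition numt :: "nat => tape" where "numt n = arr (map bit_sym (bits_of_nat n)) 0"

lemma wfc_putnum [simp]: "1 < kk ==> jj < kk ==> 3 \<le> g ==> wfc kk g (putnum jj low)"
  unfolding putnum_def by (auto intro!: wfc_putw bit_sym_less)

lemma PR_putnum:
  assumes "pbound D sz (%i. length (bits_of_nat (n i)))" "jj \<noteq> 1"
    and s: "\<And>i. i \<in> D ==> s i 1 = outt (u i) & s i jj = numt (n i)"
  shows "PR D sz (putnum jj low) s (%i. (s i)(1 := outt (u i @ map bit_sym (False # dbl (low @ bits_of_nat (n i)) @ [False]))))"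
proof -
  let ?l = "map bit_sym (False # dbl low)"
  let ?w = "%i. map bit_sym (bits_of_nat (n i))"
  let ?f = "%i k. [2, bit_sym (bits_of_nat (n i) ! k)]"
  have 1: "PR D sz (putw 1 ?l) s (%i. (s i)(1 := outt (u i @ ?l)))" by (rule PR_putw) (use s in auto)
  have 2: "PR D sz (For jj (wr 1 2 Rightwards ;; Case (%v. wr 1 (if v jj = 1 then 1 else 2) Rightwards)))
     (%i. (s i)(1 := outt (u i @ ?l))) (%i. ((s i)(1 := outt (u i @ ?l)))(1 := outt ((u i @ ?l) @ concat (map (?f i) [0..<length (?w i)]))))"
  proof (rule PR_For_emit)
    show "pbound D sz (%i. length (?w i))" using assms(1) by simp
    let ?t = "%i k x. ((s i)(1 := outt (u i @ ?l)))(jj := arr (?w i) (int k), 1 := outt ((u i @ ?l) @ concat (map (?f i) [0..<k]) @ x))"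
    let ?E = "{(i, k). i \<in> D & k < length (?w i)}"
    have a: "PR ?E (%(i, k). sz i) (wr 1 2 Rightwards) (%(i, k). ?t i k []) (%(i, k). ?t i k [2])"
      by (rule PR_wr) auto
    have b: "PR ?E (%(i, k). sz i) (Case (%v. wr 1 (if v jj = 1 then 1 else 2) Rightwards)) (%(i, k). ?t i k [2]) (%(i, k). ?t i k (?f i k))"
    proof -
      have "PR ?E (%(i, k). sz i) (Case (%v. wr 1 (if v jj = 1 then 1 else 2) Rightwards)) (%(i, k). ?t i k [2])
        (%p. ((%(i, k). ?t i k [2]) p)(1 := outt ((%(i, k). (u i @ ?l) @ concat (map (?f i) [0..<k]) @ [2]) p @ [if view ((%(i, k). ?t i k [2]) p) jj = 1 then 1 else 2])))"
        by (rule PR_copy) auto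
      then show ?thesis
      proof (rule PR_cong)
        fix p assume p: "p \<in> ?E"
        obtain i k where ik: "p = (i, k)" "k < length (bits_of_nat (n i))" using p by auto
        have "view (?t i k [2]) jj = bit_sym (bits_of_nat (n i) ! k)" using assms(2) ik by (simp add: view_def scanned_arr)
        then show "((%(i, k). ?t i k [2]) p)(1 := outt ((%(i, k). (u i @ ?l) @ concat (map (?f i) [0..<k]) @ [2]) p @ [if view ((%(i, k). ?t i k [2]) p) jj = 1 then 1 else 2]))
          = (%(i, k). ?t i k (?f i k)) p" unfolding ik(1) prod.case by (simp only: bit_sym_copy) simp
      qed simp
    qed
    show "PR ?E (%(i, k). sz i) (wr 1 2 Rightwards ;; Case (%v. wr 1 (if v jj = 1 then 1 else 2) Rightwards))
      (%(i, k). ((s i)(1 := outt (u i @ ?l)))(jj := arr (?w i) (int k), 1 := outt ((u i @ ?l) @ concat (map (?f i) [0..<k]))))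
      (%(i, k). ((s i)(1 := outt (u i @ ?l)))(jj := arr (?w i) (int k), 1 := outt ((u i @ ?l) @ concat (map (?f i) [0..<k]) @ ?f i k)))"
      using PR_Seq[OF a b] by simp
  qed (use s assms(2) in \<open>auto simp: numt_def\<close>)
  have 3: "PR D sz (wr 1 1 Rightwards) (%i. (s i)(1 := outt ((u i @ ?l) @ concat (map (?f i) [0..<length (?w i)]))))
     (%i. (s i)(1 := outt (((u i @ ?l) @ concat (map (?f i) [0..<length (?w i)])) @ [1])))"
    by (rule PR_wr) auto
  have e: "concat (map (%k. [2, bit_sym (xs ! k)]) [0..<length xs]) = map bit_sym (dbl xs)" for xs
  proof -
    have "map (%k. [2, bit_sym (xs ! k)]) [0..<length xs] = map (%b. [2, bit_sym b]) xs"
      by (rule nth_equalityI) auto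
    then show ?thesis by (simp add: dbl_def map_concat comp_def)
  qed
  have d: "dbl (a @ b) = dbl a @ dbl b" for a b by (simp add: dbl_def)
  show ?thesis unfolding putnum_def
    by (rule PR_cong[OF PR_Seq[OF 1 PR_Seq[OF 2[simplified fun_upd_upd] 3]]]) (auto simp: e d)
qed

definition low :: "nat => nat => bool list" where "low k d = map (%i. odd (d div 2 ^ i)) [0..<k]"

lemma low_Suc: "low (Suc k) d = odd d # low k (d div 2)"
proof -
  have "[0..<Suc k] = 0 # map Suc [0..<k]" by (simp add: map_Suc_upt upt_conv_Cons)
  then show ?thesis by (simp add: low_def comp_def div_mult2_eq del: upt_Suc)
qed

text \<open>For \<open>J = 0\<close> zeros at the top would have to be dropped; this is why blocks
  are numbered from 1.\<close>

lemma bits_of_nat_low: "0 < J ==> d < 2 ^ k ==> bits_of_nat (2 ^ k * J + d) = low k d @ bits_of_nat J"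
proof (induction k arbitrary: d)
  case 0
  then show ?case by (simp add: low_def)
next
  case (Suc k)
  let ?n = "2 ^ Suc k * J + d"
  have p: "0 < 2 ^ Suc k * J" using Suc.prems(1) by simp
  have o: "odd ?n = odd d" by simp
  have h: "?n div 2 = 2 ^ k * J + d div 2" by simp
  have "bits_of_nat ?n = odd ?n # bits_of_nat (?n div 2)" using p by (subst bits_of_nat.simps) simp
  also have "bits_of_nat (?n div 2) = low k (d div 2) @ bits_of_nat J" unfolding h
    by (rule Suc.IH) (use Suc.prems in auto)
  finally show ?case unfolding o low_Suc by simp
qed

definition emit_cell :: "cell => com" where
  "emit_cell c = putnum 6 (low 3 (nat (fst c))) ;; putnum 7 (low 4 (nat (fst (snd c)))) ;; putw 1 (map bit_sym (enc_int (snd (snd c))))"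

lemma wfc_emit_cell [simp]: "8 \<le> kk ==> 3 \<le> g ==> wfc kk g (emit_cell c)"
  unfolding emit_cell_def by (auto intro!: wfc_putw bit_sym_less)

lemma enc_cube_shift:
  assumes "0 < I" "0 < J" "0 \<le> x" "x < 8" "0 \<le> y" "y < 16"
  shows "enc_cube (vec_of_cell (shift I J (x, y, z))) =
    (False # dbl (low 3 (nat x) @ bits_of_nat J) @ [False]) @ (False # dbl (low 4 (nat y) @ bits_of_nat I) @ [False]) @ enc_int z"
proof -
  have x: "nat \<bar>8 * int J + x\<bar> = 2 ^ 3 * J + nat x" "nat \<bar>16 * int I + y\<bar> = 2 ^ 4 * I + nat y" using assms by auto
  have "nat x < 2 ^ 3" "nat y < 2 ^ 4" using assms by auto
  then have "enc_int (8 * int J + x) = False # dbl (low 3 (nat x) @ bits_of_nat J) @ [False]"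
    "enc_int (16 * int I + y) = False # dbl (low 4 (nat y) @ bits_of_nat I) @ [False]"
    using assms unfolding enc_int_def enc_nat_def x dbl_def[symmetric] by (simp_all add: bits_of_nat_low[of _ _ 3, simplified] bits_of_nat_low[of _ _ 4, simplified])
  then show ?thesis by (simp add: enc_cube_def)
qed

definition emit_block :: "block => com" where
  "emit_block t = seqs (%k. emit_cell (full t ! k)) (length (full t))"

lemma wfc_emit_block [simp]: "8 \<le> kk ==> 3 \<le> g ==> wfc kk g (emit_block t)"
  unfolding emit_block_def by (intro wfc_seqs) auto

definition enc_block :: "nat => nat => block => bool list" where
  "enc_block I J t = concat (map (%c. enc_cube (vec_of_cell (shift I J c))) (full t))"

lemma PR_emit_block:
  assumes b: "pbound D sz (%i. length (bits_of_nat (I i)))" "pbound D sz (%i. length (bits_of_nat (J i)))"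
    and s: "\<And>i. i \<in> D ==> s i 1 = outt (map bit_sym (u i)) & s i 6 = numt (J i) & s i 7 = numt (I i) & 0 < I i & 0 < J i"
  shows "PR D sz (emit_block t) s (%i. (s i)(1 := outt (map bit_sym (u i @ enc_block (I i) (J i) t))))"
proof -
  let ?e = "%i c. enc_cube (vec_of_cell (shift (I i) (J i) c))"
  let ?s = "%i k. (s i)(1 := outt (map bit_sym (u i @ concat (map (?e i) (take k (full t))))))"
  have "PR D sz (emit_block t) (%i. ?s i 0) (%i. ?s i (length (full t)))"
    unfolding emit_block_def
  proof (rule PR_seqs)
    fix k assume k: "k < length (full t)"
    obtain x y z where c: "full t ! k = (x, y, z)" by (cases "full t ! k")
    have m: "(x, y, z) \<in> set (full t)" using nth_mem[OF k] c by simp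
    have xy: "0 \<le> x" "x < 8" "0 \<le> y" "y < 16" using m unfolding mem_full by auto
    let ?x = "%i. False # dbl (low 3 (nat x) @ bits_of_nat (J i)) @ [False]"
    let ?y = "%i. False # dbl (low 4 (nat y) @ bits_of_nat (I i)) @ [False]"
    let ?u = "%i. map bit_sym (u i @ concat (map (?e i) (take k (full t))))"
    have "PR D sz (emit_cell (full t ! k)) (%i. ?s i k)
      (%i. (?s i k)(1 := outt (((?u i @ map bit_sym (?x i)) @ map bit_sym (?y i)) @ map bit_sym (enc_int z))))"
      unfolding emit_cell_def c fst_conv snd_conv
    proof (intro PR_Seq)
      show "PR D sz (putnum 6 (low 3 (nat x))) (%i. ?s i k) (%i. (?s i k)(1 := outt (?u i @ map bit_sym (?x i))))"
        by (rule PR_putnum[OF b(2)]) (use s in auto)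
      show "PR D sz (putnum 7 (low 4 (nat y))) (%i. (?s i k)(1 := outt (?u i @ map bit_sym (?x i))))
          (%i. (?s i k)(1 := outt ((?u i @ map bit_sym (?x i)) @ map bit_sym (?y i))))"
        by (rule PR_cong[OF PR_putnum[OF b(1), where u = "%i. ?u i @ map bit_sym (?x i)" and s = "%i. (?s i k)(1 := outt (?u i @ map bit_sym (?x i)))"]]) (use s in auto)
      show "PR D sz (putw 1 (map bit_sym (enc_int z))) (%i. (?s i k)(1 := outt ((?u i @ map bit_sym (?x i)) @ map bit_sym (?y i))))
          (%i. (?s i k)(1 := outt (((?u i @ map bit_sym (?x i)) @ map bit_sym (?y i)) @ map bit_sym (enc_int z))))"
        by (rule PR_cong[OF PR_putw[where u = "%i. (?u i @ map bit_sym (?x i)) @ map bit_sym (?y i)" and s = "%i. (?s i k)(1 := outt ((?u i @ map bit_sym (?x i)) @ map bit_sym (?y i)))"]]) auto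
    qed
    then show "PR D sz (emit_cell (full t ! k)) (%i. ?s i k) (%i. ?s i (Suc k))"
    proof (rule PR_cong)
      fix i assume i: "i \<in> D"
      have "?e i (x, y, z) = ?x i @ ?y i @ enc_int z" using s[OF i] by (intro enc_cube_shift[OF _ _ xy]) auto
      then show "(?s i k)(1 := outt (((?u i @ map bit_sym (?x i)) @ map bit_sym (?y i)) @ map bit_sym (enc_int z))) = ?s i (Suc k)"
        using k by (simp add: take_Suc_conv_app_nth c)
    qed simp
  qed
  then show ?thesis by (rule PR_cong) (use s in \<open>auto simp: enc_block_def fun_eq_iff\<close>)
qed

definition incr :: "nat => com" where
  "incr j = While (%v. v j = 2) (wr j 1 Rightwards) ;; wr j 2 Stay ;; rewind j"

lemma wfc_incr [simp]: "j < kk ==> 3 \<le> g ==> wfc kk g (incr j)"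
  by (simp add: incr_def)

fun inc :: "bool list => bool list" where
  "inc [] = [True]"
| "inc (False # w) = True # w"
| "inc (True # w) = False # inc w"

lemma bits_of_nat_Suc: "bits_of_nat (Suc n) = inc (bits_of_nat n)"
proof (induction n rule: less_induct)
  case (less n)
  show ?case
  proof (cases "n = 0")
    case True
    then show ?thesis by (simp add: bits_of_nat.simps[of 0] bits_of_nat.simps[of "Suc 0"])
  next
    case n: False
    show ?thesis
    proof (cases "odd n")
      case True
      then have "Suc n div 2 = Suc (n div 2)" by presburger
      then show ?thesis using True n less[of "n div 2"] by (simp add: bits_of_nat.simps[of "Suc n"] bits_of_nat.simps[of n])
    next
      case False
      then have "Suc n div 2 = n div 2" by presburger
      then show ?thesis using False n by (simp add: bits_of_nat.simps[of "Suc n"] bits_of_nat.simps[of n])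
    qed
  qed
qed

text \<open>The carry runs through the initial block of ones; the digit behind it is a zero or the
  blank after the word, which is where \<open>incr\<close> writes.\<close>

lemma inc_split:
  obtains k r where "w = replicate k True @ r" "r = [] \<or> (\<exists>r'. r = False # r')" "inc w = replicate k False @ True # tl r"
proof -
  have "\<exists>k r. w = replicate k True @ r & (r = [] \<or> (\<exists>r'. r = False # r')) & inc w = replicate k False @ True # tl r"
  proof (induction w rule: inc.induct)
    case (3 w)
    then obtain k r where w: "w = replicate k True @ r" and r: "r = [] \<or> (\<exists>r'. r = False # r')"
      and i: "inc w = replicate k False @ True # tl r" by blast
    have "True # w = replicate (Suc k) True @ r" using w by simp
    moreover have "inc (True # w) = replicate (Suc k) False @ True # tl r" using i by simp
    ultimately show ?case using r by blast
  qed (rule exI[of _ 0], simp)+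
  then show ?thesis using that by blast
qed

lemma PR_incr:
  assumes b: "pbound D sz (%i. length (bits_of_nat (n i)))" and s: "\<And>i. i \<in> D ==> s i j = numt (n i)"
  shows "PR D sz (incr j) s (%i. (s i)(j := numt (Suc (n i))))"
proof -
  have "\<forall>i. \<exists>k r. bits_of_nat (n i) = replicate k True @ r & (r = [] \<or> (\<exists>r'. r = False # r')) & bits_of_nat (Suc (n i)) = replicate k False @ True # tl r"
    unfolding bits_of_nat_Suc by (metis inc_split)
  then obtain k r where kr: "\<And>i. bits_of_nat (n i) = replicate (k i) True @ r i" "\<And>i. r i = [] \<or> (\<exists>r'. r i = False # r')"
    "\<And>i. bits_of_nat (Suc (n i)) = replicate (k i) False @ True # tl (r i)" by metis
  let ?w = "%i l. replicate l 1 @ replicate (k i - l) 2 @ map bit_sym (r i)"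
  let ?t = "%i l. (s i)(j := arr (?w i l) (int l))"
  let ?z = "%i. map bit_sym (bits_of_nat (Suc (n i)))"
  have 1: "PR D sz (While (%v. v j = 2) (wr j 1 Rightwards)) (%i. ?t i 0) (%i. ?t i (k i))"
  proof (rule PR_While)
    show "pbound D sz k" by (rule pbound_mono[OF b]) (simp add: kr(1))
    show "view (?t i l) j = 2" if "l < k i" for i l
      using that by (simp add: view_def scanned_arr nth_append)
    have "scanned (arr (?w i (k i)) (int (k i))) \<noteq> 2" for i
    proof (cases "r i = []")
      case True
      then show ?thesis using scanned_arr_end[of "replicate (k i) 1"] by simp
    next
      case False
      then obtain r' where "r i = False # r'" using kr(2) by blast
      then show ?thesis by (simp add: scanned_arr nth_append)
    qed
    then show "\<not> view (?t i (k i)) j = 2" for i by (simp add: view_def)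
    show "PR {(i, l). i \<in> D & l < k i} (%(i, l). sz i) (wr j 1 Rightwards) (%(i, l). ?t i l) (%(i, l). ?t i (Suc l))"
    proof (rule PR_wr, clarify)
      fix i l assume l: "l < k i"
      have "(?w i l)[l := 1] = ?w i (Suc l)"
      proof -
        have r: "replicate (k i - l) (2::nat) = 2 # replicate (k i - Suc l) 2" using l by (metis Suc_diff_Suc replicate_Suc)
        show ?thesis unfolding r
          using list_update_length[of "replicate l 1" "2::nat" "replicate (k i - Suc l) 2 @ map bit_sym (r i)" 1]
          by (simp add: replicate_app_Cons_same)
      qed
      moreover have "l < length (?w i l)" using l by simp
      ultimately have "act (1, Rightwards) (arr (?w i l) (int l)) = arr (?w i (Suc l)) (int (Suc l))"
        by (simp only: arr_write)
      then show "(?t i l)(j := act (1, Rightwards) (?t i l j)) = ?t i (Suc l)" by (simp only: fun_upd_upd fun_upd_same)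
    qed
  qed
  have 2: "PR D sz (wr j 2 Stay) (%i. ?t i (k i)) (%i. (s i)(j := arr (?z i) (int (k i))))"
  proof (rule PR_wr)
    fix i
    have "act (2, Stay) (arr (?w i (k i)) (int (k i))) = arr (?z i) (int (k i))"
    proof (cases "r i = []")
      case True
      then show ?thesis using arr_append(2)[of 2 "replicate (k i) 1"] by (simp add: kr(3))
    next
      case False
      then obtain r' where "r i = False # r'" using kr(2) by blast
      then show ?thesis by (simp add: arr_write kr(3) list_update_append)
    qed
    then show "(?t i (k i))(j := act (2, Stay) (?t i (k i) j)) = (s i)(j := arr (?z i) (int (k i)))" by simp
  qed
  have 3: "PR D sz (rewind j) (%i. (s i)(j := arr (?z i) (int (k i)))) (%i. ((s i)(j := arr (?z i) (int (k i))))(j := arr (?z i) 0))"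
  proof (rule PR_rewind[where q = k])
    have "length (?z i) \<le> length (bits_of_nat (n i)) + 1" for i by (simp add: kr)
    then show "pbound D sz (%i. length (?z i))" using b by (intro pbound_mono[OF pbound_add[OF b pbound_const[of _ _ 1]]]) auto
  qed (auto simp: kr(3))
  show ?thesis unfolding incr_def
    by (rule PR_cong[OF PR_Seq[OF 1 PR_Seq[OF 2 3]]]) (auto simp: fun_eq_iff s numt_def kr(1))
qed

text \<open>Clears the word and leaves the number 1, with which the count of the block columns
  starts again in each row.\<close>

definition reset :: "nat => com" where
  "reset j = While (%v. v j \<noteq> 0) (mv j Rightwards) ;; mv j Leftwards ;; While (%v. v j \<noteq> 0) (wr j 0 Leftwards) ;; mv j Rightwards ;; wr j 2 Stay"

lemma wfc_reset [simp]: "j < kk ==> 3 \<le> g ==> wfc kk g (reset j)"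
  by (simp add: reset_def)

lemma PR_reset:
  assumes b: "pbound D sz (%i. length (w i))" and s: "\<And>i. i \<in> D ==> s i j = arr (w i) 0 & 0 \<notin> set (w i)"
  shows "PR D sz (reset j) s (%i. (s i)(j := arr [2] 0))"
proof -
  have nz: "w i ! k \<noteq> 0" if "i \<in> D" "k < length (w i)" for i k using s[OF that(1)] nth_mem[OF that(2)] by metis
  let ?t = "%i k. (s i)(j := arr (w i) (int k))"
  let ?e = "%i k. (s i)(j := arr (take (length (w i) - k) (w i)) (int (length (w i)) - int k - 1))"
  have 1: "PR D sz (While (%v. v j \<noteq> 0) (mv j Rightwards)) (%i. ?t i 0) (%i. ?t i (length (w i)))"
  proof (rule PR_While[OF b])
    show "PR {(i, k). i \<in> D & k < length (w i)} (%(i, k). sz i) (mv j Rightwards) (%(i, k). ?t i k) (%(i, k). ?t i (Suc k))"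
      by (rule PR_mv) (auto simp: arr_move algebra_simps)
  qed (use nz in \<open>auto simp: view_def scanned_arr\<close>)
  have 2: "PR D sz (mv j Leftwards) (%i. ?t i (length (w i))) (%i. ?e i 0)"
    by (rule PR_mv) (auto simp: arr_move)
  have pos: "int (length (w i)) - int k - 1 = int (length (w i) - k - 1)" if "k < length (w i)" for i k using that by linarith
  have 3: "PR D sz (While (%v. v j \<noteq> 0) (wr j 0 Leftwards)) (%i. ?e i 0) (%i. ?e i (length (w i)))"
  proof (rule PR_While[OF b])
    fix i k assume ik: "i \<in> D" "k < length (w i)"
    have "scanned (arr (take (length (w i) - k) (w i)) (int (length (w i) - k - 1))) = w i ! (length (w i) - k - 1)"
      using ik by (subst scanned_arr) auto
    then show "view (?e i k) j \<noteq> 0" using nz[OF ik(1), of "length (w i) - k - 1"] ik by (simp add: view_def pos)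
  next
    show "PR {(i, k). i \<in> D & k < length (w i)} (%(i, k). sz i) (wr j 0 Leftwards) (%(i, k). ?e i k) (%(i, k). ?e i (Suc k))"
    proof (rule PR_wr, clarify)
      fix i k assume k: "k < length (w i)"
      define l where "l = length (w i) - k - 1"
      have l: "length (w i) - k = Suc l" "l < length (w i)" using k by (auto simp: l_def)
      have "act (0, Leftwards) (arr (take (Suc l) (w i)) (int l)) = arr (take l (w i)) (int l - 1)"
        using arr_erase_last[of "take l (w i)" "w i ! l"] l(2) by (simp add: take_Suc_conv_app_nth)
      moreover have "int (length (w i)) - int k - 1 = int l" "int (length (w i)) - int (Suc k) - 1 = int l - 1" "length (w i) - Suc k = l"
        using k by (auto simp: l_def)
      ultimately show "(?e i k)(j := act (0, Leftwards) (?e i k j)) = ?e i (Suc k)" by (simp add: l(1))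
    qed
  qed (simp add: view_def)
  have 4: "PR D sz (mv j Rightwards) (%i. ?e i (length (w i))) (%i. (s i)(j := arr [] 0))"
    by (rule PR_mv) (auto simp: arr_move)
  have 5: "PR D sz (wr j 2 Stay) (%i. (s i)(j := arr [] 0)) (%i. (s i)(j := arr [2] 0))"
    by (rule PR_wr) (use arr_append(2)[of 2 "[]"] in auto)
  show ?thesis unfolding reset_def
    by (rule PR_cong[OF PR_Seq[OF 1 PR_Seq[OF 2 PR_Seq[OF 3 PR_Seq[OF 4 5]]]]]) (use s in \<open>auto simp: fun_eq_iff\<close>)
qed

text \<open>\<open>h\<close> takes finitely many values, so the sum of the polynomials of all
  branches bounds each of them.\<close>

lemma PR_Case_fin:
  assumes "finite B" "\<And>i. i \<in> D ==> h (view (s i)) \<in> B" "\<And>b. b \<in> B ==> PR {i\<in>D. h (view (s i)) = b} sz (f b) s t"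
  shows "PR D sz (Case (%v. f (h v))) s t"
proof -
  have "\<forall>b\<in>B. \<exists>p :: nat poly. \<forall>i\<in>{i\<in>D. h (view (s i)) = b}. runs (f b) (s i) (poly p (sz i)) (t i)"
    using assms(3) by (auto simp: PR_def)
  from bchoice[OF this] obtain P :: "_ => nat poly"
    where P': "\<forall>b\<in>B. \<forall>i\<in>{i\<in>D. h (view (s i)) = b}. runs (f b) (s i) (poly (P b) (sz i)) (t i)" by blast
  show ?thesis
  proof (rule PR_intro)
    show "pbound D sz (%i. Suc (poly (\<Sum>c\<in>B. P c) (sz i)))"
      by (rule pbound_Suc) (auto simp: pbound_def)
    fix i assume i: "i \<in> D"
    have "poly (P (h (view (s i)))) (sz i) \<le> poly (\<Sum>c\<in>B. P c) (sz i)"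
      unfolding poly_sum using assms(1,2) i by (intro member_le_sum) auto
    moreover have "runs (f (h (view (s i)))) (s i) (poly (P (h (view (s i)))) (sz i)) (t i)" using P' i assms(2) by blast
    ultimately show "runs (Case (%v. f (h v))) (s i) (Suc (poly (\<Sum>c\<in>B. P c) (sz i))) (t i)"
      by (intro runs_Case) (rule runs_mono)
  qed
qed

text \<open>Crude but enough: the numbers kept on the counter tapes are themselves polynomial in the
  length of the input.\<close>

lemma length_bits_le: "length (bits_of_nat n) \<le> n"
proof (induction n rule: less_induct)
  case (less n)
  show ?case
  proof (cases "n = 0")
    case False
    then show ?thesis using less[of "n div 2"] by (simp add: bits_of_nat.simps[of n])
  qed (simp add: bits_of_nat.simps)
qed

lemma finite_UNIV_block: "finite (UNIV :: block set)"
proof -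
  have "(UNIV :: block set) = {EM, TF, TM, TP, LF, LM, HE, HX, CH, RM, RL, BM, BL}"
    by (auto intro: block.exhaust)
  then show ?thesis by (metis finite.emptyI finite.insertI)
qed

section \<open>Writing rows of blocks and the whole region\<close>

definition row_enc :: "nat => (nat => block) => nat => bool list" where
  "row_enc I ty J = concat (map (%J'. enc_block I J' (ty J')) [1..<J])"

lemma row_enc_Suc: "0 < J ==> row_enc I ty (Suc J) = row_enc I ty J @ enc_block I J (ty J)"
  by (simp add: row_enc_def)

lemma row_enc_1 [simp]: "row_enc I ty (Suc 0) = []" by (simp add: row_enc_def)

definition RS :: "store => bool list => nat => (nat => block) => nat => store" where
  "RS b u I ty J = b(1 := outt (map bit_sym (u @ row_enc I ty J)), 6 := numt J)"

lemma RS_upd: "j \<noteq> 1 ==> j \<noteq> 6 ==> (RS b u I ty J)(j := z) = RS (b(j := z)) u I ty J"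
  by (auto simp: RS_def)

lemma RS_nth: "j \<noteq> 1 ==> j \<noteq> 6 ==> RS b u I ty J j = b j" "RS b u I ty J 6 = numt J" "RS b u I ty J (Suc 0) = outt (map bit_sym (u @ row_enc I ty J))"
  by (auto simp: RS_def)

lemma pbound_bits: "pbound D sz I ==> pbound D sz (%i. length (bits_of_nat (I i)))"
  using length_bits_le by (auto intro: pbound_mono)

lemma PR_emit:
  assumes p: "pbound D sz I" "pbound D sz J"
    and b: "\<And>i. i \<in> D ==> b i 7 = numt (I i) & 0 < I i & 0 < J i & ty i (J i) = t"
  shows "PR D sz (emit_block t) (%i. RS (b i) (u i) (I i) (ty i) (J i)) (%i. (RS (b i) (u i) (I i) (ty i) (Suc (J i)))(6 := numt (J i)))"
proof -
  have "PR D sz (emit_block t) (%i. RS (b i) (u i) (I i) (ty i) (J i))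
     (%i. (RS (b i) (u i) (I i) (ty i) (J i))(1 := outt (map bit_sym ((u i @ row_enc (I i) (ty i) (J i)) @ enc_block (I i) (J i) t))))"
    by (rule PR_emit_block[OF pbound_bits[OF p(1)] pbound_bits[OF p(2)]]) (use b in \<open>auto simp: RS_nth\<close>)
  then show ?thesis
    by (rule PR_cong) (use b in \<open>auto simp: RS_def row_enc_Suc fun_eq_iff\<close>)
qed

lemma PR_incr_RS:
  assumes "pbound D sz J"
  shows "PR D sz (incr 6) (%i. (RS (b i) (u i) (I i) (ty i) (Suc (J i)))(6 := numt (J i))) (%i. RS (b i) (u i) (I i) (ty i) (Suc (J i)))"
  by (rule PR_cong[OF PR_incr[OF pbound_bits[OF assms], where s = "%i. (RS (b i) (u i) (I i) (ty i) (Suc (J i)))(6 := numt (J i))"]]) (auto simp: RS_def)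

lemma PR_block:
  assumes p: "pbound D sz I" "pbound D sz J"
    and b: "\<And>i. i \<in> D ==> b i 7 = numt (I i) & 0 < I i & 0 < J i & ty i (J i) = t"
  shows "PR D sz (emit_block t ;; incr 6) (%i. RS (b i) (u i) (I i) (ty i) (J i)) (%i. RS (b i) (u i) (I i) (ty i) (Suc (J i)))"
  by (rule PR_Seq[OF PR_emit PR_incr_RS[OF p(2)]]) (use p b in auto)

text \<open>One column of a row: the crossing, whose type depends on the symbols under heads 3 and
  4, and then one link of the chain for each symbol on tape 5.\<close>

definition lane :: "(nat => nat => block) => block => com" where
  "lane h ch = Case (%v. emit_block (h (v 3) (v 4))) ;; incr 6 ;; For 5 (emit_block ch ;; incr 6)"

lemma pbound_pair:
  "pbound D sz f ==> pbound {(i, k). i \<in> D & Q i k} (%(i, k). sz i) (%(i, k). f i)"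
  unfolding pbound_def by auto

lemma pbound_pair_add:
  assumes "pbound D sz f" "pbound D sz n"
  shows "pbound {(i, k). i \<in> D & k < n i} (%(i, k). sz i) (%(i, k). f i + k)"
  by (rule pbound_mono[OF pbound_pair[OF pbound_add[OF assms]]]) auto

lemma PR_lane:
  assumes p: "pbound D sz I" "pbound D sz J" "pbound D sz (%i. length (a i))"
    and b: "\<And>i. i \<in> D ==> b i 7 = numt (I i) & b i 5 = arr (a i) 0 & 0 \<notin> set (a i) & 0 < I i & 0 < J i
        & ty i (J i) = h (scanned (b i 3)) (scanned (b i 4)) & (\<forall>k. 0 < k & k \<le> length (a i) --> ty i (J i + k) = ch)"
  shows "PR D sz (lane h ch) (%i. RS (b i) (u i) (I i) (ty i) (J i)) (%i. RS (b i) (u i) (I i) (ty i) (Suc (J i + length (a i))))"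
proof -
  let ?T = "%i J. RS (b i) (u i) (I i) (ty i) J"
  have 1: "PR D sz (Case (%v. emit_block (h (v 3) (v 4)))) (%i. ?T i (J i)) (%i. (?T i (Suc (J i)))(6 := numt (J i)))"
  proof (rule PR_Case_fin[OF finite_UNIV_block, where h = "%v. h (v 3) (v 4)"])
    fix t
    show "PR {i\<in>D. h (view (?T i (J i)) 3) (view (?T i (J i)) 4) = t} sz (emit_block t) (%i. ?T i (J i)) (%i. (?T i (Suc (J i)))(6 := numt (J i)))"
      by (rule PR_emit) (use b p in \<open>auto simp: view_def RS_nth intro: pbound_map[where h = "%i. i"]\<close>)
  qed simp
  have 2: "PR D sz (incr 6) (%i. (?T i (Suc (J i)))(6 := numt (J i))) (%i. ?T i (Suc (J i)))"
    by (rule PR_incr_RS[OF p(2)])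
  have 3: "PR D sz (For 5 (emit_block ch ;; incr 6)) (%i. ?T i (Suc (J i) + 0)) (%i. (?T i (Suc (J i) + length (a i)))(5 := arr (a i) 0))"
  proof (rule PR_For[OF p(3)])
    have "PR {(i, k). i \<in> D & k < length (a i)} (%(i, k). sz i) (emit_block ch ;; incr 6)
      (%q. RS ((%(i, k). (b i)(5 := arr (a i) (int k))) q) ((%(i, k). u i) q) ((%(i, k). I i) q) ((%(i, k). ty i) q) ((%(i, k). Suc (J i) + k) q))
      (%q. RS ((%(i, k). (b i)(5 := arr (a i) (int k))) q) ((%(i, k). u i) q) ((%(i, k). I i) q) ((%(i, k). ty i) q) (Suc ((%(i, k). Suc (J i) + k) q)))"
    proof (rule PR_block)
      show "pbound {(i, k). i \<in> D & k < length (a i)} (%(i, k). sz i) (%(i, k). I i)" by (rule pbound_pair[OF p(1)])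
      show "pbound {(i, k). i \<in> D & k < length (a i)} (%(i, k). sz i) (%(i, k). Suc (J i) + k)"
        by (rule pbound_pair_add[OF pbound_Suc[OF p(2)] p(3)])
      fix q assume "q \<in> {(i, k). i \<in> D & k < length (a i)}"
      then obtain i k where q: "q = (i, k)" "i \<in> D" "k < length (a i)" by auto
      have "ty i (J i + Suc k) = ch" using b[OF q(2)] q(3) by (meson Suc_leI zero_less_Suc)
      then show "(%(i, k). (b i)(5 := arr (a i) (int k))) q 7 = numt ((%(i, k). I i) q) & 0 < (%(i, k). I i) q & 0 < (%(i, k). Suc (J i) + k) q & (%(i, k). ty i) q ((%(i, k). Suc (J i) + k) q) = ch"
        using b[OF q(2)] q by (simp del: mult_Suc_right)
    qed
    then show "PR {(i, k). i \<in> D & k < length (a i)} (%(i, k). sz i) (emit_block ch ;; incr 6)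
      (%(i, k). (?T i (Suc (J i) + k))(5 := arr (a i) (int k))) (%(i, k). (?T i (Suc (J i) + Suc k))(5 := arr (a i) (int k)))"
      by (rule PR_cong) (auto simp: RS_upd)
  qed (use b in \<open>auto simp: RS_nth\<close>)
  show ?thesis unfolding lane_def
  proof (rule PR_cong[OF PR_Seq[OF 1 PR_Seq[OF 2 3[simplified]]]])
    fix i assume "i \<in> D"
    then have "(b i)(5 := arr (a i) 0) = b i" using b by (metis fun_upd_triv)
    then show "(?T i (Suc (J i + length (a i))))(5 := arr (a i) 0) = ?T i (Suc (J i + length (a i)))" by (simp add: RS_upd)
  qed simp
qed

text \<open>Tape 3 has one symbol for each group of columns, and head 4 moves along with it. The
  \<open>K\<close> lanes of a group are unrolled in the program. The second loop over tape 3 only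
  brings head 4 back.\<close>

definition row :: "nat => block => (nat => nat => nat => block) => block => block => com" where
  "row K l h ch r = (emit_block l ;; incr 6) ;; For 3 (seqs (%t. lane (h t) ch) K ;; mv 4 Rightwards) ;; For 3 (mv 4 Leftwards) ;;
     (emit_block r ;; incr 6) ;; reset 6 ;; incr 7"

lemma wfc_row: "8 \<le> kk ==> 3 \<le> g ==> wfc kk g (row K l h ch r)"
  by (auto simp: row_def lane_def intro!: wfc_seqs)

lemma PR_row:
  assumes p: "pbound D sz I" "pbound D sz (%i. length (a i))" "pbound D sz (%i. length (c i))"
    and b: "\<And>i. i \<in> D ==> s i 1 = outt (map bit_sym (u i)) & s i 3 = arr (c i) 0 & 0 \<notin> set (c i) & s i 4 = (R i, q i)
        & s i 5 = arr (a i) 0 & 0 \<notin> set (a i) & s i 6 = numt 1 & s i 7 = numt (I i) & 0 < I i"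
    and ty: "\<And>i. i \<in> D ==> ty i 1 = l & ty i (2 + K * length (c i) * (length (a i) + 1)) = r"
      "\<And>i v t. i \<in> D ==> v < length (c i) ==> t < K ==> ty i (2 + (v * K + t) * (length (a i) + 1)) = h t (c i ! v) (R i (q i + int v))"
      "\<And>i v t k. i \<in> D ==> v < length (c i) ==> t < K ==> 0 < k ==> k \<le> length (a i) ==> ty i (2 + (v * K + t) * (length (a i) + 1) + k) = ch"
  shows "PR D sz (row K l h ch r) s
    (%i. (s i)(1 := outt (map bit_sym (u i @ row_enc (I i) (ty i) (3 + K * length (c i) * (length (a i) + 1)))), 7 := numt (Suc (I i))))"
proof -
  let ?m = "%i. length (a i) + 1"
  let ?T = "%i J. RS (s i) (u i) (I i) (ty i) J"
  let ?W = "%i. 2 + K * length (c i) * ?m i"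
  have 0: "?T i 1 = s i" if "i \<in> D" for i using b[OF that] by (auto simp: RS_def fun_eq_iff)
  have 1: "PR D sz (emit_block l ;; incr 6) (%i. ?T i 1) (%i. ?T i (Suc 1))"
    by (rule PR_block[OF p(1) pbound_const]) (use b ty(1) in auto)
  let ?S = "%i v. (?T i (2 + v * K * ?m i))(4 := (R i, q i + int v))"
  have 2: "PR D sz (For 3 (seqs (%t. lane (h t) ch) K ;; mv 4 Rightwards)) (%i. ?S i 0) (%i. (?S i (length (c i)))(3 := arr (c i) 0))"
  proof (rule PR_For[OF p(3)])
    let ?E = "{(i, v). i \<in> D & v < length (c i)}"
    let ?b = "%i v. (s i)(4 := (R i, q i + int v), 3 := arr (c i) (int v))"
    have "PR ?E (%(i, v). sz i) (seqs (%t. lane (h t) ch) K)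
      (%e. (%(i, v) t. RS (?b i v) (u i) (I i) (ty i) (2 + (v * K + t) * ?m i)) e 0) (%e. (%(i, v) t. RS (?b i v) (u i) (I i) (ty i) (2 + (v * K + t) * ?m i)) e K)"
    proof (rule PR_seqs)
      fix t assume t: "t < K"
      have "PR ?E (%(i, v). sz i) (lane (h t) ch)
        (%e. RS ((%(i, v). ?b i v) e) ((%(i, v). u i) e) ((%(i, v). I i) e) ((%(i, v). ty i) e) ((%(i, v). 2 + (v * K + t) * ?m i) e))
        (%e. RS ((%(i, v). ?b i v) e) ((%(i, v). u i) e) ((%(i, v). I i) e) ((%(i, v). ty i) e) (Suc ((%(i, v). 2 + (v * K + t) * ?m i) e + length ((%(i, v). a i) e))))"
      proof (rule PR_lane)
        show "pbound ?E (%(i, v). sz i) (%(i, v). I i)" by (rule pbound_pair[OF p(1)])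
        have "pbound D sz (%i. 2 + (length (c i) * K + K) * ?m i)" by (intro pbound_intros p)
        from pbound_pair[OF this] show "pbound ?E (%(i, v). sz i) (%(i, v). 2 + (v * K + t) * ?m i)"
        proof (rule pbound_mono, clarsimp)
          fix i v assume "v < length (c i)"
          then have "v * K + t \<le> length (c i) * K + K" using t by (intro add_mono mult_le_mono1) auto
          from mult_le_mono1[OF this, of "Suc (length (a i))"]
          show "v * K + t + (v * K + t) * length (a i) \<le> length (c i) * K + K + (length (c i) * K + K) * length (a i)" by simp
        qed
        have "pbound ?E (%(i, v). sz i) (%(i, v). length (a i))" by (rule pbound_pair[OF p(2)])
        then show "pbound ?E (%(i, v). sz i) (%e. length ((%(i, v). a i) e))" by (simp add: case_prod_unfold)
        fix e assume "e \<in> ?E"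
        then obtain i v where e: "e = (i, v)" "i \<in> D" "v < length (c i)" by auto
        have "scanned (arr (c i) (int v)) = c i ! v" "scanned (R i, q i + int v) = R i (q i + int v)" using e(3) by (simp add: scanned_arr, simp add: scanned_def)
        then show "(%(i, v). ?b i v) e 7 = numt ((%(i, v). I i) e) & (%(i, v). ?b i v) e 5 = arr ((%(i, v). a i) e) 0 & 0 \<notin> set ((%(i, v). a i) e)
          & 0 < (%(i, v). I i) e & 0 < (%(i, v). 2 + (v * K + t) * ?m i) e
          & (%(i, v). ty i) e ((%(i, v). 2 + (v * K + t) * ?m i) e) = h t (scanned ((%(i, v). ?b i v) e 3)) (scanned ((%(i, v). ?b i v) e 4))
          & (\<forall>k. 0 < k & k \<le> length ((%(i, v). a i) e) --> (%(i, v). ty i) e ((%(i, v). 2 + (v * K + t) * ?m i) e + k) = ch)"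
          unfolding e(1) prod.case using b[OF e(2)] ty(2)[OF e(2,3) t] ty(3)[OF e(2,3) t] by (simp del: mult_Suc_right add_Suc_right add_2_eq_Suc)
      qed
      then show "PR ?E (%(i, v). sz i) (lane (h t) ch) (%e. (%(i, v) t. RS (?b i v) (u i) (I i) (ty i) (2 + (v * K + t) * ?m i)) e t)
          (%e. (%(i, v) t. RS (?b i v) (u i) (I i) (ty i) (2 + (v * K + t) * ?m i)) e (Suc t))"
        by (rule PR_cong) (auto simp: algebra_simps)
    qed
    moreover have "PR ?E (%(i, v). sz i) (mv 4 Rightwards)
      (%e. (%(i, v) t. RS (?b i v) (u i) (I i) (ty i) (2 + (v * K + t) * ?m i)) e K) (%(i, v). (?S i (Suc v))(3 := arr (c i) (int v)))"
      by (rule PR_mv) (auto simp: RS_upd RS_nth algebra_simps fun_upd_twist[of 4 3])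
    ultimately have "PR ?E (%(i, v). sz i) (seqs (%t. lane (h t) ch) K ;; mv 4 Rightwards)
      (%e. (%(i, v) t. RS (?b i v) (u i) (I i) (ty i) (2 + (v * K + t) * ?m i)) e 0) (%(i, v). (?S i (Suc v))(3 := arr (c i) (int v)))"
      by (rule PR_Seq)
    then show "PR ?E (%(i, v). sz i) (seqs (%t. lane (h t) ch) K ;; mv 4 Rightwards)
      (%(i, v). (?S i v)(3 := arr (c i) (int v))) (%(i, v). (?S i (Suc v))(3 := arr (c i) (int v)))"
      by (rule PR_cong) (auto simp: RS_upd fun_upd_twist[of 4 3])
  qed (use b in \<open>auto simp: RS_nth\<close>)
  let ?B = "%i v. (?T i (?W i))(4 := (R i, q i + int (length (c i)) - int v))"
  have 3: "PR D sz (For 3 (mv 4 Leftwards)) (%i. ?B i 0) (%i. (?B i (length (c i)))(3 := arr (c i) 0))"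
  proof (rule PR_For[OF p(3)])
    show "PR {(i, v). i \<in> D & v < length (c i)} (%(i, v). sz i) (mv 4 Leftwards)
      (%(i, v). (?B i v)(3 := arr (c i) (int v))) (%(i, v). (?B i (Suc v))(3 := arr (c i) (int v)))"
      by (rule PR_mv) (auto simp: fun_eq_iff algebra_simps)
  qed (use b in \<open>auto simp: RS_nth\<close>)
  have 4: "PR D sz (emit_block r ;; incr 6) (%i. ?T i (?W i)) (%i. ?T i (Suc (?W i)))"
    by (rule PR_block[OF p(1)]) (use b ty(1) p in \<open>auto intro!: pbound_intros simp del: mult_Suc_right\<close>)
  have 5: "PR D sz (reset 6) (%i. ?T i (Suc (?W i))) (%i. (?T i (Suc (?W i)))(6 := arr [2] 0))"
  proof (rule PR_reset)
    show "pbound D sz (%i. length (map bit_sym (bits_of_nat (Suc (?W i)))))"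
      by (rule pbound_mono[of _ _ "%i. Suc (?W i)"]) (use p length_bits_le in \<open>auto intro!: pbound_intros simp del: mult_Suc_right\<close>)
  qed (simp add: RS_nth numt_def)
  have b1: "numt (Suc 0) = arr [2] 0" by (simp add: numt_def bits_of_nat.simps[of "Suc 0"] bits_of_nat.simps[of 0])
  have 6: "PR D sz (incr 7) (%i. (?T i (Suc (?W i)))(6 := arr [2] 0)) (%i. ((?T i (Suc (?W i)))(6 := arr [2] 0))(7 := numt (Suc (I i))))"
    by (rule PR_incr) (use b p length_bits_le in \<open>auto simp: RS_nth intro: pbound_mono[OF p(1)]\<close>)
  have e1: "?S i 0 = ?T i (Suc 1)" if "i \<in> D" for i
    using b[OF that] by (auto simp: RS_def fun_eq_iff numeral_2_eq_2)
  have e2: "(?S i (length (c i)))(3 := arr (c i) 0) = ?B i 0" if "i \<in> D" for i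
    using b[OF that] by (auto simp: RS_def fun_eq_iff mult.commute)
  have e3: "(?B i (length (c i)))(3 := arr (c i) 0) = ?T i (?W i)" if "i \<in> D" for i
    using b[OF that] by (auto simp: RS_def fun_eq_iff)
  have s2: "PR D sz (For 3 (seqs (%t. lane (h t) ch) K ;; mv 4 Rightwards)) (%i. ?T i (Suc 1)) (%i. ?B i 0)"
    by (rule PR_cong[OF 2 e1 e2])
  have s3: "PR D sz (For 3 (mv 4 Leftwards)) (%i. ?B i 0) (%i. ?T i (?W i))" by (rule PR_cong[OF 3 refl e3])
  have s1: "PR D sz (emit_block l ;; incr 6) s (%i. ?T i (Suc 1))" by (rule PR_cong[OF 1 0 refl])
  have "PR D sz (row K l h ch r) s (%i. ((?T i (Suc (?W i)))(6 := arr [2] 0))(7 := numt (Suc (I i))))"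
    unfolding row_def by (rule PR_Seq[OF s1 PR_Seq[OF s2 PR_Seq[OF s3 PR_Seq[OF 4 PR_Seq[OF 5 6]]]]])
  then show ?thesis
  proof (rule PR_cong)
    fix i assume "i \<in> D"
    then show "((?T i (Suc (?W i)))(6 := arr [2] 0))(7 := numt (Suc (I i))) =
      (s i)(1 := outt (map bit_sym (u i @ row_enc (I i) (ty i) (3 + K * length (c i) * ?m i))), 7 := numt (Suc (I i)))"
      using b[of i] b1 by (auto simp: RS_def fun_eq_iff numeral_3_eq_3)
  qed simp
qed

definition rows_enc :: "(nat => nat => block) => nat => nat => bool list" where
  "rows_enc ty W h = concat (map (%I. row_enc I (ty I) (Suc W)) [1..<h])"

lemma enc_region_list: "enc_cubes (map vec_of_cell (region_list ty W H)) = rows_enc ty W (Suc H)"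
proof -
  have c: "concat (concat xss) = concat (map concat xss)" for xss :: "bool list list list" by (induction xss) auto
  show ?thesis by (simp add: c enc_cubes_def region_list_def rows_enc_def row_enc_def enc_block_def map_concat comp_def del: upt_Suc)
qed

lemma rows_enc_Suc: "0 < h ==> rows_enc ty W (Suc h) = rows_enc ty W h @ row_enc h (ty h) (Suc W)"
  by (simp add: rows_enc_def)

definition midr :: "nat => (nat => nat => nat => nat => bool) => nat => com" where
  "midr K cv t = row K (if t = 0 then LF else LM) (%t' cls rel. if cv rel cls t t' then HE else HX) CH (if t = K - 1 then RL else RM)"

text \<open>Tape 2 counts the groups of rows. After each group head 4 starts one place further to
  the left, so its position is always the number of the column group minus that of the row group;
  the symbol there is the relation of the two cells of the tableau.\<close>

definition main :: "nat => (nat => nat => nat => nat => bool) => com" where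
  "main K cv = row K EM (%t _ _. if t = 0 then TF else TM) TP EM ;;
    For 2 (seqs (midr K cv) K ;;
      mv 4 Leftwards) ;;
    row K EM (%t _ _. if t = K - 1 then BL else BM) TP EM"

lemma wfc_main: "8 \<le> kk ==> 3 \<le> g ==> wfc kk g (main K cv)"
  by (auto simp: main_def midr_def intro!: wfc_seqs wfc_row)

context
  fixes D :: "'i set" and sz :: "'i => nat" and s :: "'i => store" and a c z :: "'i => nat list" and R :: "'i => int => nat"
    and K :: nat and cv :: "nat => nat => nat => nat => bool"
begin

definition cf :: "'i => nat => nat => bool" where
  "cf i j l = cv (R i (int (l div K) - int (j div K))) (c i ! (l div K)) (j mod K) (l mod K)"

definition TY :: "'i => nat => nat => block" where
  "TY i = grid.ty K (length (c i)) (length (a i)) (cf i)"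

definition WD :: "'i => nat" where "WD i = grid.Wd K (length (c i)) (length (a i))"

definition gst :: "'i => nat => nat => nat => store" where
  "gst i n u w = (s i)(1 := outt (map bit_sym (rows_enc (TY i) (WD i) n)), 7 := numt n, 4 := (R i, - int u), 2 := arr (z i) (int w))"

context
  assumes K: "0 < K"
    and p: "pbound D sz (%i. length (a i))" "pbound D sz (%i. length (c i))"
    and s: "\<And>i. i \<in> D ==> s i 1 = outt [] & s i 2 = arr (z i) 0 & 0 \<notin> set (z i) & length (z i) = length (c i) & s i 3 = arr (c i) 0 & 0 \<notin> set (c i)
      & s i 4 = (R i, 0) & s i 5 = arr (a i) 0 & 0 \<notin> set (a i) & s i 6 = numt 1 & s i 7 = numt 1"
begin

lemma grid: "grid K" by (simp add: grid_def K)

lemma WD_eq: "WD i = 2 + K * length (c i) * (length (a i) + 1)"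
  by (simp add: WD_def grid.Wd_def[OF grid] grid.N_def[OF grid])

lemma lane_lt: "v < length (c i) ==> t < K ==> v * K + t < K * length (c i)"
proof -
  assume "v < length (c i)" "t < K"
  then have "v * K + t < v * K + K" "Suc v * K \<le> length (c i) * K" by (auto intro: mult_le_mono1 simp del: mult_Suc)
  then show ?thesis by (simp add: mult.commute)
qed

lemma PR_row_X:
  assumes E: "\<And>e. e \<in> E ==> d e \<in> D & zs e = sz (d e) & n e \<le> 2 + K * length (c (d e)) & 0 < n e"
    and ty: "\<And>e. e \<in> E ==> TY (d e) (n e) 1 = l & TY (d e) (n e) (WD (d e)) = r"
      "\<And>e v t. e \<in> E ==> v < length (c (d e)) ==> t < K ==>
         TY (d e) (n e) (2 + (v * K + t) * (length (a (d e)) + 1)) = h t (c (d e) ! v) (R (d e) (- int (q e) + int v))"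
      "\<And>e v t k. e \<in> E ==> v < length (c (d e)) ==> t < K ==> 0 < k ==> k \<le> length (a (d e)) ==>
         TY (d e) (n e) (2 + (v * K + t) * (length (a (d e)) + 1) + k) = ch"
  shows "PR E zs (row K l h ch r) (%e. gst (d e) (n e) (q e) (w e)) (%e. gst (d e) (Suc (n e)) (q e) (w e))"
proof -
  have pc: "pbound E zs (%e. length (c (d e)))" by (rule pbound_map[OF p(2)]) (use E in auto)
  have n: "pbound E zs n"
    by (rule pbound_mono[of _ _ "%e. 2 + K * length (c (d e))"]) (use E in \<open>auto intro!: pbound_intros pc\<close>)
  have "PR E zs (row K l h ch r) (%e. gst (d e) (n e) (q e) (w e)) (%e. (gst (d e) (n e) (q e) (w e))
    (1 := outt (map bit_sym (rows_enc (TY (d e)) (WD (d e)) (n e) @ row_enc (n e) (TY (d e) (n e)) (3 + K * length (c (d e)) * (length (a (d e)) + 1)))),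
     7 := numt (Suc (n e))))"
  proof (rule PR_row[OF n _ pc])
    show "pbound E zs (%e. length (a (d e)))" by (rule pbound_map[OF p(1)]) (use E in auto)
    show "gst (d e) (n e) (q e) (w e) 1 = outt (map bit_sym (rows_enc (TY (d e)) (WD (d e)) (n e))) & gst (d e) (n e) (q e) (w e) 3 = arr (c (d e)) 0 &
       0 \<notin> set (c (d e)) & gst (d e) (n e) (q e) (w e) 4 = (R (d e), - int (q e)) & gst (d e) (n e) (q e) (w e) 5 = arr (a (d e)) 0 & 0 \<notin> set (a (d e)) &
       gst (d e) (n e) (q e) (w e) 6 = numt 1 & gst (d e) (n e) (q e) (w e) 7 = numt (n e) & 0 < n e" if "e \<in> E" for e
      using s[of "d e"] E[OF that] by (simp add: gst_def)
    show "TY (d e) (n e) 1 = l & TY (d e) (n e) (2 + K * length (c (d e)) * (length (a (d e)) + 1)) = r" if "e \<in> E" for e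
      using ty(1)[OF that] by (simp add: WD_eq)
  qed (rule ty(2,3); assumption)+
  then show ?thesis
  proof (rule PR_cong)
    fix e assume "e \<in> E"
    moreover have "3 + K * length (c (d e)) * (length (a (d e)) + 1) = Suc (WD (d e))" by (simp add: WD_eq)
    ultimately show "(gst (d e) (n e) (q e) (w e))(1 := outt (map bit_sym (rows_enc (TY (d e)) (WD (d e)) (n e) @ row_enc (n e) (TY (d e) (n e)) (3 + K * length (c (d e)) * (length (a (d e)) + 1)))),
     7 := numt (Suc (n e))) = gst (d e) (Suc (n e)) (q e) (w e)" using E[of e] unfolding gst_def by (simp only: rows_enc_Suc fun_eq_iff) simp
  qed simp
qed

lemma PR_main:
  "PR D sz (main K cv) s (%i. gst i (K * length (c i) + 3) (length (c i)) 0)"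
proof -
  let ?N = "%i. K * length (c i)"
  have N: "grid.N K (length (c i)) = ?N i" "grid.Wd K (length (c i)) (length (a i)) = WD i" "grid.col (length (a i)) l = 2 + l * (length (a i) + 1)" for i l
    by (simp_all add: grid.N_def[OF grid] grid.col_def[OF grid] WD_def)
  note top = grid.ty_top[OF grid, where G = "length (c i)" and m = "length (a i)" and conf = "cf i" for i, unfolded N, folded TY_def]
  note bot = grid.ty_bot[OF grid, where G = "length (c i)" and m = "length (a i)" and conf = "cf i" for i, unfolded N, folded TY_def]
  note mid = grid.ty_mid[OF grid, where G = "length (c i)" and m = "length (a i)" and conf = "cf i" for i, unfolded N, folded TY_def]
  have 0: "gst i 1 0 0 = s i" if "i \<in> D" for i using s[OF that] by (auto simp: gst_def fun_eq_iff rows_enc_def)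
  have 1: "PR D sz (row K EM (%t _ _. if t = 0 then TF else TM) TP EM) (%i. gst i 1 0 0) (%i. gst i (Suc 1) 0 0)"
  proof (rule PR_row_X[where w = "%i. 0" and q = "%i. 0" and d = "%i. i" and n = "%i. 1"])
    show "TY i 1 (2 + (v * K + t) * (length (a i) + 1)) = (if t = 0 then TF else TM)" if "v < length (c i)" "t < K" for i v t
      using top(3)[OF lane_lt[OF that]] that by simp
    show "TY i 1 (2 + (v * K + t) * (length (a i) + 1) + k) = TP" if "v < length (c i)" "t < K" "0 < k" "k \<le> length (a i)" for i v t k
      using top(4)[OF lane_lt[OF that(1,2)] that(3,4)] .
  qed (use top in auto)
  have 2: "PR D sz (For 2 (seqs (midr K cv) K ;; mv 4 Leftwards))
     (%i. gst i (2 + 0 * K) 0 0) (%i. (gst i (2 + length (z i) * K) (length (z i)) 0)(2 := arr (z i) 0))"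
  proof (rule PR_For)
    show "pbound D sz (%i. length (z i))" by (rule pbound_mono[OF p(2)]) (use s in auto)
    show "0 \<notin> set (z i)" "gst i (2 + 0 * K) 0 0 2 = arr (z i) 0" if "i \<in> D" for i using s[OF that] by (auto simp: gst_def)
    let ?E = "{(i, u). i \<in> D & u < length (z i)}" and ?sz = "%(i, u). sz i"
    have "PR ?E ?sz (seqs (midr K cv) K)
      (%e. gst (fst e) (2 + (snd e * K + 0)) (snd e) (snd e)) (%e. gst (fst e) (2 + (snd e * K + K)) (snd e) (snd e))"
    proof (rule PR_seqs)
      fix t assume t: "t < K"
      have "PR ?E ?sz (midr K cv t)
         (%e. gst (fst e) (2 + (snd e * K + t)) (snd e) (snd e)) (%e. gst (fst e) (Suc (2 + (snd e * K + t))) (snd e) (snd e))"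
        unfolding midr_def
      proof (rule PR_row_X)
        fix e assume "e \<in> ?E"
        then obtain i u where e: "e = (i, u)" "i \<in> D" "u < length (c i)" using s by fastforce
        note l = lane_lt[OF e(3) t]
        have ut: "(u * K + t) mod K = t" "(u * K + t) div K = u" using t by auto
        have sw: "2 + (u * K + t) = u * K + t + 2" by simp
        show "fst e \<in> D & ?sz e = sz (fst e) & 2 + (snd e * K + t) \<le> 2 + K * length (c (fst e)) & 0 < 2 + (snd e * K + t)"
          using e l by auto
        show "TY (fst e) (2 + (snd e * K + t)) 1 = (if t = 0 then LF else LM) & TY (fst e) (2 + (snd e * K + t)) (WD (fst e)) = (if t = K - 1 then RL else RM)"
          unfolding e fst_conv snd_conv sw mid(1)[OF l] mid(2)[OF l] ut by simp
        fix v t' assume v: "v < length (c (fst e))" and t': "t' < K"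
        have l': "v * K + t' < K * length (c i)" using lane_lt[of v i t'] v t' e by simp
        have vt: "(v * K + t') mod K = t'" "(v * K + t') div K = v" using t' by auto
        show "TY (fst e) (2 + (snd e * K + t)) (2 + (v * K + t') * (length (a (fst e)) + 1)) =
          (if cv (R (fst e) (- int (snd e) + int v)) (c (fst e) ! v) t t' then HE else HX)"
          unfolding e fst_conv snd_conv sw mid(3)[OF l l'] cf_def ut vt by (simp add: algebra_simps)
        fix k assume k: "0 < k" "k \<le> length (a (fst e))"
        show "TY (fst e) (2 + (snd e * K + t)) (2 + (v * K + t') * (length (a (fst e)) + 1) + k) = CH"
          using mid(4)[OF l l' k(1)] k unfolding e fst_conv snd_conv sw by simp
      qed
      then show "PR ?E ?sz (midr K cv t)
         (%e. gst (fst e) (2 + (snd e * K + t)) (snd e) (snd e)) (%e. gst (fst e) (2 + (snd e * K + Suc t)) (snd e) (snd e))" by simp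
    qed
    moreover have "PR ?E ?sz (mv 4 Leftwards) (%e. gst (fst e) (2 + (snd e * K + K)) (snd e) (snd e)) (%e. gst (fst e) (2 + (Suc (snd e)) * K) (Suc (snd e)) (snd e))"
      by (rule PR_mv) (auto simp: gst_def fun_eq_iff algebra_simps)
    ultimately have "PR ?E ?sz (seqs (midr K cv) K ;; mv 4 Leftwards)
      (%e. gst (fst e) (2 + (snd e * K + 0)) (snd e) (snd e)) (%e. gst (fst e) (2 + (Suc (snd e)) * K) (Suc (snd e)) (snd e))" by (rule PR_Seq)
    then show "PR ?E ?sz (seqs (midr K cv) K ;; mv 4 Leftwards)
      (%(i, u). (gst i (2 + u * K) u 0)(2 := arr (z i) (int u))) (%(i, u). (gst i (2 + Suc u * K) (Suc u) 0)(2 := arr (z i) (int u)))"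
      by (rule PR_cong) (auto simp: gst_def)
  qed
  have 3: "PR D sz (row K EM (%t _ _. if t = K - 1 then BL else BM) TP EM) (%i. gst i (?N i + 2) (length (c i)) 0) (%i. gst i (Suc (?N i + 2)) (length (c i)) 0)"
  proof (rule PR_row_X[where w = "%i. 0" and q = "%i. length (c i)" and d = "%i. i" and n = "%i. ?N i + 2"])
    show "TY i (?N i + 2) (2 + (v * K + t) * (length (a i) + 1)) = (if t = K - 1 then BL else BM)" if "v < length (c i)" "t < K" for i v t
      using bot(3)[OF lane_lt[OF that]] that by simp
    show "TY i (?N i + 2) (2 + (v * K + t) * (length (a i) + 1) + k) = TP" if "v < length (c i)" "t < K" "0 < k" "k \<le> length (a i)" for i v t k
      using bot(4)[OF lane_lt[OF that(1,2)] that(3,4)] .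
  qed (use bot in auto)
  have 4: "(gst i (2 + length (z i) * K) (length (z i)) 0)(2 := arr (z i) 0) = gst i (?N i + 2) (length (c i)) 0" if "i \<in> D" for i
    using s[OF that] by (simp add: gst_def mult.commute)
  have 5: "gst i (Suc 1) 0 0 = gst i (2 + 0 * K) 0 0" for i by (simp add: numeral_2_eq_2)
  have 6: "Suc (?N i + 2) = ?N i + 3" for i by simp
  show ?thesis unfolding main_def
    by (rule PR_Seq[OF PR_cong[OF 1 0 5] PR_Seq[OF PR_cong[OF 2 refl 4] 3[unfolded 6]]])
qed

end

end

section \<open>Tableaux of computations\<close>

type_synonym ltype = "nat \<times> nat list \<times> (nat \<times> int) list"

locale tableau =
  fixes M :: machine
  assumes wf: "wf_machine M"
begin

abbreviation "kt \<equiv> ntapes M"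

text \<open>Makes the step total: a halted machine stays as it is, and so does a machine that asks,
  since without an oracle every query gets stuck.\<close>

definition dl :: "nat => nat list => nat \<times> (nat \<times> dir) list" where
  "dl q a = (if q = 1 \<or> q = 2 then (q, map (%s. (s, Stay)) a) else delta M q a)"

definition pnext :: "config => config" where
  "pnext c = (fst (dl (fst c) (map scanned (snd c))), map2 act (snd (dl (fst c) (map scanned (snd c)))) (snd c))"

definition valid :: "config => bool" where
  "valid c \<longleftrightarrow> fst c < nstates M & length (snd c) = kt & (\<forall>j<kt. \<forall>z. fst (snd c ! j) z < nsyms M)"

text \<open>A cell of the tableau holds the view of a configuration from one tape position.  Recording on which side of the
  head the position lies makes the head unique in every row that is consistent between neighbours.\<close>

definition loc :: "config => int => ltype" where
  "loc c z = (fst c, map scanned (snd c), map (%t. (fst t z, sgn (z - snd t))) (snd c))"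

definition sy :: "ltype => nat => nat" where "sy t j = fst (snd (snd t) ! j)"
definition fl :: "ltype => nat => int" where "fl t j = snd (snd (snd t) ! j)"

text \<open>Two views are consistent if some configuration shows both. No explicit rule is needed,
  because there are only finitely many views and the table of consistent pairs becomes a constant of
  the reduction.\<close>

definition hz :: "ltype => ltype => bool" where
  "hz t t' \<longleftrightarrow> (\<exists>c z. valid c & t = loc c z & t' = loc c (z + 1))"
definition vt :: "int => ltype => ltype => bool" where
  "vt d t t' \<longleftrightarrow> (\<exists>c z. valid c & t = loc c z & t' = loc (pnext c) (z + d))"

lemma loc_simps: "valid c ==> j < kt ==> sy (loc c z) j = fst (snd c ! j) z" "valid c ==> j < kt ==> fl (loc c z) j = sgn (z - snd (snd c ! j))"
  "fst (loc c z) = fst c" "fst (snd (loc c z)) = map scanned (snd c)"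
  by (auto simp: loc_def sy_def fl_def valid_def)

lemma loc_eqI:
  assumes "valid c" "valid c'" "fst c = fst c'" "map scanned (snd c) = map scanned (snd c')"
    "\<And>j. j < kt ==> sy (loc c z) j = sy (loc c' z') j" "\<And>j. j < kt ==> fl (loc c z) j = fl (loc c' z') j"
  shows "loc c z = loc c' z'"
  using assms unfolding loc_def sy_def fl_def valid_def by (auto intro!: nth_equalityI simp: prod_eq_iff)

lemma dl_wf:
  assumes "q < nstates M" "length a = kt" "set a \<subseteq> {..<nsyms M}"
  shows "fst (dl q a) < nstates M" "length (snd (dl q a)) = kt" "j < kt ==> fst (snd (dl q a) ! j) < nsyms M"
proof -
  have "\<forall>q ss. q < nstates M & length ss = kt & set ss \<subseteq> {..<nsyms M} -->
        (case delta M q ss of (q', acts) => q' < nstates M & length acts = kt & fst ` set acts \<subseteq> {..<nsyms M})"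
    using wf by (simp add: wf_machine_def)
  then have d: "case delta M q a of (q', acts) => q' < nstates M & length acts = kt & fst ` set acts \<subseteq> {..<nsyms M}"
    by (elim allE impE) (use assms in auto)
  have a: "a ! j < nsyms M" if "j < kt" for j using subsetD[OF assms(3) nth_mem[of j a]] assms(2) that by simp
  obtain q' acts where e: "delta M q a = (q', acts)" by fastforce
  have d': "q' < nstates M" "length acts = kt" "fst ` set acts \<subseteq> {..<nsyms M}" using d unfolding e by simp_all
  show "fst (dl q a) < nstates M" "length (snd (dl q a)) = kt" using d' assms(1,2) by (simp_all add: dl_def e)
  have "fst (acts ! j) < nsyms M" if "j < kt"
    using subsetD[OF d'(3) imageI[OF nth_mem[of j acts]]] that d'(2) by simp
  then show "j < kt ==> fst (snd (dl q a) ! j) < nsyms M" using a assms(2) by (simp add: dl_def e)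
qed

lemma valid_scanned: "valid c ==> length (map scanned (snd c)) = kt & set (map scanned (snd c)) \<subseteq> {..<nsyms M}"
  unfolding valid_def by (clarsimp simp: in_set_conv_nth scanned_def) (metis fst_conv)

lemma pnext_nth:
  assumes "valid c" "j < kt"
  shows "snd (pnext c) ! j = act (snd (dl (fst c) (map scanned (snd c))) ! j) (snd c ! j)"
  using dl_wf(2)[of "fst c" "map scanned (snd c)"] valid_scanned[OF assms(1)] assms
  by (simp add: pnext_def valid_def)

lemma valid_pnext: assumes "valid c" shows "valid (pnext c)"
proof -
  note w = dl_wf[of "fst c" "map scanned (snd c)"] and s = valid_scanned[OF assms]
  have "fst (snd (pnext c) ! j) z < nsyms M" if "j < kt" for j z
    using w(3)[OF _ _ _ that] s assms that by (auto simp: pnext_nth valid_def act_def)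
  moreover have "fst (pnext c) < nstates M" "length (snd (pnext c)) = kt"
    using w(1,2) s assms by (auto simp: pnext_def valid_def)
  ultimately show ?thesis by (simp add: valid_def)
qed

lemma hz_props:
  assumes "hz t t'"
  shows "fst (snd t) = fst (snd t')" "j < kt ==> 0 \<le> fl t j ==> fl t' j = 1" "j < kt ==> fl t' j \<le> 0 ==> fl t j = - 1"
  using assms by (auto simp: hz_def loc_simps sgn_if split: if_splits)

text \<open>The flags spread from the heads: to the right of a flag that is at least 0 all flags are
  1, to the left of a flag that is at most 0 all are -1. The list of scanned symbols is common to
  the whole row, and where a flag is 0 it contains the symbol of that very cell.\<close>

lemma row_eq:
  fixes lo hi :: int
  assumes hz: "\<And>z. lo \<le> z ==> z < hi ==> hz (t z) (t (z + 1))" and lh: "lo < hi" and c: "valid c"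
    and q: "\<And>z. lo \<le> z ==> z \<le> hi ==> fst (t z) = fst c"
    and sy: "\<And>z j. lo \<le> z ==> z \<le> hi ==> j < kt ==> sy (t z) j = fst (snd c ! j) z"
    and hd: "\<And>j. j < kt ==> lo \<le> snd (snd c ! j) & snd (snd c ! j) \<le> hi & fl (t (snd (snd c ! j))) j = 0"
    and z: "lo \<le> z" "z \<le> hi"
  shows "t z = loc c z"
proof -
  have ex: "\<exists>c' z'. valid c' & t z = loc c' z'" if "lo \<le> z" "z \<le> hi" for z
  proof (cases "z < hi")
    case True then show ?thesis using hz[OF that(1)] by (auto simp: hz_def)
  next
    case False
    then have "hz (t (z - 1)) (t (z - 1 + 1))" using that lh by (intro hz) auto
    then show ?thesis by (auto simp: hz_def)
  qed
  have fl: "fl (t z) j = sgn (z - snd (snd c ! j))" if j: "j < kt" and z: "lo \<le> z" "z \<le> hi" for j z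
  proof -
    let ?h = "snd (snd c ! j)"
    have r: "?h + int n \<le> hi ==> fl (t (?h + int n)) j = (if n = 0 then 0 else 1)" for n
    proof (induction n)
      case (Suc n)
      then have "0 \<le> fl (t (?h + int n)) j" by simp
      moreover have "hz (t (?h + int n)) (t (?h + int n + 1))" using hd[OF j] Suc.prems by (intro hz) auto
      ultimately show ?case using hz_props(2)[OF _ j] by (simp add: algebra_simps)
    qed (use hd[OF j] in simp)
    have l: "lo \<le> ?h - int n ==> fl (t (?h - int n)) j = (if n = 0 then 0 else - 1)" for n
    proof (induction n)
      case (Suc n)
      then have "fl (t (?h - int n)) j \<le> 0" by simp
      moreover have "hz (t (?h - int n - 1)) (t (?h - int n - 1 + 1))" using hd[OF j] Suc.prems by (intro hz) auto
      ultimately show ?case using hz_props(3)[OF _ j] by (simp add: algebra_simps)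
    qed (use hd[OF j] in simp)
    consider "z = ?h + int (nat (z - ?h))" "?h \<le> z" | "z = ?h - int (nat (?h - z))" "z < ?h" by linarith
    then show ?thesis
    proof cases
      case 1 then show ?thesis using r[of "nat (z - ?h)"] z by (auto simp: sgn_if)
    next
      case 2 then show ?thesis using l[of "nat (?h - z)"] z by (auto simp: sgn_if)
    qed
  qed
  have scc: "lo + int n \<le> hi ==> fst (snd (t (lo + int n))) = fst (snd (t lo))" for n
  proof (induction n)
    case (Suc n)
    have "hz (t (lo + int n)) (t (lo + int n + 1))" using Suc.prems by (intro hz) auto
    from hz_props(1)[OF this] show ?case using Suc by (simp add: algebra_simps)
  qed simp
  have sc: "fst (snd (t z)) = fst (snd (t lo))" if "lo \<le> z" "z \<le> hi" for z
    using scc[of "nat (z - lo)"] that by simp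
  obtain c' z' where c': "valid c'" "t z = loc c' z'" using ex[OF z] by blast
  have "map scanned (snd c') = map scanned (snd c)"
  proof (rule nth_equalityI)
    show "length (map scanned (snd c')) = length (map scanned (snd c))" using c c' by (simp add: valid_def)
    fix j assume "j < length (map scanned (snd c'))"
    then have j: "j < kt" using c' by (simp add: valid_def)
    let ?h = "snd (snd c ! j)"
    obtain c2 z2 where c2: "valid c2" "t ?h = loc c2 z2" using ex hd[OF j] by blast
    have "fl (loc c2 z2) j = 0" using hd[OF j] c2 by simp
    then have "z2 = snd (snd c2 ! j)" using c2 j by (simp add: loc_simps sgn_if split: if_splits)
    then have "map scanned (snd c2) ! j = sy (loc c2 z2) j" using c2 j by (simp add: loc_simps scanned_def valid_def)
    also have "\<dots> = fst (snd c ! j) ?h" using sy[of ?h j] hd[OF j] j c2 by simp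
    also have "\<dots> = map scanned (snd c) ! j" using c j by (simp add: scanned_def valid_def)
    also have "map scanned (snd c2) ! j = map scanned (snd c') ! j"
      using sc[OF z] sc[of ?h] hd[OF j] c2(2) c'(2) by (simp add: loc_def)
    finally show "map scanned (snd c') ! j = map scanned (snd c) ! j" .
  qed
  then show ?thesis unfolding c'(2)
    using q[OF z] sy[OF z] fl[OF _ z] c c' by (intro loc_eqI) (auto simp: loc_simps)
qed

definition delt :: "dir => int" where "delt d = (case d of Leftwards => - 1 | Stay => 0 | Rightwards => 1)"

lemma act_simps: "snd (act a t) = snd t + delt (snd a)" "fst (act a t) z = (if z = snd t then fst a else fst t z)"
  by (auto simp: act_def delt_def split: dir.splits)

text \<open>State and symbols of a new cell follow from the cell above it. Where the new head is
  follows from the cell of the old head, displaced by the move; hence the displacements -1, 0 and 1.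
  The heads must be strictly inside for these cells to exist.\<close>

lemma row_step:
  fixes lo hi :: int
  assumes hz: "\<And>z. lo \<le> z ==> z < hi ==> hz (t z) (t (z + 1))" and lh: "lo < hi" and c: "valid c"
    and vt: "\<And>z d. lo \<le> z ==> z \<le> hi ==> lo \<le> z + d ==> z + d \<le> hi ==> \<bar>d\<bar> \<le> 1 ==> vt d (loc c z) (t (z + d))"
    and hd: "\<And>j. j < kt ==> lo < snd (snd c ! j) & snd (snd c ! j) < hi"
    and z: "lo \<le> z" "z \<le> hi"
  shows "t z = loc (pnext c) z"
proof (rule row_eq[where lo = lo and hi = hi and t = t])
  let ?d = "dl (fst c) (map scanned (snd c))"
  have V: "\<exists>c' z'. valid c' & fst c' = fst c & map scanned (snd c') = map scanned (snd c) & t (z + d) = loc (pnext c') (z' + d)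
     & (\<forall>j<kt. fst (snd c' ! j) z' = fst (snd c ! j) z & sgn (z' - snd (snd c' ! j)) = sgn (z - snd (snd c ! j)))"
    if zd: "lo \<le> z" "z \<le> hi" "lo \<le> z + d" "z + d \<le> hi" "\<bar>d\<bar> \<le> 1" for z d
  proof -
    obtain c' z' where c': "valid c'" "loc c z = loc c' z'" "t (z + d) = loc (pnext c') (z' + d)" using vt[OF zd] by (auto simp: vt_def)
    have "fst (loc c z) = fst (loc c' z')" "fst (snd (loc c z)) = fst (snd (loc c' z'))" using c'(2) by simp_all
    moreover have "sy (loc c z) j = sy (loc c' z') j" "fl (loc c z) j = fl (loc c' z') j" for j using c'(2) by simp_all
    ultimately show ?thesis using c c' unfolding loc_simps(3,4) by (intro exI[of _ c'] exI[of _ z']) (simp add: loc_simps(1,2)[symmetric])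
  qed
  show "fst (t z) = fst (pnext c)" if z: "lo \<le> z" "z \<le> hi" for z
    using V[of z 0] z by (auto simp: loc_simps pnext_def)
  show "sy (t z) j = fst (snd (pnext c) ! j) z" if z: "lo \<le> z" "z \<le> hi" and j: "j < kt" for z j
  proof -
    obtain c' z' where c': "valid c'" "fst c' = fst c" "map scanned (snd c') = map scanned (snd c)" "t z = loc (pnext c') z'"
      "\<forall>j<kt. fst (snd c' ! j) z' = fst (snd c ! j) z & sgn (z' - snd (snd c' ! j)) = sgn (z - snd (snd c ! j))"
      using V[of z 0] z by auto
    have "z' = snd (snd c' ! j) \<longleftrightarrow> z = snd (snd c ! j)" using spec[OF c'(5), of j] j by (auto simp: sgn_if split: if_splits)
    then show ?thesis using c' j c by (simp add: loc_simps valid_pnext pnext_nth act_simps)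
  qed
  fix j assume j: "j < kt"
  let ?h = "snd (snd c ! j)" and ?e = "delt (snd (snd ?d ! j))"
  have e: "\<bar>?e\<bar> \<le> 1" by (auto simp: delt_def split: dir.splits)
  have h': "snd (snd (pnext c) ! j) = ?h + ?e" by (simp add: pnext_nth[OF c j] act_simps)
  have b: "lo \<le> ?h + ?e" "?h + ?e \<le> hi" using hd[OF j] e by linarith+
  obtain c' z' where c': "valid c'" "fst c' = fst c" "map scanned (snd c') = map scanned (snd c)" "t (?h + ?e) = loc (pnext c') (z' + ?e)"
      "sgn (z' - snd (snd c' ! j)) = sgn (?h - ?h)"
    using V[of ?h ?e] hd[OF j] b e j by (metis order_less_imp_le)
  have "z' = snd (snd c' ! j)" using c'(5) by (simp add: sgn_if split: if_splits)
  then have "fl (t (?h + ?e)) j = 0" using c' j by (simp add: loc_simps valid_pnext pnext_nth act_simps)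
  then show "lo \<le> snd (snd (pnext c) ! j) & snd (snd (pnext c) ! j) \<le> hi & fl (t (snd (snd (pnext c) ! j))) j = 0"
    using b h' by simp
qed (fact hz lh valid_pnext[OF c] z)+

end

section \<open>Linear layout of the tableau and its table of conflicts\<close>

lemma nth_concat_rows:
  assumes "\<And>t. t < T ==> length (r t) = S" "t < T" "k < S"
  shows "concat (map r [0..<T]) ! (t * S + k) = r t ! k" "length (concat (map r [0..<T])) = T * S"
proof -
  have len: "(\<And>t. t < T ==> length (r t) = S) ==> length (concat (map r [0..<T])) = T * S" for T
    by (induction T) auto
  show "length (concat (map r [0..<T])) = T * S" by (rule len) (rule assms(1))
  show "concat (map r [0..<T]) ! (t * S + k) = r t ! k"
    using assms(1,2)
  proof (induction T)
    case (Suc T)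
    show ?case
    proof (cases "t = T")
      case True
      then show ?thesis using len[of T] Suc.prems(1) by (simp add: nth_append)
    next
      case False
      then have "t < T" using Suc.prems by simp
      moreover have "t * S + k < T * S" using \<open>t < T\<close> assms(3) mult_le_mono1[of "Suc t" T S] by simp
      ultimately show ?thesis using Suc len[of T] by (simp add: nth_append)
    qed
  qed simp
qed

text \<open>Rows of length \<open>S\<close> are written one after the other, so the difference of
  two indices tells how the cells are related: 1 the same cell, 2 the right neighbour, 3 to 5 the
  neighbours in the next row. Both 0 and 6 mean no relation; 6 fills the gap so that the word on the
  tape has no blank inside.\<close>

definition relS :: "nat => int => nat" where
  "relS S d = (if d = 0 then 1 else if d = 1 then 2 else if d = int S - 1 then 3 else if d = int S then 4 else if d = int S + 1 then 5
    else if 0 \<le> d & d \<le> int S then 6 else 0)"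

text \<open>Classes of cells: 1 and 2 input bits, 3 separator, 4 wall, 5 blank to the left of the
  input, 6 place of the witness, 7 no condition, 8 acceptance. The margins keep the heads off the
  walls for \<open>W + 1\<close> steps.\<close>

definition rowc :: "bool list => nat => nat => nat list" where
  "rowc x W t = (if t = 0 then [4, 5, 5] @ replicate W 5 @ map bit_sym x @ [3, 6] @ replicate W 6 @ [4]
     else if t \<le> W then [4, 7, 7] @ replicate W 7 @ [7, 7] @ replicate (length x) 7 @ replicate W 7 @ [4]
     else [4, 7, 7] @ replicate W 7 @ [8, 7] @ replicate (length x) 7 @ replicate W 7 @ [4])"

definition cls :: "bool list => nat => nat list" where
  "cls x W = concat (map (rowc x W) [0..<W + 2])"

definition rowlen :: "bool list => nat => nat" where "rowlen x W = 2 * W + length x + 6"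

definition cls_of :: "bool list => int => nat" where
  "cls_of x z = (if z < 0 then 5 else if z < int (length x) then bit_sym (x ! nat z) else if z = int (length x) then 3 else 6)"

lemma length_rowc: "length (rowc x W t) = rowlen x W"
  by (simp add: rowc_def rowlen_def)

lemma rowc_wall: "rowc x W t ! 0 = 4" "rowc x W t ! (rowlen x W - 1) = 4"
  by (auto simp: rowc_def rowlen_def nth_append nth_Cons split: nat.splits)

lemma rowc_nth:
  assumes "- int W - 2 \<le> z" "z \<le> int (length x) + int W + 1"
  shows "rowc x W t ! nat (z + int W + 3) = (if t = 0 then cls_of x z else if W < t & z = 0 then 8 else 7)"
proof -
  define k where "k = nat (z + int W + 3)"
  have z: "z = int k - int W - 3" "0 < k" "k < 2 * W + length x + 5" using assms by (auto simp: k_def)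
  have p: "([4, 7, 7] @ replicate W 7 @ [b, 7] @ replicate (length x) 7 @ replicate W 7 @ [4 :: nat]) ! k = (if k = W + 3 then b else 7)" for b
  proof -
    consider "k < 3" | "3 \<le> k" "k < W + 3" | "k = W + 3" | "k = W + 4" | "W + 5 \<le> k" "k < W + 5 + length x" | "W + 5 + length x \<le> k" by linarith
    then show ?thesis by cases (use z in \<open>auto simp: nth_append nth_Cons' numeral_3_eq_3\<close>)
  qed
  consider "t = 0" | "0 < t" "t \<le> W" | "W < t" by linarith
  then show ?thesis
  proof cases
    case 1
    consider "k < 3" | "3 \<le> k" "k < W + 3" | "W + 3 \<le> k" "k < W + 3 + length x" | "k = W + 3 + length x" | "k = W + 4 + length x" | "W + 5 + length x \<le> k" by linarith
    then have "([4, 5, 5] @ replicate W 5 @ map bit_sym x @ [3, 6] @ replicate W 6 @ [4]) ! k = cls_of x z"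
    proof cases
      case 3
      then have "z = int (k - W - 3)" using z by simp
      then have "nat z = k - W - 3" "\<not> z < 0" "z < int (length x)" "\<not> k - Suc (Suc (Suc 0)) < W" "k - Suc (Suc (Suc W)) < length x" using 3 by auto
      then show ?thesis using 3 by (simp add: cls_of_def nth_append nth_Cons' numeral_3_eq_3)
    qed (use z in \<open>auto simp: cls_of_def nth_append nth_Cons' numeral_3_eq_3\<close>)
    then show ?thesis using 1 by (simp add: rowc_def k_def)
  next
    case 2
    then have e: "rowc x W t = [4, 7, 7] @ replicate W 7 @ [7, 7] @ replicate (length x) 7 @ replicate W 7 @ [4]" by (simp add: rowc_def)
    show ?thesis unfolding k_def[symmetric] e p using 2 by simp
  next
    case 3
    then have e: "rowc x W t = [4, 7, 7] @ replicate W 7 @ [8, 7] @ replicate (length x) 7 @ replicate W 7 @ [4]" by (simp add: rowc_def)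
    show ?thesis unfolding k_def[symmetric] e p using 3 z by simp
  qed
qed

context tableau begin

definition inp :: "bool list => bool list => nat list" where "inp x y = map bit_sym x @ [3] @ map bit_sym y"

definition cfg :: "bool list => bool list => nat => config" where "cfg x y t = (pnext ^^ t) (initial M (inp x y))"

text \<open>In the first row any input that has the same class at some position may provide the
  view; so the condition depends on the class alone and the table is the same for all
  inputs.\<close>

definition allowed :: "nat => ltype option => bool" where
  "allowed k o' = (case o' of None => k = 4
    | Some t => k = 7 \<or> k = 8 & fst t = 1 & sy t 0 = 2 \<or> (\<exists>x y z. t = loc (initial M (inp x y)) z & k = cls_of x z))"

text \<open>A conflict between two choices. For the same cell different views always conflict, as
  \<open>core_count\<close> demands. At the place of the witness a blank must be followed by blanks,
  so that what is written there is one word. Between different cells a wall, with view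
  \<open>None\<close>, conflicts with nothing.\<close>

definition cvt :: "nat => nat => ltype option => ltype option => bool" where
  "cvt rel k o1 o2 = (if rel = 1 then \<not> (o1 = o2 & allowed k o2) else
    case (o1, o2) of (Some t, Some t') =>
      if rel = 2 then \<not> (hz t t' & (k = 6 --> sy t 0 = 0 --> sy t' 0 = 0))
      else if rel \<in> {3, 4, 5} then \<not> vt (int rel - 4) t t' else False
    | _ => False)"

definition types :: "ltype option set" where
  "types = insert None (Some ` {loc c z | c z. valid c})"

definition K :: nat where "K = card types"
definition enum :: "nat => ltype option" where
  "enum = (SOME h. bij_betw h {..<K} types)"
definition cv :: "nat => nat => nat => nat => bool" where "cv rel k t t' = cvt rel k (enum t) (enum t')"

lemma finite_types: "finite types"
proof -
  let ?A = "{..<nstates M} \<times> {l. set l \<subseteq> {..<nsyms M} & length l = kt} \<times> {l. set l \<subseteq> {..<nsyms M} \<times> {- 1, 0, 1} & length l = kt}"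
  have "loc c z \<in> ?A" if "valid c" for c z
  proof -
    have "set (map (%t. (fst t z, sgn (z - snd t))) (snd c)) \<subseteq> {..<nsyms M} \<times> {- 1, 0, 1}"
      using that by (clarsimp simp: valid_def in_set_conv_nth sgn_if) (metis fst_conv)
    then show ?thesis using valid_scanned[OF that] that unfolding loc_def valid_def by simp
  qed
  then have "{loc c z | c z. valid c} \<subseteq> ?A" by blast
  moreover have "finite ?A" by (intro finite_cartesian_product finite_lists_length_eq) auto
  ultimately show ?thesis unfolding types_def using finite_subset by blast
qed

lemma K_pos: "0 < K" using finite_types by (auto simp: K_def types_def card_gt_0_iff)

lemma enum_bij: "bij_betw enum {..<K} types"
proof -
  have "\<exists>h. bij_betw h {..<K} types" using ex_bij_betw_nat_finite[OF finite_types] by (simp add: K_def atLeast0LessThan)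
  then show ?thesis unfolding enum_def by (rule someI_ex)
qed

lemma diag: "t < K ==> t' < K ==> t \<noteq> t' ==> cv (relS S 0) k t t'"
  using enum_bij by (auto simp: cv_def cvt_def relS_def bij_betw_def dest: inj_onD)

lemma initial_nth: "snd (initial M s) ! 0 = tape_of s" "0 < j ==> j < kt ==> snd (initial M s) ! j = tape_of []"
  by (auto simp: initial_def nth_Cons')

lemma kt_pos: "0 < kt" using wf by (simp add: wf_machine_def)

lemma init_sym: "fst (tape_of (inp x y)) z = (if z < 0 then 0 else if z < int (length x) then bit_sym (x ! nat z) else if z = int (length x) then 3
   else if z \<le> int (length x) + int (length y) then bit_sym (y ! nat (z - int (length x) - 1)) else 0)"
proof -
  have "nat z - length x - 1 = nat (z - int (length x) - 1)" by simp
  then show ?thesis by (auto simp: tape_of_def inp_def nth_append nth_Cons' nat_less_iff)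
qed

lemma snd_tape_of [simp]: "snd (tape_of s) = 0" by (simp add: tape_of_def)

lemma valid_initial: "valid (initial M (inp x y))"
proof -
  have "bit_sym b < 4" for b by (cases b) auto
  moreover have g: "4 \<le> nsyms M" "0 < nstates M" "2 \<le> kt" using wf by (auto simp: wf_machine_def)
  ultimately have b: "bit_sym b < nsyms M" for b using order_less_le_trans by blast
  have "fst (tape_of (inp x y)) z < nsyms M" "fst (tape_of []) z < nsyms M" for z
    using g b unfolding init_sym by (auto simp: tape_of_def)
  then have "fst (snd (initial M (inp x y)) ! j) z < nsyms M" if "j < kt" for j z
    using initial_nth(1)[of "inp x y"] initial_nth(2)[of j "inp x y"] that by (cases "j = 0") auto
  then show ?thesis using g by (auto simp: valid_def initial_def)
qed

lemma valid_cfg: "valid (cfg x y t)"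
  by (induction t) (simp_all add: cfg_def valid_initial valid_pnext)

lemma cfg_Suc: "cfg x y (Suc t) = pnext (cfg x y t)" by (simp add: cfg_def)

lemma head_bound: "j < kt ==> \<bar>snd (snd (cfg x y t) ! j)\<bar> \<le> int t"
proof (induction t)
  case 0
  then show ?case by (cases "j = 0") (auto simp: cfg_def initial_nth)
next
  case (Suc t)
  have "\<bar>delt d\<bar> \<le> 1" for d by (auto simp: delt_def split: dir.splits)
  from this[of "snd (snd (dl (fst (cfg x y t)) (map scanned (snd (cfg x y t)))) ! j)"]
  show ?case using Suc by (simp add: cfg_Suc pnext_nth[OF valid_cfg] act_simps)
qed

lemma step_pnext: "step M Map.empty c c' ==> pnext c = c'"
  by (erule step.cases) (auto simp: pnext_def dl_def)

lemma steps_pnext: "(step M Map.empty ^^ k) c c' ==> (pnext ^^ k) c = c'"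
  by (induction k arbitrary: c') (auto dest: step_pnext)

lemma pnext_halt: assumes "valid c" "fst c = 1" shows "pnext c = c"
proof (rule prod_eqI)
  show "fst (pnext c) = fst c" using assms by (simp add: pnext_def dl_def)
  show "snd (pnext c) = snd c" using assms by (auto simp: pnext_def dl_def act_def scanned_def intro!: nth_equalityI)
qed

lemma cfg_halt: "fst (cfg x y k) = 1 ==> k \<le> l ==> cfg x y l = cfg x y k"
proof (induction l)
  case (Suc l)
  then show ?case by (cases "k = Suc l") (auto simp: cfg_Suc pnext_halt valid_cfg)
qed simp

text \<open>A halted configuration no longer changes, so the verdict can be read at any fixed time
  after the bound, from the first cell of tape 0.\<close>

lemma accept:
  assumes "outputs_within M Map.empty (inp x y) b [r]"
  shows "fst (cfg x y t) = 1 & fst (snd (cfg x y t) ! 0) 0 = 2 ==> r" "b \<le> t ==> r ==> fst (cfg x y t) = 1 & fst (snd (cfg x y t) ! 0) 0 = 2"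
proof -
  obtain k ts where k: "k \<le> b" "(step M Map.empty ^^ k) (initial M (inp x y)) (1, ts)" "holds_word (ts ! 0) [r]"
    using assms by (auto simp: outputs_within_def)
  have c: "cfg x y k = (1, ts)" using steps_pnext[OF k(2)] by (simp add: cfg_def)
  have s: "fst (ts ! 0) 0 = bit_sym r" using k(3) by (simp add: holds_word_def)
  show "r" if h: "fst (cfg x y t) = 1 & fst (snd (cfg x y t) ! 0) 0 = 2"
  proof -
    have "cfg x y t = (1, ts)" using cfg_halt[of x y k t] cfg_halt[of x y t k] h c by (cases "k \<le> t") auto
    then show r using h s by (cases r) auto
  qed
  show "fst (cfg x y t) = 1 & fst (snd (cfg x y t) ! 0) 0 = 2" if "b \<le> t" r
    using cfg_halt[of x y k t] c s k(1) that by simp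
qed

end

lemma cls_of_range: "cls_of x z \<in> {1, 2, 3, 5, 6}"
  by (cases "x ! nat z") (auto simp: cls_of_def)

lemma cls_of_6: "cls_of x z = 6 \<longleftrightarrow> int (length x) < z"
  by (cases "x ! nat z") (auto simp: cls_of_def)

section \<open>Fillings without conflicts are the accepting witnesses\<close>

context tableau begin

context
  fixes x :: "bool list" and W :: nat
begin

abbreviation "S \<equiv> rowlen x W"
abbreviation "L \<equiv> (W + 2) * S"
abbreviation "lo \<equiv> - int W - 2"
abbreviation "hi \<equiv> int (length x) + int W + 1"

definition idx :: "nat => int => nat" where "idx t z = t * S + nat (z + int W + 3)"

definition sig :: "bool list => nat => ltype option" where
  "sig y u = (if u mod S = 0 \<or> u mod S = S - 1 then None else Some (loc (cfg x y (u div S)) (int (u mod S) - int W - 3)))"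

lemma S_big: "6 \<le> S" by (simp add: rowlen_def)

lemma cls_nth: "t < W + 2 ==> k < S ==> cls x W ! (t * S + k) = rowc x W t ! k"
  unfolding cls_def by (rule nth_concat_rows(1)) (auto simp: length_rowc)

lemma off: assumes "lo \<le> z" "z \<le> hi"
  shows "0 < nat (z + int W + 3)" "nat (z + int W + 3) < S - 1" "int (nat (z + int W + 3)) = z + int W + 3"
  using assms by (auto simp: rowlen_def)

lemma idx_bounds: assumes "lo \<le> z" "z \<le> hi" "t < W + 2" shows "idx t z < L" "idx t z div S = t" "idx t z mod S = nat (z + int W + 3)"
proof -
  have l: "nat (z + int W + 3) < S" using off[OF assms(1,2)] by linarith
  then have "t * S + nat (z + int W + 3) < Suc t * S" by simp
  also have "\<dots> \<le> L" using assms(3) by (intro mult_le_mono1) auto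
  finally show "idx t z < L" by (simp add: idx_def)
  show "idx t z div S = t" "idx t z mod S = nat (z + int W + 3)" using l by (auto simp: idx_def)
qed

lemma cls_idx: "lo \<le> z ==> z \<le> hi ==> t < W + 2 ==>
   cls x W ! idx t z = (if t = 0 then cls_of x z else if t = W + 1 & z = 0 then 8 else 7)"
  using cls_nth[of t "nat (z + int W + 3)"] off[of z] rowc_nth[of W z x t] by (auto simp: idx_def)

lemma index_cases:
  assumes "u < L"
  obtains "u mod S = 0 \<or> u mod S = S - 1" "cls x W ! u = 4" | t z where "t < W + 2" "lo \<le> z" "z \<le> hi" "u = idx t z"
proof -
  have t: "u div S < W + 2" using assms S_big by (metis less_mult_imp_div_less mult.commute)
  have k: "u mod S < S" using S_big by simp
  have u: "u = u div S * S + u mod S" by (rule div_mult_mod_eq[symmetric])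
  have e: "cls x W ! u = rowc x W (u div S) ! (u mod S)" using cls_nth[OF t k] unfolding u[symmetric] .
  show ?thesis
  proof (cases "u mod S = 0 \<or> u mod S = S - 1")
    case True
    have "cls x W ! u = 4" unfolding e using True rowc_wall[of x W "u div S"] by metis
    from that(1)[OF True this] show ?thesis .
  next
    case False
    then have "0 < u mod S" "u mod S < S - 1" using k by auto
    then show ?thesis using t u by (intro that(2)[of "u div S" "int (u mod S) - int W - 3"]) (auto simp: idx_def rowlen_def)
  qed
qed

lemma sig_idx: "lo \<le> z ==> z \<le> hi ==> t < W + 2 ==> sig y (idx t z) = Some (loc (cfg x y t) z)"
  using idx_bounds[of z t] off[of z] by (simp add: sig_def)

lemma relS_cases:
  assumes "relS S (int u' - int u) \<noteq> 0" "relS S (int u' - int u) \<noteq> 6"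
  obtains "u' = u" "relS S (int u' - int u) = 1" | "u' = Suc u" "relS S (int u' - int u) = 2"
    | d where "\<bar>d\<bar> \<le> 1" "int u' = int u + int S + d" "relS S (int u' - int u) = nat (4 + d)"
proof -
  from assms consider "int u' - int u = 0" | "int u' - int u = 1" | d where "int u' - int u = int S + d" "d \<in> {- 1, 0, 1}"
    by (auto simp: relS_def split: if_splits)
  then show ?thesis
  proof cases
    case 1 then show ?thesis using that(1) by (auto simp: relS_def)
  next
    case 2 then show ?thesis using that(2) by (auto simp: relS_def)
  next
    case 3 then show ?thesis using that(3)[of d] S_big by (auto simp: relS_def)
  qed
qed

text \<open>A difference of indices can also connect the end of one row with the beginning of
  another; every such pair contains a wall and therefore has no conflict.\<close>

lemma sig_sound:
  assumes y: "fst (cfg x y (W + 1)) = 1 & fst (snd (cfg x y (W + 1)) ! 0) 0 = 2" and u: "u < L" "u' < L"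
  shows "\<not> cvt (relS S (int u' - int u)) (cls x W ! u') (sig y u) (sig y u')"
proof (cases "relS S (int u' - int u) = 0 \<or> relS S (int u' - int u) = 6")
  case True then show ?thesis by (auto simp: cvt_def split: option.splits)
next
  case False
  then have "relS S (int u' - int u) \<noteq> 0" "relS S (int u' - int u) \<noteq> 6" by auto
  then show ?thesis
  proof (cases rule: relS_cases)
    case 1
    have "allowed (cls x W ! u) (sig y u)" using u(1)
    proof (cases rule: index_cases)
      case 1 then show ?thesis by (auto simp: sig_def allowed_def)
    next
      case (2 t z)
      consider "t = 0" | "0 < t" "t = W + 1 & z = 0" | "0 < t" "\<not> (t = W + 1 & z = 0)" by blast
      then show ?thesis
      proof cases
        case 1
        then have "allowed (cls_of x z) (Some (loc (initial M (inp x y)) z))" unfolding allowed_def by auto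
        then show ?thesis using 2 1 by (simp add: cls_idx sig_idx cfg_def)
      next
        case t: 2
        then show ?thesis using 2 y kt_pos by (simp add: cls_idx sig_idx allowed_def loc_simps valid_cfg)
      next
        case t: 3
        then have "cls x W ! u = 7" using 2 by (auto simp: cls_idx)
        then show ?thesis using 2 by (simp add: sig_idx allowed_def)
      qed
    qed
    then show ?thesis using 1 by (simp add: cvt_def)
  next
    case 2
    show ?thesis using u(1)
    proof (cases rule: index_cases)
      case 1 then show ?thesis using 2 by (auto simp: sig_def cvt_def)
    next
      case t: (2 t z)
      show ?thesis
      proof (cases "z < hi")
        case True
        have u1: "u' = idx t (z + 1)" using 2 t off[of z] by (simp add: idx_def nat_add_distrib)
        have "hz (loc (cfg x y t) z) (loc (cfg x y t) (z + 1))" using valid_cfg unfolding hz_def by blast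
        moreover have "cls x W ! u' = 6 ==> t = 0 & int (length x) \<le> z"
          using u1 t True by (auto simp: cls_idx cls_of_6 split: if_splits)
        moreover have "t = 0 ==> int (length x) \<le> z ==> sy (loc (cfg x y t) z) 0 = 0 ==> sy (loc (cfg x y t) (z + 1)) 0 = 0"
          using kt_pos valid_cfg[of x y 0] by (auto simp: loc_simps cfg_def initial_nth init_sym split: if_splits)
        ultimately have "hz (loc (cfg x y t) z) (loc (cfg x y t) (z + 1)) & (cls x W ! u' = 6 --> sy (loc (cfg x y t) z) 0 = 0 --> sy (loc (cfg x y t) (z + 1)) 0 = 0)"
          by (intro conjI impI; simp)
        then show ?thesis using 2 t True sig_idx[of z t y] sig_idx[of "z + 1" t y] u1 by (simp add: cvt_def)
      next
        case False
        then have "z = hi" using t by simp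
        then have u1: "u' = t * S + (S - 1)" using 2 t by (simp add: idx_def rowlen_def)
        have "u' mod S = S - 1" unfolding u1 mod_mult_self3 using S_big by simp
        then show ?thesis using 2 by (auto simp: sig_def cvt_def)
      qed
    qed
  next
    case (3 d)
    show ?thesis using u(1)
    proof (cases rule: index_cases)
      case 1 then show ?thesis using 3 by (auto simp: sig_def cvt_def)
    next
      case t: (2 t z)
      have zd: "int (nat (z + d + int W + 3)) = z + d + int W + 3" "nat (z + d + int W + 3) < S" using t 3(1) off[of z] by auto
      have "int u' = int (Suc t * S + nat (z + d + int W + 3))" using 3(2) t off[of z] zd(1) by (simp add: idx_def)
      then have u'e: "u' = Suc t * S + nat (z + d + int W + 3)" by linarith
      have md: "u' mod S = nat (z + d + int W + 3)" "u' div S = Suc t"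
        unfolding u'e using zd(2) S_big by (simp_all only: mod_mult_self3 div_mult_self3) simp_all
      show ?thesis
      proof (cases "lo \<le> z + d & z + d \<le> hi")
        case True
        have "Suc t < W + 2" using md(2) u(2) S_big by (metis less_mult_imp_div_less)
        then have "sig y u' = Some (loc (cfg x y (Suc t)) (z + d))" using sig_idx[of "z + d" "Suc t" y] True u'e by (simp add: idx_def)
        moreover have "vt d (loc (cfg x y t) z) (loc (cfg x y (Suc t)) (z + d))" using valid_cfg unfolding vt_def cfg_Suc by blast
        moreover have "nat (4 + d) \<noteq> 1" "nat (4 + d) \<noteq> 2" "int (nat (4 + d)) - 4 = d" using 3(1) by auto
        ultimately show ?thesis using 3 t sig_idx[of z t y] by (simp add: cvt_def)
      next
        case False
        then have "u' mod S = 0 \<or> u' mod S = S - 1" using t 3(1) md by (auto simp: rowlen_def)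
        then show ?thesis using 3 by (auto simp: sig_def cvt_def)
      qed
    qed
  qed
qed

text \<open>The witness consists of the symbols behind the separator in the first row, up to the
  first blank. With it the first row is the initial configuration, \<open>row_step\<close>
  determines all later rows, and the cell of class 8 says that the last one accepts.\<close>

lemma solution:
  assumes ty: "\<And>u. u < L ==> s u \<in> types"
    and s: "\<And>u u'. u < L ==> u' < L ==> \<not> cvt (relS S (int u' - int u)) (cls x W ! u') (s u) (s u')"
  obtains y where "fst (cfg x y (W + 1)) = 1 & fst (snd (cfg x y (W + 1)) ! 0) 0 = 2" "\<And>u. u < L ==> s u = sig y u"
proof -
  have al: "allowed (cls x W ! u) (s u)" if "u < L" for u using s[OF that that] by (simp add: cvt_def relS_def)
  define T where "T t z = the (s (idx t z))" for t z
  have c6: "cls_of x z \<noteq> 4" "cls_of x z \<noteq> 7" "cls_of x z \<noteq> 8" for x z using cls_of_range[of x z] by auto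
  have T: "s (idx t z) = Some (T t z)" if "lo \<le> z" "z \<le> hi" "t < W + 2" for t z
  proof -
    have "cls x W ! idx t z \<noteq> 4" using that c6 by (simp add: cls_idx)
    then have "s (idx t z) \<noteq> None" using al[OF idx_bounds(1)[OF that]] by (cases "s (idx t z)") (simp_all add: allowed_def)
    then show ?thesis by (cases "s (idx t z)") (simp_all add: T_def)
  qed
  have H: "hz (T t z) (T t (z + 1)) & (cls x W ! idx t (z + 1) = 6 --> sy (T t z) 0 = 0 --> sy (T t (z + 1)) 0 = 0)"
    if "lo \<le> z" "z < hi" "t < W + 2" for t z
  proof -
    have "int (idx t (z + 1)) - int (idx t z) = 1" using that off[of z] by (simp add: idx_def nat_add_distrib)
    then have "relS S (int (idx t (z + 1)) - int (idx t z)) = 2" by (simp add: relS_def)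
    then show ?thesis using s[of "idx t z" "idx t (z + 1)"] idx_bounds[of z t] idx_bounds[of "z + 1" t] T[of z t] T[of "z + 1" t] that
      by (auto simp: cvt_def)
  qed
  have V: "vt d (T t z) (T (Suc t) (z + d))" if "lo \<le> z" "z \<le> hi" "lo \<le> z + d" "z + d \<le> hi" "\<bar>d\<bar> \<le> 1" "Suc t < W + 2" for t z d
  proof -
    have "int (idx (Suc t) (z + d)) - int (idx t z) = int S + d" using that off[of z] off[of "z + d"] by (simp add: idx_def)
    moreover have "d = - 1 \<or> d = 0 \<or> d = 1" using that by linarith
    ultimately have "relS S (int (idx (Suc t) (z + d)) - int (idx t z)) = nat (4 + d)" using S_big by (auto simp: relS_def)
    moreover have "nat (4 + d) \<noteq> 1" "nat (4 + d) \<noteq> 2" "int (nat (4 + d)) - 4 = d" "nat (4 + d) \<in> {3, 4, 5}" using that(5) by auto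
    ultimately show ?thesis using s[of "idx t z" "idx (Suc t) (z + d)"] idx_bounds[of z t] idx_bounds[of "z + d" "Suc t"] T[of z t] T[of "z + d" "Suc t"] that
      by (simp add: cvt_def)
  qed
  have A0: "\<exists>x' y' z'. T 0 z = loc (initial M (inp x' y')) z' & cls_of x z = cls_of x' z'" if "lo \<le> z" "z \<le> hi" for z
  proof -
    show ?thesis using c6[of x z] al[OF idx_bounds(1)[OF that, of 0]] T[OF that, of 0] that by (auto simp: cls_idx allowed_def)
  qed
  define b where "b = map (%k. sy (T 0 (int (length x) + 1 + int k)) 0) [0..<W + 1]"
  define y where "y = map (%a. a = 2) (takeWhile (%a. a \<noteq> 0) b)"
  have row0: "T 0 z = loc (cfg x y 0) z" if "lo \<le> z" "z \<le> hi" for z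
  proof (rule row_eq[where lo = lo and hi = hi and t = "T 0"])
    let ?n = "int (length x)"
    have l0: "lo \<le> z ==> z \<le> hi ==> fst (T 0 z) = fst (cfg x y 0)" for z
      using A0[of z] by (auto simp: loc_simps cfg_def initial_def)
    then show "lo \<le> z ==> z \<le> hi ==> fst (T 0 z) = fst (cfg x y 0)" for z .
    \<comment> \<open>Class 5 occurs exactly at the negative positions, so the flag is -1 there and
      nowhere else. Consistency between the positions -1 and 0 then puts every head at 0.\<close>
    have flag: "fl (T 0 z) j = - 1 \<longleftrightarrow> z < 0" if z: "lo \<le> z" "z \<le> hi" and j: "j < kt" for z j
    proof -
      obtain x' y' z' where e: "T 0 z = loc (initial M (inp x' y')) z'" "cls_of x z = cls_of x' z'" using A0[OF z] by blast
      have "snd (snd (initial M (inp x' y')) ! j) = 0" using j by (cases "j = 0") (auto simp: initial_nth)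
      then have "fl (T 0 z) j = sgn z'" using e(1) j by (simp add: loc_simps valid_initial)
      moreover have "z' < 0 \<longleftrightarrow> z < 0" using e(2) by (cases "x ! nat z"; cases "x' ! nat z'") (auto simp: cls_of_def split: if_splits)
      ultimately show ?thesis by (auto simp: sgn_if)
    qed
    show "lo \<le> snd (snd (cfg x y 0) ! j) & snd (snd (cfg x y 0) ! j) \<le> hi & fl (T 0 (snd (snd (cfg x y 0) ! j))) j = 0" if j: "j < kt" for j
    proof -
      have h: "snd (snd (cfg x y 0) ! j) = 0" using j by (cases "j = 0") (auto simp: cfg_def initial_nth)
      have "hz (T 0 (- 1)) (T 0 (- 1 + 1))" using H[of "- 1" 0] by auto
      then obtain c z' where c: "valid c" "T 0 (- 1) = loc c z'" "T 0 0 = loc c (z' + 1)" by (auto simp: hz_def)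
      have "fl (T 0 (- 1)) j = - 1" "fl (T 0 0) j \<noteq> - 1" using flag[of "- 1" j] flag[of 0 j] j by auto
      then have "fl (T 0 0) j = 0" using c j by (auto simp: loc_simps sgn_if split: if_splits)
      then show ?thesis using h by simp
    qed
    have bs: "b ! k \<in> {0, 1, 2}" if "k < W + 1" for k
    proof -
      let ?z = "?n + 1 + int k"
      have zz: "lo \<le> ?z" "?z \<le> hi" using that by auto
      obtain x' y' z' where e: "T 0 ?z = loc (initial M (inp x' y')) z'" "cls_of x ?z = cls_of x' z'" using A0[OF zz] by blast
      have "int (length x') < z'" using e(2) cls_of_6[of x ?z] cls_of_6[of x' z'] by simp
      moreover have "bit_sym a \<in> {0, 1, 2}" for a by (cases a) auto
      moreover have "b ! k = sy (T 0 ?z) 0" unfolding b_def using that by (simp del: upt_Suc)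
      ultimately show ?thesis using e(1) kt_pos by (simp add: loc_simps valid_initial initial_nth init_sym)
    qed
    \<comment> \<open>The extra condition for class 6 in \<open>cvt\<close>: blanks persist to the
      right.\<close>
    have bm: "k \<le> l ==> l < W + 1 ==> b ! k = 0 ==> b ! l = 0" for k l
    proof (induction l)
      case (Suc l)
      show ?case
      proof (cases "k = Suc l")
        case False
        then have "b ! l = 0" using Suc by simp
        then have "sy (T 0 (?n + 1 + int l)) 0 = 0" unfolding b_def using Suc.prems by (simp del: upt_Suc)
        moreover have "cls x W ! idx 0 (?n + 1 + int l + 1) = 6" using Suc.prems by (simp add: cls_idx cls_of_6)
        ultimately have "sy (T 0 (?n + 1 + int l + 1)) 0 = 0" using H[of "?n + 1 + int l" 0] Suc.prems by auto
        then show ?thesis unfolding b_def using Suc.prems by (simp add: algebra_simps del: upt_Suc)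
      qed (use Suc in simp)
    qed simp
    have lb: "length b = W + 1" by (simp add: b_def)
    have ly: "length y \<le> W + 1" using length_takeWhile_le[of "%a. a \<noteq> 0" b] lb by (simp add: y_def)
    have yk: "b ! k = (if k < length y then bit_sym (y ! k) else 0)" if "k < W + 1" for k
    proof (cases "k < length y")
      case True
      then have k: "k < length (takeWhile (%a. a \<noteq> 0) b)" by (simp add: y_def)
      then have "takeWhile (%a. a \<noteq> 0) b ! k = b ! k" "b ! k \<noteq> 0" using takeWhile_nth[OF k] nth_mem[OF k] set_takeWhileD by fastforce+
      then show ?thesis using True bs[OF that] k by (auto simp: y_def)
    next
      case False
      then have "length (takeWhile (%a. a \<noteq> 0) b) < length b" using that lb by (simp add: y_def)
      from nth_length_takeWhile[OF this] have "b ! length y = 0" by (simp add: y_def)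
      then show ?thesis using bm[of "length y" k] False that by simp
    qed
    show "sy (T 0 z) j = fst (snd (cfg x y 0) ! j) z" if z: "lo \<le> z" "z \<le> hi" and j: "j < kt" for z j
    proof -
      obtain x' y' z' where e: "T 0 z = loc (initial M (inp x' y')) z'" "cls_of x z = cls_of x' z'" using A0[OF z] by blast
      show ?thesis
      proof (cases "j = 0")
        case False
        then show ?thesis using e(1) j by (simp add: loc_simps valid_initial initial_nth cfg_def) (simp add: tape_of_def)
      next
        case 0: True
        have s0: "sy (T 0 z) 0 = fst (tape_of (inp x' y')) z'" using e(1) kt_pos by (simp add: loc_simps valid_initial initial_nth)
        show ?thesis
        proof (cases "?n < z")
          case True
          define k where "k = nat (z - ?n - 1)"
          have k: "z = ?n + 1 + int k" "k < W + 1" using True z by (auto simp: k_def)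
          have "b ! k = sy (T 0 z) 0" unfolding b_def using k by (simp del: upt_Suc)
          moreover have "fst (tape_of (inp x y)) z = (if k < length y then bit_sym (y ! k) else 0)" unfolding k(1) init_sym by auto
          ultimately show ?thesis using yk[OF k(2)] 0 by (simp add: cfg_def initial_nth)
        next
          case False
          then have "fst (tape_of (inp x' y')) z' = fst (tape_of (inp x y)) z" using e(2) unfolding init_sym
            by (cases "x ! nat z"; cases "x' ! nat z'") (auto simp: cls_of_def split: if_splits)
          then show ?thesis using s0 0 by (simp add: cfg_def initial_nth)
        qed
      qed
    qed
    show "hz (T 0 z) (T 0 (z + 1))" if "lo \<le> z" "z < hi" for z using H[OF that] by simp
  qed (use that valid_cfg in auto)
  have rows: "t < W + 2 ==> lo \<le> z ==> z \<le> hi ==> T t z = loc (cfg x y t) z" for t z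
  proof (induction t arbitrary: z)
    case 0 then show ?case using row0 by simp
  next
    case (Suc t)
    show ?case unfolding cfg_Suc
    proof (rule row_step[where lo = lo and hi = hi and t = "T (Suc t)"])
      show "vt d (loc (cfg x y t) z) (T (Suc t) (z + d))" if "lo \<le> z" "z \<le> hi" "lo \<le> z + d" "z + d \<le> hi" "\<bar>d\<bar> \<le> 1" for z d
        using V[OF that Suc.prems(1)] Suc.IH[of z] that Suc.prems by simp
      show "lo < snd (snd (cfg x y t) ! j) & snd (snd (cfg x y t) ! j) < hi" if "j < kt" for j
        using head_bound[OF that, of x y t] Suc.prems(1) by auto
    qed (use Suc.prems H valid_cfg in auto)
  qed
  have "fst (T (W + 1) 0) = 1 & sy (T (W + 1) 0) 0 = 2"
  proof -
    have "cls x W ! idx (W + 1) 0 = 8" by (auto simp: cls_idx)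
    then show ?thesis using c6(3)[symmetric] al[OF idx_bounds(1)[of 0 "W + 1"]] T[of 0 "W + 1"] by (auto simp: allowed_def)
  qed
  then have acc: "fst (cfg x y (W + 1)) = 1 & fst (snd (cfg x y (W + 1)) ! 0) 0 = 2"
    using rows[of "W + 1" 0] kt_pos by (simp add: loc_simps valid_cfg)
  have "s u = sig y u" if "u < L" for u using that
  proof (cases rule: index_cases)
    case 1
    then have "s u = None" using c6(1)[symmetric] al[OF that] 1 by (auto simp: allowed_def split: option.splits)
    then show ?thesis using 1 by (auto simp: sig_def)
  next
    case (2 t z)
    then show ?thesis using T[of z t] rows[of t z] sig_idx[of z t y] by simp
  qed
  then show ?thesis using acc that by blast
qed

text \<open>A witness has length at most \<open>W\<close>, so it is visible in the first row
  together with the blank that follows it; this makes the map from witnesses to fillings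
  injective.\<close>

theorem count_solutions:
  assumes R: "\<And>y. outputs_within M Map.empty (inp x y) (b y) [R y]" "\<And>y. R y ==> length y \<le> W & b y \<le> W + 1"
  shows "card {f \<in> PiE {..<L} (%_. {..<K}). \<forall>u<L. \<forall>u'<L. \<not> cv (relS S (int u' - int u)) (cls x W ! u') (f u) (f u')} = card {y. R y}"
proof -
  let ?acc = "%y. fst (cfg x y (W + 1)) = 1 & fst (snd (cfg x y (W + 1)) ! 0) 0 = 2"
  have acc: "?acc y \<longleftrightarrow> R y" for y using accept[OF R(1)[of y]] R(2)[of y] by blast
  define num where "num = inv_into {..<K} enum"
  define F where "F y = restrict (%u. num (sig y u)) {..<L}" for y
  let ?Sol = "{f \<in> PiE {..<L} (%_. {..<K}). \<forall>u<L. \<forall>u'<L. \<not> cv (relS S (int u' - int u)) (cls x W ! u') (f u) (f u')}"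
  have en: "enum ` {..<K} = types" "inj_on enum {..<K}" using enum_bij by (auto simp: bij_betw_def)
  have num: "num t < K" "enum (num t) = t" if "t \<in> types" for t
    using inv_into_into[of t enum "{..<K}"] f_inv_into_f[of t enum "{..<K}"] that en(1) by (auto simp: num_def)
  have sigt: "sig y u \<in> types" for y u
  proof -
    have "loc (cfg x y (u div S)) (int (u mod S) - int W - 3) \<in> {loc c z | c z. valid c}" using valid_cfg by blast
    then show ?thesis unfolding sig_def types_def by simp
  qed
  have "bij_betw F {y. R y} ?Sol"
    unfolding bij_betw_def
  proof
    show "inj_on F {y. R y}"
    proof (rule inj_onI)
      fix y y' assume h: "y \<in> {y. R y}" "y' \<in> {y. R y}" "F y = F y'"
      have e: "sig y u = sig y' u" if "u < L" for u
        using fun_cong[OF h(3), of u] that num(2)[OF sigt] by (simp add: F_def) metis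
      let ?n = "int (length x)"
      have sm: "fst (tape_of (inp x y)) z = fst (tape_of (inp x y')) z" if "?n < z" "z \<le> hi" for z
      proof -
        have "loc (cfg x y 0) z = loc (cfg x y' 0) z"
          using e[of "idx 0 z"] idx_bounds[of z 0] sig_idx[of z 0] that by auto
        then have "sy (loc (cfg x y 0) z) 0 = sy (loc (cfg x y' 0) z) 0" by simp
        then show ?thesis using kt_pos valid_initial by (simp add: loc_simps cfg_def initial_nth)
      qed
      have sk: "(if k < length y then bit_sym (y ! k) else 0) = (if k < length y' then bit_sym (y' ! k) else 0)" if "k < W + 1" for k
        using sm[of "?n + 1 + int k"] that by (simp add: init_sym split: if_splits)
      have ly: "length y \<le> W" "length y' \<le> W" using R(2) h by auto
      have len: "length y = length y'" using sk[of "length y"] sk[of "length y'"] ly by (auto split: if_splits)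
      show "y = y'"
      proof (rule nth_equalityI[OF len])
        fix k assume "k < length y"
        then have "bit_sym (y ! k) = bit_sym (y' ! k)" using sk[of k] len ly by simp
        then show "y ! k = y' ! k" by (cases "y ! k"; cases "y' ! k") auto
      qed
    qed
    show "F ` {y. R y} = ?Sol"
    proof
      show "F ` {y. R y} \<subseteq> ?Sol"
      proof
        fix f assume "f \<in> F ` {y. R y}"
        then obtain y where y: "R y" "f = F y" by blast
        have "F y \<in> PiE {..<L} (%_. {..<K})" using num(1)[OF sigt] by (auto simp: F_def)
        moreover have "\<not> cv (relS S (int u' - int u)) (cls x W ! u') (F y u) (F y u')" if "u < L" "u' < L" for u u'
          using sig_sound[OF acc[THEN iffD2, OF y(1)] that] that num(2)[OF sigt] by (simp add: F_def cv_def)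
        ultimately show "f \<in> ?Sol" using y(2) by blast
      qed
      show "?Sol \<subseteq> F ` {y. R y}"
      proof
        fix f assume f: "f \<in> ?Sol"
        have fK: "f u < K" if "u < L" for u using f that by (auto simp: PiE_iff)
        have ft: "enum (f u) \<in> types" if "u < L" for u using fK[OF that] en(1) by blast
        have fc: "\<not> cvt (relS S (int u' - int u)) (cls x W ! u') (enum (f u)) (enum (f u'))" if "u < L" "u' < L" for u u'
          using f that by (simp add: cv_def)
        obtain y where y: "?acc y" "\<And>u. u < L ==> enum (f u) = sig y u"
          using solution[of "%u. enum (f u)", OF ft fc] by blast
        have "f u = F y u" for u
        proof (cases "u < L")
          case True
          then have "num (sig y u) = f u" using y(2)[OF True, symmetric] fK[OF True] en(2) by (simp add: num_def inv_into_f_f)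
          then show ?thesis using True by (simp add: F_def)
        next
          case False
          then show ?thesis using f by (auto simp: F_def PiE_iff extensional_def)
        qed
        then show "f \<in> F ` {y. R y}" using acc y(1) by blast
      qed
    qed
  qed
  then show ?thesis by (rule bij_betw_same_card[symmetric])
qed

end

end

section \<open>The reduction\<close>

text \<open>The time bound must not depend on what is already on tape \<open>j\<close>: this is what makes the loop rule compositional.\<close>

definition emit :: "'i set => ('i => nat) => nat set => ('i => nat => nat list) => com => nat => ('i => nat list) => bool" where
  "emit D sz A w c j v \<longleftrightarrow> (\<exists>p :: nat poly. \<forall>i\<in>D. \<forall>tp u. tp j = outt u --> (\<forall>k\<in>A. tp k = arr (w i k) 0) -->
     runs c tp (poly p (sz i)) (tp(j := outt (u @ v i))))"

abbreviation edom :: "'i set => nat set => ('i => nat => nat list) => nat => ('i \<times> store \<times> nat list) set" where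
  "edom D A w j \<equiv> {(i, tp, u). i \<in> D & tp j = outt u & (\<forall>k\<in>A. tp k = arr (w i k) 0)}"

lemma emit_PR:
  assumes "PR (edom D A w j) (%(i, tp, u). sz i) c (%(i, tp, u). tp) (%(i, tp, u). tp(j := outt (u @ v i)))"
  shows "emit D sz A w c j v"
  using assms unfolding emit_def PR_def by fastforce

lemma PR_emit':
  assumes "emit D sz A w c j v"
  shows "PR (edom D A w j) (%(i, tp, u). sz i) c (%(i, tp, u). tp) (%(i, tp, u). tp(j := outt (u @ v i)))"
  using assms unfolding emit_def PR_def by fastforce

lemma emit_wr: "emit D sz A w (wr j a Rightwards) j (%i. [a])"
  by (rule emit_PR, rule PR_wr) auto

lemma emit_putw: "emit D sz A w (putw j l) j (%i. l)"
proof (rule emit_PR)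
  let ?D = "(edom D A w j)"
  have "PR ?D (%(i, tp, u). sz i) (putw j l) (%(i, tp, u). tp) (%e. ((%(i, tp, u). tp) e)(j := outt (snd (snd e) @ l)))"
    by (rule PR_putw) auto
  then show "PR ?D (%(i, tp, u). sz i) (putw j l) (%(i, tp, u). tp) (%(i, tp, u). tp(j := outt (u @ l)))"
    by (rule PR_cong) auto
qed

lemma emit_Seq:
  assumes "emit D sz A w c j v" "emit D sz A w c' j v'" "j \<notin> A"
  shows "emit D sz A w (c ;; c') j (%i. v i @ v' i)"
proof -
  obtain p p' :: "nat poly" where p: "\<forall>i\<in>D. \<forall>tp u. tp j = outt u --> (\<forall>k\<in>A. tp k = arr (w i k) 0) --> runs c tp (poly p (sz i)) (tp(j := outt (u @ v i)))"
    and p': "\<forall>i\<in>D. \<forall>tp u. tp j = outt u --> (\<forall>k\<in>A. tp k = arr (w i k) 0) --> runs c' tp (poly p' (sz i)) (tp(j := outt (u @ v' i)))"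
    using assms(1,2) unfolding emit_def by blast
  show ?thesis unfolding emit_def
  proof (intro exI[of _ "[:1:] + p + p'"] ballI allI impI)
    fix i tp u assume h: "i \<in> D" "tp j = outt u" "\<forall>k\<in>A. tp k = arr (w i k) 0"
    let ?t = "tp(j := outt (u @ v i))"
    have "runs c tp (poly p (sz i)) ?t" using p h by blast
    moreover have "?t j = outt (u @ v i)" "\<forall>k\<in>A. ?t k = arr (w i k) 0" using h(3) assms(3) by auto
    then have "runs c' ?t (poly p' (sz i)) (?t(j := outt ((u @ v i) @ v' i)))" using p' h(1) by blast
    ultimately have "runs (c ;; c') tp (Suc (poly p (sz i) + poly p' (sz i))) (?t(j := outt ((u @ v i) @ v' i)))" by (rule runs_Seq)
    then show "runs (c ;; c') tp (poly ([:1:] + p + p') (sz i)) (tp(j := outt (u @ v i @ v' i)))" by simp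
  qed
qed

lemma emit_cong: "emit D sz A w c j v ==> (\<And>i k. k \<in> A ==> w i k = w' i k) ==> emit D sz A w' c j v"
  unfolding emit_def by simp

lemma emit_For_gen:
  assumes len: "pbound D sz (%i. length (w i k))" and k: "k \<in> A" "j \<notin> A" and nz: "\<And>i. i \<in> D ==> 0 \<notin> set (w i k)"
    and c: "PR {(i, l, tp, u). i \<in> D & l < length (w i k) & tp j = outt u & (\<forall>k'\<in>A - {k}. tp k' = arr (w i k') 0) & tp k = arr (w i k) (int l)}
      (%(i, l, tp, u). sz i) c (%(i, l, tp, u). tp) (%(i, l, tp, u). tp(j := outt (u @ f i l)))"
  shows "emit D sz A w (For k c) j (%i. concat (map (f i) [0..<length (w i k)]))"
proof (rule emit_PR)
  let ?D = "(edom D A w j)"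
  let ?w = "%e. w (fst e) k" and ?s = "%e l. (fst (snd e))(j := outt (snd (snd e) @ concat (map (f (fst e)) [0..<l])))"
  have jk: "j \<noteq> k" "k' \<noteq> j" if "k' \<in> A" for k' using k that by auto
  have "PR ?D (%(i, tp, u). sz i) (For k c) (%e. ?s e 0) (%e. (?s e (length (?w e)))(k := arr (?w e) 0))"
  proof (rule PR_For)
    show "pbound ?D (%(i, tp, u). sz i) (%e. length (?w e))" by (rule pbound_map[OF len]) auto
    show "PR {(e, l). e \<in> ?D & l < length (?w e)} (%(e, l). (%(i, tp, u). sz i) e) c (%(e, l). (?s e l)(k := arr (?w e) (int l))) (%(e, l). (?s e (Suc l))(k := arr (?w e) (int l)))"
      by (rule PR_map[OF c, where h = "%(e, l). (fst e, l, (?s e l)(k := arr (?w e) (int l)), snd (snd e) @ concat (map (f (fst e)) [0..<l]))"])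
        (use k jk in \<open>auto simp: fun_eq_iff split: if_splits\<close>)
  qed (use nz k jk in auto)
  then show "PR ?D (%(i, tp, u). sz i) (For k c) (%(i, tp, u). tp) (%(i, tp, u). tp(j := outt (u @ concat (map (f i) [0..<length (w i k)]))))"
    by (rule PR_cong) (use k jk in \<open>auto simp: fun_eq_iff\<close>)
qed

lemma emit_For:
  assumes len: "pbound D sz (%i. length (w i k))" and k: "k \<in> A" "j \<notin> A" and nz: "\<And>i. i \<in> D ==> 0 \<notin> set (w i k)"
    and c: "emit D sz (A - {k}) w c j v"
  shows "emit D sz A w (For k c) j (%i. concat (replicate (length (w i k)) (v i)))"
proof -
  have "emit D sz A w (For k c) j (%i. concat (map (%l. v i) [0..<length (w i k)]))"
    by (rule emit_For_gen[where w = w and k = k, OF len k nz]) (assumption, rule PR_map[OF PR_emit'[OF c], where h = "%(i, l, tp, u). (i, tp, u)"], auto)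
  then show ?thesis by (simp add: map_replicate_const)
qed

lemma emit_For_wr:
  assumes len: "pbound D sz (%i. length (w i k))" and k: "k \<in> A" "j \<notin> A" and nz: "\<And>i. i \<in> D ==> 0 \<notin> set (w i k)"
  shows "emit D sz A w (For k (wr j a Rightwards)) j (%i. replicate (length (w i k)) a)"
proof -
  have "concat (replicate n [a]) = replicate n a" for n by (induction n) auto
  then show ?thesis using emit_For[where w = w and k = k, OF len k nz emit_wr[where a = a]] by simp
qed

lemma emit_For_copy:
  assumes len: "pbound D sz (%i. length (w i k))" and k: "k \<in> A" "j \<notin> A" and nz: "\<And>i. i \<in> D ==> 0 \<notin> set (w i k)"
  shows "emit D sz A w (For k (Case (%v. wr j (f (v k)) Rightwards))) j (%i. map f (w i k))"
proof -
  have "emit D sz A w (For k (Case (%v. wr j (f (v k)) Rightwards))) j (%i. concat (map (%l. [f (w i k ! l)]) [0..<length (w i k)]))"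
  proof (rule emit_For_gen[where w = w and k = k, OF len k nz], assumption)
    let ?D = "{(i, l, tp, u). i \<in> D & l < length (w i k) & tp j = outt u & (\<forall>k'\<in>A - {k}. tp k' = arr (w i k') 0) & tp k = arr (w i k) (int l)}"
    have "PR ?D (%(i, l, tp, u). sz i) (Case (%v. wr j (f (v k)) Rightwards)) (%(i, l, tp, u). tp)
      (%e. ((%(i, l, tp, u). tp) e)(j := outt ((%(i, l, tp, u). u) e @ [f (view ((%(i, l, tp, u). tp) e) k)])))"
      by (rule PR_copy) auto
    then show "PR ?D (%(i, l, tp, u). sz i) (Case (%v. wr j (f (v k)) Rightwards)) (%(i, l, tp, u). tp) (%(i, l, tp, u). tp(j := outt (u @ [f (w i k ! l)])))"
      by (rule PR_cong) (auto simp: view_def scanned_arr)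
  qed
  moreover have "concat (map (%l. [f (xs ! l)]) [0..<length xs]) = map f xs" for xs
  proof -
    have "map (%l. [f (xs ! l)]) [0..<length xs] = map (%x. [f x]) xs" by (rule nth_equalityI) auto
    moreover have "concat (map (%x. [f x]) xs) = map f xs" by (induction xs) auto
    ultimately show ?thesis by simp
  qed
  ultimately show ?thesis by simp
qed

definition st :: "(nat => nat list) => store" where "st w = (%k. arr (w k) 0)"

lemma PR_build:
  assumes c: "emit D sz A w c j v" and v: "pbound D sz (%i. length (v i))" "\<And>i. i \<in> D ==> 0 \<notin> set (v i) & w i j = []"
  shows "PR D sz (c ;; rewind j) (%i. st (w i)) (%i. st ((w i)(j := v i)))"
proof (rule PR_Seq)
  show "PR D sz c (%i. st (w i)) (%i. (st (w i))(j := outt (v i)))"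
    by (rule PR_map[OF PR_emit'[OF c], where h = "%i. (i, st (w i), [])"]) (use v in \<open>auto simp: st_def outt_def\<close>)
  have "PR D sz (rewind j) (%i. (st (w i))(j := outt (v i))) (%i. ((st (w i))(j := outt (v i)))(j := arr (v i) 0))"
    by (rule PR_rewind[OF v(1), where q = "%i. length (v i)"]) (use v in \<open>auto simp: outt_def\<close>)
  then show "PR D sz (rewind j) (%i. (st (w i))(j := outt (v i))) (%i. st ((w i)(j := v i)))"
    by (rule PR_cong) (auto simp: st_def)
qed

lemma length_cls: "length (cls x W) = (W + 2) * rowlen x W"
  using nth_concat_rows(2)[of "W + 2" "rowc x W" "rowlen x W" 0 0] by (simp add: cls_def length_rowc rowlen_def)

lemma cls_nonzero: "0 \<notin> set (cls x W)"
  by (auto simp: cls_def rowc_def split: if_splits)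

lemma cls_split: "cls x W = rowc x W 0 @ concat (replicate W (rowc x W 1)) @ rowc x W (W + 1)"
proof -
  have "[0..<W + 2] = [0] @ [1..<Suc W] @ [Suc W]" using upt_add_eq_append[of 0 1 "W + 1"] by (simp add: upt_rec[of 0])
  moreover have "map (rowc x W) [1..<Suc W] = replicate W (rowc x W 1)" by (rule nth_equalityI) (auto simp: rowc_def simp del: upt_Suc)
  ultimately show ?thesis by (simp add: cls_def del: upt_Suc)
qed

context
  fixes d K :: nat
begin

definition pw :: "bool list => nat" where "pw x = (length x + 2) ^ d"

definition vol :: "bool list => nat" where "vol x = (pw x + 2) * rowlen x (pw x)"

definition rels :: "bool list => nat list" where
  "rels x = [1, 2] @ replicate (pw x) 6 @ replicate (pw x) 6 @ replicate (length x) 6 @ [6, 6, 6, 3, 4, 5]"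

text \<open>The contents of all tapes after \<open>prepare\<close>. Unary words serve as loop
  counters. The chain length on tape 5 is the sum of the lengths on tapes 10 and 11: the exponent of
  the weight of one solution and the number of digits reserved for the count.\<close>

definition wf :: "bool list => nat => nat list" where
  "wf x k = (if k = 0 then map bit_sym x else if k = 8 then replicate (length x + 2) 1 else if 12 \<le> k then replicate ((length x + 2) ^ (k - 12)) 1
     else if k = 10 then replicate (K * vol x * vol x) 1 else if k = 11 then replicate (K * vol x) 1
     else if k = 9 then replicate (pw x) 1 else if k = 3 then cls x (pw x) else if k = 2 then replicate (vol x) 1 else if k = 4 then rels x
     else if k = 5 then replicate (K * vol x * vol x + K * vol x) 1 else if k = 6 \<or> k = 7 then [2] else [])"

lemma rels_tape: "fst (arr (rels x) 0) z = relS (rowlen x (pw x)) z"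
proof -
  let ?W = "pw x"
  have l: "length (rels x) = rowlen x ?W + 2" by (simp add: rels_def rowlen_def)
  consider "z < 0" | "0 \<le> z" "z < int (length (rels x))" | "int (length (rels x)) \<le> z" by linarith
  then show ?thesis
  proof cases
    case 2
    define k where "k = nat z"
    have k: "z = int k" "k < length (rels x)" using 2 by (auto simp: k_def)
    have e: "rels x = [1, 2] @ replicate (2 * ?W + length x + 3) 6 @ [3, 4, 5]"
      by (simp add: rels_def replicate_add[symmetric] numeral_3_eq_3 replicate_app_Cons_same flip: replicate_Suc append_assoc)
    have "rels x ! k = relS (rowlen x ?W) (int k)"
    proof -
      consider "k < 2" | "2 \<le> k" "k < 2 * ?W + length x + 5" | "k = 2 * ?W + length x + 5" | "k = 2 * ?W + length x + 6" | "k = 2 * ?W + length x + 7"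
        using k(2) l by (auto simp: rowlen_def) linarith
      then show ?thesis unfolding e by cases (auto simp: relS_def rowlen_def nth_append nth_Cons')
    qed
    then show ?thesis using k by (simp add: arr_def)
  qed (auto simp: arr_def relS_def l, auto simp: rowlen_def)
qed

lemma wf_nonzero: "0 \<notin> set (wf x k)"
  using cls_nonzero by (auto simp: wf_def rels_def)

lemma pb_pw: "pbound D length pw" unfolding pw_def by (intro pbound_intros)

lemma pb_vol: "pbound D length vol" unfolding vol_def rowlen_def by (intro pbound_intros pb_pw)

lemma pb_wf: "pbound D length (%x. length (wf x k))"
proof -
  have "pbound D length (%x. length x + 2 + (length x + 2) ^ (k - 12) + pw x + vol x + (8 + pw x + pw x + length x) + (K * vol x * vol x + K * vol x) + 1)"
    by (intro pbound_intros pb_pw pb_vol)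
  moreover have "length (cls x (pw x)) = vol x" for x unfolding length_cls vol_def ..
  ultimately show ?thesis by (elim pbound_mono) (auto simp: wf_def rels_def)
qed

definition wB :: "nat set => bool list => nat => nat list" where "wB B x k = (if k \<in> B then wf x k else [])"

text \<open>Each stage writes one new tape from the finished tapes \<open>A\<close> and rewinds it;
  no tape is written twice.\<close>

lemma PR_stage:
  assumes "emit UNIV length A wf c j (%x. wf x j)" "A \<subseteq> B" "j \<notin> B" "B' = insert j B"
  shows "PR UNIV length (c ;; rewind j) (%x. st (wB B x)) (%x. st (wB B' x))"
proof -
  have "emit UNIV length A (wB B) c j (%x. wf x j)"
    by (rule emit_cong[OF assms(1)]) (use assms(2) in \<open>auto simp: wB_def\<close>)
  then have "PR UNIV length (c ;; rewind j) (%x. st (wB B x)) (%x. st ((wB B x)(j := wf x j)))"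
    by (rule PR_build[OF _ pb_wf]) (use wf_nonzero assms(3) in \<open>auto simp: wB_def\<close>)
  moreover have "(wB B x)(j := wf x j) = wB B' x" for x using assms(4) by (auto simp: wB_def)
  ultimately show ?thesis by simp
qed

lemmas emits = emit_putw emit_wr emit_Seq emit_For[where w = wf, OF pb_wf _ _ wf_nonzero] emit_For_wr[where w = wf, OF pb_wf _ _ wf_nonzero] emit_For_copy[where w = wf, OF pb_wf _ _ wf_nonzero]

text \<open>Tape \<open>12 + k\<close> receives the k-th power of |x| + 2 in unary, by a double loop
  over the previous power and the base on tape 8.\<close>

definition powers :: com where "powers = seqs (%k. For (12 + k) (For 8 (wr (13 + k) 1 Rightwards)) ;; rewind (13 + k)) d"

definition midrow :: "nat list => com" where
  "midrow l = putw 3 [4, 7, 7] ;; For 9 (wr 3 7 Rightwards) ;; putw 3 l ;; For 0 (wr 3 7 Rightwards) ;; For 9 (wr 3 7 Rightwards) ;; putw 3 [4]"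

definition prepare :: com where
  "prepare = ((For 0 (wr 8 1 Rightwards) ;; putw 8 [1, 1]) ;; rewind 8) ;; (wr 12 1 Rightwards ;; rewind 12) ;; powers ;;
    (For (12 + d) (wr 9 1 Rightwards) ;; rewind 9) ;;
    (((putw 3 [4, 5, 5] ;; For 9 (wr 3 5 Rightwards) ;; For 0 (Case (%v. wr 3 (if v 0 = 1 then 1 else 2) Rightwards)) ;; putw 3 [3, 6] ;; For 9 (wr 3 6 Rightwards) ;; putw 3 [4]) ;;
      For (12 + d) (midrow [7, 7]) ;; midrow [8, 7]) ;; rewind 3) ;;
    (For 3 (wr 2 1 Rightwards) ;; rewind 2) ;;
    ((putw 4 [1, 2] ;; For 9 (wr 4 6 Rightwards) ;; For 9 (wr 4 6 Rightwards) ;; For 0 (wr 4 6 Rightwards) ;; putw 4 [6, 6, 6, 3, 4, 5]) ;; rewind 4) ;;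
    (For 2 (For 3 (putw 10 (replicate K 1))) ;; rewind 10) ;; (For 2 (putw 11 (replicate K 1)) ;; rewind 11) ;;
    ((For 10 (wr 5 1 Rightwards) ;; For 11 (wr 5 1 Rightwards)) ;; rewind 5) ;;
    (putw 6 [2] ;; rewind 6) ;; (putw 7 [2] ;; rewind 7)"

lemma concat_const: "concat (replicate a (replicate b c)) = replicate (a * b) c"
  by (induction a) (auto simp: replicate_add)

lemma wfc_prepare: "wfc (13 + d) 10 prepare"
  by (auto simp: prepare_def powers_def midrow_def intro!: wfc_seqs wfc_putw)

lemma PR_prepare: "PR UNIV length prepare (%x. start (map bit_sym x)) (%x. st (wB {0..12 + d} x))"
proof -
  have 0: "start (map bit_sym x) = st (wB {0} x)" for x by (auto simp: start_def st_def wB_def wf_def tape_of_arr)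
  have 1: "PR UNIV length ((For 0 (wr 8 1 Rightwards) ;; putw 8 [1, 1]) ;; rewind 8) (%x. st (wB {0} x)) (%x. st (wB {0, 8} x))"
  proof (rule PR_stage[where A = "{0}"])
    have "emit UNIV length {0} wf (For 0 (wr 8 1 Rightwards) ;; putw 8 [1, 1]) 8 (%x. replicate (length (wf x 0)) 1 @ [1, 1])"
      by (intro emits) auto
    moreover have "replicate (length (wf x 0)) 1 @ [1, 1] = wf x 8" for x
    proof -
      have "replicate n 1 @ [1, 1] = replicate (n + 2) (1 :: nat)" for n by (induction n) auto
      then show ?thesis by (simp add: wf_def)
    qed
    ultimately show "emit UNIV length {0} wf (For 0 (wr 8 1 Rightwards) ;; putw 8 [1, 1]) 8 (%x. wf x 8)" by simp
  qed auto
  let ?B = "%k. {0, 8} \<union> {12..<13 + k}"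
  have 2: "PR UNIV length (wr 12 1 Rightwards ;; rewind 12) (%x. st (wB {0, 8} x)) (%x. st (wB (?B 0) x))"
  proof (rule PR_stage[where A = "{}"])
    have "wf x 12 = [1]" for x by (simp add: wf_def)
    then show "emit UNIV length {} wf (wr 12 1 Rightwards) 12 (%x. wf x 12)" using emit_wr[of UNIV length "{}" wf 12 1] by simp
  qed auto
  have 3: "PR UNIV length powers (%x. st (wB (?B 0) x)) (%x. st (wB (?B d) x))" unfolding powers_def
  proof (rule PR_seqs)
    fix k
    show "PR UNIV length (For (12 + k) (For 8 (wr (13 + k) 1 Rightwards)) ;; rewind (13 + k)) (%x. st (wB (?B k) x)) (%x. st (wB (?B (Suc k)) x))"
    proof (rule PR_stage[where A = "{8, 12 + k}"])
      have "emit UNIV length {8, 12 + k} wf (For (12 + k) (For 8 (wr (13 + k) 1 Rightwards))) (13 + k) (%x. concat (replicate (length (wf x (12 + k))) (replicate (length (wf x 8)) 1)))"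
        by (intro emits) auto
      moreover have "concat (replicate (length (wf x (12 + k))) (replicate (length (wf x 8)) 1)) = wf x (13 + k)" for x
        by (simp only: concat_const) (simp add: wf_def mult.commute)
      ultimately show "emit UNIV length {8, 12 + k} wf (For (12 + k) (For 8 (wr (13 + k) 1 Rightwards))) (13 + k) (%x. wf x (13 + k))" by simp
    qed auto
  qed
  have 4: "PR UNIV length (For (12 + d) (wr 9 1 Rightwards) ;; rewind 9) (%x. st (wB (?B d) x)) (%x. st (wB (insert 9 (?B d)) x))"
  proof (rule PR_stage[where A = "{12 + d}"])
    have "emit UNIV length {12 + d} wf (For (12 + d) (wr 9 1 Rightwards)) 9 (%x. replicate (length (wf x (12 + d))) 1)"
      by (intro emits) auto
    moreover have "replicate (length (wf x (12 + d))) 1 = wf x 9" for x by (simp add: wf_def pw_def)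
    ultimately show "emit UNIV length {12 + d} wf (For (12 + d) (wr 9 1 Rightwards)) 9 (%x. wf x 9)" by simp
  qed auto
  have l: "length (wf x 9) = pw x" "length (wf x (12 + d)) = pw x" "length (wf x 0) = length x" "length (wf x 3) = vol x" "length (wf x 2) = vol x" for x
    by (simp_all add: wf_def pw_def length_cls vol_def)
  let ?c3 = "(putw 3 [4, 5, 5] ;; For 9 (wr 3 5 Rightwards) ;; For 0 (Case (%v. wr 3 (if v 0 = 1 then 1 else 2) Rightwards)) ;; putw 3 [3, 6] ;; For 9 (wr 3 6 Rightwards) ;; putw 3 [4]) ;;
      For (12 + d) (midrow [7, 7]) ;; midrow [8, 7]"
  have 5: "PR UNIV length (?c3 ;; rewind 3) (%x. st (wB (insert 9 (?B d)) x)) (%x. st (wB ({3, 9} \<union> ?B d) x))"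
  proof (rule PR_stage[where A = "{0, 9, 12 + d}"])
    let ?m = "%l x. [4, 7, 7] @ replicate (length (wf x 9)) 7 @ l @ replicate (length (wf x 0)) 7 @ replicate (length (wf x 9)) 7 @ [4]"
    have m: "emit UNIV length ({0, 9, 12 + d} - X) wf (midrow l) 3 (?m l)" if "X \<subseteq> {12 + d}" for l X
      unfolding midrow_def by (intro emits) (use that in auto)
    have m0: "emit UNIV length {0, 9, 12 + d} wf (midrow l) 3 (?m l)" for l using m[of "{}" l] by (simp only: Diff_empty empty_subsetI)
    have "emit UNIV length {0, 9, 12 + d} wf ?c3 3 (%x. ([4, 5, 5] @ replicate (length (wf x 9)) 5 @ map (%a. if a = 1 then 1 else 2) (wf x 0) @ [3, 6] @ replicate (length (wf x 9)) 6 @ [4]) @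
      concat (replicate (length (wf x (12 + d))) (?m [7, 7] x)) @ ?m [8, 7] x)"
      by (intro emits m[of "{12 + d}"] m0) auto
    moreover have "([4, 5, 5] @ replicate (length (wf x 9)) 5 @ map (%a. if a = 1 then 1 else 2) (wf x 0) @ [3, 6] @ replicate (length (wf x 9)) 6 @ [4]) @
      concat (replicate (length (wf x (12 + d))) (?m [7, 7] x)) @ ?m [8, 7] x = wf x 3" for x
    proof -
      have "map (%a. if a = 1 then 1 else 2) (wf x 0) = map bit_sym x" by (simp add: wf_def bit_sym_copy[simplified])
      moreover have "0 < pw x" by (simp add: pw_def)
      then have "rowc x (pw x) 1 = ?m [7, 7] x" "rowc x (pw x) (pw x + 1) = ?m [8, 7] x" unfolding l by (simp_all add: rowc_def)
      moreover have "wf x 3 = cls x (pw x)" by (simp add: wf_def)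
      ultimately show ?thesis unfolding cls_split l by (simp add: rowc_def)
    qed
    ultimately show "emit UNIV length {0, 9, 12 + d} wf ?c3 3 (%x. wf x 3)" by simp
  qed auto
  have 6: "PR UNIV length (For 3 (wr 2 1 Rightwards) ;; rewind 2) (%x. st (wB ({3, 9} \<union> ?B d) x)) (%x. st (wB ({2, 3, 9} \<union> ?B d) x))"
  proof (rule PR_stage[where A = "{3}"])
    have "emit UNIV length {3} wf (For 3 (wr 2 1 Rightwards)) 2 (%x. replicate (length (wf x 3)) 1)"
      by (intro emits) auto
    moreover have "replicate (length (wf x 3)) 1 = wf x 2" for x unfolding l by (simp add: wf_def)
    ultimately show "emit UNIV length {3} wf (For 3 (wr 2 1 Rightwards)) 2 (%x. wf x 2)" by simp
  qed auto
  let ?c4 = "putw 4 [1, 2] ;; For 9 (wr 4 6 Rightwards) ;; For 9 (wr 4 6 Rightwards) ;; For 0 (wr 4 6 Rightwards) ;; putw 4 [6, 6, 6, 3, 4, 5]"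
  have 7: "PR UNIV length (?c4 ;; rewind 4) (%x. st (wB ({2, 3, 9} \<union> ?B d) x)) (%x. st (wB ({2, 3, 4, 9} \<union> ?B d) x))"
  proof (rule PR_stage[where A = "{0, 9}"])
    have "emit UNIV length {0, 9} wf ?c4 4 (%x. [1, 2] @ replicate (length (wf x 9)) 6 @ replicate (length (wf x 9)) 6 @ replicate (length (wf x 0)) 6 @ [6, 6, 6, 3, 4, 5])"
      by (intro emits) auto
    moreover have "[1, 2] @ replicate (length (wf x 9)) 6 @ replicate (length (wf x 9)) 6 @ replicate (length (wf x 0)) 6 @ [6, 6, 6, 3, 4, 5] = wf x 4" for x
      unfolding l by (simp add: wf_def rels_def)
    ultimately show "emit UNIV length {0, 9} wf ?c4 4 (%x. wf x 4)" by simp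
  qed auto
  have 8: "PR UNIV length (For 2 (For 3 (putw 10 (replicate K 1))) ;; rewind 10) (%x. st (wB ({2, 3, 4, 9} \<union> ?B d) x)) (%x. st (wB ({2, 3, 4, 9, 10} \<union> ?B d) x))"
  proof (rule PR_stage[where A = "{2, 3}"])
    have "emit UNIV length {2, 3} wf (For 2 (For 3 (putw 10 (replicate K 1)))) 10 (%x. concat (replicate (length (wf x 2)) (concat (replicate (length (wf x 3)) (replicate K 1)))))"
      by (intro emits) auto
    moreover have "concat (replicate (length (wf x 2)) (concat (replicate (length (wf x 3)) (replicate K 1)))) = wf x 10" for x
      unfolding l concat_const by (simp add: wf_def mult_ac)
    ultimately show "emit UNIV length {2, 3} wf (For 2 (For 3 (putw 10 (replicate K 1)))) 10 (%x. wf x 10)" by simp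
  qed auto
  have 81: "PR UNIV length (For 2 (putw 11 (replicate K 1)) ;; rewind 11) (%x. st (wB ({2, 3, 4, 9, 10} \<union> ?B d) x)) (%x. st (wB ({2, 3, 4, 9, 10, 11} \<union> ?B d) x))"
  proof (rule PR_stage[where A = "{2}"])
    have "emit UNIV length {2} wf (For 2 (putw 11 (replicate K 1))) 11 (%x. concat (replicate (length (wf x 2)) (replicate K 1)))"
      by (intro emits) auto
    moreover have "concat (replicate (length (wf x 2)) (replicate K 1)) = wf x 11" for x
      unfolding l concat_const by (simp add: wf_def mult_ac)
    ultimately show "emit UNIV length {2} wf (For 2 (putw 11 (replicate K 1))) 11 (%x. wf x 11)" by simp
  qed auto
  let ?c5 = "For 10 (wr 5 1 Rightwards) ;; For 11 (wr 5 1 Rightwards)"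
  have 82: "PR UNIV length (?c5 ;; rewind 5) (%x. st (wB ({2, 3, 4, 9, 10, 11} \<union> ?B d) x)) (%x. st (wB ({2, 3, 4, 5, 9, 10, 11} \<union> ?B d) x))"
  proof (rule PR_stage[where A = "{10, 11}"])
    have "emit UNIV length {10, 11} wf ?c5 5 (%x. replicate (length (wf x 10)) 1 @ replicate (length (wf x 11)) 1)"
      by (intro emits) auto
    moreover have "replicate (length (wf x 10)) 1 @ replicate (length (wf x 11)) 1 = wf x 5" for x
      by (simp add: wf_def replicate_add)
    ultimately show "emit UNIV length {10, 11} wf ?c5 5 (%x. wf x 5)" by simp
  qed auto
  have w67: "wf x 6 = [2]" "wf x 7 = [2]" for x by (simp_all add: wf_def)
  have 9: "PR UNIV length (putw 6 [2] ;; rewind 6) (%x. st (wB ({2, 3, 4, 5, 9, 10, 11} \<union> ?B d) x)) (%x. st (wB ({2, 3, 4, 5, 6, 9, 10, 11} \<union> ?B d) x))"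
    by (rule PR_stage[where A = "{}"]) (use w67 emit_putw[of UNIV length "{}" wf 6 "[2]"] in auto)
  have 10: "PR UNIV length (putw 7 [2] ;; rewind 7) (%x. st (wB ({2, 3, 4, 5, 6, 9, 10, 11} \<union> ?B d) x)) (%x. st (wB ({2, 3, 4, 5, 6, 7, 9, 10, 11} \<union> ?B d) x))"
    by (rule PR_stage[where A = "{}"]) (use w67 emit_putw[of UNIV length "{}" wf 7 "[2]"] in auto)
  have fin: "wB ({2, 3, 4, 5, 6, 7, 9, 10, 11} \<union> ?B d) x = wB {0..12 + d} x" for x
    by (auto simp: wB_def fun_eq_iff) (auto simp: wf_def)
  show ?thesis unfolding prepare_def
    by (rule PR_cong[OF PR_Seq[OF 1 PR_Seq[OF 2 PR_Seq[OF 3 PR_Seq[OF 4 PR_Seq[OF 5 PR_Seq[OF 6 PR_Seq[OF 7 PR_Seq[OF 8 PR_Seq[OF 81 PR_Seq[OF 82 PR_Seq[OF 9 10]]]]]]]]]]]]) (simp_all only: 0 fin)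
qed

end

section \<open>Extracting the count from the digits of the answer\<close>

lemma bits_nth: "p < length (bits_of_nat n) & bits_of_nat n ! p \<longleftrightarrow> odd (n div 2 ^ p)"
proof (induction p arbitrary: n)
  case 0
  show ?case by (subst (1 2) bits_of_nat.simps) auto
next
  case (Suc p)
  show ?case
  proof (cases "n = 0")
    case False
    then show ?thesis using Suc[of "n div 2"] by (simp add: bits_of_nat.simps[of n] div_mult2_eq)
  qed (simp add: bits_of_nat.simps)
qed

lemma low_bits: "v < 2 ^ k ==> \<exists>r. low k v = bits_of_nat v @ replicate r False"
proof (induction k arbitrary: v)
  case 0
  then show ?case by (simp add: low_def bits_of_nat.simps)
next
  case (Suc k)
  show ?case
  proof (cases "v = 0")
    case True
    then have "low (Suc k) v = replicate (Suc k) False" by (simp add: low_def map_replicate_const del: upt_Suc)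
    moreover have "bits_of_nat v = []" using True by (simp add: bits_of_nat.simps)
    ultimately show ?thesis by (intro exI[of _ "Suc k"]) simp
  next
    case False
    obtain r where "low k (v div 2) = bits_of_nat (v div 2) @ replicate r False" using Suc.IH[of "v div 2"] Suc.prems by (auto simp: less_mult_imp_div_less mult.commute)
    then show ?thesis using False by (auto simp: low_Suc bits_of_nat.simps[of v])
  qed
qed

lemma low_mod: "low k (v mod 2 ^ k) = low k v"
proof (induction k arbitrary: v)
  case (Suc k)
  have "v mod 2 ^ Suc k = 2 * (v div 2 mod 2 ^ k) + v mod 2" by (simp add: mod_mult2_eq)
  moreover have "odd (2 * a + v mod 2) = odd v" "(2 * a + v mod 2) div 2 = a" for a by auto
  ultimately show ?case using Suc[of "v div 2"] by (simp only: low_Suc)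
qed (simp add: low_def)

lemma bits_last: "v \<noteq> 0 ==> bits_of_nat v \<noteq> [] & last (bits_of_nat v)"
proof (induction v rule: less_induct)
  case (less v)
  show ?case
  proof (cases "v = 1")
    case True then show ?thesis by (simp add: bits_of_nat.simps)
  next
    case False
    then have "v div 2 \<noteq> 0" "v div 2 < v" using less.prems by auto
    then show ?thesis using less.IH[of "v div 2"] less.prems by (simp add: bits_of_nat.simps[of v])
  qed
qed

definition post :: com where
  "post = reset 0 ;; wr 0 0 Stay ;; For 10 (mv 1 Rightwards) ;;
     For 11 (Case (%v. wr 0 (if v 1 = 2 then 2 else 1) Rightwards) ;; mv 1 Rightwards) ;;
     mv 0 Leftwards ;; While (%v. v 0 = 1) (wr 0 0 Leftwards)"

lemma wfc_post: "12 \<le> kk ==> 4 \<le> g ==> wfc kk g post"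
  by (auto simp: post_def)

lemma PR_post:
  assumes p: "pbound D sz (%i. length (w i))" "pbound D sz (%i. length (a i))" "pbound D sz (%i. length (b i))"
    and s: "\<And>i. i \<in> D ==> s i 0 = arr (w i) 0 & 0 \<notin> set (w i) & s i 1 = tape_of (map bit_sym (bits_of_nat (n i)))
      & s i 10 = arr (a i) 0 & 0 \<notin> set (a i) & s i 11 = arr (b i) 0 & 0 \<notin> set (b i)"
  obtains t where "PR D sz post s t" "\<And>i. i \<in> D ==> holds_word (t i 0) (bits_of_nat (n i div 2 ^ length (a i) mod 2 ^ length (b i)))"
proof -
  let ?ans = "%i. fst (tape_of (map bit_sym (bits_of_nat (n i))))"
  let ?v = "%i. n i div 2 ^ length (a i)"
  let ?x = "%i. n i div 2 ^ length (a i) mod 2 ^ length (b i)"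
  let ?o = "%i l. outt (map bit_sym (low l (?v i)))"
  have 1: "PR D sz (reset 0) s (%i. (s i)(0 := arr [2] 0))" by (rule PR_reset[OF p(1)]) (use s in auto)
  have 2: "PR D sz (wr 0 0 Stay) (%i. (s i)(0 := arr [2] 0)) (%i. (s i)(0 := ?o i 0, 1 := (?ans i, int 0)))"
  proof (rule PR_wr)
    have "act (0, Stay) (arr [2] 0) = ?o i 0" for i by (auto simp: act_def arr_def outt_def low_def)
    then show "((s i)(0 := arr [2] 0))(0 := act (0, Stay) (((s i)(0 := arr [2] 0)) 0)) = (s i)(0 := ?o i 0, 1 := (?ans i, int 0))" if "i \<in> D" for i
      using s[OF that] by (auto simp: fun_eq_iff tape_of_def)
  qed
  have 3: "PR D sz (For 10 (mv 1 Rightwards)) (%i. (s i)(0 := ?o i 0, 1 := (?ans i, int 0))) (%i. ((s i)(0 := ?o i 0, 1 := (?ans i, int (length (a i)))))(10 := arr (a i) 0))"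
    by (rule PR_For[OF p(2), where s = "%i l. (s i)(0 := ?o i 0, 1 := (?ans i, int l))"]) (use s in auto, rule PR_mv, auto simp: fun_eq_iff)
  let ?s = "%i l. (s i)(0 := ?o i l, 1 := (?ans i, int (length (a i)) + int l))"
  have 4: "PR D sz (For 11 (Case (%v. wr 0 (if v 1 = 2 then 2 else 1) Rightwards) ;; mv 1 Rightwards)) (%i. ?s i 0) (%i. (?s i (length (b i)))(11 := arr (b i) 0))"
  proof (rule PR_For[OF p(3), where s = ?s])
    let ?E = "{(i, l). i \<in> D & l < length (b i)}" and ?sz = "%(i, l). sz i"
    let ?t = "%e. (?s (fst e) (snd e))(11 := arr (b (fst e)) (int (snd e)))"
    have "PR ?E ?sz (Case (%v. wr 0 (if v 1 = 2 then 2 else 1) Rightwards)) ?t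
      (%e. (?t e)(0 := outt (map bit_sym (low (snd e) (?v (fst e))) @ [if view (?t e) 1 = 2 then 2 else 1])))"
      by (rule PR_copy) auto
    then have A: "PR ?E ?sz (Case (%v. wr 0 (if v 1 = 2 then 2 else 1) Rightwards)) ?t (%e. (?t e)(0 := ?o (fst e) (Suc (snd e))))"
    proof (rule PR_cong)
      fix e assume "e \<in> ?E"
      obtain i l where e: "e = (i, l)" by fastforce
      have vw: "view (?t e) 1 = ?ans i (int (length (a i) + l))" by (simp add: e view_def scanned_def)
      have an: "?ans i (int q) = (if q < length (bits_of_nat (n i)) then bit_sym (bits_of_nat (n i) ! q) else 0)" for q
        by (simp add: tape_of_def)
      have "?ans i (int q) = 2 \<longleftrightarrow> odd (n i div 2 ^ q)" for q unfolding an bits_nth[symmetric]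
        by (cases "bits_of_nat (n i) ! q") auto
      then have "view (?t e) 1 = 2 \<longleftrightarrow> odd (?v i div 2 ^ l)" unfolding vw by (simp only: power_add div_mult2_eq)
      then have "map bit_sym (low l (?v i)) @ [if view (?t e) 1 = 2 then 2 else 1] = map bit_sym (low (Suc l) (?v i))"
        by (cases "odd (?v i div 2 ^ l)") (simp_all add: low_def)
      then show "(?t e)(0 := outt (map bit_sym (low (snd e) (?v (fst e))) @ [if view (?t e) 1 = 2 then 2 else 1])) = (?t e)(0 := ?o (fst e) (Suc (snd e)))"
        by (simp only: e fst_conv snd_conv)
    qed simp
    have B: "PR ?E ?sz (mv 1 Rightwards) (%e. (?t e)(0 := ?o (fst e) (Suc (snd e)))) (%(i, l). (?s i (Suc l))(11 := arr (b i) (int l)))"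
      by (rule PR_mv) (auto simp: fun_eq_iff)
    show "PR ?E ?sz (Case (%v. wr 0 (if v 1 = 2 then 2 else 1) Rightwards) ;; mv 1 Rightwards)
      (%(i, l). (?s i l)(11 := arr (b i) (int l))) (%(i, l). (?s i (Suc l))(11 := arr (b i) (int l)))"
      by (rule PR_cong[OF PR_Seq[OF A B]]) auto
  qed (use s in auto)
  have "\<forall>i. \<exists>r. low (length (b i)) (?v i) = bits_of_nat (?x i) @ replicate r False"
    using low_bits low_mod by (metis mod_less_divisor zero_less_numeral zero_less_power)
  then obtain r where r: "\<And>i. low (length (b i)) (?v i) = bits_of_nat (?x i) @ replicate (r i) False" by metis
  have rl: "length (bits_of_nat (?x i)) + r i = length (b i)" for i using arg_cong[OF r, of length] by (simp add: low_def)
  let ?B = "%i. length (bits_of_nat (?x i))"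
  let ?u = "%i l. (?s i (length (b i)))(11 := arr (b i) 0, 0 := arr (map bit_sym (bits_of_nat (?x i) @ replicate (r i - l) False)) (int (?B i) + int (r i) - int l - 1))"
  have 5: "PR D sz (mv 0 Leftwards) (%i. (?s i (length (b i)))(11 := arr (b i) 0)) (%i. ?u i 0)"
  proof (rule PR_mv)
    fix i
    have "int (length (low (length (b i)) (?v i))) = int (?B i) + int (r i)" by (simp add: r)
    then show "((?s i (length (b i)))(11 := arr (b i) 0))(0 := (fst (((?s i (length (b i)))(11 := arr (b i) 0)) 0),
       case Leftwards of Leftwards => snd (((?s i (length (b i)))(11 := arr (b i) 0)) 0) - 1 | Stay => snd (((?s i (length (b i)))(11 := arr (b i) 0)) 0) | Rightwards => snd (((?s i (length (b i)))(11 := arr (b i) 0)) 0) + 1)) = ?u i 0"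
      by (simp add: outt_def arr_move) (simp add: r)
  qed
  have 6: "PR D sz (While (%v. v 0 = 1) (wr 0 0 Leftwards)) (%i. ?u i 0) (%i. ?u i (r i))"
  proof (rule PR_While[where s = ?u and n = r])
    show "pbound D sz r" by (rule pbound_mono[OF p(3)]) (metis le_add2 rl)
    fix i l assume l: "l < r i"
    define q where "q = r i - Suc l"
    have q: "r i - l = Suc q" "int (?B i) + int (r i) - int l - 1 = int (?B i + q)" "r i - Suc l = q" "int (?B i) + int (r i) - int (Suc l) - 1 = int (?B i + q) - 1" using l by (auto simp: q_def)
    have "scanned (arr (map bit_sym (bits_of_nat (?x i) @ replicate (Suc q) False)) (int (?B i + q))) = 1"
      by (subst scanned_arr) (auto simp: nth_append simp del: replicate_Suc)
    then show "view (?u i l) 0 = 1" by (simp only: view_def q fun_upd_same)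
  next
    fix i
    show "\<not> view (?u i (r i)) 0 = 1"
    proof (cases "?x i = 0")
      case True
      then have "bits_of_nat (?x i) = []" by (simp add: bits_of_nat.simps)
      then show ?thesis by (simp add: view_def)
    next
      case False
      then have b: "bits_of_nat (?x i) \<noteq> []" "last (bits_of_nat (?x i))" using bits_last by auto
      then have "bits_of_nat (?x i) ! (?B i - 1)" by (simp add: last_conv_nth)
      moreover have "int (?B i) - 1 = int (?B i - 1)" using b(1) by (metis One_nat_def Suc_leI length_greater_0_conv of_nat_1 of_nat_diff)
      moreover have "?B i - 1 < ?B i" using b(1) by simp
      then have "scanned (arr (map bit_sym (bits_of_nat (?x i))) (int (?B i - 1))) = bit_sym (bits_of_nat (?x i) ! (?B i - 1))" by (subst scanned_arr) auto
      ultimately have "scanned (arr (map bit_sym (bits_of_nat (?x i))) (int (?B i) - 1)) = 2" by (simp only: bit_sym.simps)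
      then show ?thesis by (simp add: view_def)
    qed
  next
    show "PR {(i, l). i \<in> D & l < r i} (%(i, l). sz i) (wr 0 0 Leftwards) (%(i, l). ?u i l) (%(i, l). ?u i (Suc l))"
    proof (rule PR_wr, clarify)
      fix i l assume l: "l < r i"
      define q where "q = r i - Suc l"
      have q: "r i - l = Suc q" "int (?B i) + int (r i) - int l - 1 = int (?B i + q)" "r i - Suc l = q" "int (?B i) + int (r i) - int (Suc l) - 1 = int (?B i + q) - 1" using l by (auto simp: q_def)
      have "act (0, Leftwards) (arr (map bit_sym (bits_of_nat (?x i) @ replicate (Suc q) False)) (int (?B i + q))) = arr (map bit_sym (bits_of_nat (?x i) @ replicate q False)) (int (?B i + q) - 1)"
        using arr_erase_last[of "map bit_sym (bits_of_nat (?x i) @ replicate q False)" 1] by (simp add: replicate_append_same)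
      then show "(?u i l)(0 := act (0, Leftwards) (?u i l 0)) = ?u i (Suc l)" by (simp only: q fun_upd_same fun_upd_upd)
    qed
  qed
  have 34: "PR D sz (For 10 (mv 1 Rightwards)) (%i. (s i)(0 := ?o i 0, 1 := (?ans i, int 0))) (%i. ?s i 0)"
    by (rule PR_cong[OF 3]) (use s in \<open>auto simp: fun_eq_iff\<close>)
  show ?thesis
  proof (rule that)
    show "PR D sz post s (%i. ?u i (r i))" unfolding post_def by (rule PR_Seq[OF 1 PR_Seq[OF 2 PR_Seq[OF 34 PR_Seq[OF 4 PR_Seq[OF 5 6]]]]])
    show "holds_word (?u i (r i) 0) (bits_of_nat (?x i))" for i by (simp add: holds_word_def arr_def)
  qed
qed

lemma poly_le_power: "\<exists>d. \<forall>n. poly f n \<le> (n + 2) ^ d" for f :: "nat poly"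
proof (induction f)
  case 0 then show ?case by simp
next
  case (pCons a f)
  then obtain d where d: "\<And>n. poly f n \<le> (n + 2) ^ d" by blast
  have "poly (pCons a f) n \<le> (n + 2) ^ (a + d + 1)" for n
  proof -
    have "a \<le> 2 ^ a" by (rule less_imp_le) (rule less_exp)
    also have "\<dots> \<le> (n + 2) ^ a" by (rule power_mono) auto
    also have "\<dots> \<le> (n + 2) ^ (a + d)" by (rule power_increasing) auto
    finally have 1: "a \<le> (n + 2) ^ (a + d)" .
    have "(n + 2) ^ d \<le> (n + 2) ^ (a + d)" by (rule power_increasing) auto
    then have "n * poly f n \<le> n * (n + 2) ^ (a + d)" using d[of n] by (intro mult_le_mono2) linarith
    then have "poly (pCons a f) n \<le> (n + 2) ^ (a + d) + n * (n + 2) ^ (a + d)" unfolding poly_pCons using 1 by (intro add_mono)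
    also have "\<dots> \<le> (n + 2) ^ (a + d + 1)" by (simp add: algebra_simps)
    finally show ?thesis .
  qed
  then show ?case by blast
qed

text \<open>The congruence fixes the lowest \<open>e + k\<close> binary digits; \<open>c\<close>
  fits into the upper \<open>k\<close> of them.\<close>

lemma div_mod_of_cong:
  assumes "[N = 2 ^ e * c] (mod 2 ^ (e + k))" "c < 2 ^ k"
  shows "N div 2 ^ e mod 2 ^ k = (c :: nat)"
proof -
  have "(2::nat) ^ e * c < 2 ^ (e + k)" using assms(2) by (simp add: power_add)
  then have "N mod 2 ^ (e + k) = 2 ^ e * c" using assms(1) by (simp add: cong_def)
  then have "2 ^ e * (N div 2 ^ e mod 2 ^ k) + N mod 2 ^ e = 2 ^ e * c" by (simp add: power_add mod_mult2_eq)
  then have "(2 ^ e * (N div 2 ^ e mod 2 ^ k) + N mod 2 ^ e) div 2 ^ e = (2 ^ e * c) div 2 ^ e" by (rule arg_cong)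
  then show ?thesis by simp
qed

theorem reduction:
  assumes "polytime_relation R" "polynomially_balanced R"
  shows "polytime_Turing_reducible (%x. card {y. R x y}) domino_tilings_problem"
proof -
  obtain M and p :: "nat poly" where M: "wf_machine M"
    and out: "\<And>x y. outputs_within M Map.empty (map bit_sym x @ [3] @ map bit_sym y) (poly p (length x + length y)) [R x y]"
    using assms(1) by (auto simp: polytime_relation_def)
  obtain q :: "nat poly" where q: "\<And>x y. R x y ==> length y \<le> poly q (length x)" using assms(2) by (auto simp: polynomially_balanced_def)
  \<comment> \<open>One exponent for both bounds: on the length of the witnesses and on the running
    time for the longest of them.\<close>
  obtain d where d: "\<And>n. poly (q + pcompose p ([:0, 1:] + q)) n \<le> (n + 2) ^ d" using poly_le_power by blast
  have dn: "poly q n \<le> (n + 2) ^ d" "poly p (n + poly q n) \<le> (n + 2) ^ d" for n using d[of n] by (simp_all add: poly_pcompose)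
  interpret tableau M by unfold_locales (rule M)
  let ?W = "pw d" and ?V = "vol d"
  have count: "card {f \<in> PiE {..<?V x} (%_. {..<K}). \<forall>u<?V x. \<forall>u'<?V x.
      \<not> cv (relS (rowlen x (?W x)) (int u' - int u)) (cls x (?W x) ! u') (f u) (f u')} = card {y. R x y}" for x
    unfolding vol_def
  proof (rule count_solutions)
    show "outputs_within M Map.empty (inp x y) (poly p (length x + length y)) [R x y]" for y using out by (simp add: inp_def)
    fix y assume "R x y"
    then have l: "length y \<le> poly q (length x)" by (rule q)
    then have "poly p (length x + length y) \<le> poly p (length x + poly q (length x))" by (intro poly_mono_nat) simp
    then show "length y \<le> ?W x & poly p (length x + length y) \<le> ?W x + 1" using l dn[of "length x"] by (simp add: pw_def)
  qed
  let ?s = "%x. st (wB d K {0..12 + d} x)"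
  let ?a = "%x. replicate (K * ?V x * ?V x + K * ?V x) (1::nat)" and ?c = "%x. cls x (?W x)" and ?z = "%x. replicate (?V x) (1::nat)"
  let ?R = "%x. fst (arr (rels d x) 0)"
  have sv: "?s x k = arr (if k \<le> 12 + d then wf d K x k else []) 0" for x k by (simp add: st_def wB_def)
  have lc: "length (?c x) = ?V x" for x by (simp add: length_cls vol_def)
  have n1: "numt 1 = arr [2] 0" by (simp add: numt_def bits_of_nat.simps[of "Suc 0"] bits_of_nat.simps[of 0])
  let ?X = "%x. gst ?s ?a ?c ?z ?R K cv x (K * length (?c x) + 3) (length (?c x)) 0"
  have mainr: "PR UNIV length (main K cv) ?s ?X"
  proof (rule PR_main[OF K_pos])
    show "pbound UNIV length (%i. length (?a i))" by (simp only: length_replicate) (intro pbound_intros pb_vol)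
    show "pbound UNIV length (%i. length (?c i))" unfolding lc by (rule pb_vol)
    fix x
    show "?s x 1 = outt [] & ?s x 2 = arr (?z x) 0 & 0 \<notin> set (?z x) & length (?z x) = length (?c x) & ?s x 3 = arr (?c x) 0 & 0 \<notin> set (?c x)
      & ?s x 4 = (?R x, 0) & ?s x 5 = arr (?a x) 0 & 0 \<notin> set (?a x) & ?s x 6 = numt 1 & ?s x 7 = numt 1"
      unfolding sv n1 lc using cls_nonzero by (simp add: wf_def outt_def) (simp add: arr_def)
  qed
  let ?c1 = "prepare d K ;; main K cv"
  have r1: "PR UNIV length ?c1 (%x. start (map bit_sym x)) ?X" by (rule PR_Seq[OF PR_prepare mainr])
  let ?ty = "%x. grid.ty K (?V x) (K * ?V x * ?V x + K * ?V x) (cf ?c ?R K cv x)"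
  let ?wd = "%x. grid.Wd K (?V x) (K * ?V x * ?V x + K * ?V x)"
  let ?n = "%x. pm adj (rowsp (?ty x) (?wd x) (K * ?V x + 2))"
  let ?q = "%x. enc_cubes (map vec_of_cell (region_list (?ty x) (?wd x) (K * ?V x + 2)))"
  have gr: "grid K" by (simp add: grid_def K_pos)
  have X1: "?X x 1 = outt (map bit_sym (?q x))" for x
    unfolding gst_def enc_region_list TY_def WD_def lc by (simp add: numeral_3_eq_3)
  have X2: "?X x k = ?s x k" if "k \<noteq> 1" "k \<noteq> 7" "k \<noteq> 4" "k \<noteq> 2" for x k using that by (simp add: gst_def)
  have ans: "domino_tilings_problem (?q x) = Some (?n x)" for x
    by (rule domino_tilings_region) (simp_all add: grid.Wd_def[OF gr])
  have res: "?n x div 2 ^ (K * ?V x * ?V x) mod 2 ^ (K * ?V x) = card {y. R x y}" for x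
  proof (rule div_mod_of_cong)
    let ?S = "{f \<in> PiE {..<?V x} (%_. {..<K}). \<forall>u<?V x. \<forall>u'<?V x. \<not> cv (relS (rowlen x (?W x)) (int u' - int u)) (cls x (?W x) ! u') (f u) (f u')}"
    have cf: "cf ?c ?R K cv x (g * K + t) (g' * K + t') = cv (relS (rowlen x (?W x)) (int g' - int g)) (cls x (?W x) ! g') t t'" if "t < K" "t' < K" for g g' t t'
      using that by (simp add: cf_def rels_tape)
    have "[pm adj (rowsp (?ty x) (?wd x) (grid.N K (?V x) + 2)) = 2 ^ (grid.N K (?V x) * ?V x) * card {f \<in> PiE {..<?V x} (%_. {..<K}). \<forall>g<?V x. \<forall>g'<?V x.
      \<not> cf ?c ?R K cv x (g * K + f g) (g' * K + f g')}] (mod 2 ^ (K * ?V x * ?V x + K * ?V x))"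
    proof (rule grid.core_count[OF gr])
      fix g t t' assume h: "g < ?V x" "t < K" "t' < K" "t \<noteq> t'"
      have "cv (relS (rowlen x (?W x)) 0) (cls x (?W x) ! g) t t'" by (rule diag[OF h(2,3,4)])
      then show "cf ?c ?R K cv x (g * K + t) (g * K + t')" unfolding cf[OF h(2,3)] by simp
    qed
    moreover have "{f \<in> PiE {..<?V x} (%_. {..<K}). \<forall>g<?V x. \<forall>g'<?V x. \<not> cf ?c ?R K cv x (g * K + f g) (g' * K + f g')} = ?S"
    proof (rule Collect_cong)
      fix f
      have e: "cf ?c ?R K cv x (g * K + f g) (g' * K + f g') = cv (relS (rowlen x (?W x)) (int g' - int g)) (cls x (?W x) ! g') (f g) (f g')"
        if "f \<in> PiE {..<?V x} (%_. {..<K})" "g < ?V x" "g' < ?V x" for g g' by (rule cf) (use that in auto)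
      show "(f \<in> PiE {..<?V x} (%_. {..<K}) & (\<forall>g<?V x. \<forall>g'<?V x. \<not> cf ?c ?R K cv x (g * K + f g) (g' * K + f g'))) =
        (f \<in> PiE {..<?V x} (%_. {..<K}) & (\<forall>u<?V x. \<forall>u'<?V x. \<not> cv (relS (rowlen x (?W x)) (int u' - int u)) (cls x (?W x) ! u') (f u) (f u')))"
        by (intro conj_cong refl all_cong1 imp_cong arg_cong[where f = Not]) (rule e)
    qed
    ultimately show "[?n x = 2 ^ (K * ?V x * ?V x) * card {y. R x y}] (mod 2 ^ (K * ?V x * ?V x + K * ?V x))"
      by (simp only: count grid.N_def[OF gr])
    \<comment> \<open>A witness is one of K^V fillings, where V is the number of cells, and K < 2^K;
      so the count has at most K V binary digits.\<close>
    have "card {y. R x y} \<le> card (PiE {..<?V x} (%_. {..<K}))" unfolding count[symmetric] by (intro card_mono finite_PiE) auto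
    also have "\<dots> = K ^ ?V x" by (simp add: card_PiE)
    also have "\<dots> < (2 ^ K) ^ ?V x" by (rule power_strict_mono) (use less_exp in \<open>auto simp: vol_def rowlen_def\<close>)
    finally show "card {y. R x y} < 2 ^ (K * ?V x)" by (simp add: power_mult)
  qed
  let ?s2 = "%x. (?X x)(1 := tape_of (map bit_sym (bits_of_nat (?n x))))"
  obtain t where t: "PR UNIV length post ?s2 t"
    "\<And>x. x \<in> UNIV ==> holds_word (t x 0) (bits_of_nat (?n x div 2 ^ length (wf d K x 10) mod 2 ^ length (wf d K x 11)))"
  proof (rule PR_post[where D = UNIV and sz = length and w = "%x. wf d K x 0" and a = "%x. wf d K x 10" and b = "%x. wf d K x 11" and s = ?s2 and n = ?n])
    show "?s2 x 0 = arr (wf d K x 0) 0 & 0 \<notin> set (wf d K x 0) & ?s2 x 1 = tape_of (map bit_sym (bits_of_nat (?n x))) &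
      ?s2 x 10 = arr (wf d K x 10) 0 & 0 \<notin> set (wf d K x 10) & ?s2 x 11 = arr (wf d K x 11) 0 & 0 \<notin> set (wf d K x 11)" for x
      using wf_nonzero X2[of 0 x] X2[of 10 x] X2[of 11 x] by (simp add: sv)
  qed (use pb_wf in blast)+
  have t2: "holds_word (t x 0) (bits_of_nat (card {y. R x y}))" for x
    using t(2)[of x] res[of x] by (simp add: wf_def)
  obtain p1 p2 :: "nat poly" where p1: "\<And>x. runs ?c1 (start (map bit_sym x)) (poly p1 (length x)) (?X x)"
    and p2: "\<And>x. runs post (?s2 x) (poly p2 (length x)) (t x)" using r1 t(1) unfolding PR_def by blast
  have "wfc (13 + d) 10 ?c1" "wfc (13 + d) 10 post" using wfc_prepare[of d K] wfc_main[of "13 + d" 10] wfc_post[of "13 + d" 10] by auto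
  from machine_of_oracle_program[OF _ _ this] obtain M' where M': "wf_machine M'"
    "\<And>F ss n1 \<tau>1 q N n2 \<tau>2 w t. set ss \<subseteq> {..<4} ==> exec ?c1 (start ss) n1 \<tau>1 ==> holds_word (\<tau>1 1) q ==> F q = Some N ==>
      exec post (\<tau>1(1 := tape_of (map bit_sym (bits_of_nat N)))) n2 \<tau>2 ==> n1 + n2 + 1 \<le> t ==> holds_word (\<tau>2 0) w ==>
      outputs_within M' F ss t w" by auto
  have "outputs_within M' domino_tilings_problem (map bit_sym x) (poly (p1 + p2 + [:1:]) (length x)) (bits_of_nat (card {y. R x y}))" for x
  proof -
    obtain n1 where n1: "n1 \<le> poly p1 (length x)" "exec ?c1 (start (map bit_sym x)) n1 (?X x)" using p1[of x] by (auto simp: runs_def)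
    obtain n2 where n2: "n2 \<le> poly p2 (length x)" "exec post (?s2 x) n2 (t x)" using p2[of x] by (auto simp: runs_def)
    have "set (map bit_sym x) \<subseteq> {..<4}" by (auto intro: bit_sym_less)
    moreover have "holds_word (?X x 1) (?q x)" unfolding X1 by (simp add: holds_word_def outt_def arr_def)
    ultimately show ?thesis using n1 n2 ans[of x] t2[of x] by (intro M'(2)) auto
  qed
  then show ?thesis unfolding polytime_Turing_reducible_def using M'(1) by blast
qed

section \<open>Checking a tiling\<close>

definition zt :: "nat list => nat list => tape" where "zt u w = arr (u @ w) (int (length u))"
definition reg :: "nat => tape" where "reg a = (%z. if z = 0 then a else 0, 0)"

lemma scanned_zt [simp]: "scanned (zt u (a # w)) = a" "scanned (zt u []) = 0"
  by (simp_all add: zt_def scanned_arr nth_append)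

lemma scanned_reg [simp]: "scanned (reg a) = a" by (simp add: reg_def scanned_def)

lemma act_reg [simp]: "act (b, Stay) (reg a) = reg b" by (auto simp: reg_def act_def)

lemma runs_mvR: "tp j = zt u (a # w) ==> runs (mv j Rightwards) tp 1 (tp(j := zt (u @ [a]) w))"
  using runs_Op[of j "%a. a" Rightwards tp] by (simp add: mv_def zt_def arr_move algebra_simps)

lemma runs_mvL: "tp j = zt (u @ [a]) w ==> runs (mv j Leftwards) tp 1 (tp(j := zt u (a # w)))"
  using runs_Op[of j "%a. a" Leftwards tp] by (simp add: mv_def zt_def arr_move)

lemma runs_reg: "tp j = reg a ==> runs (wr j b Stay) tp 1 (tp(j := reg b))"
  using runs_Op[of j "%_. b" Stay tp] by (simp add: wr_def)

lemma runs_WhileT: "p (view tp) ==> runs c tp n \<tau> ==> runs (While p c) \<tau> k \<rho> ==> runs (While p c) tp (Suc (n + k)) \<rho>"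
  unfolding runs_def by (metis Suc_le_mono add_mono exec.WhileT)

lemma runs_WhileF: "\<not> p (view tp) ==> runs (While p c) tp 1 tp"
  unfolding runs_def by (metis exec.WhileF order_refl)

section \<open>Carry automaton on pairs of encoded numbers\<close>

definition sy :: "bool => bool => nat" where "sy a b = 1 + of_bool a + 2 * of_bool b"
definition xb :: "nat => bool" where "xb a \<longleftrightarrow> a = 2 \<or> a = 4"
definition yb :: "nat => bool" where "yb a \<longleftrightarrow> a = 3 \<or> a = 4"

lemma xb_sy [simp]: "xb (sy a b) = a" "yb (sy a b) = b" "sy a b = 0 \<longleftrightarrow> False" "0 = sy a b \<longleftrightarrow> False" "sy a b = 5 \<longleftrightarrow> False" "sy a b < 5"
  by (cases a; cases b; simp add: sy_def xb_def yb_def)+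

definition sgni :: "bool => int" where "sgni s = (if s then - 1 else 1)"

text \<open>The register holds \<open>c + 2\<close> where \<open>c\<close> is the carry in the computation of \<open>\<plusminus>b \<plusminus> a + c\<close> from the least
  significant bit on; 4 records that the result is not zero.\<close>

definition upd :: "bool => bool => bool => bool => nat => nat" where
  "upd sa sb a b q = (let t = sgni sb * of_bool b - sgni sa * of_bool a + (int q - 2) in if q = 4 \<or> odd t then 4 else nat (t div 2 + 2))"

fun crun :: "bool => bool => bool list => bool list => nat => nat" where
  "crun sa sb [] [] q = q"
| "crun sa sb (a # as) [] q = crun sa sb as [] (upd sa sb a False q)"
| "crun sa sb [] (b # bs) q = crun sa sb [] bs (upd sa sb False b q)"
| "crun sa sb (a # as) (b # bs) q = crun sa sb as bs (upd sa sb a b q)"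

fun nv :: "bool list => nat" where
  "nv [] = 0"
| "nv (b # bs) = of_bool b + 2 * nv bs"

lemma upd_4 [simp]: "upd sa sb a b 4 = 4" by (simp add: upd_def)

lemma crun_4 [simp]: "crun sa sb as bs 4 = 4"
  by (induction sa sb as bs "4 :: nat" rule: crun.induct) auto

lemma upd_step:
  assumes "q \<in> {1, 2, 3}"
  shows "upd sa sb a b q = 4 & odd (sgni sb * of_bool b - sgni sa * of_bool a + (int q - 2)) \<or>
    upd sa sb a b q \<in> {1, 2, 3} & sgni sb * of_bool b - sgni sa * of_bool a + (int q - 2) = 2 * (int (upd sa sb a b q) - 2)"
  using assms by (cases sa; cases sb; cases a; cases b) (auto simp: upd_def sgni_def)

text \<open>The invariant is the signed sum of the unread parts plus the carry. An odd partial sum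
  at the current digit makes the total odd, hence nonzero; an even one can be halved, and its half
  is the next carry, again between -1 and 1.\<close>

lemma crun_correct:
  assumes "q \<in> {1, 2, 3}"
  shows "crun sa sb as bs q = 2 \<longleftrightarrow> sgni sb * int (nv bs) - sgni sa * int (nv as) + (int q - 2) = 0"
proof -
  have gen: "crun sa sb as bs (upd sa sb a b q) = 2 \<longleftrightarrow> sgni sb * (of_bool b + 2 * int (nv bs)) - sgni sa * (of_bool a + 2 * int (nv as)) + (int q - 2) = 0"
    if q: "q \<in> {1, 2, 3}" and IH: "\<And>q'. q' = upd sa sb a b q ==> q' \<in> {1, 2, 3} ==> crun sa sb as bs q' = 2 \<longleftrightarrow> sgni sb * int (nv bs) - sgni sa * int (nv as) + (int q' - 2) = 0"
    for sa sb a b as bs q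
  proof -
    let ?t = "sgni sb * of_bool b - sgni sa * of_bool a + (int q - 2)"
    have e: "sgni sb * (of_bool b + 2 * int (nv bs)) - sgni sa * (of_bool a + 2 * int (nv as)) + (int q - 2) = ?t + 2 * (sgni sb * int (nv bs) - sgni sa * int (nv as))"
      by (simp add: algebra_simps)
    from upd_step[OF q, of sa sb a b] show ?thesis
    proof
      assume o: "upd sa sb a b q = 4 & odd ?t"
      then have "odd (?t + 2 * (sgni sb * int (nv bs) - sgni sa * int (nv as)))" by presburger
      then have "?t + 2 * (sgni sb * int (nv bs) - sgni sa * int (nv as)) \<noteq> 0" by (metis even_zero)
      then show ?thesis using o unfolding e by simp
    next
      assume o: "upd sa sb a b q \<in> {1, 2, 3} & ?t = 2 * (int (upd sa sb a b q) - 2)"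
      have "Y + (u - 2) = 0 \<longleftrightarrow> 2 * (u - 2) + 2 * Y = 0" for u Y :: int by presburger
      then show ?thesis unfolding e conjunct2[OF o] IH[OF refl conjunct1[OF o]] .
    qed
  qed
  show ?thesis using assms
  proof (induction sa sb as bs q rule: crun.induct)
    case (1 sa sb q) then show ?case by auto
  next
    case (2 sa sb a as q)
    have "crun sa sb as [] (upd sa sb a False q) = 2 \<longleftrightarrow> sgni sb * (of_bool False + 2 * int (nv [])) - sgni sa * (of_bool a + 2 * int (nv as)) + (int q - 2) = 0"
      by (rule gen) (use 2 in auto)
    then show ?case by simp
  next
    case (3 sa sb b bs q)
    have "crun sa sb [] bs (upd sa sb False b q) = 2 \<longleftrightarrow> sgni sb * (of_bool b + 2 * int (nv bs)) - sgni sa * (of_bool False + 2 * int (nv [])) + (int q - 2) = 0"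
      by (rule gen) (use 3 in auto)
    then show ?case by simp
  next
    case (4 sa sb a as b bs q)
    have "crun sa sb as bs (upd sa sb a b q) = 2 \<longleftrightarrow> sgni sb * (of_bool b + 2 * int (nv bs)) - sgni sa * (of_bool a + 2 * int (nv as)) + (int q - 2) = 0"
      by (rule gen) (use 4 in auto)
    then show ?case by simp
  qed
qed

text \<open>Each number advances by one flag and one bit; a number that has reached its closing flag
  stays there and supplies zeros. The reduction \<open>mod 5\<close> serves \<open>wfc\<close>,
  which asks for small symbols at all views, also at those that never occur.\<close>

definition body :: "bool => bool => com" where
  "body sa sb = Case (%v. (if xb (v 1) then mv 1 Rightwards else Skip) ;; (if xb (v 2) then mv 2 Rightwards else Skip) ;;
     Case (%w. wr 9 (upd sa sb (xb (v 1) & xb (w 1)) (xb (v 2) & xb (w 2)) (w 9) mod 5) Stay) ;;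
     (if xb (v 1) then mv 1 Rightwards else Skip) ;; (if xb (v 2) then mv 2 Rightwards else Skip))"

definition SS :: "store => tape => tape => nat => store" where "SS tp A B q = tp(1 := A, 2 := B, 9 := reg q)"

lemma SS_simps [simp]: "SS tp A B q (Suc 0) = A" "SS tp A B q 2 = B" "SS tp A B q 9 = reg q"
  "(SS tp A B q)(Suc 0 := A') = SS tp A' B q" "(SS tp A B q)(2 := B') = SS tp A B' q" "(SS tp A B q)(9 := reg q') = SS tp A B q'"
  by (auto simp: SS_def fun_eq_iff)

lemma runs_wr_SS: "runs (wr 9 q' Stay) (SS tp A B q) 1 (SS tp A B q')"
  using runs_reg[of "SS tp A B q" 9 q q'] by simp

lemma runs_mv_SS: "runs (mv 1 Rightwards) (SS tp (zt u (a # w)) B q) 1 (SS tp (zt (u @ [a]) w) B q)"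
   "runs (mv 2 Rightwards) (SS tp A (zt u (a # w)) q) 1 (SS tp A (zt (u @ [a]) w) q)"
  using runs_mvR[of "SS tp (zt u (a # w)) B q" 1 u a w] runs_mvR[of "SS tp A (zt u (a # w)) q" 2 u a w] by simp_all

lemma upd_less: "q < 5 ==> upd sa sb a b q < 5"
  by (cases sa; cases sb; cases a; cases b) (auto simp: upd_def sgni_def Let_def less_Suc_eq numeral_eq_Suc)

lemma body_runs:
  assumes A: "f & wa = fa # ba # wa' & xb fa & ua' = ua @ [fa, ba] & a = xb ba \<or> \<not> f & wa' = wa & ua' = ua & \<not> a & \<not> xb (scanned (zt ua wa))"
    and B: "g & wb = fb # bb # wb' & xb fb & ub' = ub @ [fb, bb] & b = xb bb \<or> \<not> g & wb' = wb & ub' = ub & \<not> b & \<not> xb (scanned (zt ub wb))"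
    and q: "q < 5"
  shows "runs (body sa sb) (SS tp (zt ua wa) (zt ub wb) q) 12 (SS tp (zt ua' wa') (zt ub' wb') (upd sa sb a b q))"
proof -
  let ?v = "view (SS tp (zt ua wa) (zt ub wb) q)"
  have f: "xb (?v 1) = f" "xb (?v 2) = g" using A B by (auto simp: view_def)
  define ua1 where "ua1 = (if f then ua @ [fa] else ua)"
  define wa1 where "wa1 = (if f then ba # wa' else wa)"
  define ub1 where "ub1 = (if g then ub @ [fb] else ub)"
  define wb1 where "wb1 = (if g then bb # wb' else wb)"
  have 1: "runs (if f then mv 1 Rightwards else Skip) (SS tp (zt ua wa) B q) 1 (SS tp (zt ua1 wa1) B q)" for B
    using A runs_mv_SS(1)[of tp ua fa "ba # wa'" B q] runs_Skip by (auto simp: ua1_def wa1_def)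
  have 2: "runs (if g then mv 2 Rightwards else Skip) (SS tp A (zt ub wb) q) 1 (SS tp A (zt ub1 wb1) q)" for A
    using B runs_mv_SS(2)[of tp A ub fb "bb # wb'" q] runs_Skip by (auto simp: ub1_def wb1_def)
  have w: "(f & xb (scanned (zt ua1 wa1))) = a" "(g & xb (scanned (zt ub1 wb1))) = b" using A B by (auto simp: ua1_def wa1_def ub1_def wb1_def)
  have 3: "runs (Case (%w. wr 9 (upd sa sb (f & xb (w 1)) (g & xb (w 2)) (w 9) mod 5) Stay)) (SS tp (zt ua1 wa1) (zt ub1 wb1) q) (Suc 1) (SS tp (zt ua1 wa1) (zt ub1 wb1) (upd sa sb a b q))"
    by (rule runs_Case) (use runs_wr_SS w upd_less[OF q] in \<open>simp add: view_def\<close>)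
  have 4: "runs (if f then mv 1 Rightwards else Skip) (SS tp (zt ua1 wa1) B q) 1 (SS tp (zt ua' wa') B q)" for B q
    using A runs_mv_SS(1)[of tp ua1 ba "wa'" B q] runs_Skip by (auto simp: ua1_def wa1_def)
  have 5: "runs (if g then mv 2 Rightwards else Skip) (SS tp A (zt ub1 wb1) q) 1 (SS tp A (zt ub' wb') q)" for A q
    using B runs_mv_SS(2)[of tp A ub1 bb "wb'" q] runs_Skip by (auto simp: ub1_def wb1_def)
  have "runs (body sa sb) (SS tp (zt ua wa) (zt ub wb) q) (Suc (Suc (1 + Suc (1 + Suc (Suc 1 + Suc (1 + 1)))))) (SS tp (zt ua' wa') (zt ub' wb') (upd sa sb a b q))"
    unfolding body_def by (rule runs_Case, unfold f) (rule runs_Seq[OF 1 runs_Seq[OF 2 runs_Seq[OF 3 runs_Seq[OF 4 5]]]])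
  then show ?thesis by (rule runs_mono) simp
qed

definition fcells :: "bool list => nat list => bool" where "fcells bs w \<longleftrightarrow> map xb w = dbl bs @ [False]"

lemma fcells_Cons: "fcells (b # bs) w \<longleftrightarrow> (\<exists>f a w'. w = f # a # w' & xb f & xb a = b & fcells bs w')"
  by (auto simp: fcells_def dbl_def map_eq_Cons_conv)

lemma fcells_Nil: "fcells [] w \<longleftrightarrow> (\<exists>f. w = [f] & \<not> xb f)"
  by (auto simp: fcells_def dbl_def map_eq_Cons_conv)

lemma fcells_ne: "fcells bs w ==> w \<noteq> []"
  by (auto simp: fcells_def)

lemma num_runs:
  assumes "fcells as ca" "fcells bs cb" "q < 5"
  shows "runs (While (%v. xb (v 1) \<or> xb (v 2)) (body sa sb)) (SS tp (zt ua (ca @ ra)) (zt ub (cb @ rb)) q) (13 * (length as + length bs) + 1)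
      (SS tp (zt (ua @ butlast ca) (last ca # ra)) (zt (ub @ butlast cb) (last cb # rb)) (crun sa sb as bs q))"
  using assms
proof (induction sa sb as bs q arbitrary: ca cb ua ub rule: crun.induct)
  case (1 sa sb q)
  then obtain f h where "ca = [f]" "\<not> xb f" "cb = [h]" "\<not> xb h" by (auto simp: fcells_Nil)
  then show ?case using runs_WhileF[of "%v. xb (v 1) \<or> xb (v 2)" "SS tp (zt ua (ca @ ra)) (zt ub (cb @ rb)) q"] by (simp add: view_def)
next
  case (2 sa sb a as q)
  then obtain f c w h where w: "ca = f # c # w" "xb f" "xb c = a" "fcells as w" "cb = [h]" "\<not> xb h" by (auto simp: fcells_Cons fcells_Nil)
  have b: "runs (body sa sb) (SS tp (zt ua (ca @ ra)) (zt ub (cb @ rb)) q) 12 (SS tp (zt (ua @ [f, c]) (w @ ra)) (zt ub (cb @ rb)) (upd sa sb a False q))"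
    by (rule body_runs[where f = True and g = False]) (use w 2 in auto)
  have "runs (While (%v. xb (v 1) \<or> xb (v 2)) (body sa sb)) (SS tp (zt ua (ca @ ra)) (zt ub (cb @ rb)) q) (Suc (12 + (13 * (length as + length ([] :: bool list)) + 1)))
     (SS tp (zt ((ua @ [f, c]) @ butlast w) (last w # ra)) (zt (ub @ butlast cb) (last cb # rb)) (crun sa sb as [] (upd sa sb a False q)))"
    by (rule runs_WhileT[OF _ b 2(1)]) (use w 2 upd_less in \<open>auto simp: view_def\<close>)
  then show ?case using w fcells_ne[of as w] by (simp add: runs_mono)
next
  case (3 sa sb b bs q)
  then obtain f c w h where w: "cb = f # c # w" "xb f" "xb c = b" "fcells bs w" "ca = [h]" "\<not> xb h" by (auto simp: fcells_Cons fcells_Nil)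
  have b: "runs (body sa sb) (SS tp (zt ua (ca @ ra)) (zt ub (cb @ rb)) q) 12 (SS tp (zt ua (ca @ ra)) (zt (ub @ [f, c]) (w @ rb)) (upd sa sb False b q))"
    by (rule body_runs[where f = False and g = True]) (use w 3 in auto)
  have "runs (While (%v. xb (v 1) \<or> xb (v 2)) (body sa sb)) (SS tp (zt ua (ca @ ra)) (zt ub (cb @ rb)) q) (Suc (12 + (13 * (length ([] :: bool list) + length bs) + 1)))
     (SS tp (zt (ua @ butlast ca) (last ca # ra)) (zt ((ub @ [f, c]) @ butlast w) (last w # rb)) (crun sa sb [] bs (upd sa sb False b q)))"
    by (rule runs_WhileT[OF _ b 3(1)]) (use w 3 upd_less in \<open>auto simp: view_def\<close>)
  then show ?case using w fcells_ne[of bs w] by (simp add: runs_mono)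
next
  case (4 sa sb a as b bs q)
  then obtain f c w f' c' w' where w: "ca = f # c # w" "xb f" "xb c = a" "fcells as w" "cb = f' # c' # w'" "xb f'" "xb c' = b" "fcells bs w'" by (auto simp: fcells_Cons)
  have b: "runs (body sa sb) (SS tp (zt ua (ca @ ra)) (zt ub (cb @ rb)) q) 12 (SS tp (zt (ua @ [f, c]) (w @ ra)) (zt (ub @ [f', c']) (w' @ rb)) (upd sa sb a b q))"
    by (rule body_runs[where f = True and g = True]) (use w 4 in auto)
  have "runs (While (%v. xb (v 1) \<or> xb (v 2)) (body sa sb)) (SS tp (zt ua (ca @ ra)) (zt ub (cb @ rb)) q) (Suc (12 + (13 * (length as + length bs) + 1)))
     (SS tp (zt ((ua @ [f, c]) @ butlast w) (last w # ra)) (zt ((ub @ [f', c']) @ butlast w') (last w' # rb)) (crun sa sb as bs (upd sa sb a b q)))"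
    by (rule runs_WhileT[OF _ b 4(1)]) (use w 4 upd_less in \<open>auto simp: view_def\<close>)
  from runs_mono[OF this, of "13 * (length (a # as) + length (b # bs)) + 1"] show ?case using w fcells_ne[of as w] fcells_ne[of bs w'] by simp
qed

definition dlt :: "bool => bool => int" where "dlt m d = (if m then if d then 1 else - 1 else 0)"

text \<open>The first symbol of a number holds sign and axis mark, the second one the direction. The
  register is 2 as long as all coordinates match. Starting with the negative of the step of the
  first number as carry turns the test for zero into a test for that step.\<close>

definition coord :: com where
  "coord = Case (%v. mv 1 Rightwards ;; mv 2 Rightwards ;;
     Case (%w. wr 9 (if w 9 = 2 & dlt (yb (v 2)) (yb (w 2)) = - dlt (yb (v 1)) (yb (w 1)) then nat (2 - dlt (yb (v 1)) (yb (w 1))) else 4) Stay) ;;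
     While (%v. xb (v 1) \<or> xb (v 2)) (body (xb (v 1)) (xb (v 2))) ;; mv 1 Rightwards ;; mv 2 Rightwards)"

lemma coord_runs:
  assumes "fcells as ca" "fcells bs cb"
  shows "runs coord (SS tp (zt ua (a # ca @ ra)) (zt ub (b # cb @ rb)) q) (13 * (length as + length bs) + 13)
    (SS tp (zt (ua @ a # ca) ra) (zt (ub @ b # cb) rb)
      (if q = 2 & dlt (yb b) (yb (hd cb)) = - dlt (yb a) (yb (hd ca)) then crun (xb a) (xb b) as bs (nat (2 - dlt (yb a) (yb (hd ca)))) else 4))"
proof -
  let ?q = "if q = 2 & dlt (yb b) (yb (hd cb)) = - dlt (yb a) (yb (hd ca)) then nat (2 - dlt (yb a) (yb (hd ca))) else 4"
  have q5: "?q < 5" by (auto simp: dlt_def)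
  have v: "view (SS tp (zt ua (a # ca @ ra)) (zt ub (b # cb @ rb)) q) 1 = a" "view (SS tp (zt ua (a # ca @ ra)) (zt ub (b # cb @ rb)) q) 2 = b" by (simp_all add: view_def)
  note ne = fcells_ne[OF assms(1)] fcells_ne[OF assms(2)]
  have s: "scanned (zt u (ca @ ra)) = hd ca" "scanned (zt u (cb @ rb)) = hd cb" for u
    using ne by (cases ca, simp, simp, cases cb, simp, simp)
  have 3: "runs (Case (%w. wr 9 (if w 9 = 2 & dlt (yb b) (yb (w 2)) = - dlt (yb a) (yb (w 1)) then nat (2 - dlt (yb a) (yb (w 1))) else 4) Stay))
      (SS tp (zt (ua @ [a]) (ca @ ra)) (zt (ub @ [b]) (cb @ rb)) q) (Suc 1) (SS tp (zt (ua @ [a]) (ca @ ra)) (zt (ub @ [b]) (cb @ rb)) ?q)"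
    by (rule runs_Case) (use runs_wr_SS in \<open>simp add: view_def s\<close>)
  have e: "ca = butlast ca @ [last ca]" "cb = butlast cb @ [last cb]" using ne by simp_all
  have 4: "runs (mv 1 Rightwards) (SS tp (zt ((ua @ [a]) @ butlast ca) (last ca # ra)) B p) 1 (SS tp (zt (ua @ a # ca) ra) B p)" for B p
    using runs_mv_SS(1)[of tp "(ua @ [a]) @ butlast ca" "last ca" ra B p] e(1) by simp
  have 5: "runs (mv 2 Rightwards) (SS tp A (zt ((ub @ [b]) @ butlast cb) (last cb # rb)) p) 1 (SS tp A (zt (ub @ b # cb) rb) p)" for A p
    using runs_mv_SS(2)[of tp A "(ub @ [b]) @ butlast cb" "last cb" rb p] e(2) by simp
  have "runs coord (SS tp (zt ua (a # ca @ ra)) (zt ub (b # cb @ rb)) q) (Suc (Suc (1 + Suc (1 + Suc (Suc 1 + Suc ((13 * (length as + length bs) + 1) + Suc (1 + 1)))))))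
    (SS tp (zt (ua @ a # ca) ra) (zt (ub @ b # cb) rb) (crun (xb a) (xb b) as bs ?q))"
    unfolding coord_def by (rule runs_Case, unfold v)
      (rule runs_Seq[OF runs_mv_SS(1) runs_Seq[OF runs_mv_SS(2) runs_Seq[OF 3 runs_Seq[OF num_runs[OF assms q5] runs_Seq[OF 4 5]]]]])
  then have "runs coord (SS tp (zt ua (a # ca @ ra)) (zt ub (b # cb @ rb)) q) (13 * (length as + length bs) + 13)
    (SS tp (zt (ua @ a # ca) ra) (zt (ub @ b # cb) rb) (crun (xb a) (xb b) as bs ?q))" by (rule runs_mono) simp
  moreover have "crun (xb a) (xb b) as bs (if P then p else 4) = (if P then crun (xb a) (xb b) as bs p else 4)" for P p by simp
  ultimately show ?thesis by simp
qed

text \<open>A number of the zipped input: sign, whether the partner lies along this axis, in which direction, bits.\<close>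

type_synonym znum = "bool \<times> bool \<times> bool \<times> bool list"
type_synonym zrec = "znum \<times> znum \<times> znum"

fun encz :: "znum => nat list" where
  "encz (s, m, d, bs) = sy s m # map2 sy (dbl bs @ [False]) (d # replicate (2 * length bs) False)"

fun zval :: "znum => int" where "zval (s, m, d, bs) = sgni s * int (nv bs)"
fun zdir :: "znum => int" where "zdir (s, m, d, bs) = dlt m d"

definition zmatch :: "znum => znum => bool" where "zmatch a b \<longleftrightarrow> zval b - zval a = zdir a & zdir b = - zdir a"

definition encr :: "zrec => nat list" where "encr r = encz (fst r) @ encz (fst (snd r)) @ encz (snd (snd r))"

definition rmatch :: "zrec => zrec => bool" where
  "rmatch r r' \<longleftrightarrow> zmatch (fst r) (fst r') & zmatch (fst (snd r)) (fst (snd r')) & zmatch (snd (snd r)) (snd (snd r'))"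

lemma length_dbl [simp]: "length (dbl bs) = 2 * length bs" by (induction bs) (auto simp: dbl_def)

lemma map_xb_sy: "length a = length b ==> map xb (map2 sy a b) = a"
  by (induction a b rule: list_induct2) auto

lemma coord_z:
  obtains q' where "runs coord (SS tp (zt ua (encz a @ ra)) (zt ub (encz b @ rb)) q) (13 * (length (encz a) + length (encz b)) + 13)
    (SS tp (zt (ua @ encz a) ra) (zt (ub @ encz b) rb) q')" "q' = 2 \<longleftrightarrow> q = 2 & zmatch a b"
proof -
  obtain s m d bs s' m' d' bs' where ab: "a = (s, m, d, bs)" "b = (s', m', d', bs')" by (metis prod_cases4)
  let ?ca = "map2 sy (dbl bs @ [False]) (d # replicate (2 * length bs) False)" and ?cb = "map2 sy (dbl bs' @ [False]) (d' # replicate (2 * length bs') False)"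
  let ?q = "if q = 2 & dlt m' d' = - dlt m d then crun s s' bs bs' (nat (2 - dlt m d)) else 4"
  have f: "fcells bs ?ca" "fcells bs' ?cb" unfolding fcells_def by (rule map_xb_sy; simp)+
  have h: "yb (hd (map2 sy (dbl bs @ [False]) (d # r))) = d" for bs d r by (cases bs) (auto simp: dbl_def)
  have "dlt m' d' = - dlt m d ==> crun s s' bs bs' (nat (2 - dlt m d)) = 2 \<longleftrightarrow> zmatch a b"
    by (subst crun_correct) (auto simp: ab zmatch_def dlt_def sgni_def split: if_splits)
  then have "?q = 2 \<longleftrightarrow> q = 2 & zmatch a b" by (auto simp: ab zmatch_def)
  moreover have "runs coord (SS tp (zt ua (encz a @ ra)) (zt ub (encz b @ rb)) q) (13 * (length (encz a) + length (encz b)) + 13)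
    (SS tp (zt (ua @ encz a) ra) (zt (ub @ encz b) rb) ?q)"
    using coord_runs[OF f, of tp ua "sy s m" ra ub "sy s' m'" rb q] unfolding h xb_sy ab by (auto intro: runs_mono)
  ultimately show ?thesis using that by blast
qed

text \<open>Head 2 ends at the next record while head 1 returns to the separator 5 before its own.
  Tape 8 becomes 2 as soon as a match is found and keeps that value.\<close>

definition cmp :: com where
  "cmp = mv 1 Rightwards ;; mv 2 Rightwards ;; wr 9 2 Stay ;; coord ;; coord ;; coord ;;
     Case (%v. wr 8 (if v 9 = 2 then 2 else v 8 mod 5) Stay) ;; mv 1 Leftwards ;; While (%v. v 1 \<noteq> 5) (mv 1 Leftwards)"

lemma back_runs:
  assumes "tp 1 = zt (u @ 5 # w) (a # r)" "5 \<notin> set (w @ [a])"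
  shows "runs (While (%v. v 1 \<noteq> 5) (mv 1 Leftwards)) tp (2 * length w + 3) (tp(1 := zt u (5 # w @ a # r)))"
  using assms
proof (induction w arbitrary: a r tp rule: rev_induct)
  case Nil
  have "runs (While (%v. v 1 \<noteq> 5) (mv 1 Leftwards)) tp (Suc (1 + 1)) (tp(1 := zt u (5 # a # r)))"
    by (rule runs_WhileT[OF _ runs_mvL[of tp 1 u 5 "a # r"] runs_WhileF]) (use Nil in \<open>auto simp: view_def\<close>)
  then show ?case by (simp add: numeral_3_eq_3 del: fun_upd_apply)
next
  case (snoc b w)
  have "runs (While (%v. v 1 \<noteq> 5) (mv 1 Leftwards)) tp (Suc (1 + (2 * length w + 3))) ((tp(1 := zt (u @ 5 # w) (b # a # r)))(1 := zt u (5 # w @ b # a # r)))"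
    by (rule runs_WhileT[OF _ runs_mvL[of tp 1 "u @ 5 # w" b "a # r"] snoc.IH]) (use snoc.prems in \<open>auto simp: view_def\<close>)
  then show ?case by (simp add: runs_mono del: fun_upd_apply)
qed

lemma encr_props: "encr r \<noteq> []" "0 \<notin> set (encr r)" "5 \<notin> set (encr r)" "a \<in> set (encr r) ==> a < 5"
proof -
  have z: "0 < a & a < 5" if "a \<in> set (encz n)" for n a
  proof -
    have p: "0 < sy x y" for x y by (simp add: sy_def)
    obtain s m d bs where "n = (s, m, d, bs)" by (metis prod_cases4)
    then show ?thesis using that p xb_sy(6) by auto
  qed
  have "\<forall>a\<in>set (encr r). 0 < a & a < 5" unfolding encr_def set_append using z by blast
  then show "0 \<notin> set (encr r)" "5 \<notin> set (encr r)" "a \<in> set (encr r) ==> a < 5" by auto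
  show "encr r \<noteq> []" by (cases "fst r") (simp add: encr_def)
qed

definition S8 :: "store => tape => tape => nat => nat => store" where "S8 tp A B q f = SS (tp(8 := reg f)) A B q"

lemma S8_simps [simp]: "S8 tp A B q f (Suc 0) = A" "S8 tp A B q f 2 = B" "S8 tp A B q f 9 = reg q" "S8 tp A B q f 8 = reg f"
  "(S8 tp A B q f)(Suc 0 := A') = S8 tp A' B q f" "(S8 tp A B q f)(2 := B') = S8 tp A B' q f" "(S8 tp A B q f)(8 := reg f') = S8 tp A B q f'"
  by (auto simp: S8_def SS_def fun_eq_iff)

lemma cmp_runs:
  assumes f: "f < 5"
  obtains q' where "runs cmp (S8 tp (zt ua (5 # encr r @ ra)) (zt ub (5 # encr r' @ rb)) q f) (20 * (length (encr r) + length (encr r')) + 100)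
    (S8 tp (zt ua (5 # encr r @ ra)) (zt (ub @ 5 # encr r') rb) q' (if rmatch r r' then 2 else f))"
proof -
  obtain a b c where r: "r = (a, b, c)" by (metis prod_cases3)
  obtain a' b' c' where r': "r' = (a', b', c')" by (metis prod_cases3)
  let ?tp = "tp(8 := reg f)"
  obtain q1 where q1: "runs coord (SS ?tp (zt (ua @ [5]) (encz a @ encz b @ encz c @ ra)) (zt (ub @ [5]) (encz a' @ encz b' @ encz c' @ rb)) 2) (13 * (length (encz a) + length (encz a')) + 13)
    (SS ?tp (zt ((ua @ [5]) @ encz a) (encz b @ encz c @ ra)) (zt ((ub @ [5]) @ encz a') (encz b' @ encz c' @ rb)) q1)" "q1 = 2 \<longleftrightarrow> zmatch a a'"
    by (rule coord_z[of ?tp "ua @ [5]" a "encz b @ encz c @ ra" "ub @ [5]" a' "encz b' @ encz c' @ rb" 2]) simp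
  obtain q2 where q2: "runs coord (SS ?tp (zt ((ua @ [5]) @ encz a) (encz b @ encz c @ ra)) (zt ((ub @ [5]) @ encz a') (encz b' @ encz c' @ rb)) q1) (13 * (length (encz b) + length (encz b')) + 13)
    (SS ?tp (zt (((ua @ [5]) @ encz a) @ encz b) (encz c @ ra)) (zt (((ub @ [5]) @ encz a') @ encz b') (encz c' @ rb)) q2)" "q2 = 2 \<longleftrightarrow> q1 = 2 & zmatch b b'"
    by (rule coord_z)
  obtain q3 where q3: "runs coord (SS ?tp (zt (((ua @ [5]) @ encz a) @ encz b) (encz c @ ra)) (zt (((ub @ [5]) @ encz a') @ encz b') (encz c' @ rb)) q2) (13 * (length (encz c) + length (encz c')) + 13)
    (SS ?tp (zt ((((ua @ [5]) @ encz a) @ encz b) @ encz c) ra) (zt ((((ub @ [5]) @ encz a') @ encz b') @ encz c') rb) q3)" "q3 = 2 \<longleftrightarrow> q2 = 2 & zmatch c c'"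
    by (rule coord_z)
  let ?f = "if rmatch r r' then 2 else f" and ?A = "zt ((((ua @ [5]) @ encz a) @ encz b) @ encz c) ra" and ?B = "zt ((((ub @ [5]) @ encz a') @ encz b') @ encz c') rb"
  have q3m: "q3 = 2 \<longleftrightarrow> rmatch r r'" using q1(2) q2(2) q3(2) by (auto simp: r r' rmatch_def)
  have 4: "runs (Case (%v. wr 8 (if v 9 = 2 then 2 else v 8 mod 5) Stay)) (SS ?tp ?A ?B q3) (Suc 1) (SS (tp(8 := reg ?f)) ?A ?B q3)"
  proof (rule runs_Case)
    have v: "view (SS ?tp ?A ?B q3) 9 = q3" "view (SS ?tp ?A ?B q3) 8 = f" by (simp_all add: view_def) (simp add: SS_def)
    have "(if q3 = 2 then 2 else f mod 5) = ?f" using f q3m by simp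
    moreover have "runs (wr 8 ?f Stay) (S8 tp ?A ?B q3 f) 1 (S8 tp ?A ?B q3 ?f)" using runs_reg[of "S8 tp ?A ?B q3 f" 8 f ?f] by simp
    ultimately show "runs (wr 8 (if view (SS ?tp ?A ?B q3) 9 = 2 then 2 else view (SS ?tp ?A ?B q3) 8 mod 5) Stay) (SS ?tp ?A ?B q3) 1 (SS (tp(8 := reg ?f)) ?A ?B q3)"
      unfolding v S8_def by simp
  qed
  obtain w l where wl: "encr r = w @ [l]" using encr_props(1)[of r] by (metis rev_exhaust)
  have A: "?A = zt ((ua @ 5 # w) @ [l]) ra" using wl by (simp add: r encr_def)
  let ?\<tau> = "tp(8 := reg ?f)"
  have 5: "runs (mv 1 Leftwards) (SS ?\<tau> ?A ?B q3) 1 (SS ?\<tau> (zt (ua @ 5 # w) (l # ra)) ?B q3)"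
    using runs_mvL[of "SS ?\<tau> ?A ?B q3" 1 "ua @ 5 # w" l ra] A by simp
  have 6: "runs (While (%v. v 1 \<noteq> 5) (mv 1 Leftwards)) (SS ?\<tau> (zt (ua @ 5 # w) (l # ra)) ?B q3) (2 * length w + 3) (SS ?\<tau> (zt ua (5 # w @ l # ra)) ?B q3)"
    using back_runs[of "SS ?\<tau> (zt (ua @ 5 # w) (l # ra)) ?B q3" ua w l ra] encr_props(3)[of r] wl by simp
  have 0: "runs (wr 9 2 Stay) (SS ?tp X Y q) 1 (SS ?tp X Y 2)" for X Y by (rule runs_wr_SS)
  have "runs cmp (SS ?tp (zt ua (5 # encz a @ encz b @ encz c @ ra)) (zt ub (5 # encz a' @ encz b' @ encz c' @ rb)) q)
    (Suc (1 + Suc (1 + Suc (1 + Suc (13 * (length (encz a) + length (encz a')) + 13 + Suc (13 * (length (encz b) + length (encz b')) + 13 + Suc (13 * (length (encz c) + length (encz c')) + 13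
      + Suc (Suc 1 + Suc (1 + (2 * length w + 3)))))))))) (SS ?\<tau> (zt ua (5 # w @ l # ra)) ?B q3)"
    unfolding cmp_def
    by (rule runs_Seq[OF runs_mv_SS(1) runs_Seq[OF runs_mv_SS(2) runs_Seq[OF 0 runs_Seq[OF q1(1) runs_Seq[OF q2(1) runs_Seq[OF q3(1) runs_Seq[OF 4 runs_Seq[OF 5 6]]]]]]]])
  note R = this
  have lw: "length w \<le> length (encr r)" and rr: "5 # w @ l # ra = 5 # encr r @ ra" using wl by simp_all
  have "runs cmp (S8 tp (zt ua (5 # encr r @ ra)) (zt ub (5 # encr r' @ rb)) q f) (20 * (length (encr r) + length (encr r')) + 100) (S8 tp (zt ua (5 # encr r @ ra)) (zt (ub @ 5 # encr r') rb) q3 ?f)"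
  proof -
    have e1: "encz a @ encz b @ encz c @ ra = encr r @ ra" "encz a' @ encz b' @ encz c' @ rb = encr r' @ rb" "?B = zt (ub @ 5 # encr r') rb"
      by (simp_all add: r r' encr_def)
    show ?thesis by (rule runs_mono[OF R[unfolded e1 rr, folded S8_def]]) (use lw in \<open>simp add: r r' encr_def\<close>)
  qed
  then show ?thesis by (rule that)
qed

section \<open>Comparison of all pairs of cubes\<close>

abbreviation mk :: "zrec => nat list" where "mk r \<equiv> 5 # encr r"

lemma inner_runs:
  assumes f: "f < 5" and N: "length (encr r) \<le> N" "\<And>r'. r' \<in> set rs ==> length (encr r') \<le> N"
  shows "\<exists>q'. runs (While (%v. v 2 \<noteq> 0) cmp) (S8 tp (zt ua (mk r @ ra)) (zt ub (concat (map mk rs))) q f) (length rs * (40 * N + 101) + 1)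
    (S8 tp (zt ua (mk r @ ra)) (zt (ub @ concat (map mk rs)) []) q' (if \<exists>r'\<in>set rs. rmatch r r' then 2 else f))"
  using assms
proof (induction rs arbitrary: f ub q)
  case Nil
  show ?case using runs_WhileF[of "%v. v 2 \<noteq> 0" "S8 tp (zt ua (mk r @ ra)) (zt ub []) q f" cmp] by (auto simp: view_def intro!: exI[of _ q])
next
  case (Cons r' rs)
  let ?f = "if rmatch r r' then 2 else f"
  obtain q1 where 1: "runs cmp (S8 tp (zt ua (5 # encr r @ ra)) (zt ub (5 # encr r' @ concat (map mk rs))) q f) (20 * (length (encr r) + length (encr r')) + 100)
    (S8 tp (zt ua (5 # encr r @ ra)) (zt (ub @ 5 # encr r') (concat (map mk rs))) q1 ?f)"
    using cmp_runs[OF Cons.prems(1)] by blast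
  have f': "?f < 5" using Cons.prems(1) by simp
  have N': "\<And>r'. r' \<in> set rs ==> length (encr r') \<le> N" using Cons.prems(3) by simp
  obtain q2 where 2: "runs (While (%v. v 2 \<noteq> 0) cmp) (S8 tp (zt ua (mk r @ ra)) (zt (ub @ 5 # encr r') (concat (map mk rs))) q1 ?f) (length rs * (40 * N + 101) + 1)
    (S8 tp (zt ua (mk r @ ra)) (zt ((ub @ 5 # encr r') @ concat (map mk rs)) []) q2 (if \<exists>r'\<in>set rs. rmatch r r' then 2 else ?f))"
    using Cons.IH[OF f' Cons.prems(2) N'] by blast
  have 3: "runs cmp (S8 tp (zt ua (mk r @ ra)) (zt ub (5 # encr r' @ concat (map mk rs))) q f) (40 * N + 100)
    (S8 tp (zt ua (mk r @ ra)) (zt (ub @ 5 # encr r') (concat (map mk rs))) q1 ?f)"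
    using runs_mono[OF 1, of "40 * N + 100"] Cons.prems(2) Cons.prems(3)[of r'] by simp
  have v: "view (S8 tp (zt ua (mk r @ ra)) (zt ub (5 # encr r' @ concat (map mk rs))) q f) 2 \<noteq> 0" by (simp add: view_def)
  have "(if \<exists>r'\<in>set rs. rmatch r r' then 2 else ?f) = (if \<exists>r'\<in>set (r' # rs). rmatch r r' then 2 else f)" by (simp only: list.simps bex_simps) simp
  then show ?case using runs_WhileT[OF v 3 2] by (intro exI[of _ q2]) (simp add: algebra_simps)
qed

lemma runs_rewind:
  assumes "tp j = zt u w" "0 \<notin> set u"
  shows "runs (rewind j) tp (2 * length u + 6) (tp(j := zt [] (u @ w)))"
proof -
  let ?t = "%k. tp(j := arr (u @ w) (int (length u) - 1 - int k))"
  have 1: "runs (mv j Leftwards) tp 1 (?t 0)" using runs_Op[of j "%a. a" Leftwards tp] assms(1) by (simp add: mv_def zt_def arr_move)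
  have 2: "runs (While (%v. v j \<noteq> 0) (mv j Leftwards)) (?t 0) (Suc (length u * Suc 1)) (?t (length u))"
  proof (rule runs_While[where s = ?t])
    fix k assume k: "k < length u"
    define q where "q = length u - 1 - k"
    have q: "q < length u" "int (length u) - 1 - int k = int q" using k by (auto simp: q_def)
    have "scanned (arr (u @ w) (int q)) = u ! q" using q by (simp add: scanned_arr nth_append)
    moreover have "u ! q \<noteq> 0" using assms(2) nth_mem[OF q(1)] by metis
    ultimately show "view (?t k) j \<noteq> 0" using q(2) by (simp add: view_def)
    show "runs (mv j Leftwards) (?t k) 1 (?t (Suc k))" using runs_Op[of j "%a. a" Leftwards "?t k"] by (simp add: mv_def arr_move algebra_simps)
  qed (simp add: view_def)
  have 3: "runs (mv j Rightwards) (?t (length u)) 1 (tp(j := zt [] (u @ w)))"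
    using runs_Op[of j "%a. a" Rightwards "?t (length u)"] by (simp add: mv_def zt_def arr_move del: scanned_arr_left)
  show ?thesis unfolding rewind_def by (rule runs_mono[OF runs_Seq[OF 1 runs_Seq[OF 2 3]]]) simp
qed

lemma fwd_runs:
  assumes "tp 1 = zt u (w @ ra)" "0 \<notin> set w" "5 \<notin> set w" "ra = [] \<or> hd ra = 5"
  shows "runs (While (%v. v 1 \<noteq> 0 & v 1 \<noteq> 5) (mv 1 Rightwards)) tp (2 * length w + 1) (tp(1 := zt (u @ w) ra))"
  using assms
proof (induction w arbitrary: u tp)
  case Nil
  have "\<not> (view tp 1 \<noteq> 0 & view tp 1 \<noteq> 5)" using Nil by (cases ra) (auto simp: view_def)
  moreover have "tp(1 := zt (u @ []) ra) = tp" using Nil by (auto simp: fun_eq_iff)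
  ultimately show ?case using runs_WhileF[of "%v. v 1 \<noteq> 0 & v 1 \<noteq> 5" tp] by (simp del: fun_upd_apply)
next
  case (Cons a w)
  have "runs (While (%v. v 1 \<noteq> 0 & v 1 \<noteq> 5) (mv 1 Rightwards)) tp (Suc (1 + (2 * length w + 1))) ((tp(1 := zt (u @ [a]) (w @ ra)))(1 := zt ((u @ [a]) @ w) ra))"
    by (rule runs_WhileT[OF _ runs_mvR[of tp 1 u a "w @ ra"] Cons.IH]) (use Cons.prems in \<open>auto simp: view_def\<close>)
  then show ?case by (simp add: runs_mono del: fun_upd_apply)
qed

text \<open>The record at head 1 is compared with all records on tape 2; tape 7 is set to 2,
  rejection, if none of them matches.\<close>

definition outer :: com where
  "outer = wr 8 0 Stay ;; While (%v. v 2 \<noteq> 0) cmp ;; rewind 2 ;; Case (%v. if v 8 = 2 then Skip else wr 7 2 Stay) ;;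
     mv 1 Rightwards ;; While (%v. v 1 \<noteq> 0 & v 1 \<noteq> 5) (mv 1 Rightwards)"

definition S9 :: "store => tape => tape => nat => nat => nat => store" where "S9 tp A B q f b = S8 (tp(7 := reg b)) A B q f"

lemma S9_simps [simp]: "S9 tp A B q f b (Suc 0) = A" "S9 tp A B q f b 2 = B" "S9 tp A B q f b 8 = reg f" "S9 tp A B q f b 7 = reg b"
  "(S9 tp A B q f b)(Suc 0 := A') = S9 tp A' B q f b" "(S9 tp A B q f b)(2 := B') = S9 tp A B' q f b" "(S9 tp A B q f b)(8 := reg f') = S9 tp A B q f' b"
  "(S9 tp A B q f b)(7 := reg b') = S9 tp A B q f b'"
  by (auto simp: S9_def S8_def SS_def fun_eq_iff)

lemma mk_nonzero: "0 \<notin> set (concat (map mk rs))"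
  using encr_props(2) by auto

lemma outer_body_runs:
  assumes N: "length (encr r) \<le> N" "\<And>r'. r' \<in> set rs ==> length (encr r') \<le> N" and ra: "ra = [] \<or> hd ra = 5"
    and T: "T = concat (map mk rs)"
  shows "\<exists>q' f'. runs outer (S9 tp (zt ua (mk r @ ra)) (zt [] T) q f b) (length rs * (40 * N + 101) + 2 * length T + 2 * N + 30)
    (S9 tp (zt (ua @ mk r) ra) (zt [] T) q' f' (if \<exists>r'\<in>set rs. rmatch r r' then b else 2))"
proof -
  let ?A = "zt ua (mk r @ ra)" and ?m = "\<exists>r'\<in>set rs. rmatch r r'"
  define F where "F = (if ?m then 2 else 0 :: nat)"
  define b' where "b' = (if ?m then b else 2)"
  have "(0::nat) < 5" by simp
  from inner_runs[where tp = "tp(7 := reg b)" and ua = ua and ra = ra and ub = "[]" and q = q, OF this N]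
  obtain q' where q': "runs (While (%v. v 2 \<noteq> 0) cmp) (S8 (tp(7 := reg b)) ?A (zt [] (concat (map mk rs))) q 0) (length rs * (40 * N + 101) + 1)
    (S8 (tp(7 := reg b)) ?A (zt ([] @ concat (map mk rs)) []) q' F)" unfolding F_def by blast
  have 1: "runs (wr 8 0 Stay) (S9 tp ?A (zt [] T) q f b) 1 (S9 tp ?A (zt [] T) q 0 b)"
    using runs_reg[of "S9 tp ?A (zt [] T) q f b" 8 f 0] by simp
  have 2: "runs (While (%v. v 2 \<noteq> 0) cmp) (S9 tp ?A (zt [] T) q 0 b) (length rs * (40 * N + 101) + 1) (S9 tp ?A (zt T []) q' F b)"
    using q' unfolding S9_def T append_Nil .
  have 3: "runs (rewind 2) (S9 tp ?A (zt T []) q' F b) (2 * length T + 6) (S9 tp ?A (zt [] T) q' F b)"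
    using runs_rewind[of "S9 tp ?A (zt T []) q' F b" 2 T "[]"] mk_nonzero[of rs] by (simp add: T)
  have 4: "runs (Case (%v. if v 8 = 2 then Skip else wr 7 2 Stay)) (S9 tp ?A (zt [] T) q' F b) (Suc 1) (S9 tp ?A (zt [] T) q' F b')"
  proof (rule runs_Case)
    show "runs (if view (S9 tp ?A (zt [] T) q' F b) 8 = 2 then Skip else wr 7 2 Stay) (S9 tp ?A (zt [] T) q' F b) 1 (S9 tp ?A (zt [] T) q' F b')"
      using runs_reg[of "S9 tp ?A (zt [] T) q' F b" 7 b 2] runs_Skip[of "S9 tp ?A (zt [] T) q' F b"] by (cases ?m) (simp_all add: view_def F_def b'_def)
  qed
  have 5: "runs (mv 1 Rightwards) (S9 tp ?A (zt [] T) q' F b') 1 (S9 tp (zt (ua @ [5]) (encr r @ ra)) (zt [] T) q' F b')"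
    using runs_mvR[of "S9 tp ?A (zt [] T) q' F b'" 1 ua 5 "encr r @ ra"] by simp
  have 6: "runs (While (%v. v 1 \<noteq> 0 & v 1 \<noteq> 5) (mv 1 Rightwards)) (S9 tp (zt (ua @ [5]) (encr r @ ra)) (zt [] T) q' F b') (2 * length (encr r) + 1)
     (S9 tp (zt (ua @ mk r) ra) (zt [] T) q' F b')"
    using fwd_runs[of "S9 tp (zt (ua @ [5]) (encr r @ ra)) (zt [] T) q' F b'" "ua @ [5]" "encr r" ra] encr_props(2,3)[of r] ra by simp
  have "runs outer (S9 tp ?A (zt [] T) q f b) (length rs * (40 * N + 101) + 2 * length T + 2 * N + 30) (S9 tp (zt (ua @ mk r) ra) (zt [] T) q' F b')"
    unfolding outer_def by (rule runs_mono[OF runs_Seq[OF 1 runs_Seq[OF 2 runs_Seq[OF 3 runs_Seq[OF 4 runs_Seq[OF 5 6]]]]]]) (use N(1) in simp)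
  then show ?thesis unfolding b'_def by blast
qed

lemma outer_runs:
  assumes N: "\<And>r'. r' \<in> set (us @ rs) ==> length (encr r') \<le> N" and sub: "set us \<subseteq> set rs" and T: "T = concat (map mk rs)"
  shows "\<exists>q' f'. runs (While (%v. v 1 \<noteq> 0) outer) (S9 tp (zt ua (concat (map mk us))) (zt [] T) q f b)
      (length us * Suc (length rs * (40 * N + 101) + 2 * length T + 2 * N + 30) + 1)
    (S9 tp (zt (ua @ concat (map mk us)) []) (zt [] T) q' f' (if \<forall>r\<in>set us. \<exists>r'\<in>set rs. rmatch r r' then b else 2))"
  using N sub
proof (induction us arbitrary: ua q f b)
  case Nil
  have "runs (While (%v. v 1 \<noteq> 0) outer) (S9 tp (zt ua []) (zt [] T) q f b) 1 (S9 tp (zt ua []) (zt [] T) q f b)"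
    by (rule runs_WhileF) (simp add: view_def)
  then show ?case by simp blast
next
  case (Cons r us)
  let ?t = "length rs * (40 * N + 101) + 2 * length T + 2 * N + 30" and ?b = "if \<exists>r'\<in>set rs. rmatch r r' then b else 2"
  have "concat (map mk us) = [] \<or> hd (concat (map mk us)) = 5" by (cases us) auto
  moreover have "length (encr r) \<le> N" "\<And>r'. r' \<in> set rs ==> length (encr r') \<le> N" using Cons.prems(1) by auto
  ultimately obtain q1 f1 where 1: "runs outer (S9 tp (zt ua (mk r @ concat (map mk us))) (zt [] T) q f b) ?t (S9 tp (zt (ua @ mk r) (concat (map mk us))) (zt [] T) q1 f1 ?b)"
    using outer_body_runs[where r = r and N = N and rs = rs and ra = "concat (map mk us)", OF _ _ _ T] by blast
  have "\<And>r'. r' \<in> set (us @ rs) ==> length (encr r') \<le> N" "set us \<subseteq> set rs" using Cons.prems by auto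
  from Cons.IH[OF this] obtain q2 f2 where 2: "runs (While (%v. v 1 \<noteq> 0) outer) (S9 tp (zt (ua @ mk r) (concat (map mk us))) (zt [] T) q1 f1 ?b) (length us * Suc ?t + 1)
    (S9 tp (zt ((ua @ mk r) @ concat (map mk us)) []) (zt [] T) q2 f2 (if \<forall>r\<in>set us. \<exists>r'\<in>set rs. rmatch r r' then ?b else 2))" by blast
  have v: "view (S9 tp (zt ua (mk r @ concat (map mk us))) (zt [] T) q f b) 1 \<noteq> 0" by (simp add: view_def)
  have e: "(if \<forall>r\<in>set us. \<exists>r'\<in>set rs. rmatch r r' then ?b else 2) = (if \<forall>r\<in>set (r # us). \<exists>r'\<in>set rs. rmatch r r' then b else 2)"
    by auto
  show ?case using runs_WhileT[OF v 1 2] unfolding e by (intro exI[of _ q2] exI[of _ f2]) (simp add: algebra_simps)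
qed

section \<open>Automaton for interleaved regions and certificates\<close>

type_synonym dstate = "(nat \<times> bool \<times> nat) option"

definition endn :: "nat => bool => dstate" where
  "endn k mo = (if k < 2 then Some (Suc k, mo, 0) else if mo then Some (0, False, 0) else None)"

text \<open>States of the automaton that recognizes the zipped inputs: the current coordinate, whether a moving axis has
  been seen in the current cube, and the phase: 0 sign, 1 and 2 first flag of a fixed or moving coordinate, 3 later flag, 4 bit.\<close>

fun dstep :: "dstate => bool => bool => dstate" where
  "dstep None x y = None"
| "dstep (Some (k, mo, ph)) x y =
    (if ph = 0 then if y & mo then None else Some (k, mo \<or> y, if y then 2 else 1)
     else if ph = 4 then if y then None else Some (k, mo, 3)
     else if y & ph \<noteq> 2 then None else if x then Some (k, mo, 4) else endn k mo)"

fun drun :: "dstate => (bool \<times> bool) list => dstate" where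
  "drun s [] = s"
| "drun s ((x, y) # zs) = drun (dstep s x y) zs"

fun fout :: "dstate => (bool \<times> bool) list => nat list" where
  "fout s [] = []"
| "fout s ((x, y) # zs) = (if s = Some (0, False, 0) then [5] else []) @ [sy x y] @ fout (dstep s x y) zs"

abbreviation "q0 \<equiv> Some (0 :: nat, False, 0 :: nat)"

lemma drun_None [simp]: "drun None zs = None" by (induction zs) auto

text \<open>The certificate uses two places of every number: at the sign, whether the partner lies
  along this axis, and at the first flag, in which direction. Even the code of 0 has both places,
  because it ends with a flag. All other certificate bits are forced to be \<open>False\<close>;
  otherwise a tiling would have several certificates.\<close>

fun zw :: "znum => (bool \<times> bool) list" where
  "zw (s, m, d, bs) = (s, m) # zip (dbl bs @ [False]) (d # replicate (2 * length bs) False)"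

definition zr :: "zrec => (bool \<times> bool) list" where "zr r = zw (fst r) @ zw (fst (snd r)) @ zw (snd (snd r))"

fun zm :: "znum => bool" where "zm (s, m, d, bs) = m"
fun zd :: "znum => bool" where "zd (s, m, d, bs) = d"

definition vrec :: "zrec => bool" where
  "vrec r \<longleftrightarrow> (zm (fst r) & \<not> zm (fst (snd r)) & \<not> zm (snd (snd r)) \<or> \<not> zm (fst r) & zm (fst (snd r)) & \<not> zm (snd (snd r)) \<or> \<not> zm (fst r) & \<not> zm (fst (snd r)) & zm (snd (snd r)))
    & (zd (fst r) --> zm (fst r)) & (zd (fst (snd r)) --> zm (fst (snd r))) & (zd (snd (snd r)) --> zm (snd (snd r)))"

lemma flags_run:
  "drun (Some (k, mo, 3)) (zip (dbl bs @ [False]) (replicate (Suc (2 * length bs)) False) @ rest) = drun (endn k mo) rest"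
  "fout (Some (k, mo, 3)) (zip (dbl bs @ [False]) (replicate (Suc (2 * length bs)) False) @ rest)
    = map (%(x, y). sy x y) (zip (dbl bs @ [False]) (replicate (Suc (2 * length bs)) False)) @ fout (endn k mo) rest"
  by (induction bs) (auto simp: dbl_def)

lemma num_run:
  assumes "\<not> (zm n & mo)" "zd n --> zm n"
  shows "drun (Some (k, mo, 0)) (zw n @ rest) = drun (endn k (mo \<or> zm n)) rest"
    "fout (Some (k, mo, 0)) (zw n @ rest) = (if k = 0 & \<not> mo then [5] else []) @ encz n @ fout (endn k (mo \<or> zm n)) rest"
proof -
  obtain s m d bs where n: "n = (s, m, d, bs)" by (metis prod_cases4)
  have "drun (Some (k, mo, 0)) (zw n @ rest) = drun (endn k (mo \<or> zm n)) rest &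
    fout (Some (k, mo, 0)) (zw n @ rest) = (if k = 0 & \<not> mo then [5] else []) @ encz n @ fout (endn k (mo \<or> zm n)) rest"
  proof (cases bs)
    case Nil
    then show ?thesis using assms by (auto simp: n dbl_def)
  next
    case (Cons b bs')
    then show ?thesis using assms flags_run[of k "mo \<or> m" bs' rest] by (auto simp: n dbl_def)
  qed
  then show "drun (Some (k, mo, 0)) (zw n @ rest) = drun (endn k (mo \<or> zm n)) rest"
    "fout (Some (k, mo, 0)) (zw n @ rest) = (if k = 0 & \<not> mo then [5] else []) @ encz n @ fout (endn k (mo \<or> zm n)) rest" by auto
qed

lemma rec_run:
  assumes "vrec r"
  shows "drun q0 (zr r @ rest) = drun q0 rest" "fout q0 (zr r @ rest) = mk r @ fout q0 rest"
  using assms unfolding vrec_def zr_def encr_def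
  by (auto simp: num_run endn_def)

lemma recs_run:
  assumes "\<forall>r\<in>set rs. vrec r"
  shows "drun q0 (concat (map zr rs)) = q0" "fout q0 (concat (map zr rs)) = concat (map mk rs)"
  using assms by (induction rs) (auto simp: rec_run)

lemma parse_flags:
  "drun (Some (k, mo, 3)) zs = q0 ==> \<exists>bs rest. zs = zip (dbl bs @ [False]) (replicate (Suc (2 * length bs)) False) @ rest & drun (endn k mo) rest = q0"
proof (induction zs rule: length_induct)
  case (1 zs)
  obtain x y zs' where z: "zs = (x, y) # zs'" using 1(2) by (cases zs) auto
  have y: "\<not> y" using 1(2) by (auto simp: z)
  show ?case
  proof (cases x)
    case False
    then show ?thesis using 1(2) y by (intro exI[of _ "[]"] exI[of _ zs']) (simp add: z dbl_def)
  next
    case True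
    then have d: "drun (Some (k, mo, 4)) zs' = q0" using 1(2) y by (simp add: z)
    then obtain b y' zs'' where z': "zs' = (b, y') # zs''" by (cases zs') auto
    have y': "\<not> y'" using d by (auto simp: z')
    have "drun (Some (k, mo, 3)) zs'' = q0" using d y' by (simp add: z')
    then obtain bs rest where "zs'' = zip (dbl bs @ [False]) (replicate (Suc (2 * length bs)) False) @ rest" "drun (endn k mo) rest = q0"
      using 1(1) z z' by (metis length_Cons less_Suc_eq less_SucI)
    then show ?thesis using True y y' by (intro exI[of _ "b # bs"] exI[of _ rest]) (simp add: z z' dbl_def)
  qed
qed

lemma parse_num:
  assumes "drun (Some (k, mo, 0)) zs = q0" "zs \<noteq> []"
  shows "\<exists>n rest. zs = zw n @ rest & \<not> (zm n & mo) & (zd n --> zm n) & drun (endn k (mo \<or> zm n)) rest = q0"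
proof -
  obtain s m zs' where z: "zs = (s, m) # zs'" using assms(2) by (cases zs) auto
  have mm: "\<not> (m & mo)" using assms(1) by (auto simp: z)
  have d1: "drun (Some (k, mo \<or> m, if m then 2 else 1)) zs' = q0" using assms(1) mm by (simp add: z split: if_splits)
  then obtain x d zs2 where z': "zs' = (x, d) # zs2" by (cases zs') (auto split: if_splits)
  have dm: "d --> m" using d1 by (auto simp: z' split: if_splits)
  show ?thesis
  proof (cases x)
    case False
    then have "drun (endn k (mo \<or> m)) zs2 = q0" using d1 dm by (auto simp: z' split: if_splits)
    then show ?thesis using False mm dm by (intro exI[of _ "(s, m, d, [])"] exI[of _ zs2]) (simp add: z z' dbl_def)
  next
    case True
    then have d2: "drun (Some (k, mo \<or> m, 4)) zs2 = q0" using d1 dm by (auto simp: z' split: if_splits)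
    then obtain b y zs3 where z'': "zs2 = (b, y) # zs3" by (cases zs2) auto
    have y: "\<not> y" using d2 by (auto simp: z'')
    have "drun (Some (k, mo \<or> m, 3)) zs3 = q0" using d2 y by (simp add: z'')
    from parse_flags[OF this] obtain bs rest where "zs3 = zip (dbl bs @ [False]) (replicate (Suc (2 * length bs)) False) @ rest" "drun (endn k (mo \<or> m)) rest = q0" by blast
    then show ?thesis using True mm dm y by (intro exI[of _ "(s, m, d, b # bs)"] exI[of _ rest]) (simp add: z z' z'' dbl_def)
  qed
qed

lemma parse:
  "drun q0 zs = q0 ==> \<exists>rs. (\<forall>r\<in>set rs. vrec r) & zs = concat (map zr rs)"
proof (induction zs rule: length_induct)
  case (1 zs)
  show ?case
  proof (cases "zs = []")
    case True then show ?thesis by (intro exI[of _ "[]"]) simp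
  next
    case False
    obtain a r1 where a: "zs = zw a @ r1" "zd a --> zm a" "drun (Some (1, zm a, 0)) r1 = q0"
      using parse_num[OF 1(2) False] by (auto simp: endn_def)
    have "r1 \<noteq> []" using a(3) by auto
    from parse_num[OF a(3) this] obtain b r2 where b: "r1 = zw b @ r2" "\<not> (zm b & zm a)" "zd b --> zm b" "drun (Some (2, zm a \<or> zm b, 0)) r2 = q0"
      by (auto simp: endn_def numeral_2_eq_2)
    have "r2 \<noteq> []" using b(4) by auto
    from parse_num[OF b(4) this] obtain c r3 where c: "r2 = zw c @ r3" "\<not> (zm c & (zm a \<or> zm b))" "zd c --> zm c" "drun (endn 2 ((zm a \<or> zm b) \<or> zm c)) r3 = q0"
      by blast
    have m: "(zm a \<or> zm b) \<or> zm c" "drun q0 r3 = q0" using c(4) by (auto simp: endn_def split: if_splits)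
    have "length r3 < length zs" using a(1) b(1) c(1) by (cases a) auto
    then obtain rs where rs: "\<forall>r\<in>set rs. vrec r" "r3 = concat (map zr rs)" using 1(1) m(2) by blast
    have "vrec (a, b, c)" using a b c m by (auto simp: vrec_def)
    then show ?thesis using rs a(1) b(1) c(1) by (intro exI[of _ "(a, b, c) # rs"]) (simp add: zr_def[of "(a, b, c)"])
  qed
qed

text \<open>The state of the automaton is kept as a symbol on tape 5; there are 31 codes.\<close>

definition cd :: "dstate => nat" where
  "cd s = (case s of None => 0 | Some (k, mo, ph) => 1 + ph + 5 * k + 15 * of_bool mo)"

definition dc :: "nat => dstate" where
  "dc n = (if n = 0 then None else Some ((n - 1) div 5 mod 3, 15 \<le> n - 1, (n - 1) mod 5))"

fun vs :: "dstate => bool" where "vs None = True" | "vs (Some (k, mo, ph)) \<longleftrightarrow> k < 3 & ph < 5"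

lemma dc_cd: "vs s ==> dc (cd s) = s"
proof (cases s)
  case (Some t)
  obtain k mo ph where t: "t = (k, mo, ph)" by (cases t)
  assume "vs s"
  then have k: "k < 3" "ph < 5" using Some t by auto
  have "k = 0 \<or> k = 1 \<or> k = 2" "ph = 0 \<or> ph = 1 \<or> ph = 2 \<or> ph = 3 \<or> ph = 4" using k by linarith+
  then have "(ph + 5 * k + 15 * of_bool mo) div 5 mod 3 = k & (ph + 5 * k + 15 * of_bool mo) mod 5 = ph & (15 \<le> ph + 5 * k + 15 * of_bool mo \<longleftrightarrow> mo)"
    by (elim disjE; cases mo; simp)
  then show ?thesis using Some t by (simp add: cd_def dc_def)
qed (simp add: cd_def dc_def)

lemma vs_dstep: "vs s ==> vs (dstep s x y)"
  by (cases s) (auto simp: endn_def)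

lemma vs_dc: "vs (dc n)" by (auto simp: dc_def)

lemma cd_less: "vs s ==> cd s < 31"
  by (cases s) (auto simp: cd_def)

section \<open>The verifier\<close>

definition fst_loop :: com where
  "fst_loop = While (%v. v 6 \<noteq> 0 & v 0 \<noteq> 0) (Case (%v. (if dc (v 5) = q0 then wr 1 5 Rightwards else Skip) ;;
     wr 1 (sy (v 6 = 2) (v 0 = 2)) Rightwards ;; wr 5 (cd (dstep (dc (v 5)) (v 6 = 2) (v 0 = 2))) Stay) ;; mv 6 Rightwards ;; mv 0 Rightwards)"

definition SF :: "store => tape => tape => nat => nat list => store" where "SF tp X Y s u = tp(6 := X, 0 := Y, 5 := reg s, 1 := zt u [])"

lemma SF_simps [simp]: "SF tp X Y s u 6 = X" "SF tp X Y s u 0 = Y" "SF tp X Y s u 5 = reg s" "SF tp X Y s u (Suc 0) = zt u []"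
  "(SF tp X Y s u)(6 := X') = SF tp X' Y s u" "(SF tp X Y s u)(0 := Y') = SF tp X Y' s u" "(SF tp X Y s u)(5 := reg s') = SF tp X Y s' u"
  "(SF tp X Y s u)(Suc 0 := zt u' []) = SF tp X Y s u'"
  by (auto simp: SF_def fun_eq_iff)

lemma zt_outt: "zt u [] = outt u" by (simp add: zt_def outt_def)

lemma runs_app: "tp j = zt u [] ==> runs (wr j a Rightwards) tp 1 (tp(j := zt (u @ [a]) []))"
  using runs_Op[of j "%_. a" Rightwards tp] by (simp add: wr_def zt_outt)

lemma fst_runs:
  "vs s ==> runs fst_loop (SF tp (zt ux (map bit_sym xs)) (zt uy (map bit_sym ys)) (cd s) u) (11 * length xs + 1)
    (SF tp (zt (ux @ map bit_sym (take (length ys) xs)) (map bit_sym (drop (length ys) xs))) (zt (uy @ map bit_sym (take (length xs) ys)) (map bit_sym (drop (length xs) ys)))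
      (cd (drun s (zip xs ys))) (u @ fout s (zip xs ys)))"
proof (induction xs arbitrary: ys ux uy s u)
  case Nil
  show ?case using runs_WhileF[of "%v. v 6 \<noteq> 0 & v 0 \<noteq> 0" "SF tp (zt ux []) (zt uy (map bit_sym ys)) (cd s) u"] by (simp add: fst_loop_def view_def)
next
  case (Cons x xs)
  show ?case
  proof (cases ys)
    case Nil
    have "runs fst_loop (SF tp (zt ux (map bit_sym (x # xs))) (zt uy []) (cd s) u) 1 (SF tp (zt ux (map bit_sym (x # xs))) (zt uy []) (cd s) u)"
      unfolding fst_loop_def by (rule runs_WhileF) (simp add: view_def)
    from runs_mono[OF this, of "11 * length (x # xs) + 1"] show ?thesis using Nil by simp
  next
    case y: (Cons y ys')
    let ?X = "zt ux (map bit_sym (x # xs))" and ?Y = "zt uy (map bit_sym (y # ys'))"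
    let ?v = "view (SF tp ?X ?Y (cd s) u)"
    let ?u = "u @ (if s = q0 then [5] else [])" and ?s = "dstep s x y"
    have b2: "bit_sym b = 2 \<longleftrightarrow> b" for b by (cases b) auto
    have v: "dc (?v 5) = s" "(?v 6 = 2) = x" "(?v 0 = 2) = y" using dc_cd[OF Cons.prems] b2 by (simp_all add: view_def)
    have 1: "runs (if s = q0 then wr 1 5 Rightwards else Skip) (SF tp ?X ?Y (cd s) u) 1 (SF tp ?X ?Y (cd s) ?u)"
      using runs_app[of "SF tp ?X ?Y (cd s) u" 1 u 5] runs_Skip[of "SF tp ?X ?Y (cd s) u"] by auto
    have 2: "runs (wr 1 (sy x y) Rightwards) (SF tp ?X ?Y (cd s) ?u) 1 (SF tp ?X ?Y (cd s) (?u @ [sy x y]))"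
      using runs_app[of "SF tp ?X ?Y (cd s) ?u" 1 ?u "sy x y"] by simp
    have 3: "runs (wr 5 (cd ?s) Stay) (SF tp ?X ?Y (cd s) (?u @ [sy x y])) 1 (SF tp ?X ?Y (cd ?s) (?u @ [sy x y]))"
      using runs_reg[of "SF tp ?X ?Y (cd s) (?u @ [sy x y])" 5 "cd s" "cd ?s"] by simp
    have C: "runs (Case (%v. (if dc (v 5) = q0 then wr 1 5 Rightwards else Skip) ;; wr 1 (sy (v 6 = 2) (v 0 = 2)) Rightwards ;; wr 5 (cd (dstep (dc (v 5)) (v 6 = 2) (v 0 = 2))) Stay))
      (SF tp ?X ?Y (cd s) u) (Suc (Suc (1 + Suc (1 + 1)))) (SF tp ?X ?Y (cd ?s) (?u @ [sy x y]))"
      by (rule runs_Case, unfold v) (rule runs_Seq[OF 1 runs_Seq[OF 2 3]])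
    have 4: "runs (mv 6 Rightwards) (SF tp ?X ?Y (cd ?s) (?u @ [sy x y])) 1 (SF tp (zt (ux @ [bit_sym x]) (map bit_sym xs)) ?Y (cd ?s) (?u @ [sy x y]))"
      using runs_mvR[of "SF tp ?X ?Y (cd ?s) (?u @ [sy x y])" 6 ux "bit_sym x" "map bit_sym xs"] by simp
    have 5: "runs (mv 0 Rightwards) (SF tp X ?Y (cd ?s) (?u @ [sy x y])) 1 (SF tp X (zt (uy @ [bit_sym y]) (map bit_sym ys')) (cd ?s) (?u @ [sy x y]))" for X
      using runs_mvR[of "SF tp X ?Y (cd ?s) (?u @ [sy x y])" 0 uy "bit_sym y" "map bit_sym ys'"] by simp
    have p: "?v 6 \<noteq> 0 & ?v 0 \<noteq> 0" by (simp add: view_def)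
    note IH = Cons.IH[OF vs_dstep[OF Cons.prems], of "ux @ [bit_sym x]" "uy @ [bit_sym y]" ys' x y "?u @ [sy x y]", unfolded fst_loop_def]
    have "runs fst_loop (SF tp ?X ?Y (cd s) u) (Suc (Suc (Suc (Suc (1 + Suc (1 + 1))) + Suc (1 + 1)) + (11 * length xs + 1)))
      (SF tp (zt ((ux @ [bit_sym x]) @ map bit_sym (take (length ys') xs)) (map bit_sym (drop (length ys') xs))) (zt ((uy @ [bit_sym y]) @ map bit_sym (take (length xs) ys')) (map bit_sym (drop (length xs) ys')))
      (cd (drun ?s (zip xs ys'))) ((?u @ [sy x y]) @ fout ?s (zip xs ys')))"
      unfolding fst_loop_def by (rule runs_WhileT[OF p runs_Seq[OF C runs_Seq[OF 4 5]] IH])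
    note R = this
    have le: "Suc (Suc (Suc (Suc (1 + Suc (1 + 1))) + Suc (1 + 1)) + (11 * length xs + 1)) \<le> 11 * length (x # xs) + 1" by simp
    show ?thesis unfolding y using runs_mono[OF R le]
      by (simp only: length_Cons take_Suc_Cons drop_Suc_Cons list.map zip_Cons_Cons drun.simps fout.simps append_assoc append_Cons append_Nil)
  qed
qed

definition copyl :: "(nat => bool) => nat => nat => com" where
  "copyl P j k = While (%v. P (v j)) (Case (%v. wr k (v j mod 6) Rightwards) ;; mv j Rightwards)"

lemma copyl_runs:
  assumes "tp j = zt u (w @ ra)" "tp k = zt t []" "j \<noteq> k" "\<forall>a\<in>set w. P a & a < 6" "\<not> P (scanned (zt [] ra))"
  shows "runs (copyl P j k) tp (5 * length w + 1) (tp(j := zt (u @ w) ra, k := zt (t @ w) []))"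
  using assms
proof (induction w arbitrary: u t tp)
  case Nil
  have "scanned (zt u ra) = scanned (zt [] ra)" by (cases ra) auto
  then have "\<not> P (view tp j)" using Nil by (simp add: view_def)
  moreover have "tp(j := zt (u @ []) ra, k := zt (t @ []) []) = tp" using Nil by (auto simp: fun_eq_iff)
  ultimately show ?case using runs_WhileF[of "%v. P (v j)" tp] unfolding copyl_def by (simp del: fun_upd_apply)
next
  case (Cons a w)
  let ?t1 = "tp(k := zt (t @ [a]) [])" and ?t2 = "tp(k := zt (t @ [a]) [], j := zt (u @ [a]) (w @ ra))"
  have a: "view tp j = a" "a mod 6 = a" using Cons.prems by (auto simp: view_def)
  have 1: "runs (Case (%v. wr k (v j mod 6) Rightwards)) tp (Suc 1) ?t1"
    by (rule runs_Case, unfold a, rule runs_app, rule Cons.prems(2))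
  have 2: "runs (mv j Rightwards) ?t1 1 ?t2" by (rule runs_mvR) (use Cons.prems in auto)
  have 3: "runs (copyl P j k) ?t2 (5 * length w + 1) (?t2(j := zt ((u @ [a]) @ w) ra, k := zt ((t @ [a]) @ w) []))"
    by (rule Cons.IH) (use Cons.prems in auto)
  have p: "P (view tp j)" using Cons.prems a by simp
  have "runs (copyl P j k) tp (Suc (Suc (Suc 1 + 1) + (5 * length w + 1))) (?t2(j := zt ((u @ [a]) @ w) ra, k := zt ((t @ [a]) @ w) []))"
    unfolding copyl_def by (rule runs_WhileT[OF p runs_Seq[OF 1 2] 3[unfolded copyl_def]])
  moreover have "?t2(j := zt ((u @ [a]) @ w) ra, k := zt ((t @ [a]) @ w) []) = tp(j := zt (u @ a # w) ra, k := zt (t @ a # w) [])"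
    using Cons.prems(3) by (auto simp: fun_eq_iff)
  ultimately show ?case by (simp add: runs_mono del: fun_upd_apply)
qed

definition phase2 :: com where
  "phase2 = rewind 1 ;; copyl (%a. a \<noteq> 0) 1 2 ;; rewind 1 ;; rewind 2 ;; While (%v. v 1 \<noteq> 0) outer"

text \<open>The region moves to tape 6 while the certificate stays on tape 0, so that both can be
  read in parallel. Tape 7 holds 2 for rejection. Finally the verdict overwrites the first cell of
  tape 0, and a blank behind it ends the output.\<close>

definition ver :: com where
  "ver = copyl (%a. a \<noteq> 3) 0 6 ;; mv 0 Rightwards ;; rewind 6 ;; wr 5 1 Stay ;; fst_loop ;;
     Case (%v. if v 0 = 0 & v 6 = 0 & v 5 = 1 then phase2 else wr 7 2 Stay) ;; rewind 0 ;;
     Case (%v. wr 0 (if v 7 = 2 then 1 else 2) Rightwards) ;; wr 0 0 Stay"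

lemma wfc_ver: "wfc 10 31 ver"
proof -
  have "sy a b < 31" for a b using xb_sy(6)[of a b] by linarith
  moreover have "cd (dstep (dc n) a b) < 31" for n a b by (intro cd_less vs_dstep vs_dc)
  moreover have "nat (2 - dlt a b) < 31" for a b by (auto simp: dlt_def)
  moreover have "n mod 6 < 31" "n mod 5 < 31" for n :: nat using mod_less_divisor[of 6 n] mod_less_divisor[of 5 n] by linarith+
  ultimately show ?thesis by (auto simp: ver_def phase2_def copyl_def fst_loop_def outer_def cmp_def coord_def body_def)
qed

lemma length_mk_le: "r \<in> set rs ==> length (encr r) \<le> length (concat (map mk rs))"
  by (induction rs) auto

lemma length_mk_count: "length rs \<le> length (concat (map mk rs))"
  by (induction rs) auto

definition t2 :: "nat => nat" where "t2 n = n * (n * (40 * n + 101) + 4 * n + 31) + 20 * n + 50"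

lemma phase2_runs:
  assumes "T = concat (map mk rs)" "tp 1 = zt T []" "tp 2 = zt [] []" "tp 9 = reg 0" "tp 8 = reg 0" "tp 7 = reg 0"
  obtains \<tau> where "runs phase2 tp (t2 (length T)) \<tau>"
    "\<tau> 0 = tp 0" "\<tau> 7 = reg (if \<forall>r\<in>set rs. \<exists>r'\<in>set rs. rmatch r r' then 0 else 2)"
proof -
  have T0: "0 \<notin> set T" using mk_nonzero assms(1) by metis
  have T6: "\<forall>a\<in>set T. a \<noteq> 0 & a < 6"
  proof
    fix a assume a: "a \<in> set T"
    then have "\<exists>l\<in>set (map mk rs). a \<in> set l" unfolding assms(1) set_concat by blast
    then obtain r where "a \<in> set (mk r)" unfolding set_map by blast
    then have "a < 6" using encr_props(4)[of a r] by auto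
    then show "a \<noteq> 0 & a < 6" using a T0 by metis
  qed
  have 1: "runs (rewind 1) tp (2 * length T + 6) (tp(1 := zt [] T))" using runs_rewind[of tp 1 T "[]"] assms(2) T0 by simp
  have 2: "runs (copyl (%a. a \<noteq> 0) 1 2) (tp(1 := zt [] T)) (5 * length T + 1) (tp(1 := zt T [], 2 := zt T []))"
    using copyl_runs[of "tp(1 := zt [] T)" 1 "[]" T "[]" 2 "[]" "%a. a \<noteq> 0"] T6 assms(3) by simp
  have 3: "runs (rewind 1) (tp(1 := zt T [], 2 := zt T [])) (2 * length T + 6) (tp(1 := zt [] T, 2 := zt T []))"
    using runs_rewind[of "tp(1 := zt T [], 2 := zt T [])" 1 T "[]"] T0 by (simp add: fun_upd_twist)
  have 4: "runs (rewind 2) (tp(1 := zt [] T, 2 := zt T [])) (2 * length T + 6) (tp(1 := zt [] T, 2 := zt [] T))"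
    using runs_rewind[of "tp(1 := zt [] T, 2 := zt T [])" 2 T "[]"] T0 by simp
  have s: "tp(1 := zt [] T, 2 := zt [] T) = S9 tp (zt [] (concat (map mk rs))) (zt [] T) 0 0 0"
    using assms by (auto simp: S9_def S8_def SS_def fun_eq_iff)
  obtain q' f' where 5: "runs (While (%v. v 1 \<noteq> 0) outer) (S9 tp (zt [] (concat (map mk rs))) (zt [] T) 0 0 0)
      (length rs * Suc (length rs * (40 * length T + 101) + 2 * length T + 2 * length T + 30) + 1)
    (S9 tp (zt ([] @ concat (map mk rs)) []) (zt [] T) q' f' (if \<forall>r\<in>set rs. \<exists>r'\<in>set rs. rmatch r r' then 0 else 2))"
    using outer_runs[of rs rs "length T" T tp "[]" 0 0 0] length_mk_le assms(1) by auto
  let ?\<tau> = "S9 tp (zt ([] @ concat (map mk rs)) []) (zt [] T) q' f' (if \<forall>r\<in>set rs. \<exists>r'\<in>set rs. rmatch r r' then 0 else 2)"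
  have rl: "length rs \<le> length T" using length_mk_count assms(1) by simp
  have "length rs * Suc (length rs * (40 * length T + 101) + 2 * length T + 2 * length T + 30) + 1 \<le> length T * (length T * (40 * length T + 101) + 4 * length T + 31) + 1"
    using rl by (intro add_mono mult_le_mono) auto
  from runs_mono[OF 5 this] have 6: "runs (While (%v. v 1 \<noteq> 0) outer) (tp(1 := zt [] T, 2 := zt [] T)) (length T * (length T * (40 * length T + 101) + 4 * length T + 31) + 1) ?\<tau>"
    unfolding s .
  have "runs phase2 tp (t2 (length T)) ?\<tau>"
    unfolding phase2_def by (rule runs_mono[OF runs_Seq[OF 1 runs_Seq[OF 2 runs_Seq[OF 3 runs_Seq[OF 4 6]]]]]) (simp add: t2_def)
  then show ?thesis by (rule that) (simp_all add: S9_def S8_def SS_def)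
qed

definition good :: "bool list => bool list => zrec list => bool" where
  "good x y rs \<longleftrightarrow> length x = length y & (\<forall>r\<in>set rs. vrec r) & zip x y = concat (map zr rs)"

text \<open>With \<open>SOME\<close> the relation speaks of the records that the verifier has
  parsed, before it is known that they are unique. \<open>zrs_inject\<close> gives the uniqueness
  and \<open>RD_iff\<close> the natural form.\<close>

definition RD :: "bool list => bool list => bool" where
  "RD x y \<longleftrightarrow> (\<exists>rs. good x y rs) & (let rs = SOME rs. good x y rs in \<forall>r\<in>set rs. \<exists>r'\<in>set rs. rmatch r r')"

lemma good_iff: "(\<exists>rs. good x y rs) \<longleftrightarrow> length x = length y & drun q0 (zip x y) = q0"
  using parse[of "zip x y"] recs_run(1) by (auto simp: good_def)

lemma length_fout: "length (fout s zs) \<le> 2 * length zs"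
  by (induction s zs rule: fout.induct) auto

lemma polytime_RD: "polytime_relation RD"
proof -
  let ?t = "%n. t2 (2 * n) + 100 * n + 200 :: nat"
  have run: "\<exists>\<tau>. runs ver (start (map bit_sym x @ [3] @ map bit_sym y)) (?t (length x + length y)) \<tau> & holds_word (\<tau> 0) [RD x y]" for x y
  proof -
    let ?X = "map bit_sym x" and ?Y = "map bit_sym y"
    let ?tp = "start (?X @ [3] @ ?Y)"
    have e0: "arr [] 0 = zt [] []" "arr w 0 = zt [] w" "arr [] 0 = reg 0" for w by (auto simp: zt_def arr_def reg_def)
    have s0: "?tp 0 = zt [] (?X @ 3 # ?Y)" "0 < j ==> ?tp j = zt [] []" "0 < j ==> ?tp j = reg 0" for j
      by (simp_all add: start_def tape_of_arr e0) (simp add: e0(1)[symmetric] e0(3))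
    have b6: "\<forall>a\<in>set ?X. a \<noteq> 3 & a < 6"
    proof -
      have "bit_sym b \<noteq> 3 & bit_sym b < 6" for b by (cases b) auto
      then show ?thesis by simp
    qed
    have 1: "runs (copyl (%a. a \<noteq> 3) 0 6) ?tp (5 * length x + 1) (?tp(0 := zt ?X (3 # ?Y), 6 := zt ?X []))"
      using copyl_runs[of ?tp 0 "[]" ?X "3 # ?Y" 6 "[]" "%a. a \<noteq> 3"] s0(1) s0(2)[of 6] b6 by simp
    let ?tp1 = "?tp(0 := zt (?X @ [3]) ?Y, 6 := zt ?X [])"
    have 2: "runs (mv 0 Rightwards) (?tp(0 := zt ?X (3 # ?Y), 6 := zt ?X [])) 1 ?tp1"
      using runs_mvR[of "?tp(0 := zt ?X (3 # ?Y), 6 := zt ?X [])" 0 ?X 3 ?Y] by (simp add: fun_upd_twist)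
    have 3: "runs (rewind 6) ?tp1 (2 * length x + 6) (?tp(0 := zt (?X @ [3]) ?Y, 6 := zt [] ?X))"
      using runs_rewind[of ?tp1 6 ?X "[]"] by simp
    have 4: "runs (wr 5 1 Stay) (?tp(0 := zt (?X @ [3]) ?Y, 6 := zt [] ?X)) 1 (SF ?tp (zt [] ?X) (zt (?X @ [3]) ?Y) (cd q0) [])"
    proof -
      have "(?tp(0 := zt (?X @ [3]) ?Y, 6 := zt [] ?X))(5 := reg 1) = SF ?tp (zt [] ?X) (zt (?X @ [3]) ?Y) (cd q0) []"
        using s0(2)[of 1] by (auto simp: SF_def cd_def fun_eq_iff)
      then show ?thesis using runs_reg[of "?tp(0 := zt (?X @ [3]) ?Y, 6 := zt [] ?X)" 5 0 1] s0(3)[of 5] by simp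
    qed
    let ?T = "fout q0 (zip x y)" and ?s = "drun q0 (zip x y)"
    let ?SF = "SF ?tp (zt (map bit_sym (take (length y) x)) (map bit_sym (drop (length y) x))) (zt ((?X @ [3]) @ map bit_sym (take (length x) y)) (map bit_sym (drop (length x) y))) (cd ?s) ?T"
    have vs: "vs ?s"
    proof -
      have "vs s ==> vs (drun s zs)" for s zs by (induction s zs rule: drun.induct) (auto intro: vs_dstep)
      then show ?thesis by simp
    qed
    have 5: "runs fst_loop (SF ?tp (zt [] ?X) (zt (?X @ [3]) ?Y) (cd q0) []) (11 * length x + 1) ?SF"
      using fst_runs[of q0 ?tp "[]" x "?X @ [3]" y "[]"] by simp
    let ?n = "length x + length y"
    have c1: "cd s = 1 \<longleftrightarrow> s = q0" if "vs s" for s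
    proof
      assume "cd s = 1"
      then show "s = q0" using dc_cd[OF that] by (simp add: dc_def)
    qed (simp add: cd_def)
    have v: "view ?SF 0 = 0 & view ?SF 6 = 0 & view ?SF 5 = 1 \<longleftrightarrow> (\<exists>rs. good x y rs)"
    proof -
      have "scanned (zt u (map bit_sym w)) = 0 \<longleftrightarrow> w = []" for u w by (cases w) auto
      then show ?thesis unfolding good_iff using c1[OF vs] by (auto simp: view_def)
    qed
    obtain \<tau> where t: "runs (Case (%v. if v 0 = 0 & v 6 = 0 & v 5 = 1 then phase2 else wr 7 2 Stay)) ?SF
       (Suc (t2 (2 * ?n))) \<tau>" "\<tau> 0 = ?SF 0" "\<tau> 7 = reg (if RD x y then 0 else 2)"
    proof (cases "\<exists>rs. good x y rs")
      case True
      define rs where "rs = (SOME rs. good x y rs)"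
      have g: "good x y rs" unfolding rs_def using True by (rule someI_ex)
      have T: "?T = concat (map mk rs)" using recs_run(2)[of rs] g by (simp add: good_def)
      have "length ?T \<le> 2 * length (zip x y)" by (rule length_fout)
      then have lT: "length ?T \<le> 2 * ?n" by simp
      have RD: "RD x y \<longleftrightarrow> (\<forall>r\<in>set rs. \<exists>r'\<in>set rs. rmatch r r')" using True by (simp add: RD_def rs_def Let_def)
      obtain \<tau> where tau: "runs phase2 ?SF (t2 (length ?T)) \<tau>"
        "\<tau> 0 = ?SF 0" "\<tau> 7 = reg (if \<forall>r\<in>set rs. \<exists>r'\<in>set rs. rmatch r r' then 0 else 2)"
      proof (rule phase2_runs[OF T])
        show "?SF 2 = zt [] []" using s0(2)[of 2] by (simp add: SF_def)
        show "?SF 9 = reg 0" "?SF 8 = reg 0" "?SF 7 = reg 0" using s0(3)[of 9] s0(3)[of 8] s0(3)[of 7] by (simp_all add: SF_def)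
      qed simp
      have "t2 (length ?T) \<le> t2 (2 * ?n)"
        unfolding t2_def by (intro add_mono mult_le_mono order_refl lT)
      note tau1 = runs_mono[OF tau(1) this]
      show ?thesis
      proof (rule that)
        show "runs (Case (%v. if v 0 = 0 & v 6 = 0 & v 5 = 1 then phase2 else wr 7 2 Stay)) ?SF
          (Suc (t2 (2 * ?n))) \<tau>"
          by (rule runs_Case) (use tau1 v True in \<open>simp only: if_True simp_thms\<close>)
      qed (use tau RD in auto)
    next
      case False
      have w: "runs (wr 7 2 Stay) ?SF (t2 (2 * ?n)) (?SF(7 := reg 2))"
        by (rule runs_mono[OF runs_reg[where a = 0]]) (use s0(3)[of 7] in \<open>simp_all add: SF_def t2_def\<close>)
      show ?thesis
      proof (rule that)
        show "runs (Case (%v. if v 0 = 0 & v 6 = 0 & v 5 = 1 then phase2 else wr 7 2 Stay)) ?SF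
          (Suc (t2 (2 * ?n))) (?SF(7 := reg 2))"
          by (rule runs_Case) (use w v False in \<open>simp only: if_False simp_thms\<close>)
      qed (use False in \<open>auto simp: RD_def\<close>)
    qed
    let ?u = "(?X @ [3]) @ map bit_sym (take (length x) y)" and ?w = "map bit_sym (drop (length x) y)"
    have uw: "?u @ ?w = ?X @ [3] @ ?Y" by (simp flip: map_append)
    have 6: "runs (rewind 0) \<tau> (2 * length ?u + 6) (\<tau>(0 := arr (?X @ [3] @ ?Y) 0))"
      using runs_rewind[of \<tau> 0 ?u ?w] t(2) unfolding uw e0(2)[symmetric] by simp
    let ?r = "if RD x y then 2 else 1 :: nat"
    let ?a = "act (?r, Rightwards) (arr (?X @ [3] @ ?Y) 0)"
    have 7: "runs (Case (%v. wr 0 (if v 7 = 2 then 1 else 2) Rightwards)) (\<tau>(0 := arr (?X @ [3] @ ?Y) 0)) (Suc 1) (\<tau>(0 := ?a))"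
    proof (rule runs_Case)
      have "view (\<tau>(0 := arr (?X @ [3] @ ?Y) 0)) 7 = (if RD x y then 0 else 2)" using t(3) by (simp add: view_def)
      then have "(if view (\<tau>(0 := arr (?X @ [3] @ ?Y) 0)) 7 = 2 then 1 else 2) = ?r" by simp
      then show "runs (wr 0 (if view (\<tau>(0 := arr (?X @ [3] @ ?Y) 0)) 7 = 2 then 1 else 2) Rightwards) (\<tau>(0 := arr (?X @ [3] @ ?Y) 0)) 1 (\<tau>(0 := ?a))"
        using runs_Op[of 0 "%_. ?r" Rightwards "\<tau>(0 := arr (?X @ [3] @ ?Y) 0)"] by (simp only: wr_def fun_upd_same fun_upd_upd)
    qed
    have 8: "runs (wr 0 0 Stay) (\<tau>(0 := ?a)) 1 (\<tau>(0 := act (0, Stay) ?a))"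
      using runs_Op[of 0 "%_. 0" Stay "\<tau>(0 := ?a)"] by (simp only: wr_def fun_upd_same fun_upd_upd)
    have "runs ver ?tp (?t ?n) (\<tau>(0 := act (0, Stay) ?a))" unfolding ver_def
      by (rule runs_mono[OF runs_Seq[OF 1 runs_Seq[OF 2 runs_Seq[OF 3 runs_Seq[OF 4 runs_Seq[OF 5 runs_Seq[OF t(1) runs_Seq[OF 6 runs_Seq[OF 7 8]]]]]]]]]) simp
    moreover have "holds_word (act (0, Stay) ?a) [RD x y]" by (simp add: holds_word_def act_def arr_def)
    ultimately show ?thesis by (metis fun_upd_same)
  qed
  obtain M where M: "wf_machine M" "\<And>F ss n \<tau> w t. set ss \<subseteq> {..<4} ==> exec ver (start ss) n \<tau> ==> n \<le> t ==> holds_word (\<tau> 0) w ==> outputs_within M F ss t w"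
    using machine_of_program[OF _ _ wfc_ver] by auto
  have "pbound (UNIV :: nat set) (%n. n) ?t" unfolding t2_def by (intro pbound_intros)
  then obtain p :: "nat poly" where p: "\<And>n. ?t n \<le> poly p n" unfolding pbound_def by blast
  have "outputs_within M Map.empty (map bit_sym x @ [3] @ map bit_sym y) (poly p (length x + length y)) [RD x y]" for x y
  proof -
    obtain \<tau> where "runs ver (start (map bit_sym x @ [3] @ map bit_sym y)) (?t (length x + length y)) \<tau>" "holds_word (\<tau> 0) [RD x y]" using run by blast
    moreover have "set (map bit_sym x @ [3] @ map bit_sym y) \<subseteq> {..<4}" by (auto intro: bit_sym_less)
    ultimately show ?thesis using M(2) p[of "length x + length y"] unfolding runs_def by (meson order_trans)
  qed
  then show ?thesis unfolding polytime_relation_def using M(1) by blast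
qed

lemma balanced_RD: "polynomially_balanced RD"
  unfolding polynomially_balanced_def
  by (intro exI[of _ "[:0, 1:]"]) (auto simp: RD_def good_def)

section \<open>Certificates and tilings\<close>

text \<open>The first track is a self-delimiting code and determines the length; then the second
  track is cut at the same place, and its two free bits can be read off.\<close>

lemma zw_inject: "zw n @ u = zw n' @ u' ==> n = n' & u = u'"
proof -
  assume h: "zw n @ u = zw n' @ u'"
  obtain s m d bs s' m' d' bs' where n: "n = (s, m, d, bs)" "n' = (s', m', d', bs')" by (metis prod_cases4)
  have f: "map fst (zw (s, m, d, bs)) = s # dbl bs @ [False]" for s m d bs by simp
  have "map fst (zw n) @ map fst u = map fst (zw n') @ map fst u'" using arg_cong[OF h, of "map fst"] by simp
  then have "s = s' & dbl bs @ False # map fst u = dbl bs' @ False # map fst u'" unfolding n f by simp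
  then have sb: "s = s'" "bs = bs'" unfolding dbl_def doubled_bits_append_inject by auto
  then have "length (zw n) = length (zw n')" by (simp add: n)
  then have z: "zw n = zw n'" "u = u'" using h by auto
  have "m = m'" "d = d'" using z(1) sb by (cases bs', auto simp: n dbl_def)+
  then show ?thesis using sb z(2) by (simp add: n)
qed

lemma zr_inject: "zr r @ u = zr r' @ u' ==> r = r' & u = u'"
  unfolding zr_def by (auto dest!: zw_inject simp: prod_eq_iff)

lemma zr_ne: "zr r \<noteq> []" by (cases "fst r") (simp add: zr_def)

lemma zrs_inject: "concat (map zr rs) = concat (map zr rs') ==> rs = rs'"
proof (induction rs arbitrary: rs')
  case Nil
  then show ?case using zr_ne by (cases rs') auto
next
  case (Cons r rs)
  then obtain r' rs2 where r': "rs' = r' # rs2" using zr_ne[of r] by (cases rs') auto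
  then have "r = r' & concat (map zr rs) = concat (map zr rs2)" using Cons.prems by (intro zr_inject) simp
  then show ?case using Cons.IH r' by auto
qed

lemma RD_iff: "RD x y \<longleftrightarrow> (\<exists>rs. good x y rs & (\<forall>r\<in>set rs. \<exists>r'\<in>set rs. rmatch r r'))"
proof -
  have u: "rs' = rs" if "good x y rs" "good x y rs'" for rs rs' using that by (intro zrs_inject) (simp add: good_def)
  have s: "(SOME rs. good x y rs) = rs" if "good x y rs" for rs
    by (rule some_equality[where P = "good x y"]) (use that u in blast)+
  show ?thesis
  proof
    assume R: "RD x y"
    then have ex: "\<exists>rs. good x y rs" unfolding RD_def by (rule conjunct1)
    from someI_ex[OF ex] have "good x y (SOME rs. good x y rs)" .
    then show "\<exists>rs. good x y rs & (\<forall>r\<in>set rs. \<exists>r'\<in>set rs. rmatch r r')" using R unfolding RD_def Let_def by blast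
  next
    assume "\<exists>rs. good x y rs & (\<forall>r\<in>set rs. \<exists>r'\<in>set rs. rmatch r r')"
    then obtain rs where rs: "good x y rs" "\<forall>r\<in>set rs. \<exists>r'\<in>set rs. rmatch r r'" by blast
    then show "RD x y" unfolding RD_def Let_def s[OF rs(1)] by blast
  qed
qed

lemma fst_zw: "map fst (zw (s, m, d, bs)) = s # dbl bs @ [False]" by simp

definition nm :: "int => int => znum" where "nm z e = (z < 0, e \<noteq> 0, e = 1, bits_of_nat (nat \<bar>z\<bar>))"
definition rc :: "int ^ 3 => int ^ 3 => zrec" where "rc c v = (nm (c $ 1) (v $ 1), nm (c $ 2) (v $ 2), nm (c $ 3) (v $ 3))"
definition unit3 :: "int ^ 3 => bool" where "unit3 v \<longleftrightarrow> \<bar>v $ 1\<bar> + \<bar>v $ 2\<bar> + \<bar>v $ 3\<bar> = 1"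

lemma nv_bits: "nv (bits_of_nat n) = n"
proof (induction n rule: less_induct)
  case (less n)
  then show ?case by (cases "n = 0") (simp_all add: bits_of_nat.simps[of n], simp add: bits_of_nat.simps)
qed

lemma zval_nm: "zval (nm z e) = z" by (simp add: nm_def nv_bits sgni_def)

lemma zdir_nm: "\<bar>e\<bar> \<le> 1 ==> zdir (nm z e) = e" by (auto simp: nm_def dlt_def)

lemma fst_zw_nm: "map fst (zw (nm z e)) = enc_int z"
  unfolding nm_def fst_zw by (simp add: enc_int_def enc_nat_def dbl_def)

lemma unit3_le: "unit3 v ==> \<bar>v $ 1\<bar> \<le> 1 & \<bar>v $ 2\<bar> \<le> 1 & \<bar>v $ 3\<bar> \<le> 1"
  by (auto simp: unit3_def)

lemma rmatch_rc: "unit3 v ==> unit3 v' ==> rmatch (rc c v) (rc c' v') \<longleftrightarrow> c' = c + v & v' = - v"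
  using unit3_le[of v] unit3_le[of v'] by (auto simp: rmatch_def rc_def zmatch_def zval_nm zdir_nm vec_eq_iff forall_3)

lemma vrec_rc: "unit3 v ==> vrec (rc c v)"
  by (auto simp: vrec_def rc_def nm_def unit3_def abs_if split: if_splits)

lemma num_decode:
  assumes "map fst (zw n) @ u = enc_int z @ w" "zd n --> zm n"
  shows "n = nm z (zdir n) & u = w"
proof -
  obtain s m d bs where n: "n = (s, m, d, bs)" by (metis prod_cases4)
  have "s = (z < 0) & dbl bs @ False # u = dbl (bits_of_nat (nat \<bar>z\<bar>)) @ False # w"
    using assms(1) unfolding n fst_zw by (simp add: enc_int_def enc_nat_def dbl_def)
  then have "s = (z < 0)" "bs = bits_of_nat (nat \<bar>z\<bar>)" "u = w" unfolding dbl_def doubled_bits_append_inject by auto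
  then show ?thesis using assms(2) by (auto simp: n nm_def dlt_def)
qed

lemma rec_decode:
  assumes "map fst (zr r) @ u = enc_cube c @ w" "vrec r"
  shows "\<exists>v. r = rc c v & unit3 v & u = w"
proof -
  obtain n1 n2 n3 where r: "r = (n1, n2, n3)" by (metis prod_cases3)
  have d: "zd n1 --> zm n1" "zd n2 --> zm n2" "zd n3 --> zm n3" using assms(2) by (auto simp: vrec_def r)
  have 1: "n1 = nm (c $ 1) (zdir n1) & map fst (zw n2) @ map fst (zw n3) @ u = enc_int (c $ 2) @ enc_int (c $ 3) @ w"
    by (rule num_decode[OF _ d(1)]) (use assms(1) in \<open>simp add: r zr_def enc_cube_def\<close>)
  have 2: "n2 = nm (c $ 2) (zdir n2) & map fst (zw n3) @ u = enc_int (c $ 3) @ w"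
    by (rule num_decode[OF _ d(2)]) (use 1 in simp)
  have 3: "n3 = nm (c $ 3) (zdir n3) & u = w" by (rule num_decode[OF _ d(3)]) (use 2 in simp)
  let ?v = "vector [zdir n1, zdir n2, zdir n3] :: int ^ 3"
  have "r = rc c ?v" using 1 2 3 by (simp add: r rc_def)
  moreover have "unit3 ?v" using assms(2) by (cases n1; cases n2; cases n3) (auto simp: r vrec_def unit3_def dlt_def)
  ultimately show ?thesis using 3 by blast
qed

lemma recs_decode:
  "map fst (concat (map zr rs)) = enc_cubes cs ==> \<forall>r\<in>set rs. vrec r ==> distinct cs ==>
    \<exists>f. rs = map (%c. rc c (f c)) cs & (\<forall>c\<in>set cs. unit3 (f c))"
proof (induction cs arbitrary: rs)
  case Nil
  then show ?case using zr_ne by (cases rs) (auto simp: enc_cubes_def)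
next
  case (Cons c cs)
  have "enc_cubes (c # cs) \<noteq> []" by (simp add: enc_cubes_def enc_cube_def enc_int_def)
  then obtain r rs' where rs: "rs = r # rs'" using Cons.prems(1) by (cases rs) auto
  have "map fst (zr r) @ map fst (concat (map zr rs')) = enc_cube c @ enc_cubes cs" using Cons.prems(1) by (simp add: rs enc_cubes_def)
  from rec_decode[OF this] obtain v where v: "r = rc c v" "unit3 v" "map fst (concat (map zr rs')) = enc_cubes cs"
    using Cons.prems(2) by (auto simp: rs)
  obtain f where f: "rs' = map (%c. rc c (f c)) cs" "\<forall>c\<in>set cs. unit3 (f c)"
    using Cons.IH[OF v(3)] Cons.prems by (auto simp: rs)
  have "map (%c'. rc c' ((f(c := v)) c')) cs = map (%c. rc c (f c)) cs" using Cons.prems(3) by (intro map_cong) auto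
  then have "rs = map (%c'. rc c' ((f(c := v)) c')) (c # cs)" using f(1) v(1) by (simp add: rs del: map_eq_conv)
  moreover have "\<forall>c'\<in>set (c # cs). unit3 ((f(c := v)) c')" using f(2) v(2) by auto
  ultimately show ?case by blast
qed

text \<open>A matching as a fixed-point-free involution: \<open>c\<close> goes to
  \<open>c + f c\<close>, where \<open>f c\<close> is a unit vector. Membership in
  \<open>extensional\<close> makes \<open>f\<close> unique.\<close>

definition inv_dirs :: "(int ^ 3) set => (int ^ 3 => int ^ 3) set" where
  "inv_dirs C = {f \<in> extensional C. \<forall>c\<in>C. unit3 (f c) & c + f c \<in> C & f (c + f c) = - f c}"

text \<open>The first track prescribes the cubes and their order, so only the direction of the
  partner is free at each cube. Having a matching record means that the partner belongs to the
  region and points back.\<close>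

lemma card_RD:
  assumes "distinct cs"
  shows "card {y. RD (enc_cubes cs) y} = card (inv_dirs (set cs))"
proof -
  let ?x = "enc_cubes cs"
  define rs where "rs f = map (%c. rc c (f c)) cs" for f
  define Y where "Y f = map snd (concat (map zr (rs f)))" for f
  have fx: "map fst (concat (map zr (rs f))) = ?x" for f
  proof -
    have "map fst (zr (rc c v)) = enc_cube c" for c v by (simp add: zr_def rc_def fst_zw_nm enc_cube_def)
    then show ?thesis by (simp add: rs_def enc_cubes_def map_concat comp_def)
  qed
  have z: "zip ?x (Y f) = concat (map zr (rs f))" for f unfolding fx[of f, symmetric] Y_def by (rule zip_map_fst_snd)
  have l: "length ?x = length (Y f)" for f unfolding fx[of f, symmetric] Y_def by simp
  have inj: "inj_on Y (inv_dirs (set cs))"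
  proof (rule inj_onI)
    fix f g assume h: "f \<in> inv_dirs (set cs)" "g \<in> inv_dirs (set cs)" "Y f = Y g"
    have "rs f = rs g" using z[of f] z[of g] h(3) by (intro zrs_inject) simp
    then have e: "rc c (f c) = rc c (g c)" if "c \<in> set cs" for c using that by (simp add: rs_def)
    show "f = g"
    proof (rule extensionalityI)
      show "f \<in> extensional (set cs)" "g \<in> extensional (set cs)" using h by (auto simp: inv_dirs_def)
      fix c assume c: "c \<in> set cs"
      have u: "unit3 (f c)" "unit3 (g c)" using h c by (auto simp: inv_dirs_def)
      have "zdir (nm (c $ k) (f c $ k)) = zdir (nm (c $ k) (g c $ k))" for k using e[OF c] exhaust_3[of k] by (auto simp: rc_def)
      then show "f c = g c" using unit3_le[OF u(1)] unit3_le[OF u(2)] by (simp add: vec_eq_iff forall_3) (metis zdir_nm)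
    qed
  qed
  have "Y ` inv_dirs (set cs) = {y. RD ?x y}"
  proof (intro subset_antisym subsetI)
    fix y assume "y \<in> Y ` inv_dirs (set cs)"
    then obtain f where f: "f \<in> inv_dirs (set cs)" "y = Y f" by blast
    have u: "unit3 (f c)" "c + f c \<in> set cs" "f (c + f c) = - f c" if "c \<in> set cs" for c using f that by (auto simp: inv_dirs_def)
    have "good ?x y (rs f)" using z[of f] l[of f] f(2) u(1) vrec_rc by (auto simp: good_def rs_def)
    moreover have "\<exists>r'\<in>set (rs f). rmatch r r'" if r: "r \<in> set (rs f)" for r
    proof -
      obtain c where c: "c \<in> set cs" "r = rc c (f c)" using r unfolding rs_def set_map by blast
      have "rmatch r (rc (c + f c) (f (c + f c)))" unfolding c(2) using rmatch_rc[OF u(1)[OF c(1)] u(1)[OF u(2)[OF c(1)]]] u(3)[OF c(1)] by simp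
      then show ?thesis using u(2)[OF c(1)] by (auto simp: rs_def)
    qed
    ultimately show "y \<in> {y. RD ?x y}" unfolding RD_iff by blast
  next
    fix y assume "y \<in> {y. RD ?x y}"
    then obtain q where q: "good ?x y q" "\<forall>r\<in>set q. \<exists>r'\<in>set q. rmatch r r'" unfolding RD_iff by blast
    have qx: "map fst (concat (map zr q)) = ?x" and qy: "map snd (concat (map zr q)) = y" using q(1) unfolding good_def by (metis map_fst_zip, metis map_snd_zip)
    obtain g where g: "q = map (%c. rc c (g c)) cs" "\<forall>c\<in>set cs. unit3 (g c)" using recs_decode[OF qx _ assms] q(1) unfolding good_def by blast
    define f where "f = restrict g (set cs)"
    have qf: "q = rs f" unfolding g(1) rs_def f_def by (intro map_cong) auto
    have "unit3 (f c) & c + f c \<in> set cs & f (c + f c) = - f c" if c: "c \<in> set cs" for c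
    proof -
      have "rc c (g c) \<in> set q" using c by (simp add: g(1))
      then obtain r' where r': "r' \<in> set q" "rmatch (rc c (g c)) r'" using q(2) by blast
      obtain c' where c': "c' \<in> set cs" "r' = rc c' (g c')" using r'(1) unfolding g(1) set_map by blast
      have u: "unit3 (g c)" "unit3 (g c')" using g(2) c c'(1) by auto
      have "c' = c + g c & g c' = - g c" using r'(2) unfolding c'(2) rmatch_rc[OF u] .
      then show ?thesis using c c'(1) g(2) by (auto simp: f_def)
    qed
    moreover have "f \<in> extensional (set cs)" by (simp add: f_def)
    ultimately have "f \<in> inv_dirs (set cs)" unfolding inv_dirs_def by blast
    moreover have "y = Y f" unfolding Y_def qf[symmetric] qy ..
    ultimately show "y \<in> Y ` inv_dirs (set cs)" by blast
  qed
  then show ?thesis using card_image[OF inj] by simp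
qed

text \<open>The involution corresponds to the set of its orbits. Conversely \<open>f c\<close> is
  the difference between the other cube in the part of \<open>c\<close> and
  \<open>c\<close>.\<close>

lemma card_inv_dirs: "card (inv_dirs C) = pm vadj C"
proof -
  define P where "P f = (%c. {c, c + f c}) ` C" for f :: "int ^ 3 => int ^ 3"
  have va: "vadj c (c + v) \<longleftrightarrow> unit3 v" for c v by (simp add: vadj_def unit3_def)
  have inj: "inj_on P (inv_dirs C)"
  proof (rule inj_onI)
    fix f g assume h: "f \<in> inv_dirs C" "g \<in> inv_dirs C" "P f = P g"
    show "f = g"
    proof (rule extensionalityI)
      show "f \<in> extensional C" "g \<in> extensional C" using h by (auto simp: inv_dirs_def)
      fix c assume c: "c \<in> C"
      have "{c, c + f c} \<in> P g" using h(3) c by (auto simp: P_def)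
      then obtain c' where c': "c' \<in> C" "{c, c + f c} = {c', c' + g c'}" by (auto simp: P_def)
      have gg: "g (c' + g c') = - g c'" using h(2) c' by (auto simp: inv_dirs_def)
      have "c = c' & c + f c = c' + g c' \<or> c = c' + g c' & c + f c = c'" using c'(2) by (auto simp: doubleton_eq_iff)
      then show "f c = g c"
      proof
        assume k: "c = c' + g c' & c + f c = c'"
        then have "f c = c' - c" by (metis add_diff_cancel_left')
        then have "f c = - g c'" using k by simp
        then show ?thesis using gg k by metis
      next
        assume "c = c' & c + f c = c' + g c'"
        then show ?thesis by (metis add_left_cancel)
      qed
    qed
  qed
  have "P ` inv_dirs C = matchings vadj C"
  proof (intro subset_antisym subsetI)
    fix Q assume "Q \<in> P ` inv_dirs C"
    then obtain f where f: "f \<in> inv_dirs C" "Q = P f" by blast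
    have u: "unit3 (f c)" "c + f c \<in> C" "f (c + f c) = - f c" if "c \<in> C" for c using f that by (auto simp: inv_dirs_def)
    have "partition_on C Q"
    proof (rule partition_onI)
      show "\<Union>Q = C" using u(2) by (auto simp: f(2) P_def)
      fix p q assume "p \<in> Q" "q \<in> Q" and ne: "p \<noteq> q"
      then obtain c d where c: "c \<in> C" "p = {c, c + f c}" and d: "d \<in> C" "q = {d, d + f d}" by (auto simp: f(2) P_def)
      have i: "{e, e + f e} = {a, a + f a}" if "a \<in> C" "e \<in> {a, a + f a}" for a e using that u(3)[OF that(1)] by auto
      show "disjnt p q"
      proof (rule ccontr)
        assume "\<not> disjnt p q"
        then obtain e where "e \<in> p" "e \<in> q" by (auto simp: disjnt_def)
        then show False using i[OF c(1), of e] i[OF d(1), of e] c(2) d(2) ne by simp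
      qed
    qed (auto simp: f(2) P_def)
    moreover have "\<exists>a b. A = {a, b} & vadj a b" if A: "A \<in> Q" for A
    proof -
      obtain c where "c \<in> C" "A = {c, c + f c}" using A unfolding f(2) P_def by blast
      then show ?thesis using u(1) va by blast
    qed
    ultimately show "Q \<in> matchings vadj C" by (simp add: matchings_def)
  next
    fix Q assume Q: "Q \<in> matchings vadj C"
    then have part: "partition_on C Q" and ed: "\<And>A. A \<in> Q ==> \<exists>a b. A = {a, b} & vadj a b" by (auto simp: matchings_def)
    have ex: "\<exists>b. {c, b} \<in> Q & vadj c b" if c: "c \<in> C" for c
    proof -
      obtain A where A: "A \<in> Q" "c \<in> A" using part c unfolding partition_on_def by blast
      then obtain a b where ab: "A = {a, b}" "vadj a b" using ed by blast
      then consider "c = a" | "c = b" using A(2) by blast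
      then show ?thesis
      proof cases
        case 1 then show ?thesis using A(1) ab by blast
      next
        case 2
        moreover have "{b, a} = A" using ab(1) by blast
        ultimately show ?thesis using A(1) vadj_sym[OF ab(2)] by metis
      qed
    qed
    then obtain p where p: "\<And>c. c \<in> C ==> {c, p c} \<in> Q & vadj c (p c)" by metis
    have same: "A = B" if "A \<in> Q" "B \<in> Q" "e \<in> A" "e \<in> B" for A B e
      using part that by (auto simp: partition_on_def disjoint_def)
    have pC: "p c \<in> C" if "c \<in> C" for c using p[OF that] part by (auto simp: partition_on_def)
    have pp: "p (p c) = c" if "c \<in> C" for c
    proof -
      have "{p c, p (p c)} = {c, p c}" using same[of "{p c, p (p c)}" "{c, p c}" "p c"] p[OF that] p[OF pC[OF that]] by simp
      moreover have "p c \<noteq> c" using p[OF that] vadj_irrefl by metis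
      ultimately show ?thesis by (auto simp: doubleton_eq_iff)
    qed
    define f where "f = restrict (%c. p c - c) C"
    have "f \<in> inv_dirs C"
      using p pC pp va by (auto simp: inv_dirs_def f_def) (metis add.commute diff_add_cancel)
    moreover have "Q = P f"
    proof (intro subset_antisym subsetI)
      fix A assume A: "A \<in> Q"
      then obtain a b where ab: "A = {a, b}" "vadj a b" using ed by blast
      have a: "a \<in> C" using A ab part by (auto simp: partition_on_def)
      then have "A = {a, p a}" using same[OF A, of "{a, p a}" a] p ab by auto
      then show "A \<in> P f" using a by (auto simp: P_def f_def)
    next
      fix A assume "A \<in> P f"
      then show "A \<in> Q" using p by (auto simp: P_def f_def)
    qed
    ultimately show "Q \<in> P ` inv_dirs C" by blast
  qed
  then show ?thesis using card_image[OF inj] by (simp add: pm_def)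
qed

theorem membership: "in_sharp_P domino_tilings_problem"
  unfolding in_sharp_P_def
proof (intro bexI[of _ "%x. card {y. RD x y}"] allI impI)
  show "(%x. card {y. RD x y}) \<in> sharp_P" using polytime_RD balanced_RD by (auto simp: sharp_P_def)
  fix x n assume h: "domino_tilings_problem x = Some n"
  then obtain cs where cs: "x = enc_cubes cs" "distinct cs" by (auto simp: domino_tilings_problem_def split: if_splits)
  have "n = card (tilings domino (set cs))" using h by (simp add: cs domino_tilings_problem_enc_cubes split: if_splits)
  then show "card {y. RD x y} = n" using card_RD[OF cs(2)] by (simp add: cs(1) card_inv_dirs tilings_domino pm_def)
qed

theorem theorem1p4: "sharp_P_complete domino_tilings_problem"
  unfolding sharp_P_complete_def
proof (intro conjI ballI)
  show "in_sharp_P domino_tilings_problem" by (rule membership)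
  show "polytime_Turing_reducible g domino_tilings_problem" if "g \<in> sharp_P" for g
    using that reduction by (auto simp: sharp_P_def)
qed

end
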